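(* Let $K>0$. The distribution of $\omega(\mathfrak b,\mathcal{P}^G_K)$ does not depend on the $\sigma(\mathcal{P}_K)$-measurable proper basis $\mathfrak b$ of $\pi_1(\mathcal{P}_K)$. Besides, it is invariant by volume-preserving diffeomorphisms, in the following sense: for every $\sigma(\mathcal{P}_K)$-measurable proper basis $\mathfrak b$, for every deterministic volume-preserving diffeomorphism $\phi$ of $\mathbb{R}^2$ such that $\phi(0)=0$, and for all continuous functions $\ell_1,\dots,\ell_k:[0,1]\to\mathbb{R}^2$ with $\ell_i(0)=\ell_i(1)=0$ for $i\in\{1,\dots,k\}$ and whose ranges have vanishing Lebesgue measure, \[ \big(\omega(\mathfrak b,\mathcal{P}^G_K)[\ell_1],\dots,\omega(\mathfrak b,\mathcal{P}^G_K)[\ell_k]\big)\overset{(d)}{=}\big(\omega(\mathfrak b,\mathcal{P}^G_K)[\phi\circ\ell_1],\dots,\omega(\mathfrak b,\mathcal{P}^G_K)[\phi\circ\ell_k]\big). \]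
   Context: Let $G$ be a connected compact Lie group whose Lie algebra $\mathfrak g$ is endowed with a bi-invariant (i.e. $\mathrm{Ad}$-invariant) scalar product. For $K>0$, $\mu_K$ is the uniform probability measure on the sphere of radius $1/K$ of $\mathfrak g$. Let $\mathcal{P}^{\mathfrak g}_K$ be a Poisson process on $\mathbb{R}^2\times\mathfrak g$ with intensity $K\lambda\otimes\mu_K$ ($\lambda$ the Lebesgue measure on $\mathbb{R}^2$), $\mathcal{P}^G_K=\{(x,\exp(Z)):(x,Z)\in\mathcal{P}^{\mathfrak g}_K\}$, and $\mathcal{P}_K$ the projection of $\mathcal{P}^G_K$ on $\mathbb{R}^2$. Almost surely, for each $x\in\mathcal{P}_K$ there is a unique $\omega_x\in G$ with $(x,\omega_x)\in\mathcal{P}^G_K$, and $0\notin \mathcal P_K$. For a locally finite $\mathcal{P}\subset\mathbb{R}^2\setminus\{0\}$, set $\pi_1(\mathcal{P})=\pi_1(\mathbb{R}^2\setminus\mathcal{P},0)$. For each $x\in\mathcal{P}$ let $\gamma_x$ be a path from $0$ to $x$ without self-intersection, such that for $x\neq y$ in $\mathcal P$ the paths $\gamma_x,\gamma_y$ intersect only at $0$. Let $\ell_x$ be the loop based at $0$ that follows $\gamma_x$ up to a small neighbourhood of $x$, turns once around $x$ in the trigonometric (counterclockwise) direction, and goes back to $0$ along $\gamma_x$ backward. The family $\mathfrak b=([\ell_x])_{x\in\mathcal{P}}$ is a proper basis if it generates $\pi_1(\mathcal{P})$ (it then freely generates it). For a proper basis $\mathfrak b=([\ell_x])_{x\in\mathcal{P}}$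 and $\mathcal{P}^G=\{(x,\omega_x)\}_{x\in\mathcal{P}}$ with $\omega_x\in G$, $\omega(\mathfrak b,\mathcal{P}^G):\pi_1(\mathcal{P})\to G$ is the unique group homomorphism sending $[\ell_x]$ to $\omega_x$ for all $x\in\mathcal{P}$. For a loop $\ell$ based at $0$ avoiding $\mathcal{P}$, $\omega(\mathfrak b,\mathcal{P}^G)[\ell]$ is its value on the homotopy class of $\ell$; for a fixed loop $\ell$ whose range has vanishing Lebesgue measure, $\omega(\mathfrak b,\mathcal{P}^G_K)[\ell]$ is almost surely well defined. The distribution of $\omega(\mathfrak b,\mathcal{P}^G_K)$ is the distribution of the family $(\omega(\mathfrak b,\mathcal{P}^G_K)[\ell])_\ell$ over such loops. *)

theory Defs
  imports "HOL-Probability.Probability" "HOL-Algebra.Generated_Groups"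
begin

section \<open>Smooth maps and Lie groups\<close>

text \<open>\<open>C\<^sup>k\<close> maps between (finite-dimensional) normed spaces; meant for open \<open>S\<close>.\<close>

primrec Ck_on ::
  "nat \<Rightarrow> ('a::real_normed_vector \<Rightarrow> 'b::real_normed_vector) \<Rightarrow> 'a set \<Rightarrow> bool" where
  "Ck_on 0 f S \<longleftrightarrow> continuous_on S f"
| "Ck_on (Suc k) f S \<longleftrightarrow>
     (\<forall>x\<in>S. f differentiable (at x)) \<and>
     (\<forall>v. Ck_on k (\<lambda>x. frechet_derivative f (at x) v) S)"

definition smooth_on ::
  "('a::real_normed_vector \<Rightarrow> 'b::real_normed_vector) \<Rightarrow> 'a set \<Rightarrow> bool" where
  "smooth_on f S \<longleftrightarrow> (\<forall>k. Ck_on k f S)"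

text \<open>A chart is a domain with a coordinate map; values of the coordinate map off the domain
  are irrelevant.\<close>

type_synonym ('m, 'e) chart = "'m set \<times> ('m \<Rightarrow> 'e)"

definition chart_inv :: "('m, 'e) chart \<Rightarrow> 'e \<Rightarrow> 'm" where
  "chart_inv c = inv_into (fst c) (snd c)"

definition smooth_map ::
  "('m::topological_space, 'e::euclidean_space) chart set \<Rightarrow>
   ('n::topological_space, 'f::euclidean_space) chart set \<Rightarrow> ('m \<Rightarrow> 'n) \<Rightarrow> bool" where
  "smooth_map \<A> \<B> f \<longleftrightarrow> continuous_on UNIV f \<and>
     (\<forall>c\<in>\<A>. \<forall>d\<in>\<B>. smooth_on (snd d \<circ> f \<circ> chart_inv c) (snd c ` (fst c \<inter> f -` fst d)))"

definition smooth_atlas :: "('m::topological_space, 'e::euclidean_space) chart set \<Rightarrow> bool" where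
  "smooth_atlas \<A> \<longleftrightarrow>
     (\<Union>c\<in>\<A>. fst c) = UNIV \<and>
     (\<forall>c\<in>\<A>. open (fst c) \<and> open (snd c ` fst c) \<and>
             homeomorphism (fst c) (snd c ` fst c) (snd c) (chart_inv c)) \<and>
     (\<forall>c\<in>\<A>. \<forall>d\<in>\<A>. smooth_on (snd d \<circ> chart_inv c) (snd c ` (fst c \<inter> fst d)))"

definition prod_atlas :: "('m, 'e) chart set \<Rightarrow> ('n, 'f) chart set \<Rightarrow> ('m \<times> 'n, 'e \<times> 'f) chart set" where
  "prod_atlas \<A> \<B> = {(fst c \<times> fst d, map_prod (snd c) (snd d)) | c d. c \<in> \<A> \<and> d \<in> \<B>}"

definition lie_group ::
  "('g::{t2_space, second_countable_topology}) monoid \<Rightarrow> ('g, 'e::euclidean_space) chart set \<Rightarrow> bool" where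
  "lie_group G \<A> \<longleftrightarrow>
     group G \<and> carrier G = UNIV \<and> smooth_atlas \<A> \<and>
     smooth_map (prod_atlas \<A> \<A>) \<A> (\<lambda>(g, h). g \<otimes>\<^bsub>G\<^esub> h) \<and>
     smooth_map \<A> \<A> (\<lambda>g. inv\<^bsub>G\<^esub> g)"

section \<open>The Lie algebra\<close>

text \<open>The Lie algebra is the tangent space at \<open>\<one>\<close>, identified with the model space \<open>'e\<close> through
  the differential of a chart \<open>c\<close> around \<open>\<one>\<close>: the vector \<open>Z :: 'e\<close> stands for the velocity at
  \<open>\<one>\<close> of the curves whose expression in the chart \<open>c\<close> has derivative \<open>Z\<close>.  The scalar product
  of the Lie algebra is an arbitrary one, unrelated to the inner product carried by the type \<open>'e\<close>.\<close>

definition one_parameter_subgroup ::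
  "('g::topological_space) monoid \<Rightarrow> ('g, 'e::euclidean_space) chart \<Rightarrow> 'e \<Rightarrow> (real \<Rightarrow> 'g) \<Rightarrow> bool" where
  "one_parameter_subgroup G c Z \<gamma> \<longleftrightarrow>
     continuous_on UNIV \<gamma> \<and> (\<forall>s t. \<gamma> (s + t) = \<gamma> s \<otimes>\<^bsub>G\<^esub> \<gamma> t) \<and>
     ((snd c \<circ> \<gamma>) has_vector_derivative Z) (at 0)"

definition lie_exp ::
  "('g::topological_space) monoid \<Rightarrow> ('g, 'e::euclidean_space) chart \<Rightarrow> 'e \<Rightarrow> 'g" where
  "lie_exp G c Z = (THE \<gamma>. one_parameter_subgroup G c Z \<gamma>) 1"

definition Ad ::
  "('g::topological_space) monoid \<Rightarrow> ('g, 'e::euclidean_space) chart \<Rightarrow> 'g \<Rightarrow> 'e \<Rightarrow> 'e" where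
  "Ad G c g = frechet_derivative
     (snd c \<circ> (\<lambda>h. g \<otimes>\<^bsub>G\<^esub> h \<otimes>\<^bsub>G\<^esub> inv\<^bsub>G\<^esub> g) \<circ> chart_inv c) (at (snd c \<one>\<^bsub>G\<^esub>))"

definition is_scalar_product :: "('e::euclidean_space \<Rightarrow> 'e \<Rightarrow> real) \<Rightarrow> bool" where
  "is_scalar_product B \<longleftrightarrow>
     bilinear B \<and> (\<forall>X Y. B X Y = B Y X) \<and> (\<forall>X. X \<noteq> 0 \<longrightarrow> B X X > 0)"

definition Ad_invariant ::
  "('g::topological_space) monoid \<Rightarrow> ('g, 'e::euclidean_space) chart \<Rightarrow> ('e \<Rightarrow> 'e \<Rightarrow> real) \<Rightarrow> bool" where
  "Ad_invariant G c B \<longleftrightarrow> (\<forall>g\<in>carrier G. \<forall>X Y. B (Ad G c g X) (Ad G c g Y) = B X Y)"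

text \<open>The uniform probability measure on the sphere of radius \<open>r\<close> for the scalar product \<open>B\<close>:
  the image of the uniform measure on the unit ball of \<open>B\<close> under radial projection.  The
  normalization of Lebesgue measure cancels, so \<open>lborel\<close> can be used for any \<open>B\<close>.\<close>

definition uniform_sphere :: "('e::euclidean_space \<Rightarrow> 'e \<Rightarrow> real) \<Rightarrow> real \<Rightarrow> 'e measure" where
  "uniform_sphere B r =
     distr (uniform_measure lborel {Z. B Z Z \<le> 1}) borel (\<lambda>Z. (r / sqrt (B Z Z)) *\<^sub>R Z)"

section \<open>Poisson processes\<close>

text \<open>Point configurations are sets of points, with the sigma-algebra generated by the counting
  maps \<open>S \<mapsto> #(S \<inter> A)\<close> (the value \<open>\<infinity>\<close> being the remaining event).\<close>

definition config_algebra :: "'a measure \<Rightarrow> 'a set measure" where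
  "config_algebra N = sigma UNIV {{S. finite (S \<inter> A) \<and> card (S \<inter> A) = n} | A n. A \<in> sets N}"

definition poisson_process :: "'w measure \<Rightarrow> 'a measure \<Rightarrow> ('w \<Rightarrow> 'a set) \<Rightarrow> bool" where
  "poisson_process M \<nu> P \<longleftrightarrow>
     P \<in> M \<rightarrow>\<^sub>M config_algebra \<nu> \<and>
     (\<forall>A\<in>sets \<nu>. emeasure \<nu> A < \<infinity> \<longrightarrow>
        (AE w in M. finite (P w \<inter> A)) \<and>
        (\<forall>n. measure M {w \<in> space M. card (P w \<inter> A) = n} =
               measure \<nu> A ^ n / fact n * exp (- measure \<nu> A))) \<and>
     (\<forall>A::nat \<Rightarrow> 'a set.
        disjoint_family A \<and> (\<forall>i. A i \<in> sets \<nu> \<and> emeasure \<nu> (A i) < \<infinity>) \<longrightarrow>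
        prob_space.indep_vars M (\<lambda>_. count_space UNIV) (\<lambda>i w. card (P w \<inter> A i)) UNIV)"

definition sigma_config :: "'w measure \<Rightarrow> ('w \<Rightarrow> 'a::topological_space set) \<Rightarrow> 'w measure" where
  "sigma_config M P = vimage_algebra (space M) P (config_algebra borel)"

section \<open>Fundamental groups and proper bases\<close>

definition loops_at :: "'a::topological_space set \<Rightarrow> 'a \<Rightarrow> (real \<Rightarrow> 'a) set" where
  "loops_at X a = {p. path p \<and> path_image p \<subseteq> X \<and> pathstart p = a \<and> pathfinish p = a}"

definition loop_class :: "'a::topological_space set \<Rightarrow> (real \<Rightarrow> 'a) \<Rightarrow> (real \<Rightarrow> 'a) set" where
  "loop_class X p = {q. homotopic_paths X p q}"

definition pi1 :: "'a::topological_space set \<Rightarrow> 'a \<Rightarrow> (real \<Rightarrow> 'a) set monoid" where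
  "pi1 X a = \<lparr>carrier = loop_class X ` loops_at X a,
              mult = (\<lambda>A B. \<Union>p\<in>A. \<Union>q\<in>B. loop_class X (p +++ q)),
              one = loop_class X (\<lambda>_. a)\<rparr>"

text \<open>The plane is \<open>complex\<close>.\<close>

definition good_config :: "complex set \<Rightarrow> bool" where
  "good_config P \<longleftrightarrow> 0 \<notin> P \<and> (\<forall>C. compact C \<longrightarrow> finite (P \<inter> C))"

text \<open>Follow \<open>\<gamma>\<close> up to time \<open>t\<close>, run once counterclockwise along the circle with center \<open>x\<close> through
  \<open>\<gamma> t\<close>, and come back along \<open>\<gamma>\<close>.\<close>

definition lasso :: "complex \<Rightarrow> (real \<Rightarrow> complex) \<Rightarrow> real \<Rightarrow> real \<Rightarrow> complex" where
  "lasso x \<gamma> t =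
     subpath 0 t \<gamma> +++ ((\<lambda>s. x + (\<gamma> t - x) * cis (2 * pi * s)) +++ reversepath (subpath 0 t \<gamma>))"

text \<open>The number \<open>\<epsilon>\<close> is the size of the small neighbourhood of \<open>x\<close>, which \<open>\<gamma>\<close> does not leave after
  time \<open>t\<close>; the resulting class depends neither on \<open>\<epsilon>\<close> nor on \<open>t\<close>.\<close>

definition is_lasso_class ::
  "complex set \<Rightarrow> complex \<Rightarrow> (real \<Rightarrow> complex) \<Rightarrow> (real \<Rightarrow> complex) set \<Rightarrow> bool" where
  "is_lasso_class P x \<gamma> c \<longleftrightarrow>
     (\<exists>\<epsilon>>0. \<exists>t. 0 < t \<and> t < 1 \<and> cball x \<epsilon> \<inter> P = {x} \<and> \<gamma> ` {t..1} \<subseteq> cball x \<epsilon> \<and>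
        c = loop_class (- P) (lasso x \<gamma> t))"

definition proper_basis :: "complex set \<Rightarrow> (complex \<Rightarrow> (real \<Rightarrow> complex) set) \<Rightarrow> bool" where
  "proper_basis P b \<longleftrightarrow>
     good_config P \<and>
     (\<exists>\<gamma>. (\<forall>x\<in>P. arc (\<gamma> x) \<and> pathstart (\<gamma> x) = 0 \<and> pathfinish (\<gamma> x) = x) \<and>
          (\<forall>x\<in>P. \<forall>y\<in>P. x \<noteq> y \<longrightarrow> path_image (\<gamma> x) \<inter> path_image (\<gamma> y) = {0}) \<and>
          (\<forall>x\<in>P. is_lasso_class P x (\<gamma> x) (b x))) \<and>
     generate (pi1 (- P) 0) (b ` P) = carrier (pi1 (- P) 0)"

text \<open>A random proper basis \<open>b\<close> of the fundamental group of the complement of the random set \<open>P\<close>,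
  measurable with respect to \<open>\<sigma>(P)\<close>.  Fundamental groups of complements of locally finite sets are
  countable, so the measurability of the random family \<open>(b x)\<^sub>x\<close> is that of its level sets: for every
  deterministic loop \<open>l\<close>, the set of the \<open>(w, x)\<close> for which \<open>l\<close> avoids \<open>P w\<close> and represents \<open>b w x\<close>
  is jointly measurable.\<close>

definition measurable_proper_basis ::
  "'w measure \<Rightarrow> ('w \<Rightarrow> complex set) \<Rightarrow> ('w \<Rightarrow> complex \<Rightarrow> (real \<Rightarrow> complex) set) \<Rightarrow> bool" where
  "measurable_proper_basis M P b \<longleftrightarrow>
     (AE w in M. proper_basis (P w) (b w)) \<and>
     (\<forall>l\<in>loops_at UNIV 0.
        {(w, x). w \<in> space M \<and> good_config (P w) \<and> x \<in> P w \<and>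
                 path_image l \<inter> P w = {} \<and> b w x = loop_class (- P w) l}
          \<in> sets (sigma_config M P \<Otimes>\<^sub>M borel))"

section \<open>Holonomies\<close>

definition exp_marks ::
  "('g::topological_space) monoid \<Rightarrow> ('g, 'e::euclidean_space) chart \<Rightarrow>
   (complex \<times> 'e) set \<Rightarrow> (complex \<times> 'g) set" where
  "exp_marks G c S = (\<lambda>(x, Z). (x, lie_exp G c Z)) ` S"

definition holonomy_hom ::
  "('g, 'z) monoid_scheme \<Rightarrow> (complex \<Rightarrow> (real \<Rightarrow> complex) set) \<Rightarrow> (complex \<times> 'g) set \<Rightarrow>
   (real \<Rightarrow> complex) set \<Rightarrow> 'g" where
  "holonomy_hom G b PG =
     (THE h. h \<in> hom (pi1 (- (fst ` PG)) 0) G \<inter> extensional (carrier (pi1 (- (fst ` PG)) 0)) \<and>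
             (\<forall>x\<in>fst ` PG. h (b x) = (THE g. (x, g) \<in> PG)))"

definition holonomy ::
  "('g, 'z) monoid_scheme \<Rightarrow> (complex \<Rightarrow> (real \<Rightarrow> complex) set) \<Rightarrow> (complex \<times> 'g) set \<Rightarrow>
   (real \<Rightarrow> complex) \<Rightarrow> 'g" where
  "holonomy G b PG l = holonomy_hom G b PG (loop_class (- (fst ` PG)) l)"

definition null_loops :: "(real \<Rightarrow> complex) set" where
  "null_loops = {l \<in> loops_at UNIV 0. path_image l \<in> null_sets lborel}"

text \<open>Holonomies are only almost surely well defined, so they are random variables on the
  completed probability space.  Measurability is part of the definition because \<open>distr\<close> is
  meaningless for non-measurable maps.\<close>

definition same_distribution ::
  "'w measure \<Rightarrow> 'a measure \<Rightarrow> ('w \<Rightarrow> 'a) \<Rightarrow> ('w \<Rightarrow> 'a) \<Rightarrow> bool" where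
  "same_distribution M N X Y \<longleftrightarrow>
     X \<in> completion M \<rightarrow>\<^sub>M N \<and> Y \<in> completion M \<rightarrow>\<^sub>M N \<and>
     distr (completion M) N X = distr (completion M) N Y"

text \<open>Only \<open>C\<^sup>1\<close> regularity is asked of diffeomorphisms; smooth ones are included.\<close>

definition diffeomorphism :: "(complex \<Rightarrow> complex) \<Rightarrow> bool" where
  "diffeomorphism \<phi> \<longleftrightarrow> bij \<phi> \<and> Ck_on 1 \<phi> UNIV \<and> Ck_on 1 (inv_into UNIV \<phi>) UNIV"

definition volume_preserving :: "(complex \<Rightarrow> complex) \<Rightarrow> bool" where
  "volume_preserving \<phi> \<longleftrightarrow> (\<forall>A\<in>sets borel. emeasure lborel (\<phi> ` A) = emeasure lborel A)"

end

theory Submission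
  imports Defs "HOL-Library.Sublist" "HOL-Real_Asymp.Real_Asymp"
begin

text \<open>
  For finitely many points with distinct abscissas, the cuts along the vertical half-lines above the points
  turn loops into reduced words; a word is invariant under homotopy because it is the holonomy of a cocycle
  which is locally a coboundary.  The class of a lasso around \<open>x\<close> has a word that is conjugate to a power of
  the letter \<open>x\<close>, a property which survives homeomorphisms.  If such words \<open>v x\<close> generate the free group,
  then the powers are \<open>x\<close> or its inverse, and Nielsen moves reduce the family \<open>v\<close> to the letters.  As the
  law \<open>\<nu>\<close> of \<open>exp Z\<close> is invariant under conjugation and inversion, each move, hence \<open>v\<close>, preserves
  \<open>\<nu>\<^sup>B\<close> and acts surjectively on \<open>G\<^sup>B\<close>.

  Surjectivity shows that the basis has no relation, so that the holonomy homomorphism exists.  Invariance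
  shows that, given the configuration \<open>X\<close>, the joint law of the holonomies of the loops \<open>\<phi> \<circ> l i\<close> is that of
  the crossing words of the \<open>l i\<close> with respect to \<open>\<phi>\<^bsup>-1\<^esup> X\<close>, evaluated at independent elements of law
  \<open>\<nu>\<close>.  This is a measurable function of \<open>\<phi>\<^bsup>-1\<^esup> X\<close>, which does not involve the basis, and \<open>\<phi>\<^bsup>-1\<^esup> X\<close> has the
  law of \<open>X\<close> when \<open>\<phi>\<close> preserves the area.
\<close>

section \<open>Words and free groups\<close>

text \<open>The basis depends on the configuration, so no free basis can be fixed before the points
  are drawn. Discs, representative loops and words from countable families cut the probability space
  into pieces on which the holonomies are fixed words in the marks of finitely many disjoint discs.
  Given the configuration such marks are independent, by a comparison of void probabilities.

  The diffeomorphism moves the points and not the basis, and the image of a lasso need not contain a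
  circle. Hence a lasso is remembered only through a contraction of its loop to \<open>x\<close>,
  which homeomorphisms carry along. Vertical cuts require distinct abscissas before and after the
  change of coordinates; both hold almost surely.

  Besides continuity of the group operations, three facts about \<open>lie_exp\<close> reach the
  probabilistic part: continuity, equivariance under \<open>Ad\<close>, and that \<open>- Z\<close>
  goes to the inverse. As \<open>lie_exp\<close> is a definite description, one-parameter subgroups
  have to be constructed and shown unique; iterated square roots in a chart do both without
  differential equations.\<close>

primrec weval :: "('h, 'z) monoid_scheme \<Rightarrow> ('x \<Rightarrow> 'h) \<Rightarrow> ('x \<times> bool) list \<Rightarrow> 'h" where
  "weval H f [] = \<one>\<^bsub>H\<^esub>"
| "weval H f (a # w) = (if snd a then f (fst a) else inv\<^bsub>H\<^esub> f (fst a)) \<otimes>\<^bsub>H\<^esub> weval H f w"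

definition flip :: "'x \<times> bool \<Rightarrow> 'x \<times> bool" where
  "flip a = (fst a, \<not> snd a)"

definition winv :: "('x \<times> bool) list \<Rightarrow> ('x \<times> bool) list" where
  "winv w = rev (map flip w)"

lemma flip_flip [simp]: "flip (flip a) = a"
  and fst_flip [simp]: "fst (flip a) = fst a"
  and snd_flip [simp]: "snd (flip a) = (\<not> snd a)"
  and flip_neq [simp]: "flip a \<noteq> a" "a \<noteq> flip a"
  by (auto simp: flip_def prod_eq_iff)

lemma flip_eq_iff: "flip a = b \<longleftrightarrow> a = flip b"
  by (auto simp: flip_def prod_eq_iff)

lemma fst_set_winv [simp]: "fst ` set (winv w) = fst ` set w"
  by (simp add: winv_def image_image)

lemma (in group) weval_closed:
  "f ` fst ` set w \<subseteq> carrier G \<Longrightarrow> weval G f w \<in> carrier G"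
  by (induction w) auto

lemma (in group) weval_append:
  "f ` fst ` set u \<subseteq> carrier G \<Longrightarrow> f ` fst ` set w \<subseteq> carrier G \<Longrightarrow>
    weval G f (u @ w) = weval G f u \<otimes> weval G f w"
  by (induction u) (auto simp: m_assoc weval_closed)

lemma weval_cong:
  "(\<And>x. x \<in> fst ` set w \<Longrightarrow> f x = g x) \<Longrightarrow> weval H f w = weval H g w"
  by (induction w) auto

lemma weval_map:
  "weval H f (map (\<lambda>a. (\<sigma> (fst a), snd a)) w) = weval H (\<lambda>j. f (\<sigma> j)) w"
  by (induction w) auto

lemma (in group_hom) hom_weval:
  "f ` fst ` set w \<subseteq> carrier G \<Longrightarrow> h (weval G f w) = weval H (\<lambda>x. h (f x)) w"
  by (induction w) (auto simp: G.weval_closed)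

lemma (in group) generate_weval:
  assumes "a \<in> generate G (f ` B)" "f ` B \<subseteq> carrier G"
  obtains w where "fst ` set w \<subseteq> B" "weval G f w = a"
proof -
  have "\<exists>w. fst ` set w \<subseteq> B \<and> weval G f w = a"
    using assms(1)
  proof induction
    case one
    show ?case by (rule exI[of _ "[]"]) simp
  next
    case (incl h)
    then obtain x where "x \<in> B" "h = f x" by auto
    then show ?case using assms(2) by (intro exI[of _ "[(x, True)]"]) auto
  next
    case (inv h)
    then obtain x where "x \<in> B" "h = f x" by auto
    then show ?case using assms(2) by (intro exI[of _ "[(x, False)]"]) auto
  next
    case (eng h1 h2)
    then obtain w1 w2 where "fst ` set w1 \<subseteq> B" "weval G f w1 = h1" "fst ` set w2 \<subseteq> B" "weval G f w2 = h2"
      by auto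
    then show ?case using assms(2)
      by (intro exI[of _ "w1 @ w2"]) (auto simp: weval_append image_subset_iff)
  qed
  then show ?thesis using that by auto
qed

section \<open>Reduced words and the free group\<close>

abbreviation reduced :: "('x \<times> bool) list \<Rightarrow> bool" where
  "reduced \<equiv> successively (\<lambda>a b. b \<noteq> flip a)"

text \<open>Left multiplication of a reduced word by one letter. Letting letters act on reduced
  words in this way (van der Waerden's trick) gives the law of the free group without a confluence
  argument; reduced words being normal forms, equality in \<open>freeg\<close> is equality of
  lists.\<close>

fun push :: "'x \<times> bool \<Rightarrow> ('x \<times> bool) list \<Rightarrow> ('x \<times> bool) list" where
  "push a [] = [a]"
| "push a (b # w) = (if b = flip a then w else a # b # w)"

definition freeg :: "'x set \<Rightarrow> ('x \<times> bool) list monoid" where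
  "freeg B = \<lparr>carrier = {w. reduced w \<and> fst ` set w \<subseteq> B}, mult = foldr push, one = []\<rparr>"

lemma carrier_freeg: "w \<in> carrier (freeg B) \<longleftrightarrow> reduced w \<and> fst ` set w \<subseteq> B"
  and mult_freeg [simp]: "u \<otimes>\<^bsub>freeg B\<^esub> w = foldr push u w"
  and one_freeg [simp]: "\<one>\<^bsub>freeg B\<^esub> = []"
  by (auto simp: freeg_def)

lemma reduced_push: "reduced w \<Longrightarrow> reduced (push a w)"
  by (cases w) (auto simp: successively_Cons split: if_splits)

lemma reduced_foldr_push: "reduced w \<Longrightarrow> reduced (foldr push u w)"
  by (induction u) (auto simp: reduced_push)

text \<open>If \<open>w\<close> starts with \<open>a\<close>, the inner \<open>push\<close> removes
  this letter; reducedness is what prevents the outer \<open>push\<close> from cancelling against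
  the next one.\<close>

lemma push_flip: "reduced w \<Longrightarrow> push a (push (flip a) w) = w"
  by (cases w) (auto simp: successively_Cons split: if_splits elim: successively.elims)

lemma set_push: "fst ` set (push a w) \<subseteq> insert (fst a) (fst ` set w)"
  by (cases w) auto

lemma set_foldr_push: "fst ` set (foldr push u w) \<subseteq> fst ` set u \<union> fst ` set w"
proof (induction u)
  case (Cons a u)
  have "fst ` set (foldr push (a # u) w) \<subseteq> insert (fst a) (fst ` set (foldr push u w))"
    using set_push[of a "foldr push u w"] by simp
  also have "\<dots> \<subseteq> insert (fst a) (fst ` set u \<union> fst ` set w)"
    using Cons.IH by blast
  finally show ?case by simp
qed simp

text \<open>A cancellation inside \<open>push a u\<close> is matched by a cancellation of the two
  actions on \<open>w\<close>. Associativity of the product then follows letter by letter.\<close>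

lemma foldr_push_push: "reduced w \<Longrightarrow> foldr push (push a u) w = push a (foldr push u w)"
  by (cases u) (auto simp: push_flip reduced_foldr_push)

lemma foldr_push_assoc:
  "reduced w \<Longrightarrow> foldr push (foldr push u v) w = foldr push u (foldr push v w)"
  by (induction u) (auto simp: foldr_push_push)

lemma reduced_append_eq: "reduced (u @ w) \<Longrightarrow> foldr push u w = u @ w"
proof (induction u)
  case (Cons a u)
  then have "foldr push u w = u @ w" by (auto simp: successively_Cons)
  with Cons.prems show ?case by (cases "u @ w") auto
qed simp

lemma reduced_winv: "reduced w \<Longrightarrow> reduced (winv w)"
  unfolding winv_def successively_rev successively_map
  by (erule successively_mono) (auto simp: flip_eq_iff)

lemma foldr_push_winv: "foldr push (winv u) u = []"
proof (induction u)
  case (Cons a u)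
  have "push (flip a) (a # u) = u"
    by simp
  with Cons show ?case by (simp add: winv_def)
qed (simp add: winv_def)

lemma group_freeg: "group (freeg B)"
proof (rule groupI)
  fix x y assume "x \<in> carrier (freeg B)" "y \<in> carrier (freeg B)"
  then show "x \<otimes>\<^bsub>freeg B\<^esub> y \<in> carrier (freeg B)"
    using set_foldr_push[of x y] unfolding carrier_freeg
    by (simp add: reduced_foldr_push) (metis Un_least subset_trans)
next
  fix x assume "x \<in> carrier (freeg B)"
  then show "\<exists>y\<in>carrier (freeg B). y \<otimes>\<^bsub>freeg B\<^esub> x = \<one>\<^bsub>freeg B\<^esub>"
    by (intro bexI[of _ "winv x"]) (auto simp: carrier_freeg reduced_winv foldr_push_winv)
qed (auto simp: carrier_freeg foldr_push_assoc)

lemma inv_freeg: "w \<in> carrier (freeg B) \<Longrightarrow> inv\<^bsub>freeg B\<^esub> w = winv w"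
  using group.inv_equality[OF group_freeg[of B], of "winv w" w]
  by (auto simp: carrier_freeg reduced_winv foldr_push_winv)

lemma letter_in_freeg [simp]: "[a] \<in> carrier (freeg B) \<longleftrightarrow> fst a \<in> B"
  by (auto simp: carrier_freeg)

lemma (in group) weval_push:
  assumes "f ` fst ` set w \<subseteq> carrier G" "f (fst a) \<in> carrier G"
  shows "weval G f (push a w) = (if snd a then f (fst a) else inv (f (fst a))) \<otimes> weval G f w"
proof (cases w)
  case (Cons b w')
  then show ?thesis using assms
    by (auto simp: m_assoc[symmetric] weval_closed)
qed simp

lemma (in group) weval_foldr_push:
  assumes "f ` fst ` set w \<subseteq> carrier G" "f ` fst ` set u \<subseteq> carrier G"
  shows "weval G f (foldr push u w) = weval G f u \<otimes> weval G f w"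
  using assms(2)
proof (induction u)
  case (Cons a u)
  have "f ` fst ` set (foldr push u w) \<subseteq> carrier G"
    using image_mono[OF set_foldr_push[of u w], of f] assms(1) Cons.prems
    by (simp add: image_Un subset_trans)
  with Cons assms(1) show ?case
    by (auto simp: weval_push m_assoc weval_closed)
qed (use assms in \<open>simp add: weval_closed\<close>)

lemma (in group) weval_hom:
  assumes "f ` B \<subseteq> carrier G"
  shows "group_hom (freeg B) G (weval G f)"
proof (rule group_hom.intro[OF group_freeg is_group group_hom_axioms.intro])
  show "weval G f \<in> hom (freeg B) G"
  proof (rule homI)
    have sub: "f ` fst ` set w \<subseteq> carrier G" if "w \<in> carrier (freeg B)" for w
      using assms that by (auto simp only: carrier_freeg)
    fix x y assume xy: "x \<in> carrier (freeg B)" "y \<in> carrier (freeg B)"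
    show "weval G f x \<in> carrier G" by (rule weval_closed[OF sub[OF xy(1)]])
    show "weval G f (x \<otimes>\<^bsub>freeg B\<^esub> y) = weval G f x \<otimes> weval G f y"
      using weval_foldr_push[OF sub[OF xy(2)] sub[OF xy(1)]] by simp
  qed
qed

lemma weval_letters:
  assumes "fst ` set w \<subseteq> B"
  shows "weval (freeg B) (\<lambda>x. [(x, True)]) w = foldr push w []"
  using assms
proof (induction w)
  case (Cons a w)
  then show ?case by (cases a) (auto simp: inv_freeg winv_def flip_def)
qed simp

text \<open>The exponent of \<open>z\<close> in the abelianization: an additive function on the free
  group, unchanged by conjugation.\<close>

definition expsum :: "'x \<Rightarrow> ('x \<times> bool) list \<Rightarrow> int" where
  "expsum z w = (\<Sum>a\<leftarrow>w. if fst a = z then (if snd a then 1 else - 1) else 0)"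

lemma expsum_push: "expsum z (push a w) = expsum z [a] + expsum z w"
  by (cases w) (auto simp: expsum_def)

lemma expsum_foldr_push: "expsum z (foldr push u w) = expsum z u + expsum z w"
  by (induction u) (auto simp: expsum_push, auto simp: expsum_def)

lemma expsum_winv: "expsum z (winv w) = - expsum z w"
  by (induction w) (auto simp: expsum_def winv_def)

text \<open>Neighbours in a reduced word are never inverse to each other, so on a single letter all
  signs agree.\<close>

lemma reduced_single_letter:
  assumes "reduced w" "fst ` set w \<subseteq> {x}"
  obtains e where "w = replicate (length w) (x, e)"
proof -
  have "\<exists>e. w = replicate (length w) (x, e)"
    using assms
  proof (induction w)
    case (Cons a w)
    then obtain e where e: "w = replicate (length w) (x, e)"
      by (auto simp: successively_Cons)
    show ?case
    proof (cases w)
      case Nil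
      then show ?thesis using Cons.prems by (cases a) auto
    next
      case (Cons b w')
      then have "b = (x, e)" using e by auto
      with Cons Cons.prems have "a = (x, e)"
        by (cases a) (auto simp: flip_def)
      then show ?thesis using e by (auto intro!: exI[of _ e])
    qed
  qed simp
  then show ?thesis using that by auto
qed

lemma single_letter_expsum_unit:
  assumes "reduced w" "fst ` set w \<subseteq> {x}" "\<bar>expsum x w\<bar> = 1"
  obtains e where "w = [(x, e)]"
proof -
  obtain e where e: "w = replicate (length w) (x, e)"
    using reduced_single_letter[OF assms(1,2)] .
  have "expsum x (replicate n (x, e)) = (if e then int n else - int n)" for n
    by (induction n) (auto simp: expsum_def)
  with e assms(3) have "length w = 1" by (metis abs_minus_cancel abs_of_nat of_nat_eq_1_iff)
  with e that[of e] show ?thesis by (metis One_nat_def replicate_0 replicate_Suc)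
qed

section \<open>Conjugates of letters that generate a free group\<close>

context
  fixes B :: "'x set" and F :: "('x \<times> bool) list monoid"
  defines "F \<equiv> freeg B"
begin

interpretation F: group F
  unfolding F_def by (rule group_freeg)

lemma expsum_mult_F: "expsum z (u \<otimes>\<^bsub>F\<^esub> w) = expsum z u + expsum z w"
  by (simp add: F_def expsum_foldr_push)

lemma expsum_inv_F: "w \<in> carrier F \<Longrightarrow> expsum z (inv\<^bsub>F\<^esub> w) = - expsum z w"
  by (simp add: F_def inv_freeg expsum_winv)

text \<open>The exponent sum of \<open>z\<close> ignores conjugation, so on the subgroup generated
  by the \<open>v x\<close> it only takes multiples of its value at \<open>p z\<close>. As the
  letter \<open>z\<close> itself lies in this subgroup, that value is a unit, and a power of
  \<open>z\<close> with exponent sum 1 or - 1 is the letter or its inverse.\<close>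

lemma generating_conjugates_of_powers:
  assumes u: "\<And>x. x \<in> B \<Longrightarrow> u x \<in> carrier F"
    and p: "\<And>x. x \<in> B \<Longrightarrow> p x \<in> carrier F \<and> fst ` set (p x) \<subseteq> {x}"
    and v: "\<And>x. x \<in> B \<Longrightarrow> v x = u x \<otimes>\<^bsub>F\<^esub> p x \<otimes>\<^bsub>F\<^esub> inv\<^bsub>F\<^esub> (u x)"
    and gen: "generate F (v ` B) = carrier F"
    and z: "z \<in> B"
  obtains e where "p z = [(z, e)]"
proof -
  have vexp: "expsum z (v x) = (if x = z then expsum z (p z) else 0)" if "x \<in> B" for x
  proof -
    have "expsum z (v x) = expsum z (p x)"
      using v[OF that] u[OF that] p[OF that] by (simp add: expsum_mult_F expsum_inv_F)
    moreover have "expsum z (p x) = 0" if "x \<noteq> z"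
    proof -
      have *: "\<forall>a\<in>set (p x). fst a \<noteq> z" using p[OF \<open>x \<in> B\<close>] that by auto
      have "expsum z w = 0" if "\<forall>a\<in>set w. fst a \<noteq> z" for w :: "('x \<times> bool) list"
        using that by (induction w) (auto simp: expsum_def)
      with * show ?thesis by blast
    qed
    ultimately show ?thesis by auto
  qed
  have vc: "v x \<in> carrier F" if "x \<in> B" for x
    using v[OF that] u[OF that] p[OF that] by simp
  have dvd: "expsum z (p z) dvd expsum z a" if "a \<in> generate F (v ` B)" for a
    using that
  proof induction
    case one
    show ?case by (simp add: F_def expsum_def)
  next
    case (incl h)
    then show ?case by (auto simp: vexp)
  next
    case (inv h)
    then show ?case by (auto simp: vexp expsum_inv_F vc)
  next
    case (eng h1 h2)
    then show ?case by (auto simp: expsum_mult_F)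
  qed
  have "expsum z (p z) dvd expsum z [(z, True)]"
    by (rule dvd) (use z in \<open>simp add: gen\<close>, simp add: F_def)
  then have "\<bar>expsum z (p z)\<bar> = 1"
    by (simp add: expsum_def)
  then show ?thesis
    using single_letter_expsum_unit[of "p z" z] p[OF z] that by (auto simp: F_def carrier_freeg)
qed

text \<open>The cancellation argument: when no \<open>u x\<close> starts with \<open>u y\<close> followed by a letter \<open>y\<close> or its inverse,
  nothing to the left of the middle letter of the first factor cancels in a reduced product.\<close>

lemma prefix_weval_conjugates:
  assumes u: "\<And>x. x \<in> B \<Longrightarrow> u x \<in> carrier F \<and> (u x \<noteq> [] \<longrightarrow> fst (last (u x)) \<noteq> x)"
    and v: "\<And>x. x \<in> B \<Longrightarrow> v x = u x \<otimes>\<^bsub>F\<^esub> [(x, True)] \<otimes>\<^bsub>F\<^esub> inv\<^bsub>F\<^esub> (u x)"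
    and noprefix: "\<And>x y s. x \<in> B \<Longrightarrow> y \<in> B \<Longrightarrow> \<not> prefix (u y @ [(y, s)]) (u x)"
  shows "fst ` set ((x, s) # w) \<subseteq> B \<Longrightarrow> reduced ((x, s) # w) \<Longrightarrow>
    prefix (u x @ [(x, s)]) (weval F v ((x, s) # w))"
proof -
  have vc: "v x \<in> carrier F" if "x \<in> B" for x
  proof -
    have "[(x, True)] \<in> carrier F" using that by (simp add: F_def)
    then show ?thesis using v[OF that] u[OF that] by simp
  qed
  \<comment> \<open>One factor at a time: multiplying \<open>r\<close> by \<open>v x\<close> or its
    inverse keeps the middle letter of the new factor visible, provided that \<open>r\<close> does
    not begin with \<open>u x\<close> followed by the opposite letter.\<close>
  have main: "prefix (u x @ [(x, s)]) (weval F v ((x, s) # w))"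
    if w: "fst ` set ((x, s) # w) \<subseteq> B" and np: "\<not> prefix (u x @ [(x, \<not> s)]) (weval F v w)" for x s w
  proof -
    define r where "r = weval F v w"
    have x: "x \<in> B" and rc: "r \<in> carrier F"
      using w vc by (auto simp: r_def intro!: F.weval_closed)
    note ux = u[OF x, THEN conjunct1]
    have lc: "[(x, t)] \<in> carrier F" for t using x by (simp add: F_def)
    define q where "q = inv\<^bsub>F\<^esub> (u x) \<otimes>\<^bsub>F\<^esub> r"
    have qc: "q \<in> carrier F" using ux rc by (simp add: q_def)
    have glue: "u x \<otimes>\<^bsub>F\<^esub> ((x, t) # q') = u x @ (x, t) # q'" if "(x, t) # q' \<in> carrier F" for t q'
    proof -
      have "reduced (u x @ (x, t) # q')"
        using that u[OF x]
        by (auto simp: F_def carrier_freeg successively_append_iff dest: arg_cong[of "(x, t)" _ fst])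
      then show ?thesis by (simp add: F_def reduced_append_eq)
    qed
    have nq: "\<not> (\<exists>q'. q = (x, \<not> s) # q')"
    proof
      assume "\<exists>q'. q = (x, \<not> s) # q'"
      then obtain q' where q': "q = (x, \<not> s) # q'" by auto
      have "r = u x \<otimes>\<^bsub>F\<^esub> q"
        using ux rc by (simp add: q_def F.m_assoc[symmetric])
      also have "\<dots> = u x @ (x, \<not> s) # q'" using glue qc q' by simp
      finally show False using np by (auto simp: r_def prefix_def)
    qed
    have vs: "(if s then v x else inv\<^bsub>F\<^esub> v x) = u x \<otimes>\<^bsub>F\<^esub> [(x, s)] \<otimes>\<^bsub>F\<^esub> inv\<^bsub>F\<^esub> (u x)"
    proof (cases s)
      case False
      have "inv\<^bsub>F\<^esub> [(x, True)] = [(x, False)]"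
        using x by (simp add: F_def inv_freeg winv_def flip_def)
      then show ?thesis using False v[OF x] ux lc
        by (simp add: F.inv_mult_group F.m_assoc)
    qed (use v[OF x] in simp)
    have xq: "[(x, s)] \<otimes>\<^bsub>F\<^esub> q = (x, s) # q"
      using nq by (cases q) (auto simp: F_def flip_def)
    have "weval F v ((x, s) # w) = u x \<otimes>\<^bsub>F\<^esub> ([(x, s)] \<otimes>\<^bsub>F\<^esub> q)"
      using vs ux lc rc by (simp only: weval.simps fst_conv snd_conv r_def[symmetric] q_def F.m_assoc F.m_closed F.inv_closed)
    also have "\<dots> = u x @ (x, s) # q"
      using glue[of s q] lc qc xq by (metis F.m_closed)
    finally show ?thesis by (simp add: prefix_def)
  qed
  show "fst ` set ((x, s) # w) \<subseteq> B \<Longrightarrow> reduced ((x, s) # w) \<Longrightarrow>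
    prefix (u x @ [(x, s)]) (weval F v ((x, s) # w))"
  proof (induction w arbitrary: x s)
    case Nil
    show ?case
      by (rule main) (use Nil in \<open>auto simp: F_def\<close>)
  next
    case (Cons a w x s)
    obtain y t where a: "a = (y, t)" by (cases a)
    from Cons.prems have "reduced (a # w)" "fst ` set (a # w) \<subseteq> B" and at: "a \<noteq> flip (x, s)"
      by auto
    with Cons.IH a have IH: "prefix (u y @ [(y, t)]) (weval F v (a # w))" by auto
    have xy: "x \<in> B" "y \<in> B" using Cons.prems a by auto
    show ?case
    proof (rule main)
      show "\<not> prefix (u x @ [(x, \<not> s)]) (weval F v (a # w))"
      proof
        assume "prefix (u x @ [(x, \<not> s)]) (weval F v (a # w))"
        \<comment> \<open>Two prefixes of the same word are comparable. A strict inclusion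
          contradicts \<open>noprefix\<close>, and equality would make the two middle letters
          inverse to each other in a reduced word.\<close>
        then consider "prefix (u x @ [(x, \<not> s)]) (u y @ [(y, t)])"
          | "prefix (u y @ [(y, t)]) (u x @ [(x, \<not> s)])"
          using IH prefix_same_cases by blast
        then show False
          using noprefix[of y x] noprefix[of x y] at a xy
          by cases (auto simp: prefix_snoc flip_def)
      qed
    qed (use Cons.prems in auto)
  qed
qed

text \<open>A conjugator ending with \<open>x\<close> or its inverse can drop this letter, since it
  commutes with \<open>[(x, e)]\<close>; the length does not grow.\<close>

lemma strip_conjugator:
  assumes "w \<in> carrier F" "x \<in> B"
  obtains w' where "w' \<in> carrier F" "length w' \<le> length w" "w' \<noteq> [] \<longrightarrow> fst (last w') \<noteq> x"
    "\<And>e. w \<otimes>\<^bsub>F\<^esub> [(x, e)] \<otimes>\<^bsub>F\<^esub> inv\<^bsub>F\<^esub> w = w' \<otimes>\<^bsub>F\<^esub> [(x, e)] \<otimes>\<^bsub>F\<^esub> inv\<^bsub>F\<^esub> w'"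
proof -
  have "\<exists>w'. w' \<in> carrier F \<and> length w' \<le> length w \<and> (w' \<noteq> [] \<longrightarrow> fst (last w') \<noteq> x) \<and>
    (\<forall>e. w \<otimes>\<^bsub>F\<^esub> [(x, e)] \<otimes>\<^bsub>F\<^esub> inv\<^bsub>F\<^esub> w = w' \<otimes>\<^bsub>F\<^esub> [(x, e)] \<otimes>\<^bsub>F\<^esub> inv\<^bsub>F\<^esub> w')"
    using assms(1)
  proof (induction w rule: rev_induct)
    case Nil
    then show ?case by (intro exI[of _ "[]"]) auto
  next
    case (snoc a w)
    show ?case
    proof (cases "fst a = x")
      case False
      then show ?thesis using snoc.prems by (intro exI[of _ "w @ [a]"]) auto
    next
      case True
      then obtain s where a: "a = (x, s)" by (cases a) auto
      have w: "w \<in> carrier F" and red: "reduced (w @ [a])"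
        using snoc.prems by (auto simp: F_def carrier_freeg successively_append_iff)
      have lc: "[(x, t)] \<in> carrier F" for t using assms(2) by (simp add: F_def)
      have wa: "w @ [a] = w \<otimes>\<^bsub>F\<^esub> [a]" using red by (simp add: F_def reduced_append_eq)
      have xx: "[a] \<otimes>\<^bsub>F\<^esub> [(x, e)] \<otimes>\<^bsub>F\<^esub> inv\<^bsub>F\<^esub> [a] = [(x, e)]" for e
        using assms(2) a by (cases s; cases e) (auto simp: F_def inv_freeg winv_def flip_def)
      have "(w @ [a]) \<otimes>\<^bsub>F\<^esub> [(x, e)] \<otimes>\<^bsub>F\<^esub> inv\<^bsub>F\<^esub> (w @ [a]) = w \<otimes>\<^bsub>F\<^esub> [(x, e)] \<otimes>\<^bsub>F\<^esub> inv\<^bsub>F\<^esub> w" for e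
      proof -
        have "(w @ [a]) \<otimes>\<^bsub>F\<^esub> [(x, e)] \<otimes>\<^bsub>F\<^esub> inv\<^bsub>F\<^esub> (w @ [a]) =
          w \<otimes>\<^bsub>F\<^esub> ([a] \<otimes>\<^bsub>F\<^esub> [(x, e)] \<otimes>\<^bsub>F\<^esub> inv\<^bsub>F\<^esub> [a]) \<otimes>\<^bsub>F\<^esub> inv\<^bsub>F\<^esub> w"
          unfolding wa using w lc a by (simp add: F.m_assoc F.inv_mult_group)
        then show ?thesis by (simp add: xx)
      qed
      with snoc.IH[OF w] show ?thesis
        by (metis le_Suc_eq length_append_singleton)
    qed
  qed
  then show ?thesis using that by blast
qed

lemma length_foldr_push: "length (foldr push u w) \<le> length u + length w"
proof (induction u)
  case (Cons a u)
  have "length (push a (foldr push u w)) \<le> Suc (length (foldr push u w))"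
    by (cases "foldr push u w") auto
  with Cons show ?case by simp
qed simp

text \<open>Nielsen reduction: as long as some \<open>u x\<close> starts with \<open>u y\<close> followed by a letter \<open>y\<close> or its inverse,
  conjugating \<open>v x\<close> by \<open>v y\<close> or its inverse shortens \<open>u x\<close>.\<close>

theorem generating_conjugates_induct:
  fixes G :: "('g, 'z) monoid_scheme" and Q :: "(('x \<Rightarrow> 'g) \<Rightarrow> 'x \<Rightarrow> 'g) \<Rightarrow> bool"
  assumes G: "group G" and UN: "carrier G = UNIV" and fin: "finite B"
    and Q_id: "Q (\<lambda>g. restrict g B)"
    and Q_conj: "\<And>\<Psi> x y s. x \<in> B \<Longrightarrow> y \<in> B \<Longrightarrow> x \<noteq> y \<Longrightarrow> Q \<Psi> \<Longrightarrow>
      Q (\<lambda>g. (\<Psi> g)(x := (if s then \<Psi> g y else inv\<^bsub>G\<^esub> \<Psi> g y) \<otimes>\<^bsub>G\<^esub> \<Psi> g x \<otimes>\<^bsub>G\<^esub>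
        inv\<^bsub>G\<^esub> (if s then \<Psi> g y else inv\<^bsub>G\<^esub> \<Psi> g y)))"
    and Q_inv: "\<And>\<Psi> x. x \<in> B \<Longrightarrow> Q \<Psi> \<Longrightarrow> Q (\<lambda>g. (\<Psi> g)(x := inv\<^bsub>G\<^esub> \<Psi> g x))"
    and u: "\<And>x. x \<in> B \<Longrightarrow> u x \<in> carrier F"
    and v: "\<And>x. x \<in> B \<Longrightarrow> v x = u x \<otimes>\<^bsub>F\<^esub> [(x, e x)] \<otimes>\<^bsub>F\<^esub> inv\<^bsub>F\<^esub> (u x)"
    and gen: "generate F (v ` B) = carrier F"
  shows "Q (\<lambda>g. \<lambda>x\<in>B. weval G g (v x))"
proof -
  interpret G: group G by fact
  have hom: "group_hom F G (weval G g)" for g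
    unfolding F_def by (rule G.weval_hom) (simp add: UN)
  have lc: "[(x, t)] \<in> carrier F" if "x \<in> B" for t x using that by (simp add: F_def)
  have linv: "inv\<^bsub>F\<^esub> [(x, t)] = [(x, \<not> t)]" if "x \<in> B" for t x
    using that by (simp add: F_def inv_freeg winv_def flip_def)
  have genI: "generate F (v' ` B) = carrier F"
    if "generate F (v ` B) = carrier F" "v' ` B \<subseteq> carrier F" "v ` B \<subseteq> generate F (v' ` B)" for v v'
    using F.generate_subgroup_incl[OF that(3) F.generate_is_subgroup[OF that(2)]] that(1)
      F.generate_incl[OF that(2)] by blast
  have u': "\<exists>u'. \<forall>x\<in>B. u' x \<in> carrier F \<and> (u' x \<noteq> [] \<longrightarrow> fst (last (u' x)) \<noteq> x) \<and>
      v x = u' x \<otimes>\<^bsub>F\<^esub> [(x, e x)] \<otimes>\<^bsub>F\<^esub> inv\<^bsub>F\<^esub> (u' x)"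
    using strip_conjugator[OF u] v by (intro bchoice) metis
  then obtain u' where u': "\<And>x. x \<in> B \<Longrightarrow> u' x \<in> carrier F \<and> (u' x \<noteq> [] \<longrightarrow> fst (last (u' x)) \<noteq> x)"
    "\<And>x. x \<in> B \<Longrightarrow> v x = u' x \<otimes>\<^bsub>F\<^esub> [(x, e x)] \<otimes>\<^bsub>F\<^esub> inv\<^bsub>F\<^esub> (u' x)" by blast
  have "Q (\<lambda>g. \<lambda>x\<in>B. weval G g (v x))"
    if "\<And>x. x \<in> B \<Longrightarrow> u x \<in> carrier F \<and> (u x \<noteq> [] \<longrightarrow> fst (last (u x)) \<noteq> x)"
      "\<And>x. x \<in> B \<Longrightarrow> v x = u x \<otimes>\<^bsub>F\<^esub> [(x, e x)] \<otimes>\<^bsub>F\<^esub> inv\<^bsub>F\<^esub> (u x)"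
      "generate F (v ` B) = carrier F" for u v e
    using that
  \<comment> \<open>The measure is the total length of the conjugators plus one for every inverted
    middle letter, so that inversions and conjugations both decrease it.\<close>
  proof (induction "\<Sum>x\<in>B. length (u x) + (if e x then 0 else 1)" arbitrary: u v e rule: less_induct)
    case less
    note u = less.prems(1) and v = less.prems(2) and gen = less.prems(3)
    have vc: "v x \<in> carrier F" if "x \<in> B" for x
      using v[OF that] u[OF that] lc[OF that] by simp
    show ?case
    proof (cases "\<exists>x\<in>B. \<not> e x")
      case True
      then obtain x where x: "x \<in> B" "\<not> e x" by auto
      define e' where "e' = e(x := True)"
      define v' where "v' = v(x := inv\<^bsub>F\<^esub> (v x))"
      have v'c: "v' ` B \<subseteq> carrier F" using vc by (auto simp: v'_def)
      have lt: "(\<Sum>y\<in>B. length (u y) + (if e' y then 0 else 1)) <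
        (\<Sum>y\<in>B. length (u y) + (if e y then 0 else 1))"
        by (rule sum_strict_mono_ex1[OF fin]) (use x in \<open>auto simp: e'_def\<close>)
      have "Q (\<lambda>g. \<lambda>x\<in>B. weval G g (v' x))"
      proof (rule less.hyps[OF lt u])
        show "v' y = u y \<otimes>\<^bsub>F\<^esub> [(y, e' y)] \<otimes>\<^bsub>F\<^esub> inv\<^bsub>F\<^esub> (u y)" if "y \<in> B" for y
          using v[OF that] u[OF that] lc[OF that] x linv[OF x(1)]
          by (auto simp: v'_def e'_def F.inv_mult_group F.m_assoc)
        show "generate F (v' ` B) = carrier F"
        proof (rule genI[OF gen v'c])
          have "v y \<in> generate F (v' ` B)" if "y \<in> B" for y
          proof (cases "y = x")
            case True
            then have "v y = inv\<^bsub>F\<^esub> (v' x)" using vc x by (simp add: v'_def)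
            then show ?thesis using x by (auto intro: generate.inv)
          next
            case False
            then have "v y = v' y" by (simp add: v'_def)
            then show ?thesis using that by (auto intro: generate.incl)
          qed
          then show "v ` B \<subseteq> generate F (v' ` B)" by auto
        qed
      qed
      from Q_inv[OF x(1) this]
      have "Q (\<lambda>g. (\<lambda>y\<in>B. weval G g (v' y))(x := inv\<^bsub>G\<^esub> (weval G g (v' x))))"
        using x by simp
      moreover have "(\<lambda>y\<in>B. weval G g (v' y))(x := inv\<^bsub>G\<^esub> (weval G g (v' x))) = (\<lambda>y\<in>B. weval G g (v y))" for g
        using group_hom.hom_inv[OF hom, of "v x" g] vc x UN by (auto simp: v'_def fun_eq_iff)
      ultimately show ?thesis by simp
    next
      case False
      then have v: "v x = u x \<otimes>\<^bsub>F\<^esub> [(x, True)] \<otimes>\<^bsub>F\<^esub> inv\<^bsub>F\<^esub> (u x)" if "x \<in> B" for x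
        using v that by auto
      show ?thesis
      proof (cases "\<exists>x\<in>B. \<exists>y\<in>B. \<exists>s. prefix (u y @ [(y, s)]) (u x)")
        case True
        then obtain x y s t where x: "x \<in> B" and y: "y \<in> B" and ux: "u x = u y @ (y, s) # t"
          by (auto simp: prefix_def)
        have xy: "x \<noteq> y" using ux by auto
        have tc: "t \<in> carrier F" and red: "reduced (u y @ (y, s) # t)"
          using u[OF x] unfolding ux
          by (auto simp: F_def carrier_freeg successively_append_iff successively_Cons)
        have uy: "u y \<in> carrier F" using u[OF y] by simp
        \<comment> \<open>As \<open>u x\<close> is \<open>u y\<close> followed by
          \<open>(y, s)\<close> and \<open>t\<close>, it equals \<open>a\<close> times the product
          of \<open>u y\<close> and \<open>t\<close>. Conjugating \<open>v x\<close> by the inverse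
          of \<open>a\<close>, which is \<open>v y\<close> or its inverse, thus leaves a conjugator
          without the letter \<open>(y, s)\<close>.\<close>
        define a where "a = u y \<otimes>\<^bsub>F\<^esub> [(y, s)] \<otimes>\<^bsub>F\<^esub> inv\<^bsub>F\<^esub> (u y)"
        have ac: "a \<in> carrier F" using uy lc[OF y] by (simp add: a_def)
        have as: "a = (if s then v y else inv\<^bsub>F\<^esub> (v y))"
        proof (cases s)
          case False
          then show ?thesis using v[OF y] uy lc[OF y] linv[OF y]
            by (simp add: a_def F.inv_mult_group F.m_assoc)
        qed (simp add: a_def v[OF y])
        have "u x = u y \<otimes>\<^bsub>F\<^esub> ([(y, s)] \<otimes>\<^bsub>F\<^esub> t)"
        proof -
          have "[(y, s)] \<otimes>\<^bsub>F\<^esub> t = (y, s) # t"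
            using red reduced_append_eq[of "[(y, s)]" t]
            by (simp add: F_def successively_append_iff)
          moreover have "u y \<otimes>\<^bsub>F\<^esub> ((y, s) # t) = u y @ (y, s) # t"
            unfolding F_def mult_freeg by (rule reduced_append_eq[OF red])
          ultimately show ?thesis using ux by simp
        qed
        then have uxa: "u x = a \<otimes>\<^bsub>F\<^esub> (u y \<otimes>\<^bsub>F\<^esub> t)"
          unfolding a_def using uy tc lc[OF y] by (simp add: F.m_assoc F.inv_solve_left)
        obtain w where w: "w \<in> carrier F" "length w \<le> length (u y \<otimes>\<^bsub>F\<^esub> t)"
          "w \<noteq> [] \<longrightarrow> fst (last w) \<noteq> x"
          "\<And>e. (u y \<otimes>\<^bsub>F\<^esub> t) \<otimes>\<^bsub>F\<^esub> [(x, e)] \<otimes>\<^bsub>F\<^esub> inv\<^bsub>F\<^esub> (u y \<otimes>\<^bsub>F\<^esub> t) =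
            w \<otimes>\<^bsub>F\<^esub> [(x, e)] \<otimes>\<^bsub>F\<^esub> inv\<^bsub>F\<^esub> w"
          using strip_conjugator[of "u y \<otimes>\<^bsub>F\<^esub> t" x] uy tc x by (metis F.m_closed)
        have lenw: "length w < length (u x)"
          using w(2) length_foldr_push[of "u y" t] ux by (simp add: F_def)
        define u' where "u' = u(x := w)"
        define v' where "v' = v(x := w \<otimes>\<^bsub>F\<^esub> [(x, True)] \<otimes>\<^bsub>F\<^esub> inv\<^bsub>F\<^esub> w)"
        have v'xc: "v' x \<in> carrier F" using w lc[OF x] by (simp add: v'_def)
        have v'c: "v' ` B \<subseteq> carrier F" using vc v'xc by (auto simp: v'_def)
        have v'y: "v' y = v y" using xy by (simp add: v'_def)
        have vx: "v x = a \<otimes>\<^bsub>F\<^esub> v' x \<otimes>\<^bsub>F\<^esub> inv\<^bsub>F\<^esub> a"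
          unfolding v[OF x] uxa using w(4)[of True, symmetric] ac uy tc lc[OF x]
          by (simp add: v'_def F.inv_mult_group F.m_assoc)
        have lt: "(\<Sum>z\<in>B. length (u' z) + (if e z then 0 else 1)) <
          (\<Sum>z\<in>B. length (u z) + (if e z then 0 else 1))"
          by (rule sum_strict_mono_ex1[OF fin]) (use x lenw in \<open>auto simp: u'_def\<close>)
        have "Q (\<lambda>g. \<lambda>x\<in>B. weval G g (v' x))"
        proof (rule less.hyps[OF lt])
          show "u' z \<in> carrier F \<and> (u' z \<noteq> [] \<longrightarrow> fst (last (u' z)) \<noteq> z)" if "z \<in> B" for z
            using u[OF that] w by (auto simp: u'_def)
          show "v' z = u' z \<otimes>\<^bsub>F\<^esub> [(z, e z)] \<otimes>\<^bsub>F\<^esub> inv\<^bsub>F\<^esub> (u' z)" if "z \<in> B" for z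
            using False v[OF that] that by (auto simp: u'_def v'_def)
          show "generate F (v' ` B) = carrier F"
          proof (rule genI[OF gen v'c])
            interpret S: subgroup "generate F (v' ` B)" F
              by (rule F.generate_is_subgroup[OF v'c])
            have "a \<in> generate F (v' ` B)"
              using as generate.incl[of "v' y" "v' ` B" F] generate.inv[of "v' y" "v' ` B" F] imageI[OF y, of v']
              unfolding v'y by auto
            then have "v x \<in> generate F (v' ` B)"
              unfolding vx using x by (auto intro: generate.incl)
            then have "v z \<in> generate F (v' ` B)" if "z \<in> B" for z
              using that by (cases "z = x") (auto simp: v'_def intro: generate.incl)
            then show "v ` B \<subseteq> generate F (v' ` B)" by auto
          qed
        qed
        from Q_conj[OF x y xy this, of s]
        have "Q (\<lambda>g. (\<lambda>x\<in>B. weval G g (v' x))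
          (x := (if s then weval G g (v y) else inv\<^bsub>G\<^esub> (weval G g (v y))) \<otimes>\<^bsub>G\<^esub> weval G g (v' x) \<otimes>\<^bsub>G\<^esub>
            inv\<^bsub>G\<^esub> (if s then weval G g (v y) else inv\<^bsub>G\<^esub> (weval G g (v y)))))"
          using x y by (simp only: restrict_apply' v'y)
        moreover have "(\<lambda>x\<in>B. weval G g (v' x))
          (x := (if s then weval G g (v y) else inv\<^bsub>G\<^esub> (weval G g (v y))) \<otimes>\<^bsub>G\<^esub> weval G g (v' x) \<otimes>\<^bsub>G\<^esub>
            inv\<^bsub>G\<^esub> (if s then weval G g (v y) else inv\<^bsub>G\<^esub> (weval G g (v y)))) = (\<lambda>z\<in>B. weval G g (v z))" for g
        proof -
          interpret h: group_hom F G "weval G g" by (rule hom)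
          have wa: "weval G g a = (if s then weval G g (v y) else inv\<^bsub>G\<^esub> (weval G g (v y)))"
            using as vc[OF y] by (simp add: h.hom_inv)
          have "weval G g (v x) = weval G g a \<otimes>\<^bsub>G\<^esub> weval G g (v' x) \<otimes>\<^bsub>G\<^esub> inv\<^bsub>G\<^esub> weval G g a"
            unfolding vx using ac v'xc by (simp only: h.hom_mult h.hom_inv F.m_closed F.inv_closed)
          then show ?thesis using x unfolding wa by (auto simp: v'_def fun_eq_iff)
        qed
        ultimately show ?thesis by simp
      next
        case nopre: False
        \<comment> \<open>The letter \<open>z\<close> is a reduced product of the
          \<open>v x\<close>. By \<open>prefix_weval_conjugates\<close> it begins with
          \<open>u x @ [(x, s)]\<close> for the first factor, and having length 1 it forces
          \<open>u x\<close> to be empty and \<open>x\<close> to be \<open>z\<close>.\<close>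
        have uz: "u z = []" if z: "z \<in> B" for z
        proof -
          have "[(z, True)] \<in> generate F (v ` B)" using gen lc[OF z] by simp
          then obtain w where w: "fst ` set w \<subseteq> B" "weval F v w = [(z, True)]"
            using F.generate_weval[of _ v B] vc by auto
          define r where "r = foldr push w []"
          have r: "fst ` set r \<subseteq> B" "reduced r"
            using set_foldr_push[of w "[]"] w(1) by (auto simp: r_def reduced_foldr_push)
          have "weval F v r = weval F v w"
          proof -
            have "v ` fst ` set w \<subseteq> carrier F" using w(1) vc by blast
            then show ?thesis by (simp add: r_def F.weval_foldr_push F.weval_closed)
          qed
          then have wr: "weval F v r = [(z, True)]" using w by simp
          have "r \<noteq> []" using wr by (auto simp: F_def)
          then obtain x s r' where r': "r = (x, s) # r'" by (cases r) auto
          have "prefix (u x @ [(x, s)]) (weval F v r)"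
            unfolding r'
            by (rule prefix_weval_conjugates[where u = u, folded F_def])
               (use u v nopre r r' in auto)
          then have "prefix (u x @ [(x, s)]) ([] @ [(z, True)])" using wr by simp
          then show ?thesis by (cases "u x") (auto simp: prefix_def)
        qed
        have "weval G g (v x) = g x" if "x \<in> B" for x g
          using v[OF that] uz[OF that] that lc[OF that] UN by (simp add: F_def inv_freeg winv_def carrier_freeg)
        then have "(\<lambda>g. \<lambda>x\<in>B. weval G g (v x)) = (\<lambda>g. restrict g B)" by (auto simp: fun_eq_iff)
        then show ?thesis using Q_id by simp
      qed
    qed
  qed
  from this[OF u'(1) u'(2) gen] show ?thesis by blast
qed

end


section \<open>Holonomy of a cocycle that is locally a coboundary\<close>

primrec seqprod :: "('g, 'z) monoid_scheme \<Rightarrow> (nat \<Rightarrow> 'g) \<Rightarrow> nat \<Rightarrow> 'g" where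
  "seqprod G f 0 = \<one>\<^bsub>G\<^esub>"
| "seqprod G f (Suc n) = seqprod G f n \<otimes>\<^bsub>G\<^esub> f n"

lemma seqprod_cong: "(\<And>i. i < n \<Longrightarrow> f i = g i) \<Longrightarrow> seqprod G f n = seqprod G g n"
  by (induction n) auto

lemma (in group) seqprod_closed: "(\<And>i. i < n \<Longrightarrow> f i \<in> carrier G) \<Longrightarrow> seqprod G f n \<in> carrier G"
  by (induction n) auto

lemma (in group) seqprod_add:
  "(\<And>i. f i \<in> carrier G) \<Longrightarrow> seqprod G f (m + n) = seqprod G f m \<otimes> seqprod G (\<lambda>i. f (m + i)) n"
  by (induction n) (auto simp: m_assoc seqprod_closed)

lemma (in group) seqprod_mult:
  "(\<And>i. f i \<in> carrier G) \<Longrightarrow> seqprod G f (n * m) = seqprod G (\<lambda>i. seqprod G (\<lambda>j. f (i * m + j)) m) n"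
  by (induction n) (auto simp: seqprod_add add.commute[of m])

lemma (in group) seqprod_telescope:
  "(\<And>i. t i \<in> carrier G) \<Longrightarrow> (\<And>i. i < n \<Longrightarrow> f i = inv t i \<otimes> t (Suc i)) \<Longrightarrow>
    seqprod G f n = inv t 0 \<otimes> t n"
proof (induction n)
  case (Suc n)
  have "(inv t 0 \<otimes> t n) \<otimes> (inv t n \<otimes> t (Suc n)) = inv t 0 \<otimes> (t n \<otimes> inv t n) \<otimes> t (Suc n)"
    by (simp only: m_assoc m_closed inv_closed Suc.prems(1))
  with Suc show ?case by simp
qed simp

lemma (in group) seqprod_gauge:
  "(\<And>i. k i \<in> carrier G) \<Longrightarrow> (\<And>i. g i \<in> carrier G) \<Longrightarrow>
    (\<And>i. i < n \<Longrightarrow> f i = k i \<otimes> g i \<otimes> inv k (Suc i)) \<Longrightarrow>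
    seqprod G f n = k 0 \<otimes> seqprod G g n \<otimes> inv k n"
proof (induction n)
  case (Suc n)
  then have c: "k n \<in> carrier G" "g n \<in> carrier G" "k 0 \<in> carrier G" "seqprod G g n \<in> carrier G" "k (Suc n) \<in> carrier G"
    by (auto intro: seqprod_closed)
  have "seqprod G f (Suc n) = (k 0 \<otimes> seqprod G g n \<otimes> inv k n) \<otimes> (k n \<otimes> g n \<otimes> inv k (Suc n))"
    using Suc by simp
  also have "\<dots> = k 0 \<otimes> seqprod G g n \<otimes> (inv k n \<otimes> k n) \<otimes> g n \<otimes> inv k (Suc n)"
    using c by (simp only: m_assoc m_closed inv_closed)
  finally show ?case using c by (simp add: m_assoc)
qed auto

lemma (in group) coboundary_gauge:
  assumes [simp]: "a \<in> carrier G" "b \<in> carrier G" "a' \<in> carrier G" "b' \<in> carrier G"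
  shows "inv a \<otimes> b = (inv a \<otimes> a') \<otimes> (inv a' \<otimes> b') \<otimes> inv (inv b \<otimes> b')"
proof -
  have "(inv a \<otimes> a') \<otimes> (inv a' \<otimes> b') \<otimes> inv (inv b \<otimes> b') = inv a \<otimes> (a' \<otimes> inv a') \<otimes> (b' \<otimes> inv b') \<otimes> b"
    by (simp only: inv_mult_group inv_inv m_assoc m_closed inv_closed assms)
  then show ?thesis by simp
qed

text \<open>A flat connection in discrete form: \<open>c z z'\<close> is the transport along the
  short segment from \<open>z\<close> to \<open>z'\<close>, and on balls whose radius is uniform
  over a compact set it has a primitive \<open>\<tau>\<close>. No continuity is asked: cuts make
  \<open>c\<close> jump, and the primitives jump with it.\<close>

locale flat_transport = group F for F (structure) +
  fixes X :: "'a::real_normed_vector set" and c :: "'a \<Rightarrow> 'a \<Rightarrow> 'f"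
  assumes c_closed [simp]: "c z z' \<in> carrier F"
    and local_coboundary: "compact K \<Longrightarrow> K \<subseteq> X \<Longrightarrow> \<exists>\<delta>>0. \<forall>z0\<in>K. \<exists>\<tau>. (\<forall>z. \<tau> z \<in> carrier F) \<and>
      (\<forall>z\<in>ball z0 \<delta>. \<forall>z'\<in>ball z0 \<delta>. c z z' = inv (\<tau> z) \<otimes> \<tau> z')"
begin

definition H :: "nat \<Rightarrow> (real \<Rightarrow> 'a) \<Rightarrow> 'f" where
  "H n p = seqprod F (\<lambda>i. c (p (real i / real n)) (p (real (Suc i) / real n))) n"

text \<open>For a path in \<open>X\<close> the products \<open>H n p\<close> are eventually
  constant, and the description picks this constant; no topology on the group is involved.\<close>

definition hol :: "(real \<Rightarrow> 'a) \<Rightarrow> 'f" where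
  "hol p = (THE a. \<forall>\<^sub>F n in sequentially. H n p = a)"

lemma H_closed [simp]: "H n p \<in> carrier F"
  unfolding H_def by (rule seqprod_closed) simp

lemma ball_coboundary:
  assumes "compact K" "K \<subseteq> X"
  obtains \<delta> where "\<delta> > 0"
    "\<And>z0. z0 \<in> K \<Longrightarrow> \<exists>\<tau>. (\<forall>z. \<tau> z \<in> carrier F) \<and> (\<forall>z\<in>ball z0 \<delta>. \<forall>z'\<in>ball z0 \<delta>. c z z' = inv (\<tau> z) \<otimes> \<tau> z')"
  using local_coboundary[OF assms] by blast

lemma path_mesh:
  fixes p :: "real \<Rightarrow> 'a"
  assumes "path p" "\<delta> > 0"
  obtains N where "N > 0" "\<And>n s t. n \<ge> N \<Longrightarrow> s \<in> {0..1} \<Longrightarrow> t \<in> {0..1} \<Longrightarrow> \<bar>s - t\<bar> \<le> 1 / real n \<Longrightarrow> dist (p s) (p t) < \<delta>"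
proof -
  have "uniformly_continuous_on {0..1} p"
    using assms(1) by (intro compact_uniformly_continuous) (auto simp: path_def)
  then obtain e where e: "e > 0" "\<And>s t. s \<in> {0..1} \<Longrightarrow> t \<in> {0..1} \<Longrightarrow> dist t s < e \<Longrightarrow> dist (p t) (p s) < \<delta>"
    using assms(2) unfolding uniformly_continuous_on_def by metis
  obtain N where N: "N > 0" "inverse (real N) < e"
    using e(1) ex_inverse_of_nat_less by blast
  show ?thesis
  proof (rule that[OF N(1)])
    fix n s t assume n: "n \<ge> N" and st: "s \<in> {0..1}" "t \<in> {0..1}" "\<bar>s - t\<bar> \<le> 1 / real n"
    have "1 / real n \<le> 1 / real N" using n N(1) by (simp add: frac_le)
    with st N show "dist (p s) (p t) < \<delta>"
      by (intro e(2)) (auto simp: dist_real_def inverse_eq_divide)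
  qed
qed

lemma c_refl: assumes "z \<in> X" shows "c z z = \<one>"
  using ball_coboundary[of "{z}"] assms
  by (metis centre_in_ball compact_sing empty_subsetI insert_subset l_inv singletonI)

text \<open>On a fine mesh every piece of the path stays in a ball with a primitive, so that the
  product over a further subdivision of the piece telescopes to the transport between its
  ends.\<close>

lemma H_refine:
  assumes p: "path p" "path_image p \<subseteq> X"
  obtains N where "N > 0" "\<And>n m. n \<ge> N \<Longrightarrow> m > 0 \<Longrightarrow> H (n * m) p = H n p"
proof -
  obtain \<delta> where \<delta>: "\<delta> > 0"
    "\<And>z0. z0 \<in> path_image p \<Longrightarrow> \<exists>\<tau>. (\<forall>z. \<tau> z \<in> carrier F) \<and> (\<forall>z\<in>ball z0 \<delta>. \<forall>z'\<in>ball z0 \<delta>. c z z' = inv (\<tau> z) \<otimes> \<tau> z')"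
    using ball_coboundary[of "path_image p"] p compact_path_image by blast
  obtain N where N: "N > 0" "\<And>n s t. n \<ge> N \<Longrightarrow> s \<in> {0..1} \<Longrightarrow> t \<in> {0..1} \<Longrightarrow> \<bar>s - t\<bar> \<le> 1 / real n \<Longrightarrow> dist (p s) (p t) < \<delta>"
    by (rule path_mesh[OF p(1) \<delta>(1)]) blast
  show ?thesis
  proof (rule that[OF N(1)])
    fix n m :: nat assume n: "n \<ge> N" and m: "m > 0"
    then have n0: "n > 0" using N by simp
    have "seqprod F (\<lambda>j. c (p (real (i * m + j) / real (n * m))) (p (real (Suc (i * m + j)) / real (n * m)))) m =
        c (p (real i / real n)) (p (real (Suc i) / real n))" if i: "i < n" for i
    proof -
      have pin: "p (real i / real n) \<in> path_image p"
        using i by (auto simp: path_image_def)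
      obtain \<tau> where \<tau>: "\<And>z. \<tau> z \<in> carrier F"
        "\<And>z z'. z \<in> ball (p (real i / real n)) \<delta> \<Longrightarrow> z' \<in> ball (p (real i / real n)) \<delta> \<Longrightarrow> c z z' = inv (\<tau> z) \<otimes> \<tau> z'"
        using \<delta>(2)[OF pin] by blast
      have bl: "p (real (i * m + j) / real (n * m)) \<in> ball (p (real i / real n)) \<delta>" if "j \<le> m" for j
      proof -
        have eq: "real (i * m + j) / real (n * m) = real i / real n + (real j / real m) / real n"
          using n0 m by (simp add: add_divide_distrib)
        have "real j / real m \<le> 1" using that m by simp
        then have le: "(real j / real m) / real n \<le> 1 / real n" using n0 by (intro divide_right_mono) auto
        have "real i / real n + 1 / real n \<le> 1" using i n0 by (simp add: add_divide_distrib[symmetric])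
        with le have "real i / real n + (real j / real m) / real n \<le> 1" by linarith
        then show ?thesis
          unfolding mem_ball eq using le i by (intro N(2)[OF n]) auto
      qed
      let ?t = "\<lambda>j. \<tau> (p (real (i * m + j) / real (n * m)))"
      have "seqprod F (\<lambda>j. c (p (real (i * m + j) / real (n * m))) (p (real (Suc (i * m + j)) / real (n * m)))) m =
          inv (?t 0) \<otimes> ?t m"
      proof (rule seqprod_telescope)
        fix j assume "j < m"
        then show "c (p (real (i * m + j) / real (n * m))) (p (real (Suc (i * m + j)) / real (n * m))) =
            inv (?t j) \<otimes> ?t (Suc j)"
          unfolding add_Suc_right[symmetric] by (intro \<tau>(2) bl) auto
      qed (rule \<tau>(1))
      also have "\<dots> = c (p (real (i * m + 0) / real (n * m))) (p (real (i * m + m) / real (n * m)))"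
        using bl[of 0] bl[of m] by (intro \<tau>(2)[symmetric]) auto
      also have "real (i * m + 0) / real (n * m) = real i / real n"
        using m by simp
      also have "real (i * m + m) / real (n * m) = real (Suc i) / real n"
      proof -
        have "real (i * m + m) = real (Suc i) * real m" by (simp add: algebra_simps)
        then show ?thesis using m by simp
      qed
      finally show ?thesis .
    qed
    then show "H (n * m) p = H n p"
      unfolding H_def by (intro trans[OF seqprod_mult[OF c_closed] seqprod_cong])
  qed
qed

text \<open>Two fine meshes with \<open>n\<close> and \<open>N\<close> steps are compared through
  their common refinement with \<open>n * N\<close> steps.\<close>

lemma hol_eq_H:
  assumes p: "path p" "path_image p \<subseteq> X"
  obtains N where "N > 0" "\<And>n. n \<ge> N \<Longrightarrow> hol p = H n p"
proof -
  obtain N where N: "N > 0" "\<And>n m. n \<ge> N \<Longrightarrow> m > 0 \<Longrightarrow> H (n * m) p = H n p"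
    using H_refine[OF p] by blast
  have eq: "H n p = H N p" if "n \<ge> N" for n
  proof -
    have "H n p = H (n * N) p" using N(2)[OF that N(1)] ..
    also have "\<dots> = H (N * n) p" by (simp only: mult.commute)
    also have "\<dots> = H N p" using N that by (intro N(2)) auto
    finally show ?thesis .
  qed
  have "hol p = H N p"
    unfolding hol_def
  proof (rule the_equality)
    show "\<forall>\<^sub>F n in sequentially. H n p = H N p"
      unfolding eventually_sequentially using eq by blast
    fix a assume "\<forall>\<^sub>F n in sequentially. H n p = a"
    then obtain N' where "\<And>n. n \<ge> N' \<Longrightarrow> H n p = a" by (auto simp: eventually_sequentially)
    from trans[OF this[symmetric, of "max N N'"] eq[of "max N N'"]] show "a = H N p" by simp
  qed
  then have "hol p = H n p" if "n \<ge> N" for n using eq[OF that] by (rule trans[OF _ sym])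
  with N(1) show ?thesis by (rule that)
qed

lemma hol_closed: "path p \<Longrightarrow> path_image p \<subseteq> X \<Longrightarrow> hol p \<in> carrier F"
  using hol_eq_H[of p] H_closed by (metis order_refl)

lemma hol_join:
  assumes p: "path p" "path_image p \<subseteq> X" and q: "path q" "path_image q \<subseteq> X"
    and pq: "pathfinish p = pathstart q"
  shows "hol (p +++ q) = hol p \<otimes> hol q"
proof -
  have j: "path (p +++ q)" "path_image (p +++ q) \<subseteq> X"
    using p q pq by (auto simp: path_image_join)
  obtain N1 where N1: "\<And>n. n \<ge> N1 \<Longrightarrow> hol p = H n p" using hol_eq_H[OF p] by blast
  obtain N2 where N2: "\<And>n. n \<ge> N2 \<Longrightarrow> hol q = H n q" using hol_eq_H[OF q] by blast
  obtain N3 where N3: "\<And>n. n \<ge> N3 \<Longrightarrow> hol (p +++ q) = H n (p +++ q)" using hol_eq_H[OF j] by blast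
  define n where "n = Suc (max N1 (max N2 N3))"
  have n: "n > 0" "n \<ge> N1" "n \<ge> N2" "n + n \<ge> N3" by (auto simp: n_def)
  \<comment> \<open>With \<open>n + n\<close> steps the junction at time 1 / 2 is a node, and the
    product splits there.\<close>
  have l: "(p +++ q) (real i / real (n + n)) = p (real i / real n)" if "i \<le> n" for i
    using that n(1) by (simp add: joinpaths_def field_simps)
  have r: "(p +++ q) (real (n + i) / real (n + n)) = q (real i / real n)" for i
  proof (cases "i = 0")
    case True
    then show ?thesis using n(1) pq
      by (simp add: joinpaths_def field_simps pathfinish_def pathstart_def)
  next
    case False
    moreover have "2 * (real (n + i) / real (n + n)) - 1 = real i / real n"
      using n(1) by (simp add: field_simps)
    moreover have "real (n + i) / real (n + n) > 1 / 2" using False n(1) by (simp add: field_simps)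
    ultimately show ?thesis by (simp add: joinpaths_def)
  qed
  have "H (n + n) (p +++ q) = H n p \<otimes> H n q"
    unfolding H_def
    apply (subst seqprod_add)
     apply simp
    apply (intro arg_cong2[of _ _ _ _ "(\<otimes>)"] seqprod_cong)
    using l r by (simp_all only: add_Suc_right[symmetric] less_imp_le Suc_leI)
  then show ?thesis using N1 N2 N3 n by metis
qed

text \<open>When a single primitive serves along the whole path, however long, the product
  telescopes to its values at the end points.\<close>

lemma hol_telescope:
  assumes p: "path p" "path_image p \<subseteq> X" and \<tau>: "\<And>z. \<tau> z \<in> carrier F" and "\<delta> > 0"
    and c: "\<And>s t. s \<in> {0..1} \<Longrightarrow> t \<in> {0..1} \<Longrightarrow> \<bar>s - t\<bar> < \<delta> \<Longrightarrow> c (p s) (p t) = inv (\<tau> (p s)) \<otimes> \<tau> (p t)"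
  shows "hol p = inv (\<tau> (pathstart p)) \<otimes> \<tau> (pathfinish p)"
proof -
  obtain N where N: "\<And>n. n \<ge> N \<Longrightarrow> hol p = H n p" using hol_eq_H[OF p] by blast
  obtain M where M: "M > 0" "inverse (real M) < \<delta>"
    using \<open>\<delta> > 0\<close> ex_inverse_of_nat_less by blast
  define n where "n = N + M"
  have n: "n \<ge> N" "n > 0" "1 / real n < \<delta>"
    using M by (auto simp: n_def inverse_eq_divide intro!: le_less_trans[OF _ M(2)] frac_le)
  have "H n p = inv (\<tau> (p (real 0 / real n))) \<otimes> \<tau> (p (real n / real n))"
    unfolding H_def
    by (rule seqprod_telescope) (use n in \<open>auto intro!: c \<tau> simp: diff_divide_distrib[symmetric]\<close>)
  with N[OF n(1)] n(2) show ?thesis by (simp add: pathstart_def pathfinish_def)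
qed

lemma hol_const: "a \<in> X \<Longrightarrow> hol (\<lambda>_. a) = \<one>"
  using hol_telescope[of "\<lambda>_. a" "\<lambda>_. \<one>" 1] c_refl[of a] by (auto simp: path_image_def path_def)

text \<open>Chain along the homotopy: uniformly close paths have holonomies that differ by the transports between
  their end points.\<close>

lemma hol_free_homotopy:
  fixes h :: "real \<times> real \<Rightarrow> 'a"
  assumes h: "continuous_on ({0..1} \<times> {0..1}) h" "h ` ({0..1} \<times> {0..1}) \<subseteq> X"
    and loops: "\<And>s. s \<in> {0..1} \<Longrightarrow> h (s, 0) = h (s, 1)"
  obtains g where "g \<in> carrier F" "hol (\<lambda>t. h (0, t)) = g \<otimes> hol (\<lambda>t. h (1, t)) \<otimes> inv g"
    "(\<And>s. s \<in> {0..1} \<Longrightarrow> h (s, 0) = h (0, 0)) \<Longrightarrow> g = \<one>"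
proof -
  let ?Q = "{0..1} \<times> {0..1} :: (real \<times> real) set"
  have cQ: "compact ?Q" by (intro compact_Times compact_Icc)
  obtain \<delta> where \<delta>: "\<delta> > 0"
    "\<And>z0. z0 \<in> h ` ?Q \<Longrightarrow> \<exists>\<tau>. (\<forall>z. \<tau> z \<in> carrier F) \<and> (\<forall>z\<in>ball z0 \<delta>. \<forall>z'\<in>ball z0 \<delta>. c z z' = inv (\<tau> z) \<otimes> \<tau> z')"
    using ball_coboundary[OF compact_continuous_image[OF h(1) cQ] h(2)] by blast
  have "uniformly_continuous_on ?Q h" using h(1) cQ by (rule compact_uniformly_continuous)
  then obtain e where e: "e > 0" "\<And>x y. x \<in> ?Q \<Longrightarrow> y \<in> ?Q \<Longrightarrow> dist y x < e \<Longrightarrow> dist (h y) (h x) < \<delta>"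
    using \<delta>(1) unfolding uniformly_continuous_on_def by metis
  define q where "q s = (\<lambda>t. h (s, t))" for s
  have q: "path (q s)" "path_image (q s) \<subseteq> X" if "s \<in> {0..1}" for s
  proof -
    have "continuous_on {0..1} (\<lambda>t. h (s, t))"
      by (rule continuous_on_compose2[OF h(1)]) (use that in \<open>auto intro!: continuous_intros\<close>)
    then show "path (q s)" by (simp add: q_def path_def)
    show "path_image (q s) \<subseteq> X" using h(2) that by (auto simp: q_def path_image_def)
  qed
  have step: "\<exists>g\<in>carrier F. hol (q s) = g \<otimes> hol (q s') \<otimes> inv g \<and> (h (s, 0) = h (s', 0) \<longrightarrow> g = \<one>)"
    if s: "s \<in> {0..1}" "s' \<in> {0..1}" "\<bar>s - s'\<bar> < e / 2" for s s'
  proof -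
    obtain N1 where N1: "\<And>n. n \<ge> N1 \<Longrightarrow> hol (q s) = H n (q s)" using hol_eq_H[OF q[OF s(1)]] by blast
    obtain N2 where N2: "\<And>n. n \<ge> N2 \<Longrightarrow> hol (q s') = H n (q s')" using hol_eq_H[OF q[OF s(2)]] by blast
    obtain M where M: "M > 0" "inverse (real M) < e / 2"
      using \<open>e > 0\<close> ex_inverse_of_nat_less[of "e / 2"] by auto
    define n where "n = N1 + N2 + M"
    have "1 / real n \<le> 1 / real M" using M(1) by (intro frac_le) (auto simp: n_def)
    then have n: "n \<ge> N1" "n \<ge> N2" "n > 0" "1 / real n < e / 2"
      using M by (auto simp: n_def inverse_eq_divide)
    \<comment> \<open>The rungs of the ladder between two neighbouring loops: \<open>k i\<close> is
      the transport from one to the other at the node \<open>i\<close>. Both loops close up, hence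
      the first and the last rung agree and the two holonomies are conjugate.\<close>
    define k where "k i = c (q s (real i / real n)) (q s' (real i / real n))" for i
    have "H n (q s) = k 0 \<otimes> H n (q s') \<otimes> inv (k n)"
      unfolding H_def
    proof (rule seqprod_gauge)
      fix i assume i: "i < n"
      have i01: "real i / real n \<in> {0..1}" "real (Suc i) / real n \<in> {0..1}" using i by auto
      have di: "\<bar>real (Suc i) / real n - real i / real n\<bar> < e / 2"
        using n by (simp add: diff_divide_distrib[symmetric])
      have cl: "dist (h (s1, t1)) (q s (real i / real n)) < \<delta>"
        if "s1 \<in> {s, s'}" "t1 \<in> {real i / real n, real (Suc i) / real n}" for s1 t1
        unfolding q_def
      proof (rule e(2))
        have "dist (s1, t1) (s, real i / real n) \<le> \<bar>s1 - s\<bar> + \<bar>t1 - real i / real n\<bar>"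
          unfolding dist_Pair_Pair dist_real_def using sqrt_sum_squares_le_sum_abs[of "\<bar>s1 - s\<bar>" "\<bar>t1 - real i / real n\<bar>"] by simp
        also have "\<dots> < e"
        proof (rule order.strict_trans1[OF add_mono])
          show "\<bar>s1 - s\<bar> \<le> \<bar>s - s'\<bar>" using that(1) by auto
          show "\<bar>t1 - real i / real n\<bar> \<le> \<bar>real (Suc i) / real n - real i / real n\<bar>"
            using that(2) by (auto simp del: of_nat_Suc)
        qed (use s(3) di in linarith)
        finally show "dist (s1, t1) (s, real i / real n) < e" .
      qed (use that s i01 in auto)
      have qin: "q s (real i / real n) \<in> h ` ?Q" using s i01 by (auto simp: q_def)
      obtain \<tau> where \<tau>: "\<And>z. \<tau> z \<in> carrier F"
        "\<And>z z'. z \<in> ball (q s (real i / real n)) \<delta> \<Longrightarrow> z' \<in> ball (q s (real i / real n)) \<delta> \<Longrightarrow> c z z' = inv (\<tau> z) \<otimes> \<tau> z'"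
        using \<delta>(2)[OF qin] by blast
      have in_ball: "q s1 t1 \<in> ball (q s (real i / real n)) \<delta>"
        if "s1 \<in> {s, s'}" "t1 \<in> {real i / real n, real (Suc i) / real n}" for s1 t1
        using cl[OF that] by (simp add: q_def dist_commute)
      have c4: "c (q s1 t1) (q s2 t2) = inv (\<tau> (q s1 t1)) \<otimes> \<tau> (q s2 t2)"
        if "s1 \<in> {s, s'}" "t1 \<in> {real i / real n, real (Suc i) / real n}"
          "s2 \<in> {s, s'}" "t2 \<in> {real i / real n, real (Suc i) / real n}" for s1 t1 s2 t2
        using in_ball that by (intro \<tau>(2)) auto
      show "c (q s (real i / real n)) (q s (real (Suc i) / real n)) =
        k i \<otimes> c (q s' (real i / real n)) (q s' (real (Suc i) / real n)) \<otimes> inv k (Suc i)"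
        unfolding k_def c4[OF insertI1 insertI1 insertI1 insertI2[OF singletonI]]
          c4[OF insertI1 insertI1 insertI2[OF singletonI] insertI1]
          c4[OF insertI2[OF singletonI] insertI1 insertI2[OF singletonI] insertI2[OF singletonI]]
          c4[OF insertI1 insertI2[OF singletonI] insertI2[OF singletonI] insertI2[OF singletonI]]
        by (rule coboundary_gauge) (rule \<tau>(1))+
    qed (simp_all add: k_def)
    moreover have "k n = k 0"
      using loops[OF s(1)] loops[OF s(2)] n(3) by (simp add: k_def q_def)
    moreover have "k 0 = \<one>" if "h (s, 0) = h (s', 0)"
    proof -
      have "h (s', 0) \<in> X" using s(2) h(2) by (auto simp: image_subset_iff)
      then show ?thesis using that c_refl by (simp add: k_def q_def)
    qed
    ultimately show ?thesis using N1[OF n(1)] N2[OF n(2)]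
      by (intro bexI[of _ "k 0"]) (auto simp: k_def)
  qed
  obtain M where M: "M > 0" "inverse (real M) < e / 2"
    using \<open>e > 0\<close> ex_inverse_of_nat_less[of "e / 2"] by auto
  have "\<exists>g\<in>carrier F. hol (q 0) = g \<otimes> hol (q (real k / real M)) \<otimes> inv g \<and>
    ((\<forall>s\<in>{0..1}. h (s, 0) = h (0, 0)) \<longrightarrow> g = \<one>)" if "k \<le> M" for k
    using that
  proof (induction k)
    case 0
    then show ?case using hol_closed[OF q[of 0]] by (intro bexI[of _ \<one>]) auto
  next
    case (Suc k)
    then obtain g where g: "g \<in> carrier F" "hol (q 0) = g \<otimes> hol (q (real k / real M)) \<otimes> inv g"
      "(\<forall>s\<in>{0..1}. h (s, 0) = h (0, 0)) \<longrightarrow> g = \<one>" by auto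
    have k01: "real k / real M \<in> {0..1}" "real (Suc k) / real M \<in> {0..1}" using Suc.prems by auto
    have "\<bar>real k / real M - real (Suc k) / real M\<bar> < e / 2"
      using M by (simp add: diff_divide_distrib[symmetric] inverse_eq_divide)
    from step[OF k01 this] obtain g' where g': "g' \<in> carrier F"
      "hol (q (real k / real M)) = g' \<otimes> hol (q (real (Suc k) / real M)) \<otimes> inv g'"
      "h (real k / real M, 0) = h (real (Suc k) / real M, 0) \<longrightarrow> g' = \<one>" by auto
    have "hol (q (real (Suc k) / real M)) \<in> carrier F" using hol_closed[OF q[OF k01(2)]] .
    then have "hol (q 0) = (g \<otimes> g') \<otimes> hol (q (real (Suc k) / real M)) \<otimes> inv (g \<otimes> g')"
      unfolding g(2) g'(2) using g(1) g'(1) by (simp only: m_assoc inv_mult_group m_closed inv_closed)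
    moreover have "g \<otimes> g' = \<one>" if "\<forall>s\<in>{0..1}. h (s, 0) = h (0, 0)"
    proof -
      have "h (real k / real M, 0) = h (real (Suc k) / real M, 0)" using bspec[OF that k01(1)] bspec[OF that k01(2)] by (rule trans[OF _ sym])
      then have "g' = \<one>" using g'(3) by (rule mp[rotated])
      moreover have "g = \<one>" using that by (rule mp[OF g(3)])
      ultimately show ?thesis by simp
    qed
    ultimately show ?case using m_closed[OF g(1) g'(1)] by (intro bexI[of _ "g \<otimes> g'"] conjI impI)
  qed
  then obtain g where g: "g \<in> carrier F" "hol (q 0) = g \<otimes> hol (q (real M / real M)) \<otimes> inv g"
    "(\<forall>s\<in>{0..1}. h (s, 0) = h (0, 0)) \<longrightarrow> g = \<one>"
    by blast
  show ?thesis
  proof (rule that[OF g(1)])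
    show "hol (\<lambda>t. h (0, t)) = g \<otimes> hol (\<lambda>t. h (1, t)) \<otimes> inv g"
      using g(2) M(1) by (simp add: q_def)
  qed (use g(3) in blast)
qed

lemma hol_homotopic:
  assumes "homotopic_paths X p q" "pathstart p = pathfinish p"
  shows "hol p = hol q"
proof -
  obtain h :: "real \<times> real \<Rightarrow> 'a" where h0: "continuous_on ({0..1} \<times> {0..1}) h" "h \<in> {0..1} \<times> {0..1} \<rightarrow> X"
    "\<forall>x\<in>{0..1}. h (0, x) = p x" "\<forall>x\<in>{0..1}. h (1, x) = q x"
    "\<forall>t\<in>{0..1}. pathstart (h \<circ> Pair t) = pathstart p \<and> pathfinish (h \<circ> Pair t) = pathfinish p"
    using assms(1) unfolding homotopic_paths by blast
  then have h: "continuous_on ({0..1} \<times> {0..1}) h" "h ` ({0..1} \<times> {0..1}) \<subseteq> X"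
    "\<And>x. x \<in> {0..1} \<Longrightarrow> h (0, x) = p x" "\<And>x. x \<in> {0..1} \<Longrightarrow> h (1, x) = q x"
    "\<And>t. t \<in> {0..1} \<Longrightarrow> pathstart (h \<circ> Pair t) = pathstart p"
    "\<And>t. t \<in> {0..1} \<Longrightarrow> pathfinish (h \<circ> Pair t) = pathfinish p"
    by blast+
  have cong: "hol p' = hol q'" if "\<And>x. x \<in> {0..1} \<Longrightarrow> p' x = q' x" for p' q'
  proof -
    have "H n p' = H n q'" for n
      unfolding H_def by (rule seqprod_cong) (use that in \<open>auto simp del: of_nat_Suc\<close>)
    then show ?thesis by (simp add: hol_def)
  qed
  have loops: "h (s, 0) = h (s, 1)" "h (s, 0) = h (0, 0)" if "s \<in> {0..1}" for s
    using h(5,6)[OF that] h(5)[of 0] assms(2) by (auto simp: pathstart_def pathfinish_def)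
  obtain g where g: "g \<in> carrier F" "hol (\<lambda>t. h (0, t)) = g \<otimes> hol (\<lambda>t. h (1, t)) \<otimes> inv g"
    "(\<And>s. s \<in> {0..1} \<Longrightarrow> h (s, 0) = h (0, 0)) \<Longrightarrow> g = \<one>"
    using hol_free_homotopy[OF h(1,2) loops(1)] by blast
  have "g = \<one>" by (rule g(3)) (rule loops)
  moreover have "hol (\<lambda>t. h (0, t)) = hol p" "hol (\<lambda>t. h (1, t)) = hol q"
    by (rule cong, simp add: h)+
  moreover have "hol q \<in> carrier F"
    using assms(1) by (intro hol_closed) (auto dest: homotopic_paths_imp_path homotopic_paths_imp_subset)
  ultimately show ?thesis using g(2) by simp
qed

lemma hol_reversepath:
  assumes p: "path p" "path_image p \<subseteq> X"
  shows "hol (reversepath p) = inv (hol p)"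
proof -
  have "hol (p +++ reversepath p) = hol (linepath (pathstart p) (pathstart p))"
    by (rule hol_homotopic[OF homotopic_paths_rinv[OF p]]) simp
  also have "\<dots> = \<one>"
    using hol_const[of "pathstart p"] p(2) pathstart_in_path_image[of p] by (auto simp: linepath_refl)
  finally have *: "hol p \<otimes> hol (reversepath p) = \<one>"
    using hol_join[of p "reversepath p"] p by simp
  have "hol p \<in> carrier F" "hol (reversepath p) \<in> carrier F"
    using p by (auto intro!: hol_closed)
  with * show ?thesis using inv_equality[of "hol (reversepath p)" "hol p"] by (metis inv_comm)
qed

end


lemma (in group) conj_solve:
  assumes "g \<in> carrier G" "a \<in> carrier G" "b = g \<otimes> a \<otimes> inv g"
  shows "a = inv g \<otimes> b \<otimes> g"
proof -
  have "inv g \<otimes> b \<otimes> g = (inv g \<otimes> g) \<otimes> a \<otimes> (inv g \<otimes> g)"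
    unfolding assms(3) using assms(1,2) by (simp only: m_assoc m_closed inv_closed)
  then show ?thesis using assms(1,2) by simp
qed

section \<open>Crossing words in the punctured plane\<close>

text \<open>Cut the plane along the vertical half-lines going upwards from the points of \<open>B\<close>.  A short segment
  from \<open>z\<close> to \<open>z'\<close> crosses the cut at \<open>x\<close> when \<open>x \<in> crossing z z'\<close>.\<close>

definition crossing :: "complex \<Rightarrow> complex \<Rightarrow> complex set" where
  "crossing z z' = {x. Im x < Im z \<and> (Re z < Re x \<and> Re x \<le> Re z' \<or> Re z' < Re x \<and> Re x \<le> Re z)}"

text \<open>The empty word stands for no crossing, and is also the default for several crossings,
  which steps finer than the gaps between abscissas exclude. With half-open intervals of abscissas,
  two successive steps that meet on a cut cross it only once.\<close>

definition stepw :: "complex set \<Rightarrow> complex \<Rightarrow> complex \<Rightarrow> (complex \<times> bool) list" where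
  "stepw B z z' = (if \<exists>!x. x \<in> B \<inter> crossing z z'
     then [(THE x. x \<in> B \<inter> crossing z z', Re z < Re z')] else [])"

text \<open>The local primitive of the transport. \<open>up\<close> tells that the neighbourhood
  lies above \<open>x\<close>, where the cut splits it in two: the letter \<open>x\<close> on the
  right-hand side and on the cut, the empty word on the left. Below \<open>x\<close> there is no
  cut.\<close>

definition cut_gauge :: "complex \<Rightarrow> bool \<Rightarrow> complex \<Rightarrow> (complex \<times> bool) list" where
  "cut_gauge x up z = (if up \<and> Re x \<le> Re z then [(x, True)] else [])"

lemma stepw_none: "B \<inter> crossing z z' = {} \<Longrightarrow> stepw B z z' = []"
  by (auto simp: stepw_def)

lemma stepw_one: "B \<inter> crossing z z' = {x} \<Longrightarrow> stepw B z z' = [(x, Re z < Re z')]"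
  by (auto simp: stepw_def)

lemma stepw_letters: "fst ` set (stepw B z z') \<subseteq> B \<inter> crossing z z'"
proof (cases "\<exists>!x. x \<in> B \<inter> crossing z z'")
  case True
  then obtain x where "B \<inter> crossing z z' = {x}" by blast
  then show ?thesis using stepw_one[of B z z' x] by auto
qed (simp add: stepw_def)

lemma stepw_closed: "stepw B z z' \<in> carrier (freeg B)"
  using stepw_letters[of B z z'] by (auto simp: carrier_freeg stepw_def)

lemma stepw_eq_gauge:
  assumes x: "x \<in> B" and z: "Im x < Im z \<longleftrightarrow> up"
    and only: "\<And>y. y \<in> B \<Longrightarrow> y \<noteq> x \<Longrightarrow> y \<notin> crossing z z'"
  shows "stepw B z z' = inv\<^bsub>freeg B\<^esub> (cut_gauge x up z) \<otimes>\<^bsub>freeg B\<^esub> cut_gauge x up z'"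
proof -
  have inv: "inv\<^bsub>freeg B\<^esub> [] = []" "inv\<^bsub>freeg B\<^esub> [(x, True)] = [(x, False)]"
    using x by (auto simp: inv_freeg carrier_freeg winv_def flip_def)
  show ?thesis
  proof (cases "x \<in> crossing z z'")
    case True
    then have "stepw B z z' = [(x, Re z < Re z')]" using x only by (intro stepw_one) auto
    then show ?thesis using True z by (auto simp: crossing_def cut_gauge_def inv flip_def)
  next
    case False
    then have "stepw B z z' = []" using only by (intro stepw_none) auto
    then show ?thesis using False z by (auto simp: crossing_def cut_gauge_def inv flip_def)
  qed
qed

definition plane_hol :: "complex set \<Rightarrow> (real \<Rightarrow> complex) \<Rightarrow> (complex \<times> bool) list" where
  "plane_hol B = flat_transport.hol (freeg B) (stepw B)"

lemma Re_gap:
  assumes "finite B" "inj_on Re B"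
  obtains e where "e > 0" "\<And>x y. x \<in> B \<Longrightarrow> y \<in> B \<Longrightarrow> x \<noteq> y \<Longrightarrow> \<bar>Re x - Re y\<bar> \<ge> e"
proof -
  let ?D = "(\<lambda>(x, y). \<bar>Re x - Re y\<bar>) ` ((B \<times> B) - Id)"
  \<comment> \<open>The extra element 1 gives the minimum a meaning when \<open>B\<close> has fewer
    than two points.\<close>
  have fin: "finite (insert 1 ?D)" using assms(1) by auto
  have pos: "d > 0" if d: "d \<in> insert 1 ?D" for d
  proof (cases "d = 1")
    case False
    then obtain x y where "x \<in> B" "y \<in> B" "x \<noteq> y" "d = \<bar>Re x - Re y\<bar>" using d by auto
    then show ?thesis using inj_onD[OF assms(2), of x y] by auto
  qed simp
  show ?thesis
  proof (rule that[of "Min (insert 1 ?D)"])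
    show "Min (insert 1 ?D) > 0" by (rule pos[OF Min_in[OF fin insert_not_empty]])
    fix x y assume "x \<in> B" "y \<in> B" "x \<noteq> y"
    then have "\<bar>Re x - Re y\<bar> \<in> insert 1 ?D" by (intro insertI2 image_eqI[of _ _ "(x, y)"]) auto
    then show "\<bar>Re x - Re y\<bar> \<ge> Min (insert 1 ?D)" by (rule Min_le[OF fin])
  qed
qed

context
  fixes B :: "complex set"
  assumes finB: "finite B" and injB: "inj_on Re B"
begin

lemma flat_transport_stepw: "flat_transport (freeg B) (- B) (stepw B)"
proof (intro flat_transport.intro flat_transport_axioms.intro group_freeg stepw_closed)
  fix K :: "complex set" assume K: "compact K" "K \<subseteq> - B"
  obtain e where e: "e > 0" "\<And>x y. x \<in> B \<Longrightarrow> y \<in> B \<Longrightarrow> x \<noteq> y \<Longrightarrow> \<bar>Re x - Re y\<bar> \<ge> e"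
    using Re_gap[OF finB injB] by blast
  obtain d where d: "d > 0" "\<And>x y. x \<in> K \<Longrightarrow> y \<in> B \<Longrightarrow> d \<le> dist x y"
    using separate_compact_closed[of K B] K finite_imp_closed[OF finB] by blast
  \<comment> \<open>A quarter of both gaps: at most one abscissa of \<open>B\<close> then comes
    within reach of a ball, and if it is that of \<open>x\<close>, the distance
    \<open>4 * \<delta>\<close> from \<open>x\<close> has to be vertical, so that the whole ball
    lies above or below \<open>x\<close>.\<close>
  define \<delta> where "\<delta> = min d e / 4"
  have \<delta>: "\<delta> > 0" "4 * \<delta> \<le> d" "4 * \<delta> \<le> e" using d e by (auto simp: \<delta>_def)
  show "\<exists>\<delta>>0. \<forall>z0\<in>K. \<exists>\<tau>. (\<forall>z. \<tau> z \<in> carrier (freeg B)) \<and>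
    (\<forall>z\<in>ball z0 \<delta>. \<forall>z'\<in>ball z0 \<delta>. stepw B z z' = inv\<^bsub>freeg B\<^esub> \<tau> z \<otimes>\<^bsub>freeg B\<^esub> \<tau> z')"
  proof (intro exI[of _ \<delta>] conjI ballI \<delta>)
    fix z0 assume z0: "z0 \<in> K"
    have RI: "\<bar>Re z - Re z0\<bar> < \<delta>" "\<bar>Im z - Im z0\<bar> < \<delta>" if "z \<in> ball z0 \<delta>" for z
      using that abs_Re_le_cmod[of "z - z0"] abs_Im_le_cmod[of "z - z0"] by (auto simp: dist_norm norm_minus_commute)
    show "\<exists>\<tau>. (\<forall>z. \<tau> z \<in> carrier (freeg B)) \<and>
      (\<forall>z\<in>ball z0 \<delta>. \<forall>z'\<in>ball z0 \<delta>. stepw B z z' = inv\<^bsub>freeg B\<^esub> \<tau> z \<otimes>\<^bsub>freeg B\<^esub> \<tau> z')"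
    proof (cases "\<exists>x\<in>B. \<bar>Re x - Re z0\<bar> \<le> \<delta>")
      case True
      then obtain x where x: "x \<in> B" "\<bar>Re x - Re z0\<bar> \<le> \<delta>" by auto
      have "4 * \<delta> \<le> cmod (x - z0)" using d(2)[OF z0 x(1)] \<delta> by (simp add: dist_norm norm_minus_commute)
      also have "\<dots> \<le> \<bar>Re (x - z0)\<bar> + \<bar>Im (x - z0)\<bar>" by (rule cmod_le)
      finally have im: "\<bar>Im x - Im z0\<bar> \<ge> 3 * \<delta>" using x(2) by simp
      show ?thesis
      proof (intro exI[of _ "cut_gauge x (Im x < Im z0)"] conjI ballI allI)
        show "cut_gauge x (Im x < Im z0) z \<in> carrier (freeg B)" for z
          using x by (auto simp: cut_gauge_def carrier_freeg)
        fix z z' assume z: "z \<in> ball z0 \<delta>" "z' \<in> ball z0 \<delta>"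
        show "stepw B z z' = inv\<^bsub>freeg B\<^esub> cut_gauge x (Im x < Im z0) z \<otimes>\<^bsub>freeg B\<^esub> cut_gauge x (Im x < Im z0) z'"
        proof (rule stepw_eq_gauge[OF x(1)])
          show "Im x < Im z \<longleftrightarrow> Im x < Im z0" using im RI(2)[OF z(1)] by linarith
          fix y assume "y \<in> B" "y \<noteq> x"
          then have "\<bar>Re y - Re x\<bar> \<ge> 4 * \<delta>" using e(2)[OF _ x(1), of y] \<delta> by linarith
          then show "y \<notin> crossing z z'" using x(2) RI(1)[OF z(1)] RI(1)[OF z(2)]
            unfolding crossing_def mem_Collect_eq by linarith
        qed
      qed
    next
      case False
      have "stepw B z z' = []" if "z \<in> ball z0 \<delta>" "z' \<in> ball z0 \<delta>" for z z'
      proof (rule stepw_none)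
        show "B \<inter> crossing z z' = {}"
        proof -
          have "x \<notin> crossing z z'" if "x \<in> B" for x
          proof -
            have "\<not> \<bar>Re x - Re z0\<bar> \<le> \<delta>" using False that by blast
            then show ?thesis
              using RI(1)[OF \<open>z \<in> ball z0 \<delta>\<close>] RI(1)[OF \<open>z' \<in> ball z0 \<delta>\<close>]
              unfolding crossing_def mem_Collect_eq by linarith
          qed
          then show ?thesis by blast
        qed
      qed
      then show ?thesis
        by (intro exI[of _ "\<lambda>_. []"]) (auto simp: carrier_freeg inv_freeg winv_def)
    qed
  qed
qed

interpretation T: flat_transport "freeg B" "- B" "stepw B"
  rewrites "flat_transport.hol (freeg B) (stepw B) = plane_hol B"
  by (rule flat_transport_stepw) (simp add: plane_hol_def)

lemmas plane_hol_closed = T.hol_closed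
  and plane_hol_join = T.hol_join
  and plane_hol_homotopic = T.hol_homotopic
  and plane_hol_reversepath = T.hol_reversepath
  and plane_hol_const = T.hol_const

lemma plane_hol_eq_H:
  assumes "path p" "path_image p \<subseteq> - B"
  obtains N where "N > 0" "\<And>n. n \<ge> N \<Longrightarrow> plane_hol B p =
    seqprod (freeg B) (\<lambda>i. stepw B (p (real i / real n)) (p (real (Suc i) / real n))) n"
  using T.hol_eq_H[OF assms] unfolding T.H_def by blast

text \<open>The path stays in a vertical strip around \<open>x\<close> which contains no other
  abscissa of \<open>B\<close>, so no step can cross another cut.\<close>

lemma plane_hol_in_strip:
  assumes p: "path p" "path_image p \<subseteq> - B"
    and strip: "\<And>z y. z \<in> path_image p \<Longrightarrow> y \<in> B \<Longrightarrow> y \<noteq> x \<Longrightarrow> \<bar>Re z - Re x\<bar> < \<bar>Re y - Re x\<bar>"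
  shows "fst ` set (plane_hol B p) \<subseteq> {x}"
proof -
  obtain N where N: "N > 0" "\<And>n. n \<ge> N \<Longrightarrow> plane_hol B p =
    seqprod (freeg B) (\<lambda>i. stepw B (p (real i / real n)) (p (real (Suc i) / real n))) n"
    using plane_hol_eq_H[OF p] by blast
  have st: "fst ` set (stepw B (p s) (p t)) \<subseteq> {x}" if "s \<in> {0..1}" "t \<in> {0..1}" for s t
  proof -
    have "p s \<in> path_image p" "p t \<in> path_image p" using that by (auto simp: path_image_def)
    then have "y \<notin> crossing (p s) (p t)" if "y \<in> B" "y \<noteq> x" for y
      using strip[of "p s" y] strip[of "p t" y] that by (auto simp: crossing_def)
    then show ?thesis using stepw_letters[of B "p s" "p t"] by blast
  qed
  have sp: "fst ` set (seqprod (freeg B) f n) \<subseteq> {x}" if "\<And>i. i < n \<Longrightarrow> fst ` set (f i) \<subseteq> {x}" for f n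
    using that
  proof (induction n)
    case (Suc n)
    have "fst ` set (seqprod (freeg B) f n) \<subseteq> {x}" by (rule Suc.IH) (simp add: Suc.prems)
    then have "fst ` set (seqprod (freeg B) f n) \<union> fst ` set (f n) \<subseteq> {x}"
      by (rule Un_least) (simp add: Suc.prems)
    then show ?case
      using subset_trans[OF set_foldr_push[of "seqprod (freeg B) f n" "f n"]] by simp
  qed simp
  show ?thesis unfolding N(2)[OF order_refl]
    by (rule sp) (rule st; use N(1) in \<open>simp del: of_nat_Suc\<close>)
qed

lemma plane_hol_without_crossing:
  assumes p: "path p" "path_image p \<subseteq> - B"
    and no: "\<And>z z'. z \<in> path_image p \<Longrightarrow> z' \<in> path_image p \<Longrightarrow> B \<inter> crossing z z' = {}"
  shows "plane_hol B p = []"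
  using T.hol_telescope[OF p, of "\<lambda>_. []" 1] no
  by (auto simp: carrier_freeg inv_freeg winv_def path_image_def stepw_none)

text \<open>Moving the loop along the contraction \<open>h\<close> only conjugates its word. If
  \<open>x\<close> is not in \<open>B\<close>, the loop can be moved to a constant one. Otherwise it
  is moved close to \<open>x\<close>, where it fits into a strip that misses the other abscissas,
  and its word is a power of \<open>x\<close>.\<close>

lemma plane_hol_shrinking:
  fixes h :: "real \<times> real \<Rightarrow> complex"
  assumes p: "path p" "path_image p \<subseteq> - B" "pathfinish p = h (1, 0)"
    and h: "continuous_on ({0..1} \<times> {0..1}) h"
    and h0: "\<And>t. t \<in> {0..1} \<Longrightarrow> h (0, t) = x"
    and h1: "\<And>s t. s \<in> {0<..1} \<Longrightarrow> t \<in> {0..1} \<Longrightarrow> h (s, t) \<notin> B"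
    and loops: "\<And>s. s \<in> {0..1} \<Longrightarrow> h (s, 0) = h (s, 1)"
  defines "l \<equiv> p +++ ((\<lambda>t. h (1, t)) +++ reversepath p)"
  shows "x \<notin> B \<Longrightarrow> plane_hol B l = []"
    and "x \<in> B \<Longrightarrow> \<exists>u w. u \<in> carrier (freeg B) \<and> w \<in> carrier (freeg B) \<and> fst ` set w \<subseteq> {x} \<and>
      plane_hol B l = u \<otimes>\<^bsub>freeg B\<^esub> w \<otimes>\<^bsub>freeg B\<^esub> inv\<^bsub>freeg B\<^esub> u"
proof -
  define q where "q s = (\<lambda>t. h (s, t))" for s
  have pathq: "path (q s)" if "s \<in> {0..1}" for s
    unfolding q_def path_def
    by (rule continuous_on_compose2[OF h]) (use that in \<open>auto intro!: continuous_intros\<close>)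
  have imq: "path_image (q s) \<subseteq> - B" if "s \<in> {0<..1}" for s
    using h1[OF that] by (auto simp: q_def path_image_def)
  have lq: "plane_hol B l = plane_hol B p \<otimes>\<^bsub>freeg B\<^esub> (plane_hol B (q 1) \<otimes>\<^bsub>freeg B\<^esub> inv\<^bsub>freeg B\<^esub> plane_hol B p)"
  proof -
    have e: "pathstart (q 1) = pathfinish p" "pathfinish (q 1) = pathfinish p"
      using p(3) loops[of 1] by (auto simp: q_def pathstart_def pathfinish_def)
    have i: "path (q 1)" "path_image (q 1) \<subseteq> - B" using pathq[of 1] imq[of 1] by auto
    show ?thesis
      unfolding l_def q_def[symmetric] using p(1,2) e i
      by (simp add: T.hol_join T.hol_reversepath path_image_join del: mult_freeg)
  qed
  have pc: "plane_hol B p \<in> carrier (freeg B)" by (rule T.hol_closed[OF p(1,2)])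
  have conj: "\<exists>g\<in>carrier (freeg B). plane_hol B (q s) = g \<otimes>\<^bsub>freeg B\<^esub> plane_hol B (q 1) \<otimes>\<^bsub>freeg B\<^esub> inv\<^bsub>freeg B\<^esub> g"
    if s: "s \<in> {0..1}" "s > 0 \<or> x \<notin> B" for s
  proof -
    define h' where "h' = (\<lambda>(r, t). h (s + (1 - s) * r, t))"
    have rng: "s + (1 - s) * r \<in> {0..1}" "s > 0 \<Longrightarrow> s + (1 - s) * r \<in> {0<..1}" if "r \<in> {0..1}" for r
    proof -
      have "(1 - s) * r \<ge> 0" "(1 - s) * r \<le> 1 - s" using that s by (auto intro: mult_left_le)
      then show "s + (1 - s) * r \<in> {0..1}" "s > 0 \<Longrightarrow> s + (1 - s) * r \<in> {0<..1}" using s by auto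
    qed
    have "continuous_on ({0..1} \<times> {0..1}) h'"
      unfolding h'_def case_prod_unfold
      by (rule continuous_on_compose2[OF h]) (use rng in \<open>auto intro!: continuous_intros\<close>)
    moreover have "h' ` ({0..1} \<times> {0..1}) \<subseteq> - B"
    proof -
      have "h (s + (1 - s) * r, t) \<notin> B" if rt: "r \<in> {0..1}" "t \<in> {0..1}" for r t
      proof (cases "s + (1 - s) * r = 0")
        case True
        then have "\<not> s > 0" using rng(2)[OF rt(1)] by auto
        then show ?thesis using True s(2) h0[OF rt(2)] by simp
      next
        case False
        then have "s + (1 - s) * r \<in> {0<..1}" using rng(1)[OF rt(1)] by auto
        then show ?thesis by (rule h1[OF _ rt(2)])
      qed
      then show ?thesis by (auto simp: h'_def)
    qed
    moreover have "h' (r, 0) = h' (r, 1)" if "r \<in> {0..1}" for r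
      using loops[OF rng(1)[OF that]] by (simp add: h'_def)
    ultimately obtain g where "g \<in> carrier (freeg B)" "plane_hol B (\<lambda>t. h' (0, t)) =
        g \<otimes>\<^bsub>freeg B\<^esub> plane_hol B (\<lambda>t. h' (1, t)) \<otimes>\<^bsub>freeg B\<^esub> inv\<^bsub>freeg B\<^esub> g"
      using T.hol_free_homotopy[of h'] by metis
    then show ?thesis by (auto simp: h'_def q_def)
  qed
  have q1c: "plane_hol B (q 1) \<in> carrier (freeg B)"
    using T.hol_closed[OF pathq[of 1] imq[of 1]] by auto
  show "plane_hol B l = []" if "x \<notin> B"
  proof -
    obtain g where g: "g \<in> carrier (freeg B)"
      "plane_hol B (q 0) = g \<otimes>\<^bsub>freeg B\<^esub> plane_hol B (q 1) \<otimes>\<^bsub>freeg B\<^esub> inv\<^bsub>freeg B\<^esub> g"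
      using conj[of 0] \<open>x \<notin> B\<close> by auto
    have "plane_hol B (q 0) = []"
    proof (rule plane_hol_without_crossing)
      show "path (q 0)" by (rule pathq) simp
      have "path_image (q 0) = {x}" using h0 by (force simp: q_def path_image_def)
      then show "path_image (q 0) \<subseteq> - B" "\<And>z z'. z \<in> path_image (q 0) \<Longrightarrow> z' \<in> path_image (q 0) \<Longrightarrow> B \<inter> crossing z z' = {}"
        using that by (auto simp: crossing_def)
    qed
    then have "plane_hol B (q 1) = \<one>\<^bsub>freeg B\<^esub>"
      using T.conj_solve[OF g(1) q1c g(2)] g(1) by (metis T.l_inv T.r_one T.inv_closed one_freeg)
    then have "plane_hol B l = plane_hol B p \<otimes>\<^bsub>freeg B\<^esub> (\<one>\<^bsub>freeg B\<^esub> \<otimes>\<^bsub>freeg B\<^esub> inv\<^bsub>freeg B\<^esub> plane_hol B p)"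
      using lq by simp
    also have "\<dots> = \<one>\<^bsub>freeg B\<^esub>"
      using pc by (simp only: T.l_one T.r_inv T.inv_closed)
    finally show ?thesis by simp
  qed
  show "\<exists>u w. u \<in> carrier (freeg B) \<and> w \<in> carrier (freeg B) \<and> fst ` set w \<subseteq> {x} \<and>
      plane_hol B l = u \<otimes>\<^bsub>freeg B\<^esub> w \<otimes>\<^bsub>freeg B\<^esub> inv\<^bsub>freeg B\<^esub> u" if "x \<in> B"
  proof -
    obtain e where e: "e > 0" "\<And>x y. x \<in> B \<Longrightarrow> y \<in> B \<Longrightarrow> x \<noteq> y \<Longrightarrow> \<bar>Re x - Re y\<bar> \<ge> e"
      using Re_gap[OF finB injB] by blast
    have "uniformly_continuous_on ({0..1} \<times> {0..1}) h"
      using h by (intro compact_uniformly_continuous compact_Times) auto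
    then obtain d where d: "d > 0" "\<And>a b. a \<in> {0..1} \<times> {0..1} \<Longrightarrow> b \<in> {0..1} \<times> {0..1} \<Longrightarrow> dist b a < d \<Longrightarrow> dist (h b) (h a) < e"
      using e(1) unfolding uniformly_continuous_on_def by metis
    \<comment> \<open>By uniform continuity the loop with parameter \<open>s\<close> stays within
      the gap \<open>e\<close> of \<open>x\<close>.\<close>
    define s where "s = min 1 (d / 2)"
    have s: "s \<in> {0<..1}" "s < d" using d(1) by (auto simp: s_def)
    have near: "dist (h (s, t)) x < e" if "t \<in> {0..1}" for t
      using d(2)[of "(0, t)" "(s, t)"] s that h0[OF that] by (auto simp: dist_Pair_Pair)
    have s01: "s \<in> {0..1}" "s > 0 \<or> x \<notin> B" using s by auto
    obtain g where g: "g \<in> carrier (freeg B)"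
      "plane_hol B (q s) = g \<otimes>\<^bsub>freeg B\<^esub> plane_hol B (q 1) \<otimes>\<^bsub>freeg B\<^esub> inv\<^bsub>freeg B\<^esub> g"
      using conj[OF s01] by auto
    have w: "fst ` set (plane_hol B (q s)) \<subseteq> {x}"
    proof (rule plane_hol_in_strip[OF pathq[OF s01(1)] imq[OF s(1)]])
      fix z y assume "z \<in> path_image (q s)" "y \<in> B" "y \<noteq> x"
      then obtain t where t: "t \<in> {0..1}" "z = h (s, t)" by (auto simp: q_def path_image_def)
      have "\<bar>Re z - Re x\<bar> \<le> dist z x" using abs_Re_le_cmod[of "z - x"] by (simp add: dist_norm)
      also have "\<dots> < e" using near t by simp
      also have "\<dots> \<le> \<bar>Re y - Re x\<bar>" using e(2) \<open>y \<in> B\<close> \<open>y \<noteq> x\<close> \<open>x \<in> B\<close> by blast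
      finally show "\<bar>Re z - Re x\<bar> < \<bar>Re y - Re x\<bar>" .
    qed
    have wc: "plane_hol B (q s) \<in> carrier (freeg B)"
      by (rule T.hol_closed[OF pathq[OF s01(1)] imq[OF s(1)]])
    let ?m = "(\<otimes>\<^bsub>freeg B\<^esub>)"
    have "plane_hol B (q 1) = ?m (?m (inv\<^bsub>freeg B\<^esub> g) (plane_hol B (q s))) g"
      by (rule T.conj_solve[OF g(1) q1c g(2)])
    then have "plane_hol B l = ?m (?m (?m (plane_hol B p) (inv\<^bsub>freeg B\<^esub> g)) (plane_hol B (q s)))
        (inv\<^bsub>freeg B\<^esub> (?m (plane_hol B p) (inv\<^bsub>freeg B\<^esub> g)))"
      unfolding lq using g(1) pc wc
      by (simp only: T.m_assoc T.inv_mult_group T.inv_inv T.m_closed T.inv_closed)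
    moreover have "?m (plane_hol B p) (inv\<^bsub>freeg B\<^esub> g) \<in> carrier (freeg B)"
      using g(1) pc by (intro T.m_closed T.inv_closed)
    ultimately show ?thesis using w wc by blast
  qed
qed

section \<open>Realising every word by a loop\<close>

lemma path_avoiding_countable:
  assumes "open U" "connected U" "countable S" "a \<in> U - S" "b \<in> U - (S :: complex set)"
  obtains p where "path p" "path_image p \<subseteq> U - S" "pathstart p = a" "pathfinish p = b"
proof -
  have "path_connected (U - S)"
    by (rule path_connected_open_diff_countable) (use assms in auto)
  then show ?thesis using assms(4,5) that unfolding path_connected_def by metis
qed

lemma open_avoiding_countable:
  assumes "open U" "z \<in> U" "countable (S :: complex set)"
  obtains a where "a \<in> U - S"
proof -
  obtain e where "e > 0" "ball z e \<subseteq> U" using assms(1,2) openE by blast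
  moreover have "\<not> ball z e \<subseteq> S" using uncountable_ball[OF \<open>e > 0\<close>] assms(3) countable_subset by blast
  ultimately show ?thesis using that by blast
qed

text \<open>From a point below all of \<open>B\<close>, climb on the left of \<open>x\<close>, pass
  over \<open>x\<close>, descend on the right and return below. Each region used is open and
  connected, hence still path connected after removal of the countable set \<open>S\<close>, so the
  loop can avoid more points than those of \<open>B\<close>.\<close>

lemma plane_hol_surj_letter:
  assumes S: "countable S" "B \<subseteq> S" and z0: "z0 \<notin> S" "\<And>y. y \<in> B \<Longrightarrow> Im z0 < Im y" and x: "x \<in> B"
  obtains l where "path l" "path_image l \<subseteq> - S" "pathstart l = z0" "pathfinish l = z0" "plane_hol B l = [(x, True)]"
proof -
  obtain e where e: "e > 0" "\<And>x y. x \<in> B \<Longrightarrow> y \<in> B \<Longrightarrow> x \<noteq> y \<Longrightarrow> \<bar>Re x - Re y\<bar> \<ge> e"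
    using Re_gap[OF finB injB] by blast
  define m where "m = Min (Im ` B)"
  have fin: "finite (Im ` B)" "Im ` B \<noteq> {}" using finB x by auto
  have m: "Im z0 < m" using Min_in[OF fin] z0(2) by (auto simp: m_def)
  have m': "m \<le> Im y" if "y \<in> B" for y using Min_le[OF fin(1)] that by (simp add: m_def)
  \<comment> \<open>\<open>L\<close> lies below all points of \<open>B\<close>; \<open>V1\<close>
    and \<open>V2\<close> are the strips on the left and on the right of the vertical line through
    \<open>x\<close>; \<open>W\<close> straddles this line above \<open>x\<close>. Only inside
    \<open>W\<close> can a cut be crossed, and only the one at \<open>x\<close>.\<close>
  define L where "L = {z. Im z < m}"
  define V1 where "V1 = {z. Re x - e < Re z} \<inter> {z. Re z < Re x}"
  define V2 where "V2 = {z. Re x < Re z} \<inter> {z. Re z < Re x + e}"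
  define W where "W = {z. Re x - e < Re z} \<inter> {z. Re z < Re x + e} \<inter> {z. Im x < Im z}"
  have op: "open L" "open V1" "open V2" "open W"
    unfolding L_def V1_def V2_def W_def
    by (intro open_Int open_halfspace_Re_lt open_halfspace_Re_gt open_halfspace_Im_lt open_halfspace_Im_gt)+
  have conn: "connected L" "connected V1" "connected V2" "connected W"
    unfolding L_def V1_def V2_def W_def
    by (intro convex_connected convex_Int convex_halfspace_Re_lt convex_halfspace_Re_gt convex_halfspace_Im_lt convex_halfspace_Im_gt)+
  have z0L: "z0 \<in> L - S" using m z0 by (simp add: L_def)
  have "Complex (Re x - e / 2) (m - 1) \<in> L \<inter> V1" "Complex (Re x - e / 2) (Im x + 1) \<in> V1 \<inter> W"
    "Complex (Re x + e / 2) (Im x + 1) \<in> W \<inter> V2" "Complex (Re x + e / 2) (m - 1) \<in> V2 \<inter> L"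
    using e(1) by (auto simp: L_def V1_def V2_def W_def)
  then obtain a1 a2 a3 a4 where a: "a1 \<in> L \<inter> V1 - S" "a2 \<in> V1 \<inter> W - S" "a3 \<in> W \<inter> V2 - S" "a4 \<in> V2 \<inter> L - S"
    using open_avoiding_countable[OF open_Int[OF op(1,2)] _ S(1)] open_avoiding_countable[OF open_Int[OF op(2,4)] _ S(1)]
      open_avoiding_countable[OF open_Int[OF op(4,3)] _ S(1)] open_avoiding_countable[OF open_Int[OF op(3,1)] _ S(1)]
    by metis
  obtain p1 where p1: "path p1" "path_image p1 \<subseteq> L - S" "pathstart p1 = z0" "pathfinish p1 = a1"
    by (rule path_avoiding_countable[OF op(1) conn(1) S(1), of z0 a1]) (use z0L a in auto)
  obtain p2 where p2: "path p2" "path_image p2 \<subseteq> V1 - S" "pathstart p2 = a1" "pathfinish p2 = a2"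
    by (rule path_avoiding_countable[OF op(2) conn(2) S(1), of a1 a2]) (use a in auto)
  obtain p3 where p3: "path p3" "path_image p3 \<subseteq> W - S" "pathstart p3 = a2" "pathfinish p3 = a3"
    by (rule path_avoiding_countable[OF op(4) conn(4) S(1), of a2 a3]) (use a in auto)
  obtain p4 where p4: "path p4" "path_image p4 \<subseteq> V2 - S" "pathstart p4 = a3" "pathfinish p4 = a4"
    by (rule path_avoiding_countable[OF op(3) conn(3) S(1), of a3 a4]) (use a in auto)
  obtain p5 where p5: "path p5" "path_image p5 \<subseteq> L - S" "pathstart p5 = a4" "pathfinish p5 = z0"
    by (rule path_avoiding_countable[OF op(1) conn(1) S(1), of a4 z0]) (use z0L a in auto)
  have B: "path_image p \<subseteq> - B" "path_image p \<subseteq> - S" if "path_image p \<subseteq> U - S" for p and U :: "complex set"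
    using that S(2) by blast+
  have outside: "\<bar>Re y - Re x\<bar> \<ge> e" if "y \<in> B" "y \<noteq> x" for y
    using e(2)[OF that(1) x that(2)] .
  have noL: "B \<inter> crossing z z' = {}" if "z \<in> L" "z' \<in> L" for z z'
    using that m' by (force simp: L_def crossing_def)
  have no1: "B \<inter> crossing z z' = {}" if "z \<in> V1" "z' \<in> V1" for z z'
  proof -
    have "y \<notin> crossing z z'" if "y \<in> B" for y
      using \<open>z \<in> V1\<close> \<open>z' \<in> V1\<close> outside[OF that] by (cases "y = x") (auto simp: V1_def crossing_def)
    then show ?thesis by blast
  qed
  have no2: "B \<inter> crossing z z' = {}" if "z \<in> V2" "z' \<in> V2" for z z'
  proof -
    have "y \<notin> crossing z z'" if "y \<in> B" for y
      using \<open>z \<in> V2\<close> \<open>z' \<in> V2\<close> outside[OF that] by (cases "y = x") (auto simp: V2_def crossing_def)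
    then show ?thesis by blast
  qed
  have hU: "plane_hol B p = []"
    if "path p" "path_image p \<subseteq> U - S" "\<And>z z'. z \<in> U \<Longrightarrow> z' \<in> U \<Longrightarrow> B \<inter> crossing z z' = {}" for p U
  proof (rule plane_hol_without_crossing[OF that(1) B(1)[OF that(2)]])
    fix z z' assume "z \<in> path_image p" "z' \<in> path_image p"
    then show "B \<inter> crossing z z' = {}" using that(2) by (intro that(3)) auto
  qed
  have h1: "plane_hol B p1 = []" by (rule hU[OF p1(1,2) noL])
  have h2: "plane_hol B p2 = []" by (rule hU[OF p2(1,2) no1])
  have h4: "plane_hol B p4 = []" by (rule hU[OF p4(1,2) no2])
  have h5: "plane_hol B p5 = []" by (rule hU[OF p5(1,2) noL])
  have h3: "plane_hol B p3 = [(x, True)]"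
  proof -
    have "plane_hol B p3 = inv\<^bsub>freeg B\<^esub> cut_gauge x True (pathstart p3) \<otimes>\<^bsub>freeg B\<^esub> cut_gauge x True (pathfinish p3)"
    proof (rule T.hol_telescope[OF p3(1) B(1)[OF p3(2)], of _ 1])
      show "cut_gauge x True z \<in> carrier (freeg B)" for z
        using x by (auto simp: cut_gauge_def carrier_freeg)
      fix s t :: real assume "s \<in> {0..1}" "t \<in> {0..1}"
      then have "p3 s \<in> path_image p3" "p3 t \<in> path_image p3" by (auto simp: path_image_def)
      then have st: "p3 s \<in> W" "p3 t \<in> W" using p3(2) by blast+
      show "stepw B (p3 s) (p3 t) = inv\<^bsub>freeg B\<^esub> cut_gauge x True (p3 s) \<otimes>\<^bsub>freeg B\<^esub> cut_gauge x True (p3 t)"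
      proof (rule stepw_eq_gauge[OF x])
        show "Im x < Im (p3 s) \<longleftrightarrow> True" using st by (simp add: W_def)
        show "y \<notin> crossing (p3 s) (p3 t)" if "y \<in> B" "y \<noteq> x" for y
          using outside[OF that] st by (auto simp: W_def crossing_def)
      qed
    qed simp
    also have "\<dots> = [(x, True)]"
      using a(2,3) p3 by (auto simp: V1_def V2_def cut_gauge_def inv_freeg carrier_freeg winv_def)
    finally show ?thesis .
  qed
  define l where "l = p1 +++ (p2 +++ (p3 +++ (p4 +++ p5)))"
  show ?thesis
  proof (rule that[of l])
    show "path l" "pathstart l = z0" "pathfinish l = z0"
      using p1 p2 p3 p4 p5 by (auto simp: l_def)
    show "path_image l \<subseteq> - S"
      unfolding l_def using p1 p2 p3 p4 p5 B(2) by (simp add: path_image_join)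
    show "plane_hol B l = [(x, True)]"
      unfolding l_def using p1 p2 p3 p4 p5 B(1) h1 h2 h3 h4 h5
      by (simp add: T.hol_join path_image_join)
  qed
qed

text \<open>Letters are realised at a base point below \<open>B\<close>. The path \<open>r\<close>
  from 0 to this point conjugates by its word \<open>u\<close>, which is compensated by realising
  the conjugate of \<open>a\<close> by the inverse of \<open>u\<close> instead of
  \<open>a\<close>.\<close>

theorem plane_hol_surj:
  assumes S: "countable S" "B \<subseteq> S" "0 \<notin> S"
  shows "plane_hol B ` loops_at (- S) 0 = carrier (freeg B)"
proof
  show "plane_hol B ` loops_at (- S) 0 \<subseteq> carrier (freeg B)"
    using S by (auto simp: loops_at_def intro!: T.hol_closed)
  show "carrier (freeg B) \<subseteq> plane_hol B ` loops_at (- S) 0"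
  proof
    fix a assume a: "a \<in> carrier (freeg B)"
    define U where "U = (\<Inter>y\<in>B. {z. Im z < Im y})"
    have "open U" unfolding U_def by (intro open_INT finB ballI open_halfspace_Im_lt)
    moreover have "Complex 0 (Min (insert 0 (Im ` B)) - 1) \<in> U"
    proof -
      have "Min (insert 0 (Im ` B)) \<le> Im y" if "y \<in> B" for y using finB that by (intro Min_le) auto
      then show ?thesis unfolding U_def by (force intro: less_le_trans)
    qed
    ultimately obtain z0 where z0: "z0 \<in> U - S" using open_avoiding_countable S(1) by metis
    obtain r where r: "path r" "path_image r \<subseteq> UNIV - S" "pathstart r = 0" "pathfinish r = z0"
      by (rule path_avoiding_countable[of UNIV S 0 z0]) (use S z0 in auto)
    then have rB: "path_image r \<subseteq> - B" "path_image r \<subseteq> - S" using S by auto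
    define u where "u = plane_hol B r"
    have u: "u \<in> carrier (freeg B)" unfolding u_def by (rule T.hol_closed[OF r(1) rB(1)])
    have loops: "\<exists>l. path l \<and> path_image l \<subseteq> - S \<and> pathstart l = z0 \<and> pathfinish l = z0 \<and>
        plane_hol B l = weval (freeg B) (\<lambda>x. [(x, True)]) w" if "fst ` set w \<subseteq> B" for w
      using that
    proof (induction w)
      case Nil
      have "z0 \<in> - B" using z0 S by auto
      from T.hol_const[OF this] show ?case
        using z0 by (intro exI[of _ "\<lambda>_. z0"]) (auto simp: path_def path_image_def pathstart_def pathfinish_def)
    next
      case (Cons b w)
      then obtain l where l: "path l" "path_image l \<subseteq> - S" "pathstart l = z0" "pathfinish l = z0"
        "plane_hol B l = weval (freeg B) (\<lambda>x. [(x, True)]) w" by auto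
      have b: "fst b \<in> B" using Cons by auto
      obtain k where k: "path k" "path_image k \<subseteq> - S" "pathstart k = z0" "pathfinish k = z0"
        "plane_hol B k = [(fst b, True)]"
        using plane_hol_surj_letter[OF S(1,2) _ _ b] z0 by (auto simp: U_def)
      have kB: "path_image k \<subseteq> - B" "path_image l \<subseteq> - B" using k l S by auto
      define k' where "k' = (if snd b then k else reversepath k)"
      have k': "path k'" "path_image k' \<subseteq> - S" "path_image k' \<subseteq> - B" "pathstart k' = z0" "pathfinish k' = z0"
        "plane_hol B k' = (if snd b then [(fst b, True)] else inv\<^bsub>freeg B\<^esub> [(fst b, True)])"
        using k kB by (auto simp: k'_def T.hol_reversepath)
      show ?case
      proof (intro exI[of _ "k' +++ l"] conjI)
        show "plane_hol B (k' +++ l) = weval (freeg B) (\<lambda>x. [(x, True)]) (b # w)"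
          using k' l kB by (simp add: T.hol_join del: mult_freeg)
      qed (use k' l in \<open>auto simp: path_image_join\<close>)
    qed
    let ?a = "inv\<^bsub>freeg B\<^esub> u \<otimes>\<^bsub>freeg B\<^esub> a \<otimes>\<^bsub>freeg B\<^esub> u"
    have ac: "?a \<in> carrier (freeg B)" using u a by (intro T.m_closed T.inv_closed)
    have "weval (freeg B) (\<lambda>x. [(x, True)]) ?a = foldr push ?a []"
      by (rule weval_letters) (use ac in \<open>simp only: carrier_freeg\<close>)
    also have "\<dots> = ?a" using reduced_append_eq[of ?a "[]"] ac by (simp add: carrier_freeg)
    finally obtain l where l: "path l" "path_image l \<subseteq> - S" "pathstart l = z0" "pathfinish l = z0"
      "plane_hol B l = ?a"
      using loops[of ?a] ac by (auto simp only: carrier_freeg)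
    have lB: "path_image l \<subseteq> - B" using l S by auto
    have "plane_hol B (r +++ (l +++ reversepath r)) = u \<otimes>\<^bsub>freeg B\<^esub> (?a \<otimes>\<^bsub>freeg B\<^esub> inv\<^bsub>freeg B\<^esub> u)"
      using r rB l lB by (simp add: T.hol_join T.hol_reversepath path_image_join u_def del: mult_freeg)
    also have "\<dots> = (u \<otimes>\<^bsub>freeg B\<^esub> inv\<^bsub>freeg B\<^esub> u) \<otimes>\<^bsub>freeg B\<^esub> a \<otimes>\<^bsub>freeg B\<^esub> (u \<otimes>\<^bsub>freeg B\<^esub> inv\<^bsub>freeg B\<^esub> u)"
      using u a by (simp only: T.m_assoc T.m_closed T.inv_closed)
    also have "\<dots> = a" using u a by (simp only: T.r_inv T.l_one T.r_one)
    finally have "a = plane_hol B (r +++ (l +++ reversepath r))" ..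
    moreover have "r +++ (l +++ reversepath r) \<in> loops_at (- S) 0"
      using r rB l by (auto simp: loops_at_def path_image_join)
    ultimately show "a \<in> plane_hol B ` loops_at (- S) 0" by blast
  qed
qed

end


section \<open>Linearization of a doubling map\<close>

text \<open>The model is the squaring map of a Lie group in a chart that places the unit at 0. Near
  0 it is the doubling up to a remainder whose Lipschitz constant is linear in the radius; the aim
  is a solution of \<open>E z = \<sigma> (E (z /\<^sub>R 2))\<close>, the linearization of an
  expanding fixed point.\<close>

locale doubling_map =
  fixes \<sigma> :: "'e::banach \<Rightarrow> 'e" and C r :: real
  assumes C: "C > 0" and r: "r > 0" and zero: "\<sigma> 0 = 0"
    and est: "norm x < r \<Longrightarrow> norm y < r \<Longrightarrow>
      norm (\<sigma> x - \<sigma> y - 2 *\<^sub>R (x - y)) \<le> C * max (norm x) (norm y) * norm (x - y)"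
begin

text \<open>The bound \<open>1 / C\<close> keeps the denominator of \<open>\<phi>\<close> above 1 /
  2, so that \<open>\<phi> t \<le> 2 * t\<close>; the bound \<open>r / 3\<close> then keeps
  \<open>\<phi>\<close> below \<open>r\<close>.\<close>

definition \<rho> :: real where "\<rho> = min (1 / C) (r / 3)"

text \<open>A majorant for the growth of the iterates: \<open>2 \<phi> t + C (\<phi> t)\<^sup>2 \<le> \<phi> (2 t)\<close>.\<close>

definition \<phi> :: "real \<Rightarrow> real" where "\<phi> t = t / (1 - C / 2 * t)"

lemma rho: "\<rho> > 0" "t \<le> \<rho> \<Longrightarrow> C / 2 * t \<le> 1 / 2" "2 * \<rho> < r"
proof -
  show "\<rho> > 0" using C r by (simp add: \<rho>_def)
  show "2 * \<rho> < r" using C r by (simp add: \<rho>_def)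
  assume "t \<le> \<rho>"
  then have "C * t \<le> C * (1 / C)" using C by (intro mult_left_mono) (auto simp: \<rho>_def)
  then show "C / 2 * t \<le> 1 / 2" using C by simp
qed

lemma phi_bounds: assumes "0 \<le> t" "t \<le> \<rho>" shows "t \<le> \<phi> t" "\<phi> t \<le> 2 * t" "0 \<le> \<phi> t" "\<phi> t < r"
proof -
  define u where "u = 1 - C / 2 * t"
  have u: "1 / 2 \<le> u" "u \<le> 1" using rho(2)[OF assms(2)] C assms(1) by (auto simp: u_def)
  have "t * u \<le> t * 1" using u assms(1) by (intro mult_left_mono) auto
  then show 1: "t \<le> \<phi> t" using u unfolding \<phi>_def u_def[symmetric] by (simp add: field_simps)
  have "t * (1 / 2) \<le> t * u" using u assms(1) by (intro mult_left_mono) auto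
  then show 2: "\<phi> t \<le> 2 * t" using u unfolding \<phi>_def u_def[symmetric] by (simp add: field_simps)
  show "0 \<le> \<phi> t" using 1 assms by simp
  show "\<phi> t < r" using 2 assms rho(3) by simp
qed

lemma est_step:
  assumes "0 \<le> t" "t \<le> \<rho>" "norm x \<le> \<phi> t" "norm y \<le> \<phi> t"
  shows "norm (\<sigma> x - \<sigma> y) \<le> 2 / (1 - C / 2 * t) * norm (x - y)"
proof -
  define u where "u = 1 - C / 2 * t"
  have u: "u > 0" using rho(2)[OF assms(2)] by (auto simp: u_def)
  have "norm x < r" "norm y < r" using assms phi_bounds[of t] by auto
  then have "norm (\<sigma> x - \<sigma> y - 2 *\<^sub>R (x - y)) \<le> C * max (norm x) (norm y) * norm (x - y)"
    by (rule est)
  also have "\<dots> \<le> C * \<phi> t * norm (x - y)"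
    using assms C by (intro mult_right_mono mult_left_mono) auto
  finally have "norm (\<sigma> x - \<sigma> y) \<le> C * \<phi> t * norm (x - y) + norm (2 *\<^sub>R (x - y))"
    using norm_triangle_sub[of "\<sigma> x - \<sigma> y" "2 *\<^sub>R (x - y)"] by linarith
  also have "\<dots> = (C * \<phi> t + 2) * norm (x - y)" by (simp only: norm_scaleR) (simp add: algebra_simps)
  also have "C * \<phi> t + 2 = 2 / u"
  proof -
    have "C * t + 2 * u = 2" by (simp add: u_def)
    then have "C * (t / u) + 2 = 2 / u" using u by (simp add: field_simps)
    then show ?thesis by (simp add: \<phi>_def u_def)
  qed
  finally show ?thesis by (simp add: u_def)
qed

lemma step_bound:
  assumes "0 \<le> t" "2 * t \<le> \<rho>" "norm x \<le> \<phi> t"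
  shows "norm (\<sigma> x) \<le> \<phi> (2 * t)"
proof -
  define u where "u = C / 2 * t"
  have u: "0 \<le> u" "2 * u \<le> 1 / 2" using rho(2)[of "2 * t"] assms C by (auto simp: u_def)
  have t: "t \<le> \<rho>" using assms by simp
  have "norm (\<sigma> x) \<le> 2 / (1 - u) * norm x"
    using est_step[OF assms(1) t assms(3), of 0] phi_bounds(3)[OF assms(1) t] zero by (simp add: u_def)
  also have "\<dots> \<le> 2 / (1 - u) * \<phi> t"
    using assms(3) u by (intro mult_left_mono) auto
  also have "\<dots> = 2 * t / (1 - u)\<^sup>2"
    unfolding \<phi>_def u_def[symmetric] by (simp add: power2_eq_square)
  \<comment> \<open>The square of \<open>1 - u\<close> is at least \<open>1 - 2 * u\<close>: this is
    what the form of \<open>\<phi>\<close> is made for.\<close>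
  also have "\<dots> \<le> 2 * t / (1 - 2 * u)"
    using u assms(1) by (intro divide_left_mono mult_pos_pos zero_less_power) (auto simp: power2_eq_square algebra_simps)
  also have "\<dots> = \<phi> (2 * t)" by (simp add: \<phi>_def u_def)
  finally show ?thesis .
qed

lemma iterate_bound:
  assumes "0 \<le> t" "2 ^ k * t \<le> \<rho>" "norm x \<le> \<phi> t"
  shows "norm ((\<sigma> ^^ k) x) \<le> \<phi> (2 ^ k * t)"
  using assms(2)
proof (induction k)
  case (Suc k)
  have "0 \<le> 2 ^ k * t" using assms(1) by simp
  moreover have "2 * (2 ^ k * t) \<le> \<rho>" using Suc.prems by (simp add: mult.assoc)
  ultimately have "2 ^ k * t \<le> \<rho>" by linarith
  then have "norm ((\<sigma> ^^ k) x) \<le> \<phi> (2 ^ k * t)" by (rule Suc.IH)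
  then show ?case using step_bound[of "2 ^ k * t"] Suc.prems assms(1) by (simp add: mult.assoc)
qed (use assms in simp)

text \<open>Each step expands by at most \<open>2 / (1 - u)\<close>, where \<open>u\<close> doubles
  from one step to the next. Since the square of \<open>1 - u\<close> is at least
  \<open>1 - 2 * u\<close>, the product of the corrections telescopes and stays below 2, uniformly
  in \<open>k\<close>.\<close>

lemma iterate_lipschitz:
  assumes "0 \<le> t" "2 ^ k * t \<le> \<rho>" "norm x \<le> \<phi> t" "norm y \<le> \<phi> t"
  shows "norm ((\<sigma> ^^ k) x - (\<sigma> ^^ k) y) \<le> 2 * 2 ^ k * norm (x - y)"
proof -
  have main: "norm ((\<sigma> ^^ k) x - (\<sigma> ^^ k) y) \<le> 2 ^ k / (1 - C / 2 * (2 ^ k * t)) * norm (x - y)"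
    using assms(2)
  proof (induction k)
    case 0
    have "1 \<le> 1 / (1 - C / 2 * t)"
      using rho(2)[of t] 0 C assms(1) by (subst le_divide_eq_1_pos) auto
    then have "1 * norm (x - y) \<le> 1 / (1 - C / 2 * t) * norm (x - y)"
      by (intro mult_right_mono) auto
    then show ?case by simp
  next
    case (Suc k)
    define t' where "t' = 2 ^ k * t"
    define u where "u = C / 2 * t'"
    have "0 \<le> t'" "2 * t' \<le> \<rho>" using assms(1) Suc.prems by (auto simp: t'_def mult.assoc)
    then have t': "0 \<le> t'" "t' \<le> \<rho>" "2 * t' \<le> \<rho>" by auto
    have u: "0 \<le> u" "2 * u \<le> 1 / 2" using rho(2)[OF t'(3)] t'(1) C by (auto simp: u_def)
    have b: "norm ((\<sigma> ^^ k) x) \<le> \<phi> t'" "norm ((\<sigma> ^^ k) y) \<le> \<phi> t'"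
      unfolding t'_def using assms t' by (auto intro!: iterate_bound simp: t'_def)
    have "norm ((\<sigma> ^^ Suc k) x - (\<sigma> ^^ Suc k) y) \<le> 2 / (1 - u) * norm ((\<sigma> ^^ k) x - (\<sigma> ^^ k) y)"
      using est_step[OF t'(1,2) b] by (simp add: u_def)
    also have "\<dots> \<le> 2 / (1 - u) * (2 ^ k / (1 - u) * norm (x - y))"
      using Suc t' u by (intro mult_left_mono) (auto simp: u_def t'_def)
    also have "\<dots> = 2 ^ Suc k * (1 / (1 - u)\<^sup>2) * norm (x - y)"
      by (simp add: power2_eq_square)
    also have "\<dots> \<le> 2 ^ Suc k * (1 / (1 - 2 * u)) * norm (x - y)"
      using u by (intro mult_right_mono mult_left_mono divide_left_mono mult_pos_pos zero_less_power)
        (auto simp: power2_eq_square algebra_simps)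
    also have "\<dots> = 2 ^ Suc k / (1 - C / 2 * (2 ^ Suc k * t)) * norm (x - y)"
      by (simp add: u_def t'_def mult_ac)
    finally show ?case .
  qed
  define u where "u = 1 - C / 2 * (2 ^ k * t)"
  have u: "1 / 2 \<le> u" using rho(2)[OF assms(2)] by (simp add: u_def)
  have "2 ^ k / u \<le> 2 ^ k / (1 / 2)" using u by (intro divide_left_mono) auto
  then have "2 ^ k / u * norm (x - y) \<le> 2 * 2 ^ k * norm (x - y)"
    by (intro mult_right_mono) auto
  with main show ?thesis unfolding u_def by linarith
qed

text \<open>With the same scaled limit, the two sequences differ at the index \<open>n + k\<close>
  by less than any multiple of \<open>1 / 2 ^ (n + k)\<close>, while the \<open>k\<close>
  applications of \<open>\<sigma>\<close> that lead back to the index \<open>n\<close> expand by at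
  most \<open>2 * 2 ^ k\<close>. Letting \<open>k\<close> grow leaves no difference at
  \<open>n\<close>.\<close>

lemma root_unique:
  fixes x y :: "nat \<Rightarrow> 'e"
  assumes x: "\<And>n. n \<ge> N \<Longrightarrow> \<sigma> (x (Suc n)) = x n" and y: "\<And>n. n \<ge> N \<Longrightarrow> \<sigma> (y (Suc n)) = y n"
    and limx: "(\<lambda>n. 2 ^ n *\<^sub>R x n) \<longlonglongrightarrow> Z" and limy: "(\<lambda>n. 2 ^ n *\<^sub>R y n) \<longlonglongrightarrow> Z"
  shows "\<forall>\<^sub>F n in sequentially. x n = y n"
proof -
  obtain A1 where A1: "\<And>n. norm (2 ^ n *\<^sub>R x n) \<le> A1" using limx by (metis BseqE convergentI convergent_imp_Bseq)
  obtain A2 where A2: "\<And>n. norm (2 ^ n *\<^sub>R y n) \<le> A2" using limy by (metis BseqE convergentI convergent_imp_Bseq)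
  define A where "A = \<bar>A1\<bar> + \<bar>A2\<bar>"
  have A: "norm (x n) \<le> A / 2 ^ n" "norm (y n) \<le> A / 2 ^ n" for n
    using A1[of n] A2[of n] by (auto simp: A_def field_simps)
  have A0: "A \<ge> 0" by (simp add: A_def)
  have "(\<lambda>n. A / 2 ^ n) \<longlonglongrightarrow> 0" by real_asymp
  then have "\<forall>\<^sub>F n in sequentially. A / 2 ^ n < \<rho>" using rho(1) by (auto dest: order_tendstoD(2))
  then obtain M where M: "\<And>n. n \<ge> M \<Longrightarrow> A / 2 ^ n < \<rho>" by (auto simp: eventually_sequentially)
  have "x n = y n" if n: "n \<ge> max M N" for n
  proof -
    have iter: "(\<sigma> ^^ k) (x (n + k)) = x n" "(\<sigma> ^^ k) (y (n + k)) = y n" for k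
    proof (induction k)
      case (Suc k)
      { case 1 show ?case using Suc x[of "n + k"] n by (simp add: funpow_swap1) }
      { case 2 show ?case using Suc y[of "n + k"] n by (simp add: funpow_swap1) }
    qed auto
    have bd: "norm (x n - y n) \<le> 2 / 2 ^ n * norm (2 ^ (n + k) *\<^sub>R x (n + k) - 2 ^ (n + k) *\<^sub>R y (n + k))" for k
    proof -
      have e: "2 ^ k * (A / 2 ^ (n + k)) = A / 2 ^ n" by (simp add: power_add)
      have l: "A / 2 ^ (n + k) \<le> \<rho>" using M[of "n + k"] n by simp
      have p: "A / 2 ^ (n + k) \<le> \<phi> (A / 2 ^ (n + k))" using A0 l by (intro phi_bounds) auto
      have "norm ((\<sigma> ^^ k) (x (n + k)) - (\<sigma> ^^ k) (y (n + k))) \<le> 2 * 2 ^ k * norm (x (n + k) - y (n + k))"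
        using A0 e M[of n] n A[of "n + k"] p by (intro iterate_lipschitz[of "A / 2 ^ (n + k)"]) auto
      also have "\<dots> = 2 / 2 ^ n * norm (2 ^ (n + k) *\<^sub>R (x (n + k) - y (n + k)))"
        by (simp add: power_add)
      finally show ?thesis by (simp add: iter scaleR_diff_right)
    qed
    have "(\<lambda>k. 2 / 2 ^ n * norm (2 ^ (n + k) *\<^sub>R x (n + k) - 2 ^ (n + k) *\<^sub>R y (n + k))) \<longlonglongrightarrow> 2 / 2 ^ n * norm (Z - Z)"
      using LIMSEQ_ignore_initial_segment[OF limx, of n] LIMSEQ_ignore_initial_segment[OF limy, of n]
      by (intro tendsto_intros) (simp_all add: add.commute)
    then have "norm (x n - y n) \<le> 2 / 2 ^ n * norm (Z - Z)"
      by (rule LIMSEQ_le_const) (use bd in auto)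
    then show ?thesis by simp
  qed
  then show ?thesis unfolding eventually_sequentially by blast
qed

text \<open>\<open>E\<close> is the uniform limit of the \<open>n\<close>-th iterate of
  \<open>\<sigma>\<close> at \<open>z /\<^sub>R 2 ^ n\<close>. One more halving changes this by a
  quadratic error at the scale \<open>1 / 2 ^ n\<close>, expanded \<open>2 ^ n\<close> times; the
  differences form a geometric series, whose sum is the final error bound.\<close>

lemma linearization_exists:
  obtains E where "continuous_on (cball 0 \<rho>) E" "\<And>z. norm z \<le> \<rho> \<Longrightarrow> norm (E z) < r"
    "\<And>z. norm z \<le> \<rho> \<Longrightarrow> E z = \<sigma> (E (z /\<^sub>R 2))"
    "\<And>z. norm z \<le> \<rho> \<Longrightarrow> norm (E z - z) \<le> C * (norm z)\<^sup>2"
proof -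
  define En where "En n z = (\<sigma> ^^ n) (z /\<^sub>R 2 ^ n)" for n z
  have small: "norm (z /\<^sub>R 2 ^ n) = norm z / 2 ^ n" for n and z :: 'e by (simp add: field_simps)
  have En_bound: "norm (En n z) \<le> 2 * \<rho>" if "norm z \<le> \<rho>" for n and z :: 'e
  proof -
    have "norm z / 2 ^ n \<le> norm z" by (simp add: divide_le_eq mult_le_cancel_left1)
    then have z2: "norm z / 2 ^ n \<le> \<rho>" using that by linarith
    have "norm (En n z) \<le> \<phi> (2 ^ n * (norm z / 2 ^ n))"
      unfolding En_def using that z2 small phi_bounds(1)[of "norm z / 2 ^ n"]
      by (intro iterate_bound) auto
    also have "\<dots> \<le> 2 * norm z" using that by (simp add: phi_bounds)
    finally show ?thesis using that by simp
  qed
  have En_diff: "norm (En (Suc n) z - En n z) \<le> C / 2 * (norm z)\<^sup>2 * (1 / 2) ^ n" if z: "norm z \<le> \<rho>" for n and z :: 'e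
  proof -
    have le: "norm z / 2 ^ k \<le> norm z" for k
      by (simp add: divide_le_eq mult_le_cancel_left1)
    let ?x = "z /\<^sub>R 2 ^ Suc n" and ?t = "norm z / 2 ^ n"
    have t: "0 \<le> ?t" "?t \<le> \<rho>" "2 ^ n * ?t \<le> \<rho>" using le[of n] z by auto
    have t2: "0 \<le> norm ?x" "norm ?x \<le> \<rho>" "2 * norm ?x \<le> \<rho>" "2 * norm ?x = ?t" "norm ?x = norm z / 2 ^ Suc n"
    proof -
      show nx: "norm ?x = norm z / 2 ^ Suc n" by (rule small)
      show "2 * norm ?x = ?t" unfolding nx by simp
      then show "2 * norm ?x \<le> \<rho>" "norm ?x \<le> \<rho>" using t(2) norm_ge_zero[of ?x] by linarith+
    qed simp
    have x2: "z /\<^sub>R 2 ^ n = 2 *\<^sub>R ?x" by simp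
    have "norm (\<sigma> ?x) \<le> \<phi> (2 * norm ?x)"
      using t2 phi_bounds(1)[OF t2(1,2)] by (intro step_bound) auto
    then have sb: "norm (\<sigma> ?x) \<le> \<phi> ?t" by (simp only: t2(4))
    have zb: "norm (z /\<^sub>R 2 ^ n) \<le> \<phi> ?t" using phi_bounds(1)[OF t(1,2)] small by simp
    have "En (Suc n) z - En n z = (\<sigma> ^^ n) (\<sigma> ?x) - (\<sigma> ^^ n) (z /\<^sub>R 2 ^ n)"
      unfolding En_def funpow_Suc_right o_def by simp
    also have "norm \<dots> \<le> 2 * 2 ^ n * norm (\<sigma> ?x - z /\<^sub>R 2 ^ n)"
      by (rule iterate_lipschitz[OF t(1,3) sb zb])
    also have "norm (\<sigma> ?x - z /\<^sub>R 2 ^ n) \<le> C * norm ?x * norm ?x"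
    proof -
      have "norm ?x < r" using t2(2) rho by linarith
      from est[OF this, of 0] show ?thesis using r zero unfolding x2 by simp
    qed
    also have "2 * 2 ^ n * (C * norm ?x * norm ?x) = C / 2 * (norm z)\<^sup>2 * (1 / 2) ^ n"
      unfolding t2(5) by (simp add: power2_eq_square power_one_over field_simps)
    finally show ?thesis by simp
  qed
  have "uniform_limit (cball 0 \<rho>) (\<lambda>n z. \<Sum>i<n. En (Suc i) z - En i z) (\<lambda>z. \<Sum>i. En (Suc i) z - En i z) sequentially"
  proof (rule Weierstrass_m_test)
    show "summable (\<lambda>n. C / 2 * \<rho>\<^sup>2 * (1 / 2) ^ n :: real)"
      by (intro summable_mult summable_geometric) simp
    fix n z assume "z \<in> cball (0::'e) \<rho>"
    then have z: "norm z \<le> \<rho>" by simp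
    have "C / 2 * (norm z)\<^sup>2 * (1 / 2) ^ n \<le> C / 2 * \<rho>\<^sup>2 * (1 / 2) ^ n"
      using z C by (intro mult_right_mono mult_left_mono power_mono) auto
    with En_diff[OF z, of n] show "norm (En (Suc n) z - En n z) \<le> C / 2 * \<rho>\<^sup>2 * (1 / 2) ^ n" by linarith
  qed
  then have "uniform_limit (cball 0 \<rho>) (\<lambda>n z. En 0 z + (\<Sum>i<n. En (Suc i) z - En i z))
      (\<lambda>z. En 0 z + (\<Sum>i. En (Suc i) z - En i z)) sequentially"
    by (intro uniform_limit_add uniform_limit_const)
  moreover have "En 0 z + (\<Sum>i<n. En (Suc i) z - En i z) = En n z" for n z
    using sum_lessThan_telescope[of "\<lambda>i. En i z" n] by simp
  ultimately obtain E where E: "uniform_limit (cball 0 \<rho>) En E sequentially" by auto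
  have lim: "(\<lambda>n. En n z) \<longlonglongrightarrow> E z" if "norm z \<le> \<rho>" for z
    using tendsto_uniform_limitI[OF E, of z] that by simp
  have cont_\<sigma>: "continuous_on (ball 0 r) \<sigma>"
  proof (rule continuous_onI)
    fix x :: 'e and e :: real assume x: "x \<in> ball 0 r" and e: "e > 0"
    have lip: "norm (\<sigma> y - \<sigma> x) \<le> (C * r + 2) * norm (y - x)" if "y \<in> ball 0 r" for y
    proof -
      have "norm (\<sigma> y - \<sigma> x - 2 *\<^sub>R (y - x)) \<le> C * max (norm y) (norm x) * norm (y - x)"
        using x that by (intro est) auto
      also have "\<dots> \<le> C * r * norm (y - x)" using x that C by (intro mult_right_mono mult_left_mono) auto
      finally have "norm (\<sigma> y - \<sigma> x) \<le> C * r * norm (y - x) + norm (2 *\<^sub>R (y - x))"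
        using norm_triangle_sub[of "\<sigma> y - \<sigma> x" "2 *\<^sub>R (y - x)"] by linarith
      also have "norm (2 *\<^sub>R (y - x)) = 2 * norm (y - x)" by simp
      finally show ?thesis by (simp add: algebra_simps)
    qed
    have pos: "C * r + 2 > 0" using C r by (simp add: add_pos_pos)
    show "\<exists>d>0. \<forall>x'\<in>ball 0 r. dist x' x < d \<longrightarrow> dist (\<sigma> x') (\<sigma> x) \<le> e"
    proof (intro exI[of _ "e / (C * r + 2)"] conjI ballI impI)
      show "e / (C * r + 2) > 0" using e pos by simp
      fix y assume y: "y \<in> ball 0 r" "dist y x < e / (C * r + 2)"
      have "norm (\<sigma> y - \<sigma> x) \<le> (C * r + 2) * norm (y - x)" by (rule lip[OF y(1)])
      also have "\<dots> \<le> e" using y(2) pos by (simp add: dist_norm field_simps)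
      finally show "dist (\<sigma> y) (\<sigma> x) \<le> e" by (simp add: dist_norm)
    qed
  qed
  have En_cont: "continuous_on (cball 0 \<rho>) (En n)" for n
  proof -
    have "continuous_on (cball 0 \<rho>) (\<lambda>z. (\<sigma> ^^ k) (z /\<^sub>R 2 ^ n))" if "k \<le> n" for k
      using that
    proof (induction k)
      case (Suc k)
      have "norm ((\<sigma> ^^ k) (z /\<^sub>R 2 ^ n)) < r" if z: "norm z \<le> \<rho>" for z
      proof -
        have e: "z /\<^sub>R 2 ^ n = (z /\<^sub>R 2 ^ (n - k)) /\<^sub>R 2 ^ k"
        proof -
          have "(2::real) ^ n = 2 ^ k * 2 ^ (n - k)" using Suc.prems by (simp add: power_add[symmetric])
          then show ?thesis by simp
        qed
        have "norm (z /\<^sub>R 2 ^ (n - k)) \<le> norm z" unfolding small by (simp add: divide_le_eq mult_le_cancel_left1)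
        then have "norm (En k (z /\<^sub>R 2 ^ (n - k))) \<le> 2 * \<rho>" using z by (intro En_bound) simp
        then show ?thesis unfolding e En_def using rho by linarith
      qed
      then show ?case
        using Suc by (auto intro!: continuous_on_compose2[OF cont_\<sigma>])
    qed (auto intro!: continuous_intros)
    then show ?thesis by (simp add: En_def[abs_def])
  qed
  have bound: "norm (E z) \<le> 2 * \<rho>" if "norm z \<le> \<rho>" for z
    by (rule LIMSEQ_le_const2[OF tendsto_norm[OF lim[OF that]]]) (use En_bound[OF that] in auto)
  show ?thesis
  proof (rule that)
    show "continuous_on (cball 0 \<rho>) E"
      by (rule uniform_limit_theorem[OF always_eventually E]) (auto intro: En_cont)
    show "norm (E z) < r" if "norm z \<le> \<rho>" for z using bound[OF that] rho by linarith
    show "E z = \<sigma> (E (z /\<^sub>R 2))" if z: "norm z \<le> \<rho>" for z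
    proof (rule LIMSEQ_unique)
      show "(\<lambda>n. En (Suc n) z) \<longlonglongrightarrow> E z" using lim[OF z] by (rule LIMSEQ_Suc)
      have z2: "norm (z /\<^sub>R 2) \<le> \<rho>" using z rho(1) by simp
      have in_ball: "norm (E (z /\<^sub>R 2)) < r" "\<And>n. norm (En n (z /\<^sub>R 2)) < r"
        using bound[OF z2] En_bound[OF z2] rho(3) by (auto intro: le_less_trans)
      have "isCont \<sigma> (E (z /\<^sub>R 2))"
        using cont_\<sigma> in_ball by (simp add: continuous_on_eq_continuous_at)
      from isCont_tendsto_compose[OF this lim[OF z2]]
      show "(\<lambda>n. En (Suc n) z) \<longlonglongrightarrow> \<sigma> (E (z /\<^sub>R 2))"
        by (simp add: En_def)
    qed
    show "norm (E z - z) \<le> C * (norm z)\<^sup>2" if z: "norm z \<le> \<rho>" for z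
    proof (rule LIMSEQ_le_const2)
      show "(\<lambda>n. norm (En n z - z)) \<longlonglongrightarrow> norm (E z - z)" by (intro tendsto_intros lim z)
      have "norm (En n z - z) \<le> C * (norm z)\<^sup>2" for n
      proof -
        have "En n z - z = (\<Sum>i<n. En (Suc i) z - En i z)"
          using sum_lessThan_telescope[of "\<lambda>i. En i z" n] by (simp add: En_def)
        also have "norm \<dots> \<le> (\<Sum>i<n. C / 2 * (norm z)\<^sup>2 * (1 / 2) ^ i)"
          by (rule sum_norm_le) (rule En_diff[OF z])
        also have "\<dots> = C / 2 * (norm z)\<^sup>2 * (\<Sum>i<n. (1 / 2) ^ i)" by (simp add: sum_distrib_left)
        also have "\<dots> \<le> C / 2 * (norm z)\<^sup>2 * 2"
        proof (intro mult_left_mono)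
          have "(\<Sum>i<n. (1 / 2) ^ i) = 2 - 2 * (1 / 2 :: real) ^ n" by (induction n) auto
          then show "(\<Sum>i<n. (1 / 2) ^ i) \<le> (2 :: real)" by simp
        qed (use C in simp)
        finally show ?thesis by simp
      qed
      then show "\<exists>N. \<forall>n\<ge>N. norm (En n z - z) \<le> C * (norm z)\<^sup>2" by auto
    qed
  qed
qed

end


section \<open>The exponential map of a Lie group\<close>

text \<open>The derivative tested along a sequence that shrinks like \<open>1 / 2 ^ n\<close>, the
  form in which tangent vectors are handled below.\<close>

lemma tendsto_scaled_difference:
  fixes f :: "'a::real_normed_vector \<Rightarrow> 'b::real_normed_vector"
  assumes f: "(f has_derivative L) (at e)" and a: "(\<lambda>n. 2 ^ n *\<^sub>R a n) \<longlonglongrightarrow> Z"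
  shows "(\<lambda>n. 2 ^ n *\<^sub>R (f (e + a n) - f e)) \<longlonglongrightarrow> L Z"
proof -
  interpret L: bounded_linear L using f by (rule has_derivative_bounded_linear)
  have a0: "a \<longlonglongrightarrow> 0"
  proof -
    have "(\<lambda>n. (1 / 2) ^ n *\<^sub>R (2 ^ n *\<^sub>R a n)) \<longlonglongrightarrow> 0 *\<^sub>R Z"
      by (intro tendsto_scaleR a LIMSEQ_power_zero) simp
    then show ?thesis by (simp add: power_one_over)
  qed
  have "(\<lambda>n. 2 ^ n *\<^sub>R (f (e + a n) - f e) - L (2 ^ n *\<^sub>R a n)) \<longlonglongrightarrow> 0"
  proof (rule LIMSEQ_I)
    fix s :: real assume s: "s > 0"
    obtain K where K: "K > 0" "\<And>n. norm (2 ^ n *\<^sub>R a n) \<le> K"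
      using convergent_imp_Bseq[OF convergentI[OF a]] by (auto simp: Bseq_def)
    obtain d where d: "d > 0" "\<And>y. norm (y - e) < d \<Longrightarrow> norm (f y - f e - L (y - e)) \<le> s / (2 * K) * norm (y - e)"
      using f s K(1) unfolding has_derivative_at_alt by (metis divide_pos_pos mult_pos_pos zero_less_numeral)
    obtain N where N: "\<And>n. n \<ge> N \<Longrightarrow> norm (a n) < d"
      using a0 d(1) by (force simp: LIMSEQ_iff)
    have "norm (2 ^ n *\<^sub>R (f (e + a n) - f e) - L (2 ^ n *\<^sub>R a n) - 0) < s" if "n \<ge> N" for n
    proof -
      have "2 ^ n *\<^sub>R (f (e + a n) - f e) - L (2 ^ n *\<^sub>R a n) - 0 = 2 ^ n *\<^sub>R (f (e + a n) - f e - L (a n))"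
        by (simp add: L.scaleR algebra_simps)
      also have "norm \<dots> = 2 ^ n * norm (f (e + a n) - f e - L (a n))" by simp
      also have "\<dots> \<le> 2 ^ n * (s / (2 * K) * norm (a n))"
        using d(2)[of "e + a n"] N[OF that] by (intro mult_left_mono) auto
      also have "\<dots> = s / (2 * K) * norm (2 ^ n *\<^sub>R a n)" by simp
      also have "\<dots> \<le> s / (2 * K) * K" using s K by (intro mult_left_mono) auto
      also have "\<dots> < s" using s K by simp
      finally show ?thesis .
    qed
    then show "\<exists>N. \<forall>n\<ge>N. norm (2 ^ n *\<^sub>R (f (e + a n) - f e) - L (2 ^ n *\<^sub>R a n) - 0) < s" by blast
  qed
  from tendsto_add[OF this L.tendsto[OF a]] show ?thesis by simp
qed

text \<open>Applied to the derivative of the squaring map, in the place of a second-order Taylor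
  formula.\<close>

lemma differentiable_pointwise_lipschitz:
  fixes f :: "'a::real_normed_vector \<Rightarrow> 'b::real_normed_vector"
  assumes "f differentiable (at e)"
  obtains K d where "K > 0" "d > 0" "\<And>y. norm (y - e) < d \<Longrightarrow> norm (f y - f e) \<le> K * norm (y - e)"
proof -
  obtain L where L: "(f has_derivative L) (at e)" using assms by (auto simp: differentiable_def)
  interpret L: bounded_linear L using L by (rule has_derivative_bounded_linear)
  obtain K where K: "K > 0" "\<And>x. norm (L x) \<le> norm x * K" using L.pos_bounded by blast
  obtain d where d: "d > 0" "\<And>y. norm (y - e) < d \<Longrightarrow> norm (f y - f e - L (y - e)) \<le> 1 * norm (y - e)"
    using L unfolding has_derivative_at_alt by (metis zero_less_one)
  show ?thesis
  proof (rule that[of "K + 1" d])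
    fix y assume y: "norm (y - e) < d"
    have "norm (f y - f e) \<le> norm (f y - f e - L (y - e)) + norm (L (y - e))"
      using norm_triangle_sub[of "f y - f e" "L (y - e)"] by linarith
    also have "\<dots> \<le> 1 * norm (y - e) + norm (y - e) * K" using d(2)[OF y] K(2)[of "y - e"] by linarith
    finally show "norm (f y - f e) \<le> (K + 1) * norm (y - e)" by (simp add: algebra_simps)
  qed (use K d in auto)
qed

lemma Ck_on_cong:
  assumes "open S" "Ck_on k f S" "\<And>x. x \<in> S \<Longrightarrow> f x = g x"
  shows "Ck_on k g S"
  using assms(2,3)
proof (induction k arbitrary: f g)
  case 0
  then show ?case by (auto cong: continuous_on_cong)
next
  case (Suc k)
  have d: "g differentiable (at x)" "frechet_derivative f (at x) = frechet_derivative g (at x)" if "x \<in> S" for x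
  proof -
    have f: "f differentiable (at x)" using Suc.prems that by simp
    then obtain L where "(f has_derivative L) (at x)" by (auto simp: differentiable_def)
    then have "(g has_derivative L) (at x)"
      by (rule has_derivative_transform_within_open[OF _ assms(1) that Suc.prems(2)])
    then show "g differentiable (at x)" by (auto simp: differentiable_def)
    show "frechet_derivative f (at x) = frechet_derivative g (at x)"
      by (rule frechet_derivative_transform_within_open[OF f assms(1) that Suc.prems(2)])
  qed
  show ?case
    unfolding Ck_on.simps
  proof (intro conjI ballI allI d(1))
    fix v
    have "Ck_on k (\<lambda>x. frechet_derivative f (at x) v) S" using Suc.prems(1) by simp
    then show "Ck_on k (\<lambda>x. frechet_derivative g (at x) v) S"
      by (rule Suc.IH) (simp add: d(2))
  qed
qed

section \<open>A Lie group read in a chart around the unit\<close>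

locale lie_chart =
  fixes G :: "('g::{t2_space, second_countable_topology}) monoid" (structure)
    and \<A> :: "('g, 'e::euclidean_space) chart set" and c :: "('g, 'e) chart"
  assumes lie: "lie_group G \<A>" and c: "c \<in> \<A>" and one_in_chart: "\<one> \<in> fst c"
begin

sublocale group G using lie by (simp add: lie_group_def)

lemma carrier_UNIV [simp]: "carrier G = UNIV" using lie by (simp add: lie_group_def)

lemma continuous_mult: "continuous_on UNIV (\<lambda>(g, h). g \<otimes> h)"
  and continuous_inv: "continuous_on UNIV (\<lambda>g. inv g)"
  using lie by (auto simp: lie_group_def smooth_map_def)

lemma continuous_on_mult [continuous_intros]:
  "continuous_on S f \<Longrightarrow> continuous_on S g \<Longrightarrow> continuous_on S (\<lambda>x. f x \<otimes> g x)"
  using continuous_on_compose2[OF continuous_mult, of S "\<lambda>x. (f x, g x)"] by (simp add: continuous_on_Pair)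

lemma continuous_on_pow [continuous_intros]: "continuous_on S f \<Longrightarrow> continuous_on S (\<lambda>x. f x [^] (n::nat))"
  by (induction n) (auto intro: continuous_intros)

lemma chart_facts:
  assumes "d \<in> \<A>"
  shows "open (fst d)" "open (snd d ` fst d)"
    "continuous_on (fst d) (snd d)" "continuous_on (snd d ` fst d) (chart_inv d)"
    "g \<in> fst d \<Longrightarrow> chart_inv d (snd d g) = g"
    "y \<in> snd d ` fst d \<Longrightarrow> snd d (chart_inv d y) = y" "y \<in> snd d ` fst d \<Longrightarrow> chart_inv d y \<in> fst d"
  using assms lie unfolding lie_group_def smooth_atlas_def homeomorphism_def by auto

text \<open>Smoothness of the product refers to a product chart, whose inverse is specified only on
  its image. Here it becomes smoothness of an explicit function on an explicit open set.\<close>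

lemma mult_in_charts:
  assumes d: "d1 \<in> \<A>" "d2 \<in> \<A>" "d3 \<in> \<A>" and g: "g1 \<in> fst d1" "g2 \<in> fst d2" "g1 \<otimes> g2 \<in> fst d3"
  obtains W where "open W" "(snd d1 g1, snd d2 g2) \<in> W" "W \<subseteq> (snd d1 ` fst d1) \<times> (snd d2 ` fst d2)"
    "\<forall>p\<in>W. chart_inv d1 (fst p) \<otimes> chart_inv d2 (snd p) \<in> fst d3"
    "smooth_on (\<lambda>p. snd d3 (chart_inv d1 (fst p) \<otimes> chart_inv d2 (snd p))) W"
proof -
  define D where "D = (fst d1 \<times> fst d2, map_prod (snd d1) (snd d2))"
  define W where "W = snd D ` (fst D \<inter> (\<lambda>(g, h). g \<otimes> h) -` fst d3)"
  define V where "V = (snd d1 ` fst d1) \<times> (snd d2 ` fst d2)"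
  have inj: "inj_on (snd D) (fst D)"
    unfolding D_def using chart_facts(5)[OF d(1)] chart_facts(5)[OF d(2)]
    by (auto simp: inj_on_def) metis+
  have invD: "chart_inv D p = (chart_inv d1 (fst p), chart_inv d2 (snd p))" if "p \<in> V" for p
    unfolding chart_inv_def[of D]
    by (rule inv_into_f_eq[OF inj])
       (use that chart_facts(6,7)[OF d(1)] chart_facts(6,7)[OF d(2)] in \<open>auto simp: D_def V_def\<close>)
  have W_eq: "W = V \<inter> (\<lambda>p. chart_inv d1 (fst p) \<otimes> chart_inv d2 (snd p)) -` fst d3"
  proof
    show "W \<subseteq> V \<inter> (\<lambda>p. chart_inv d1 (fst p) \<otimes> chart_inv d2 (snd p)) -` fst d3"
      using chart_facts(5)[OF d(1)] chart_facts(5)[OF d(2)] by (auto simp: W_def V_def D_def)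
    show "V \<inter> (\<lambda>p. chart_inv d1 (fst p) \<otimes> chart_inv d2 (snd p)) -` fst d3 \<subseteq> W"
    proof
      fix p assume p: "p \<in> V \<inter> (\<lambda>p. chart_inv d1 (fst p) \<otimes> chart_inv d2 (snd p)) -` fst d3"
      then have "p = snd D (chart_inv d1 (fst p), chart_inv d2 (snd p))"
        using chart_facts(6)[OF d(1)] chart_facts(6)[OF d(2)] by (auto simp: D_def V_def)
      moreover have "(chart_inv d1 (fst p), chart_inv d2 (snd p)) \<in> fst D \<inter> (\<lambda>(g, h). g \<otimes> h) -` fst d3"
        using p chart_facts(7)[OF d(1)] chart_facts(7)[OF d(2)] by (auto simp: D_def V_def)
      ultimately show "p \<in> W" unfolding W_def by blast
    qed
  qed
  have openW: "open W"
    unfolding W_eq V_def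
  proof (rule continuous_open_preimage)
    show "continuous_on (snd d1 ` fst d1 \<times> snd d2 ` fst d2) (\<lambda>p. chart_inv d1 (fst p) \<otimes> chart_inv d2 (snd p))"
      by (intro continuous_intros continuous_on_compose2[OF chart_facts(4)[OF d(1)]]
            continuous_on_compose2[OF chart_facts(4)[OF d(2)]]) auto
  qed (use chart_facts d in \<open>auto intro: open_Times\<close>)
  have "D \<in> prod_atlas \<A> \<A>" using d unfolding prod_atlas_def D_def by blast
  then have "smooth_on (snd d3 \<circ> (\<lambda>(g, h). g \<otimes> h) \<circ> chart_inv D) W"
    using lie d(3) unfolding lie_group_def smooth_map_def W_def by blast
  then have sm: "Ck_on k (snd d3 \<circ> (\<lambda>(g, h). g \<otimes> h) \<circ> chart_inv D) W" for k
    unfolding smooth_on_def by blast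
  have "smooth_on (\<lambda>p. snd d3 (chart_inv d1 (fst p) \<otimes> chart_inv d2 (snd p))) W"
    unfolding smooth_on_def by (intro allI Ck_on_cong[OF openW sm]) (use invD W_eq in auto)
  moreover have "(snd d1 g1, snd d2 g2) \<in> W"
    unfolding W_def by (rule image_eqI[of _ _ "(g1, g2)"]) (use g in \<open>auto simp: D_def\<close>)
  moreover have "W \<subseteq> (snd d1 ` fst d1) \<times> (snd d2 ` fst d2)" using W_eq by (simp add: V_def)
  moreover have "\<forall>p\<in>W. chart_inv d1 (fst p) \<otimes> chart_inv d2 (snd p) \<in> fst d3"
    using W_eq by blast
  ultimately show ?thesis using that openW by blast
qed

definition e :: 'e where "e = snd c \<one>"
definition U :: "'g set" where "U = fst c"
definition V :: "'e set" where "V = snd c ` fst c"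
text \<open>The inverse chart recentred so that the unit has coordinate 0; \<open>\<kappa>\<close>
  is the recentred chart. A translation leaves the identification of the tangent space with
  \<open>'e\<close> unchanged.\<close>

definition \<psi> :: "'e \<Rightarrow> 'g" where "\<psi> z = chart_inv c (e + z)"
definition \<kappa> :: "'g \<Rightarrow> 'e" where "\<kappa> g = snd c g - e"

lemma open_U: "open U" and open_V: "open V" and one_U: "\<one> \<in> U" and e_V: "e \<in> V"
  using chart_facts(1,2)[OF c] one_in_chart by (auto simp: U_def V_def e_def)

lemma psi_chi: "g \<in> U \<Longrightarrow> \<psi> (\<kappa> g) = g" and chi_psi: "e + z \<in> V \<Longrightarrow> \<kappa> (\<psi> z) = z"
  and psi_U: "e + z \<in> V \<Longrightarrow> \<psi> z \<in> U"
  using chart_facts(5-7)[OF c] by (auto simp: U_def V_def \<psi>_def \<kappa>_def)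

lemma chi_one: "\<kappa> \<one> = 0" and psi_zero: "\<psi> 0 = \<one>"
  using chart_facts(5)[OF c one_in_chart] by (auto simp: \<kappa>_def \<psi>_def e_def)

lemma continuous_psi: "continuous_on {z. e + z \<in> V} \<psi>"
  unfolding \<psi>_def V_def
  by (intro continuous_on_compose2[OF chart_facts(4)[OF c]] continuous_intros) auto

definition F :: "'e \<times> 'e \<Rightarrow> 'e" where "F p = snd c (chart_inv c (fst p) \<otimes> chart_inv c (snd p))"
text \<open>The squaring map in the recentred chart, to which \<open>doubling_map\<close> will be
  applied.\<close>

definition \<sigma> :: "'e \<Rightarrow> 'e" where "\<sigma> z = \<kappa> (\<psi> z \<otimes> \<psi> z)"

lemma F_smooth:
  obtains W where "open W" "(e, e) \<in> W" "W \<subseteq> V \<times> V" "smooth_on F W"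
    "\<forall>p\<in>W. chart_inv c (fst p) \<otimes> chart_inv c (snd p) \<in> U"
proof -
  have "\<one> \<otimes> \<one> \<in> fst c" using one_in_chart by simp
  then obtain W where W: "open W" "(snd c \<one>, snd c \<one>) \<in> W" "W \<subseteq> (snd c ` fst c) \<times> (snd c ` fst c)"
    "\<forall>p\<in>W. chart_inv c (fst p) \<otimes> chart_inv c (snd p) \<in> fst c"
    "smooth_on (\<lambda>p. snd c (chart_inv c (fst p) \<otimes> chart_inv c (snd p))) W"
    by (rule mult_in_charts[OF c c c one_in_chart one_in_chart])
  show ?thesis
    by (rule that[of W]) (use W in \<open>simp_all add: F_def[abs_def] e_def U_def V_def\<close>)
qed

text \<open>Multiplication by the unit, on either side, is the identity; this gives the two partial
  derivatives, and differentiability does the rest.\<close>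

lemma F_has_derivative: "(F has_derivative (\<lambda>(v, w). v + w)) (at (e, e))"
proof -
  obtain W where W: "open W" "(e, e) \<in> W" "smooth_on F W"
    by (rule F_smooth)
  have "Ck_on 1 F W" using W(3) by (auto simp: smooth_on_def)
  then have "F differentiable (at (e, e))" using W(2) by simp
  then obtain L where L: "(F has_derivative L) (at (e, e))" by (auto simp: differentiable_def)
  interpret L: bounded_linear L using L by (rule has_derivative_bounded_linear)
  have "((\<lambda>x. F (x, e)) has_derivative (\<lambda>v. L (v, 0))) (at e)"
    by (rule has_derivative_compose[where f = "\<lambda>x. (x, e)" and g = F and g' = L, OF _ L]) (auto intro!: derivative_eq_intros)
  moreover have "((\<lambda>x. F (x, e)) has_derivative (\<lambda>v. v)) (at e)"
    by (rule has_derivative_transform_within_open[OF has_derivative_ident open_V e_V])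
       (use chart_facts(5-7)[OF c] one_in_chart in \<open>auto simp: F_def V_def e_def\<close>)
  ultimately have 1: "(\<lambda>v. L (v, 0)) = (\<lambda>v. v)" by (rule has_derivative_unique)
  have "((\<lambda>x. F (e, x)) has_derivative (\<lambda>v. L (0, v))) (at e)"
    by (rule has_derivative_compose[where f = "\<lambda>x. (e, x)" and g = F and g' = L, OF _ L]) (auto intro!: derivative_eq_intros)
  moreover have "((\<lambda>x. F (e, x)) has_derivative (\<lambda>v. v)) (at e)"
    by (rule has_derivative_transform_within_open[OF has_derivative_ident open_V e_V])
       (use chart_facts(5-7)[OF c] one_in_chart in \<open>auto simp: F_def V_def e_def\<close>)
  ultimately have 2: "(\<lambda>v. L (0, v)) = (\<lambda>v. v)" by (rule has_derivative_unique)
  have "L (v, w) = v + w" for v w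
    using L.add[of "(v, 0)" "(0, w)"] fun_cong[OF 1, of v] fun_cong[OF 2, of w] by simp
  then have "L = (\<lambda>(v, w). v + w)" by auto
  with L show ?thesis by simp
qed

text \<open>The derivative \<open>A z\<close> of \<open>\<sigma>\<close> is twice the identity at 0,
  and \<open>A z b\<close> is differentiable at 0 for every fixed \<open>b\<close>. Expanding along
  the basis makes the resulting linear bound uniform in the direction, and the mean value inequality
  on a ball turns it into the estimate of \<open>doubling_map\<close>.\<close>

lemma doubling:
  obtains C r where "doubling_map \<sigma> C r" "\<And>z. norm z < r \<Longrightarrow> e + z \<in> V" "\<And>z. norm z < r \<Longrightarrow> \<psi> z \<otimes> \<psi> z \<in> U"
proof -
  obtain W where W: "open W" "(e, e) \<in> W" "W \<subseteq> V \<times> V" "smooth_on F W"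
    "\<forall>p\<in>W. chart_inv c (fst p) \<otimes> chart_inv c (snd p) \<in> U"
    by (rule F_smooth)
  have "Ck_on (Suc (Suc 0)) F W" using W(4) by (auto simp: smooth_on_def)
  then have D: "F differentiable (at p)" "(\<lambda>q. frechet_derivative F (at q) v) differentiable (at p)" if "p \<in> W" for p v
    using that by (cases v; simp)+
  define A where "A z v = frechet_derivative F (at (e + z, e + z)) (v, v)" for z v
  have \<sigma>_F: "\<sigma> z = F (e + z, e + z) - e" for z by (simp add: \<sigma>_def F_def \<kappa>_def \<psi>_def)
  have "open {z. (e + z, e + z) \<in> W}"
  proof -
    have "continuous_on UNIV (\<lambda>z. (e + z, e + z))" by (intro continuous_intros)
    from open_vimage[OF W(1) this] show ?thesis by (simp add: vimage_def)
  qed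
  moreover have "0 \<in> {z. (e + z, e + z) \<in> W}" using W(2) by simp
  ultimately obtain r0 where r0: "r0 > 0" "ball 0 r0 \<subseteq> {z. (e + z, e + z) \<in> W}" by (meson openE)
  have \<sigma>': "(\<sigma> has_derivative A z) (at z)" if "z \<in> ball 0 r0" for z
  proof -
    have p: "(e + z, e + z) \<in> W" using r0 that by auto
    have "(F has_derivative frechet_derivative F (at (e + z, e + z))) (at ((\<lambda>z. (e + z, e + z)) z))"
      using D(1)[OF p] by (simp add: frechet_derivative_works)
    then have "((\<lambda>z. F (e + z, e + z)) has_derivative (\<lambda>v. frechet_derivative F (at (e + z, e + z)) (v, v))) (at z)"
      by (rule has_derivative_compose[rotated]) (auto intro!: derivative_eq_intros)
    then show ?thesis unfolding \<sigma>_F[abs_def] A_def by (auto intro!: derivative_eq_intros)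
  qed
  have A0: "A 0 v = 2 *\<^sub>R v" for v
  proof -
    have "frechet_derivative F (at (e, e)) = (\<lambda>(v, w). v + w)"
      using F_has_derivative frechet_derivative_at by metis
    then show ?thesis by (simp add: A_def scaleR_2)
  qed
  have "\<exists>K d. K > 0 \<and> d > 0 \<and> (\<forall>z. norm z < d \<longrightarrow> norm (A z b - A 0 b) \<le> K * norm z)" for b
  proof -
    have "(\<lambda>q. frechet_derivative F (at q) (b, b)) differentiable (at ((\<lambda>z. (e + z, e + z)) 0))"
      using D(2)[OF W(2)] by simp
    moreover have "(\<lambda>z. (e + z, e + z)) differentiable (at 0)"
      unfolding differentiable_def by (rule exI) (auto intro!: derivative_eq_intros)
    ultimately have "((\<lambda>q. frechet_derivative F (at q) (b, b)) \<circ> (\<lambda>z. (e + z, e + z))) differentiable (at 0)"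
      by (intro differentiable_chain_at)
    then have "(\<lambda>z. A z b) differentiable (at 0)"
      by (simp add: A_def o_def)
    from differentiable_pointwise_lipschitz[OF this] show ?thesis by (metis diff_zero)
  qed
  then obtain K d where Kd: "\<And>b. K b > 0" "\<And>b. d b > 0" "\<And>b z. norm z < d b \<Longrightarrow> norm (A z b - A 0 b) \<le> K b * norm z"
    by metis
  define r where "r = Min (insert r0 (d ` Basis))"
  define C where "C = (\<Sum>b\<in>Basis. K b)"
  have r: "r > 0" "r \<le> r0" "\<And>b. b \<in> Basis \<Longrightarrow> r \<le> d b"
  proof -
    have fin: "finite (insert r0 (d ` Basis))" by simp
    show "r > 0" unfolding r_def using r0 Kd(2) by (subst Min_gr_iff) auto
    show "r \<le> r0" "\<And>b. b \<in> Basis \<Longrightarrow> r \<le> d b" unfolding r_def by (auto intro!: Min_le simp del: Min_insert)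
  qed
  have C: "C > 0" unfolding C_def using Kd(1) by (intro sum_pos) auto
  have linA: "linear (A z)" if "norm z < r" for z
    using \<sigma>'[of z] that r(2) by (auto intro!: has_derivative_linear)
  have Abound: "norm (A z v - 2 *\<^sub>R v) \<le> C * norm z * norm v" if z: "norm z < r" for z v
  proof -
    have lin: "linear (\<lambda>v. A z v - 2 *\<^sub>R v)"
      using linA[OF z] by (intro linear_compose_sub linear_scale_self) auto
    have "A z v - 2 *\<^sub>R v = (\<lambda>v. A z v - 2 *\<^sub>R v) (\<Sum>b\<in>Basis. (v \<bullet> b) *\<^sub>R b)"
      by (simp only: euclidean_representation)
    also have "\<dots> = (\<Sum>b\<in>Basis. (v \<bullet> b) *\<^sub>R (A z b - 2 *\<^sub>R b))"
      by (simp only: linear_sum[OF lin] linear_scale[OF lin])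
    also have "norm \<dots> \<le> (\<Sum>b\<in>Basis. norm v * (K b * norm z))"
    proof (rule sum_norm_le)
      fix b :: 'e assume b: "b \<in> Basis"
      have "norm (A z b - 2 *\<^sub>R b) \<le> K b * norm z" using Kd(3)[of z b] z r(3)[OF b] A0 by simp
      then show "norm ((v \<bullet> b) *\<^sub>R (A z b - 2 *\<^sub>R b)) \<le> norm v * (K b * norm z)"
        using Basis_le_norm[OF b, of v] by (simp add: mult_mono)
    qed
    also have "\<dots> = C * norm z * norm v" by (simp add: C_def sum_distrib_left sum_distrib_right mult_ac)
    finally show ?thesis .
  qed
  have dm: "doubling_map \<sigma> C r"
  proof
    show "\<sigma> 0 = 0" using one_in_chart by (simp add: \<sigma>_def psi_zero chi_one)
    fix x y :: 'e assume xy: "norm x < r" "norm y < r"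
    define m where "m = max (norm x) (norm y)"
    have m: "m < r" using xy by (simp add: m_def)
    have "norm ((\<sigma> x - 2 *\<^sub>R x) - (\<sigma> y - 2 *\<^sub>R y)) \<le> C * m * norm (x - y)"
    proof (rule differentiable_bound[of "cball 0 m" "\<lambda>z. \<sigma> z - 2 *\<^sub>R z" "\<lambda>z v. A z v - 2 *\<^sub>R v"])
      fix z :: 'e assume "z \<in> cball 0 m"
      then have z: "norm z \<le> m" "norm z < r" using m by auto
      then have "(\<sigma> has_derivative A z) (at z within cball 0 m)"
        using \<sigma>'[of z] r(2) by (auto intro: has_derivative_at_withinI)
      then show "((\<lambda>z. \<sigma> z - 2 *\<^sub>R z) has_derivative (\<lambda>v. A z v - 2 *\<^sub>R v)) (at z within cball 0 m)"
        by (auto intro!: derivative_eq_intros)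
      show "onorm (\<lambda>v. A z v - 2 *\<^sub>R v) \<le> C * m"
      proof (rule onorm_bound)
        fix v
        have "norm (A z v - 2 *\<^sub>R v) \<le> C * norm z * norm v" by (rule Abound[OF z(2)])
        also have "\<dots> \<le> C * m * norm v" using z C by (intro mult_right_mono mult_left_mono) auto
        finally show "norm (A z v - 2 *\<^sub>R v) \<le> C * m * norm v" .
      qed (use C in \<open>simp add: m_def le_max_iff_disj\<close>)
    qed (auto simp: m_def)
    then show "norm (\<sigma> x - \<sigma> y - 2 *\<^sub>R (x - y)) \<le> C * max (norm x) (norm y) * norm (x - y)"
      by (simp add: m_def algebra_simps)
  qed (use C r in auto)
  show ?thesis
  proof (rule that[OF dm])
    fix z :: 'e assume "norm z < r"
    then have "z \<in> ball 0 r0" using r(2) by simp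
    then have "(e + z, e + z) \<in> W" using r0(2) by blast
    then show "e + z \<in> V" "\<psi> z \<otimes> \<psi> z \<in> U" using W(3) W(5) by (auto simp: \<psi>_def)
  qed
qed

end


section \<open>Velocities and sequences of iterated square roots\<close>

context lie_chart
begin

text \<open>The sequence tends to the unit with velocity \<open>Z\<close> on the scale
  \<open>1 / 2 ^ n\<close>. Products add velocities, inversion negates them, differentiable maps act
  by their differential.\<close>

definition tang :: "(nat \<Rightarrow> 'g) \<Rightarrow> 'e \<Rightarrow> bool" where
  "tang x Z \<longleftrightarrow> (\<forall>\<^sub>F n in sequentially. x n \<in> U) \<and> (\<lambda>n. 2 ^ n *\<^sub>R \<kappa> (x n)) \<longlonglongrightarrow> Z"

text \<open>Each term is the square of the next one. The sequence to have in mind is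
  \<open>exp (Z / 2 ^ n)\<close>, whose first term is the exponential of \<open>Z\<close>.\<close>

definition root_seq :: "(nat \<Rightarrow> 'g) \<Rightarrow> 'e \<Rightarrow> bool" where
  "root_seq x Z \<longleftrightarrow> (\<forall>n. x (Suc n) \<otimes> x (Suc n) = x n) \<and> tang x Z"

lemma scaled_null:
  fixes a :: "nat \<Rightarrow> 'a::real_normed_vector"
  assumes "(\<lambda>n. 2 ^ n *\<^sub>R a n) \<longlonglongrightarrow> Z" shows "a \<longlonglongrightarrow> 0"
proof -
  have "(\<lambda>n. (1 / 2) ^ n *\<^sub>R (2 ^ n *\<^sub>R a n)) \<longlonglongrightarrow> 0 *\<^sub>R Z"
    by (intro tendsto_scaleR assms LIMSEQ_power_zero) simp
  then show ?thesis by (simp add: power_one_over)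
qed

lemma tang_eventually: "tang x Z \<Longrightarrow> \<forall>\<^sub>F n in sequentially. x n \<in> U"
  by (simp add: tang_def)

lemma tang_chart_inv:
  assumes "tang x Z" shows "\<forall>\<^sub>F n in sequentially. chart_inv c (e + \<kappa> (x n)) = x n"
  using tang_eventually[OF assms]
  by eventually_elim (simp add: psi_chi[unfolded \<psi>_def])

lemma tang_limit: assumes "tang x Z" shows "x \<longlonglongrightarrow> \<one>"
proof -
  have "(\<lambda>n. \<kappa> (x n)) \<longlonglongrightarrow> 0" using assms by (auto simp: tang_def intro: scaled_null)
  moreover have "isCont \<psi> 0"
  proof -
    have "{z. e + z \<in> V} = (\<lambda>z. e + z) -` V" by auto
    moreover have "open ((\<lambda>z. e + z) -` V)"
      by (rule open_vimage[OF open_V]) (intro continuous_intros)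
    ultimately show ?thesis
      using continuous_psi e_V by (auto simp: continuous_on_eq_continuous_at)
  qed
  ultimately have "(\<lambda>n. \<psi> (\<kappa> (x n))) \<longlonglongrightarrow> \<psi> 0" using isCont_tendsto_compose by blast
  moreover have "\<forall>\<^sub>F n in sequentially. \<psi> (\<kappa> (x n)) = x n"
    using tang_eventually[OF assms] by eventually_elim (rule psi_chi)
  ultimately show ?thesis unfolding psi_zero by (rule Lim_transform_eventually)
qed

lemma tang_map:
  assumes f: "continuous_on UNIV f" "f \<one> = \<one>"
    and L: "((\<lambda>z. snd c (f (chart_inv c z))) has_derivative L) (at e)" and x: "tang x Z"
  shows "tang (\<lambda>n. f (x n)) (L Z)"
proof -
  have "(\<lambda>n. f (x n)) \<longlonglongrightarrow> f \<one>"
    by (rule isCont_tendsto_compose[OF _ tang_limit[OF x]]) (use f(1) in \<open>simp add: continuous_on_eq_continuous_at\<close>)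
  then have "\<forall>\<^sub>F n in sequentially. f (x n) \<in> U"
    by (rule topological_tendstoD[OF _ open_U]) (simp add: f(2) one_U)
  moreover have "(\<lambda>n. 2 ^ n *\<^sub>R \<kappa> (f (x n))) \<longlonglongrightarrow> L Z"
  proof (rule Lim_transform_eventually)
    show "(\<lambda>n. 2 ^ n *\<^sub>R (snd c (f (chart_inv c (e + \<kappa> (x n)))) - snd c (f (chart_inv c e)))) \<longlonglongrightarrow> L Z"
      by (rule tendsto_scaled_difference[OF L]) (use x in \<open>simp add: tang_def\<close>)
    have fe: "f (chart_inv c e) = \<one>" using psi_zero f(2) by (simp add: \<psi>_def)
    show "\<forall>\<^sub>F n in sequentially. 2 ^ n *\<^sub>R (snd c (f (chart_inv c (e + \<kappa> (x n)))) - snd c (f (chart_inv c e))) =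
        2 ^ n *\<^sub>R \<kappa> (f (x n))"
      using tang_chart_inv[OF x] by eventually_elim (simp add: fe \<kappa>_def e_def[symmetric])
  qed
  ultimately show ?thesis by (simp add: tang_def)
qed

lemma tang_one: "tang (\<lambda>_. \<one>) 0"
  by (simp add: tang_def one_U chi_one)

lemma tang_mult:
  assumes x: "tang x Z" and y: "tang y W"
  shows "tang (\<lambda>n. x n \<otimes> y n) (Z + W)"
proof -
  have "(\<lambda>n. (x n, y n)) \<longlonglongrightarrow> (\<one>, \<one>)" using tang_limit[OF x] tang_limit[OF y] by (rule tendsto_Pair)
  then have "(\<lambda>n. (\<lambda>(g, h). g \<otimes> h) (x n, y n)) \<longlonglongrightarrow> (\<lambda>(g, h). g \<otimes> h) (\<one>, \<one>)"
    by (rule isCont_tendsto_compose[rotated]) (use continuous_mult in \<open>simp add: continuous_on_eq_continuous_at\<close>)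
  then have "(\<lambda>n. x n \<otimes> y n) \<longlonglongrightarrow> \<one>" by simp
  then have "\<forall>\<^sub>F n in sequentially. x n \<otimes> y n \<in> U"
    by (rule topological_tendstoD[OF _ open_U one_U])
  moreover have "(\<lambda>n. 2 ^ n *\<^sub>R \<kappa> (x n \<otimes> y n)) \<longlonglongrightarrow> Z + W"
  proof (rule Lim_transform_eventually)
    have "(\<lambda>n. 2 ^ n *\<^sub>R (\<kappa> (x n), \<kappa> (y n))) \<longlonglongrightarrow> (Z, W)"
      using x y by (auto simp: tang_def intro!: tendsto_Pair)
    from tendsto_scaled_difference[OF F_has_derivative this]
    show "(\<lambda>n. 2 ^ n *\<^sub>R (F ((e, e) + (\<kappa> (x n), \<kappa> (y n))) - F (e, e))) \<longlonglongrightarrow> Z + W" by simp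
    have Fe: "F (e, e) = e" using psi_zero by (simp add: F_def \<psi>_def e_def)
    show "\<forall>\<^sub>F n in sequentially. 2 ^ n *\<^sub>R (F ((e, e) + (\<kappa> (x n), \<kappa> (y n))) - F (e, e)) =
        2 ^ n *\<^sub>R \<kappa> (x n \<otimes> y n)"
      using tang_chart_inv[OF x] tang_chart_inv[OF y] unfolding Fe by eventually_elim (simp add: F_def \<kappa>_def)
  qed
  ultimately show ?thesis by (simp add: tang_def)
qed

lemma tang_unique: "tang x Z \<Longrightarrow> tang x W \<Longrightarrow> Z = W"
  unfolding tang_def using LIMSEQ_unique by blast

text \<open>Smoothness provides some differential for the inversion; multiplying by
  \<open>x n\<close> gives the constant unit, with velocity 0, which identifies it.\<close>

lemma tang_inv: assumes x: "tang x Z" shows "tang (\<lambda>n. inv (x n)) (- Z)"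
proof -
  have "smooth_on (snd c \<circ> (\<lambda>g. inv g) \<circ> chart_inv c) (snd c ` (fst c \<inter> (\<lambda>g. inv g) -` fst c))"
    using lie c unfolding lie_group_def smooth_map_def by blast
  then have "Ck_on (Suc 0) (snd c \<circ> (\<lambda>g. inv g) \<circ> chart_inv c) (snd c ` (fst c \<inter> (\<lambda>g. inv g) -` fst c))"
    unfolding smooth_on_def by blast
  moreover have "e \<in> snd c ` (fst c \<inter> (\<lambda>g. inv g) -` fst c)" using one_in_chart by (auto simp: e_def)
  ultimately have "(snd c \<circ> (\<lambda>g. inv g) \<circ> chart_inv c) differentiable (at e)"
    unfolding Ck_on.simps by blast
  then obtain L where L0: "((\<lambda>z. snd c (inv (chart_inv c z))) has_derivative L) (at e)"
    by (auto simp: differentiable_def o_def)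
  have L: "tang (\<lambda>n. inv (x n)) (L Z)" by (rule tang_map[OF continuous_inv _ L0 x]) simp
  have "tang (\<lambda>n. x n \<otimes> inv (x n)) (Z + L Z)" by (rule tang_mult[OF x L])
  then have "tang (\<lambda>_. \<one>) (Z + L Z)" by simp
  then have "Z + L Z = 0" using tang_one by (rule tang_unique)
  then have "L Z = - Z" by (simp add: add_eq_0_iff)
  with L show ?thesis by simp
qed

lemma tang_pow: "tang x Z \<Longrightarrow> tang (\<lambda>n. x n [^] (k::nat)) (real k *\<^sub>R Z)"
proof (induction k)
  case (Suc k)
  from tang_mult[OF Suc.IH[OF Suc.prems] Suc.prems] show ?case by (simp add: scaleR_add_left add.commute)
qed (simp add: tang_one)

text \<open>\<open>root_unique\<close> gives equality for all large indices, and squaring carries it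
  down to every index. This is the uniqueness principle behind all identities for the
  exponential.\<close>

lemma root_seq_unique:
  assumes x: "root_seq x Z" and y: "root_seq y Z"
  shows "x n = y n"
proof -
  obtain C r where Cr: "doubling_map \<sigma> C r" "\<And>z. norm z < r \<Longrightarrow> e + z \<in> V" "\<And>z. norm z < r \<Longrightarrow> \<psi> z \<otimes> \<psi> z \<in> U"
    using doubling by blast
  interpret doubling_map \<sigma> C r by fact
  have step: "\<forall>\<^sub>F n in sequentially. x n \<in> U \<and> x (Suc n) \<in> U \<and> \<sigma> (\<kappa> (x (Suc n))) = \<kappa> (x n)"
    if x: "root_seq x Z" for x
  proof -
    have "\<forall>\<^sub>F n in sequentially. x n \<in> U" using x by (simp add: root_seq_def tang_def)
    moreover then have "\<forall>\<^sub>F n in sequentially. x (Suc n) \<in> U" 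
      using eventually_sequentially_Suc[of "\<lambda>n. x n \<in> U"] by simp
    ultimately show ?thesis
      by eventually_elim (use x in \<open>simp add: \<sigma>_def psi_chi root_seq_def\<close>)
  qed
  obtain N where N0: "\<forall>n\<ge>N. (x n \<in> U \<and> x (Suc n) \<in> U \<and> \<sigma> (\<kappa> (x (Suc n))) = \<kappa> (x n)) \<and>
      (y n \<in> U \<and> y (Suc n) \<in> U \<and> \<sigma> (\<kappa> (y (Suc n))) = \<kappa> (y n))"
    using eventually_conj[OF step[OF x] step[OF y]] unfolding eventually_sequentially by (rule exE)
  then have N: "n \<ge> N \<Longrightarrow> x n \<in> U \<and> \<sigma> (\<kappa> (x (Suc n))) = \<kappa> (x n)"
    "n \<ge> N \<Longrightarrow> y n \<in> U \<and> \<sigma> (\<kappa> (y (Suc n))) = \<kappa> (y n)" for n by auto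
  have "\<forall>\<^sub>F n in sequentially. \<kappa> (x n) = \<kappa> (y n)"
    by (rule root_unique[of N]) (use N x y in \<open>auto simp: root_seq_def tang_def\<close>)
  then obtain M where M: "\<forall>n\<ge>M. \<kappa> (x n) = \<kappa> (y n)" unfolding eventually_sequentially by (rule exE)
  have eq: "x k = y k" if "k \<ge> max M N" for k
  proof -
    have "x k = \<psi> (\<kappa> (x k))" using N(1)[of k] that psi_chi by simp
    also have "\<dots> = \<psi> (\<kappa> (y k))" using M that by simp
    also have "\<dots> = y k" using N(2)[of k] that psi_chi by simp
    finally show ?thesis .
  qed
  have "x (max M N - k) = y (max M N - k)" for k
  proof (induction k)
    case (Suc k)
    show ?case
    proof (cases "k < max M N")
      case True
      then have S: "Suc (max M N - Suc k) = max M N - k" by simp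
      have "x (max M N - Suc k) = x (max M N - k) \<otimes> x (max M N - k)"
        "y (max M N - Suc k) = y (max M N - k) \<otimes> y (max M N - k)"
        using x y S unfolding root_seq_def by metis+
      then show ?thesis using Suc by simp
    next
      case False
      then have "max M N - Suc k = max M N - k" by arith
      then show ?thesis using Suc by (simp only:)
    qed
  qed (simp add: eq)
  note down = this
  show ?thesis
  proof (cases "n \<le> max M N")
    case True
    then have "max M N - (max M N - n) = n" by simp
    with down[of "max M N - n"] show ?thesis by (simp only:)
  next
    case False
    then show ?thesis by (intro eq) linarith
  qed
qed

end


section \<open>Construction of the exponential\<close>

context lie_chart
begin

lemma local_exponential:
  obtains \<rho> \<epsilon> C where "\<rho> > 0" "C > 0" "continuous_on (cball 0 \<rho>) \<epsilon>"
    "\<And>z. norm z \<le> \<rho> \<Longrightarrow> \<epsilon> z \<in> U" "\<And>z. norm z \<le> \<rho> \<Longrightarrow> norm (\<kappa> (\<epsilon> z) - z) \<le> C * (norm z)\<^sup>2"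
    "\<And>z. norm z \<le> \<rho> \<Longrightarrow> \<epsilon> (z /\<^sub>R 2) \<otimes> \<epsilon> (z /\<^sub>R 2) = \<epsilon> z"
proof -
  obtain C r where Cr: "doubling_map \<sigma> C r" "\<And>z. norm z < r \<Longrightarrow> e + z \<in> V" "\<And>z. norm z < r \<Longrightarrow> \<psi> z \<otimes> \<psi> z \<in> U"
    using doubling by blast
  interpret doubling_map \<sigma> C r by fact
  obtain E where E: "continuous_on (cball 0 \<rho>) E" "\<And>z. norm z \<le> \<rho> \<Longrightarrow> norm (E z) < r"
    "\<And>z. norm z \<le> \<rho> \<Longrightarrow> E z = \<sigma> (E (z /\<^sub>R 2))"
    "\<And>z. norm z \<le> \<rho> \<Longrightarrow> norm (E z - z) \<le> C * (norm z)\<^sup>2"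
    by (rule linearization_exists) blast
  show ?thesis
  proof (rule that[of \<rho> C "\<lambda>z. \<psi> (E z)"])
    show "continuous_on (cball 0 \<rho>) (\<lambda>z. \<psi> (E z))"
      by (rule continuous_on_compose2[OF continuous_psi E(1)]) (use E(2) Cr(2) in auto)
    fix z :: 'e assume z: "norm z \<le> \<rho>"
    then have z2: "norm (z /\<^sub>R 2) \<le> \<rho>" using rho(1) by simp
    show "\<psi> (E z) \<in> U" using E(2)[OF z] Cr(2) psi_U by blast
    show "norm (\<kappa> (\<psi> (E z)) - z) \<le> C * (norm z)\<^sup>2" using E(2)[OF z] E(4)[OF z] Cr(2) chi_psi by simp
    show "\<psi> (E (z /\<^sub>R 2)) \<otimes> \<psi> (E (z /\<^sub>R 2)) = \<psi> (E z)"
      using E(3)[OF z] psi_chi[OF Cr(3)[OF E(2)[OF z2]]] by (simp add: \<sigma>_def)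
  qed (use rho C in auto)
qed

text \<open>A large \<open>Z\<close> is halved until the local exponential applies, and the result
  is squared back. The number of halvings is irrelevant by \<open>pow_eq\<close>, hence the
  arbitrary choice by \<open>SOME\<close>; on a fixed ball one number serves for all
  \<open>Z\<close>, which gives continuity.\<close>

lemma exponential:
  obtains Exp where "continuous_on UNIV Exp" "\<And>Z. root_seq (\<lambda>n. Exp (Z /\<^sub>R 2 ^ n)) Z"
    "\<And>Z. ((\<lambda>t. snd c (Exp (t *\<^sub>R Z))) has_vector_derivative Z) (at 0)"
proof -
  obtain \<rho> \<epsilon> C where \<rho>: "\<rho> > 0" and C: "C > 0" and cont: "continuous_on (cball 0 \<rho>) \<epsilon>"
    and \<epsilon>: "\<And>z. norm z \<le> \<rho> \<Longrightarrow> \<epsilon> z \<in> U" "\<And>z. norm z \<le> \<rho> \<Longrightarrow> norm (\<kappa> (\<epsilon> z) - z) \<le> C * (norm z)\<^sup>2"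
    "\<And>z. norm z \<le> \<rho> \<Longrightarrow> \<epsilon> (z /\<^sub>R 2) \<otimes> \<epsilon> (z /\<^sub>R 2) = \<epsilon> z"
    by (rule local_exponential) blast
  define Exp where "Exp Z = \<epsilon> (Z /\<^sub>R 2 ^ (SOME n. norm Z / 2 ^ n \<le> \<rho>)) [^] ((2::nat) ^ (SOME n. norm Z / 2 ^ n \<le> \<rho>))" for Z
  have small: "norm (z /\<^sub>R 2 ^ n) = norm z / 2 ^ n" for n and z :: 'e by (simp add: field_simps)
  have ex: "\<exists>n. norm Z / 2 ^ n \<le> \<rho>" for Z :: 'e
  proof -
    have "(\<lambda>n. norm Z / 2 ^ n) \<longlonglongrightarrow> 0" by real_asymp
    then have "\<forall>\<^sub>F n in sequentially. norm Z / 2 ^ n < \<rho>" using \<rho> by (auto dest: order_tendstoD(2))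
    then obtain N where "\<forall>n\<ge>N. norm Z / 2 ^ n < \<rho>" unfolding eventually_sequentially by (rule exE)
    then have "norm Z / 2 ^ N \<le> \<rho>" by (simp add: less_imp_le)
    then show ?thesis by (rule exI)
  qed
  have pow_eq: "\<epsilon> (Z /\<^sub>R 2 ^ (n + k)) [^] ((2::nat) ^ (n + k)) = \<epsilon> (Z /\<^sub>R 2 ^ n) [^] ((2::nat) ^ n)"
    if "norm Z / 2 ^ n \<le> \<rho>" for Z n k
  proof (induction k)
    case (Suc k)
    have "norm Z / 2 ^ (n + k) \<le> norm Z / 2 ^ n" by (intro divide_left_mono) (auto simp: power_add)
    then have "norm (Z /\<^sub>R 2 ^ (n + k)) \<le> \<rho>" using that unfolding small by linarith
    from \<epsilon>(3)[OF this] have sq: "\<epsilon> (Z /\<^sub>R 2 ^ (n + Suc k)) \<otimes> \<epsilon> (Z /\<^sub>R 2 ^ (n + Suc k)) = \<epsilon> (Z /\<^sub>R 2 ^ (n + k))"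
      by (simp add: mult.commute)
    have "\<epsilon> (Z /\<^sub>R 2 ^ (n + Suc k)) [^] ((2::nat) ^ (n + Suc k)) =
        (\<epsilon> (Z /\<^sub>R 2 ^ (n + Suc k)) [^] (2::nat)) [^] ((2::nat) ^ (n + k))"
      by (simp only: nat_pow_pow carrier_UNIV UNIV_I add_Suc_right power_Suc)
    also have "\<epsilon> (Z /\<^sub>R 2 ^ (n + Suc k)) [^] (2::nat) = \<epsilon> (Z /\<^sub>R 2 ^ (n + k))"
      using sq by (simp only: numeral_2_eq_2 nat_pow_Suc nat_pow_0 l_one carrier_UNIV UNIV_I)
    finally show ?case using Suc by (simp only:)
  qed simp
  have Exp_eq: "Exp Z = \<epsilon> (Z /\<^sub>R 2 ^ n) [^] ((2::nat) ^ n)" if n: "norm Z / 2 ^ n \<le> \<rho>" for Z n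
  proof -
    define m where "m = (SOME n. norm Z / 2 ^ n \<le> \<rho>)"
    have m: "norm Z / 2 ^ m \<le> \<rho>" unfolding m_def by (rule someI_ex[OF ex])
    show ?thesis
      unfolding Exp_def m_def[symmetric]
      using pow_eq[OF n, of "m - n"] pow_eq[OF m, of "n - m"] by (cases "m \<le> n") auto
  qed
  have Exp_small: "Exp Z = \<epsilon> Z" if "norm Z \<le> \<rho>" for Z using Exp_eq[of Z 0] that by simp
  have double: "Exp (Z /\<^sub>R 2) \<otimes> Exp (Z /\<^sub>R 2) = Exp Z" for Z
  proof -
    obtain n where n: "norm Z / 2 ^ n \<le> \<rho>" using ex by blast
    have "norm (Z /\<^sub>R 2) / 2 ^ n \<le> norm Z / 2 ^ n" by (intro divide_right_mono) auto
    then have n': "norm (Z /\<^sub>R 2) / 2 ^ n \<le> \<rho>" using n by linarith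
    have "norm Z / 2 ^ Suc n \<le> \<rho>"
    proof -
      have "norm Z / 2 ^ Suc n \<le> norm Z / 2 ^ n" by (intro divide_left_mono) auto
      then show ?thesis using n by linarith
    qed
    then have "Exp Z = \<epsilon> (Z /\<^sub>R 2 ^ Suc n) [^] ((2::nat) ^ n + 2 ^ n)"
      using Exp_eq[of Z "Suc n"] by (simp only: power_Suc mult_2)
    also have "\<dots> = \<epsilon> (Z /\<^sub>R 2 ^ Suc n) [^] ((2::nat) ^ n) \<otimes> \<epsilon> (Z /\<^sub>R 2 ^ Suc n) [^] ((2::nat) ^ n)"
      by (simp only: nat_pow_mult carrier_UNIV UNIV_I)
    also have "Z /\<^sub>R 2 ^ Suc n = (Z /\<^sub>R 2) /\<^sub>R 2 ^ n" by (simp add: mult.commute)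
    finally show ?thesis using Exp_eq[OF n'] by (simp only:)
  qed
  have tendsto: "tang (\<lambda>n. Exp (Z /\<^sub>R 2 ^ n)) Z" for Z
  proof -
    obtain N where N: "norm Z / 2 ^ N \<le> \<rho>" using ex by blast
    have sm: "norm (Z /\<^sub>R 2 ^ n) \<le> \<rho>" if "n \<ge> N" for n
    proof -
      have "norm Z / 2 ^ n \<le> norm Z / 2 ^ N" using that by (intro divide_left_mono) auto
      then show ?thesis using N unfolding small by linarith
    qed
    have "(\<lambda>n. 2 ^ n *\<^sub>R \<kappa> (Exp (Z /\<^sub>R 2 ^ n)) - Z) \<longlonglongrightarrow> 0"
    proof (rule Lim_null_comparison)
      show "\<forall>\<^sub>F n in sequentially. norm (2 ^ n *\<^sub>R \<kappa> (Exp (Z /\<^sub>R 2 ^ n)) - Z) \<le> C * (norm Z)\<^sup>2 / 2 ^ n"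
        unfolding eventually_sequentially
      proof (intro exI[of _ N] allI impI)
        fix n assume n: "N \<le> n"
        have "2 ^ n *\<^sub>R \<kappa> (Exp (Z /\<^sub>R 2 ^ n)) - Z = 2 ^ n *\<^sub>R (\<kappa> (\<epsilon> (Z /\<^sub>R 2 ^ n)) - Z /\<^sub>R 2 ^ n)"
          by (simp add: Exp_small[OF sm[OF n]] scaleR_diff_right)
        also have "norm \<dots> \<le> 2 ^ n * (C * (norm (Z /\<^sub>R 2 ^ n))\<^sup>2)"
          using \<epsilon>(2)[OF sm[OF n]] by simp
        also have "\<dots> = C * (norm Z)\<^sup>2 / 2 ^ n" unfolding small by (simp add: power2_eq_square field_simps)
        finally show "norm (2 ^ n *\<^sub>R \<kappa> (Exp (Z /\<^sub>R 2 ^ n)) - Z) \<le> C * (norm Z)\<^sup>2 / 2 ^ n" .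
      qed
      show "(\<lambda>n. C * (norm Z)\<^sup>2 / 2 ^ n) \<longlonglongrightarrow> 0" by real_asymp
    qed
    then have "(\<lambda>n. 2 ^ n *\<^sub>R \<kappa> (Exp (Z /\<^sub>R 2 ^ n))) \<longlonglongrightarrow> Z" by (rule LIM_zero_cancel)
    moreover have "Exp (Z /\<^sub>R 2 ^ n) \<in> U" if "n \<ge> N" for n
      using \<epsilon>(1)[OF sm[OF that]] by (simp add: Exp_small[OF sm[OF that]])
    ultimately show ?thesis unfolding tang_def eventually_sequentially by blast
  qed
  show ?thesis
  proof (rule that)
    show "root_seq (\<lambda>n. Exp (Z /\<^sub>R 2 ^ n)) Z" for Z
      unfolding root_seq_def
    proof (intro conjI allI tendsto)
      fix n
      have "Z /\<^sub>R 2 ^ Suc n = (Z /\<^sub>R 2 ^ n) /\<^sub>R 2" by simp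
      then show "Exp (Z /\<^sub>R 2 ^ Suc n) \<otimes> Exp (Z /\<^sub>R 2 ^ Suc n) = Exp (Z /\<^sub>R 2 ^ n)"
        using double[of "Z /\<^sub>R 2 ^ n"] by (simp only:)
    qed
    have "continuous_on (ball 0 (\<rho> * 2 ^ n)) Exp" for n
    proof -
      have "continuous_on (ball 0 (\<rho> * 2 ^ n)) (\<lambda>Z. \<epsilon> (Z /\<^sub>R 2 ^ n) [^] ((2::nat) ^ n))"
        by (intro continuous_intros continuous_on_compose2[OF cont]) (auto simp: field_simps)
      then show ?thesis
        by (rule continuous_on_eq) (subst Exp_eq, auto simp: field_simps)
    qed
    then have "continuous_on (\<Union>n. ball 0 (\<rho> * 2 ^ n)) Exp"
      by (intro continuous_on_open_UN) auto
    moreover have "(\<Union>n. ball (0::'e) (\<rho> * 2 ^ n)) = UNIV"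
    proof -
      have "\<exists>n. norm Z < \<rho> * 2 ^ n" for Z :: 'e
      proof -
        obtain n where "norm (2 *\<^sub>R Z) / 2 ^ n \<le> \<rho>" using ex by blast
        then have "2 * norm Z \<le> \<rho> * 2 ^ n" by (simp add: divide_le_eq)
        moreover have "\<rho> * 2 ^ n > 0" using \<rho> by simp
        ultimately have "norm Z < \<rho> * 2 ^ n" using norm_ge_zero[of Z] by linarith
        then show ?thesis by (rule exI)
      qed
      then show ?thesis by auto
    qed
    ultimately show "continuous_on UNIV Exp" by simp
    show "((\<lambda>t. snd c (Exp (t *\<^sub>R Z))) has_vector_derivative Z) (at 0)" for Z
      unfolding has_vector_derivative_def has_derivative_at_alt
    proof (intro conjI allI impI bounded_linear_scaleR_left)
      fix s :: real assume s: "s > 0"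
      \<comment> \<open>The first bound keeps \<open>t *\<^sub>R Z\<close> in the ball where
        \<open>\<epsilon>\<close> is controlled, the second makes the quadratic error at most
        \<open>s * \<bar>t\<bar>\<close>; adding 1 covers \<open>Z = 0\<close>.\<close>
      define d where "d = min (\<rho> / (norm Z + 1)) (s / (C * (norm Z)\<^sup>2 + 1))"
      have pos: "norm Z + 1 > 0" "C * (norm Z)\<^sup>2 + 1 > 0" using C by (auto intro: add_nonneg_pos)
      have d: "d > 0" using \<rho> s pos by (simp add: d_def)
      have main: "norm (snd c (Exp (t *\<^sub>R Z)) - snd c (Exp (0 *\<^sub>R Z)) - (t - 0) *\<^sub>R Z) \<le> s * norm (t - 0)"
        if t: "norm (t - 0) < d" for t :: real
      proof -
        have t1: "\<bar>t\<bar> * (norm Z + 1) \<le> \<rho>" and t2: "\<bar>t\<bar> * (C * (norm Z)\<^sup>2 + 1) \<le> s"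
          using t pos by (auto simp: d_def pos_less_divide_eq less_imp_le)
        have n: "norm (t *\<^sub>R Z) \<le> \<rho>" using t1 by (simp add: algebra_simps) 
        have E0: "snd c (Exp 0) = e" using \<epsilon>(2)[of 0] \<rho> Exp_small[of 0] by (simp add: \<kappa>_def)
        have "norm (\<kappa> (\<epsilon> (t *\<^sub>R Z)) - t *\<^sub>R Z) \<le> C * (norm (t *\<^sub>R Z))\<^sup>2" by (rule \<epsilon>(2)[OF n])
        also have "\<dots> = \<bar>t\<bar> * (C * (norm Z)\<^sup>2) * \<bar>t\<bar>" by (simp add: power2_eq_square mult_ac)
        also have "\<dots> \<le> s * \<bar>t\<bar>"
          using t2 by (intro mult_right_mono) (auto simp: algebra_simps)
        finally show ?thesis using Exp_small[OF n] by (simp add: \<kappa>_def E0)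
      qed
      show "\<exists>d>0. \<forall>t. norm (t - 0) < d \<longrightarrow>
          norm (snd c (Exp (t *\<^sub>R Z)) - snd c (Exp (0 *\<^sub>R Z)) - (t - 0) *\<^sub>R Z) \<le> s * norm (t - 0)"
        using d main by blast
    qed
  qed
qed

end


section \<open>Conjugation, one-parameter subgroups and identification of the exponential\<close>

context lie_chart
begin

lemma root_seq_inv: assumes "root_seq x Z" shows "root_seq (\<lambda>n. inv (x n)) (- Z)"
  unfolding root_seq_def
proof (intro conjI allI)
  show "tang (\<lambda>n. inv (x n)) (- Z)" using assms by (auto simp: root_seq_def intro: tang_inv)
  fix n
  have "x (Suc n) \<otimes> x (Suc n) = x n" using assms by (simp add: root_seq_def)
  then show "inv (x (Suc n)) \<otimes> inv (x (Suc n)) = inv (x n)"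
    using inv_mult_group[of "x (Suc n)" "x (Suc n)"] by simp
qed

lemma root_seq_pow: assumes "root_seq x Z" shows "root_seq (\<lambda>n. x n [^] (k::nat)) (real k *\<^sub>R Z)"
  unfolding root_seq_def
proof (intro conjI allI)
  show "tang (\<lambda>n. x n [^] k) (real k *\<^sub>R Z)" using assms by (auto simp: root_seq_def intro: tang_pow)
  fix n
  have "x n = x (Suc n) [^] (2::nat)"
    using assms by (simp add: root_seq_def numeral_2_eq_2)
  then have "x n [^] k = x (Suc n) [^] (2 * k)" by (simp only: nat_pow_pow carrier_UNIV UNIV_I)
  also have "\<dots> = x (Suc n) [^] k \<otimes> x (Suc n) [^] k"
    by (simp only: nat_pow_mult carrier_UNIV UNIV_I mult_2)
  finally show "x (Suc n) [^] k \<otimes> x (Suc n) [^] k = x n [^] k" ..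
qed

text \<open>As \<open>h\<close> may be far from the unit, conjugation is factored through a chart
  \<open>d\<close> around \<open>h\<close>: first \<open>a\<close>, the multiplication by
  \<open>h\<close> on the left, read from \<open>c\<close> to \<open>d\<close>, then
  \<open>b\<close>, the multiplication by its inverse on the right, read from \<open>d\<close> back
  to \<open>c\<close>.\<close>

lemma conj_differentiable:
  "(\<lambda>x. snd c (h \<otimes> chart_inv c x \<otimes> inv h)) differentiable (at e)"
proof -
  have cover: "(\<Union>c\<in>\<A>. fst c) = UNIV" using lie by (simp add: lie_group_def smooth_atlas_def)
  obtain d where d: "d \<in> \<A>" "h \<in> fst d" using cover by blast
  obtain d' where d': "d' \<in> \<A>" "inv h \<in> fst d'" using cover by blast
  have hd: "h \<otimes> \<one> \<in> fst d" "h \<otimes> inv h \<in> fst c" using d one_in_chart by auto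
  obtain W1 where W1: "open W1" "(snd d h, snd c \<one>) \<in> W1" "W1 \<subseteq> (snd d ` fst d) \<times> (snd c ` fst c)"
    "\<forall>p\<in>W1. chart_inv d (fst p) \<otimes> chart_inv c (snd p) \<in> fst d"
    "smooth_on (\<lambda>p. snd d (chart_inv d (fst p) \<otimes> chart_inv c (snd p))) W1"
    by (rule mult_in_charts[OF d(1) c d(1) d(2) one_in_chart hd(1)])
  obtain W2 where W2: "open W2" "(snd d h, snd d' (inv h)) \<in> W2" "W2 \<subseteq> (snd d ` fst d) \<times> (snd d' ` fst d')"
    "\<forall>p\<in>W2. chart_inv d (fst p) \<otimes> chart_inv d' (snd p) \<in> fst c"
    "smooth_on (\<lambda>p. snd c (chart_inv d (fst p) \<otimes> chart_inv d' (snd p))) W2"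
    by (rule mult_in_charts[OF d(1) d'(1) c d(2) d'(2) hd(2)])
  have h: "chart_inv d (snd d h) = h" "chart_inv d' (snd d' (inv h)) = inv h" "chart_inv c e = \<one>"
    using chart_facts(5)[OF d(1)] chart_facts(5)[OF d'(1)] chart_facts(5)[OF c] d(2) d'(2) one_in_chart
    by (auto simp: e_def)
  have "Ck_on (Suc 0) (\<lambda>p. snd d (chart_inv d (fst p) \<otimes> chart_inv c (snd p))) W1"
    using W1(5) unfolding smooth_on_def by blast
  then have D1: "(\<lambda>p. snd d (chart_inv d (fst p) \<otimes> chart_inv c (snd p))) differentiable (at ((\<lambda>x. (snd d h, x)) e))"
    using W1(2) by (auto simp: e_def)
  have "Ck_on (Suc 0) (\<lambda>p. snd c (chart_inv d (fst p) \<otimes> chart_inv d' (snd p))) W2"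
    using W2(5) unfolding smooth_on_def by blast
  then have D2: "(\<lambda>p. snd c (chart_inv d (fst p) \<otimes> chart_inv d' (snd p))) differentiable (at ((\<lambda>y. (y, snd d' (inv h))) (snd d h)))"
    using W2(2) by auto
  have i1: "(\<lambda>x. (snd d h, x)) differentiable (at e)"
    unfolding differentiable_def by (rule exI) (auto intro!: derivative_eq_intros)
  have i2: "(\<lambda>y. (y, snd d' (inv h))) differentiable (at (snd d h))"
    unfolding differentiable_def by (rule exI) (auto intro!: derivative_eq_intros)
  define a where "a = (\<lambda>x. snd d (h \<otimes> chart_inv c x))"
  define b where "b = (\<lambda>y. snd c (chart_inv d y \<otimes> inv h))"
  have "a differentiable (at e)"
    using differentiable_chain_at[OF i1 D1] by (simp add: o_def a_def h)
  moreover have "b differentiable (at (a e))"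
    using differentiable_chain_at[OF i2 D2] by (simp add: o_def b_def a_def h)
  ultimately have "(b \<circ> a) differentiable (at e)" by (rule differentiable_chain_at)
  then obtain L where L: "((b \<circ> a) has_derivative L) (at e)" by (auto simp: differentiable_def)
  let ?N = "{x. (snd d h, x) \<in> W1}"
  have N: "open ?N"
  proof -
    have "continuous_on UNIV (\<lambda>x. (snd d h, x))" by (intro continuous_intros)
    from open_vimage[OF W1(1) this] show ?thesis by (simp add: vimage_def)
  qed
  have "((\<lambda>x. snd c (h \<otimes> chart_inv c x \<otimes> inv h)) has_derivative L) (at e)"
  proof (rule has_derivative_transform_within_open[OF L N])
    show "e \<in> ?N" using W1(2) by (simp add: e_def)
    fix x assume "x \<in> ?N"
    then have "h \<otimes> chart_inv c x \<in> fst d" using W1(4) h(1) by force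
    then show "(b \<circ> a) x = snd c (h \<otimes> chart_inv c x \<otimes> inv h)"
      by (simp add: a_def b_def chart_facts(5)[OF d(1)])
  qed
  then show ?thesis by (auto simp: differentiable_def)
qed

lemma Ad_eq: "Ad G c h = frechet_derivative (\<lambda>x. snd c (h \<otimes> chart_inv c x \<otimes> inv h)) (at e)"
  by (simp add: Ad_def o_def e_def)

lemma linear_Ad: "linear (Ad G c h)"
  unfolding Ad_eq by (rule linear_frechet_derivative[OF conj_differentiable])

lemma root_seq_conj: assumes "root_seq x Z" shows "root_seq (\<lambda>n. h \<otimes> x n \<otimes> inv h) (Ad G c h Z)"
  unfolding root_seq_def
proof (intro conjI allI)
  show "tang (\<lambda>n. h \<otimes> x n \<otimes> inv h) (Ad G c h Z)"
  proof (rule tang_map[where f = "\<lambda>g. h \<otimes> g \<otimes> inv h" and L = "Ad G c h" and Z = Z])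
    show "continuous_on UNIV (\<lambda>g. h \<otimes> g \<otimes> inv h)" by (intro continuous_intros)
    show "((\<lambda>z. snd c (h \<otimes> chart_inv c z \<otimes> inv h)) has_derivative Ad G c h) (at e)"
      unfolding Ad_eq using conj_differentiable frechet_derivative_works by blast
    show "tang x Z" using assms by (simp add: root_seq_def)
  qed simp
  fix n
  have "x n = x (Suc n) \<otimes> x (Suc n)" using assms by (simp add: root_seq_def)
  then have "h \<otimes> x n \<otimes> inv h = h \<otimes> x (Suc n) \<otimes> (inv h \<otimes> h) \<otimes> x (Suc n) \<otimes> inv h"
    by (simp add: m_assoc)
  also have "\<dots> = (h \<otimes> x (Suc n) \<otimes> inv h) \<otimes> (h \<otimes> x (Suc n) \<otimes> inv h)"
    by (simp only: m_assoc carrier_UNIV UNIV_I)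
  finally show "(h \<otimes> x (Suc n) \<otimes> inv h) \<otimes> (h \<otimes> x (Suc n) \<otimes> inv h) = h \<otimes> x n \<otimes> inv h" ..
qed

text \<open>Halving the time is taking a square root, and the derivative at 0 gives the velocity.
  With this for every \<open>t\<close>, uniqueness of root sequences determines the whole
  subgroup.\<close>

lemma one_parameter_root_seq:
  assumes "one_parameter_subgroup G c Z \<gamma>"
  shows "root_seq (\<lambda>n. \<gamma> (t / 2 ^ n)) (t *\<^sub>R Z)"
proof -
  have cont: "continuous_on UNIV \<gamma>" and add: "\<And>s t. \<gamma> (s + t) = \<gamma> s \<otimes> \<gamma> t"
    and der: "((snd c \<circ> \<gamma>) has_derivative (\<lambda>s. s *\<^sub>R Z)) (at 0)"
    using assms by (auto simp: one_parameter_subgroup_def has_vector_derivative_def)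
  have g0: "\<gamma> 0 = \<one>"
  proof -
    have "\<gamma> 0 \<otimes> \<gamma> 0 = \<gamma> 0" using add[of 0 0] by simp
    then show ?thesis by (metis carrier_UNIV UNIV_I l_cancel_one')
  qed
  have t0: "(\<lambda>n. t / 2 ^ n) \<longlonglongrightarrow> 0" by real_asymp
  have "(\<lambda>n. \<gamma> (t / 2 ^ n)) \<longlonglongrightarrow> \<gamma> 0"
    by (rule isCont_tendsto_compose[OF _ t0]) (use cont in \<open>simp add: continuous_on_eq_continuous_at\<close>)
  then have "\<forall>\<^sub>F n in sequentially. \<gamma> (t / 2 ^ n) \<in> U"
    by (rule topological_tendstoD[OF _ open_U]) (simp add: g0 one_U)
  moreover have "(\<lambda>n. 2 ^ n *\<^sub>R \<kappa> (\<gamma> (t / 2 ^ n))) \<longlonglongrightarrow> t *\<^sub>R Z"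
    using tendsto_scaled_difference[OF der, of "\<lambda>n. t / 2 ^ n" t] by (simp add: \<kappa>_def g0 e_def)
  moreover have "\<gamma> (t / 2 ^ Suc n) \<otimes> \<gamma> (t / 2 ^ Suc n) = \<gamma> (t / 2 ^ n)" for n
  proof -
    have "t / 2 ^ Suc n + t / 2 ^ Suc n = t / 2 ^ n" by simp
    then show ?thesis using add[of "t / 2 ^ Suc n" "t / 2 ^ Suc n"] by (simp only:)
  qed
  ultimately show ?thesis unfolding root_seq_def tang_def by blast
qed

text \<open>Both sides of each identity are first terms of root sequences with the same velocity.
  Once \<open>Exp\<close> is additive along lines, it provides the only one-parameter subgroup with
  velocity \<open>Z\<close>, so the description in \<open>lie_exp\<close> selects it.\<close>

theorem lie_exp_facts:
  shows "continuous_on UNIV (lie_exp G c)"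
    and "h \<otimes> lie_exp G c Z \<otimes> inv h = lie_exp G c (Ad G c h Z)"
    and "lie_exp G c (- Z) = inv (lie_exp G c Z)"
proof -
  obtain Exp where cont: "continuous_on UNIV Exp" and root: "\<And>Z. root_seq (\<lambda>n. Exp (Z /\<^sub>R 2 ^ n)) Z"
    and der: "\<And>Z. ((\<lambda>t. snd c (Exp (t *\<^sub>R Z))) has_vector_derivative Z) (at 0)"
    by (rule exponential) blast
  have eqI: "x 0 = Exp Z" if "root_seq x Z" for x Z
    using root_seq_unique[OF that root, of 0] by simp
  have inv: "Exp (- Z) = inv (Exp Z)" for Z
    using eqI[OF root_seq_inv[OF root[of Z]]] by simp
  have pow: "Exp (real k *\<^sub>R Z) = Exp Z [^] k" for k Z
    using eqI[OF root_seq_pow[OF root[of Z], of k]] by simp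
  have ipow: "Exp (of_int i *\<^sub>R Z) = Exp Z [^] i" for i Z
  proof (cases "i \<ge> 0")
    case True
    then have "Exp (of_int i *\<^sub>R Z) = Exp (real (nat i) *\<^sub>R Z)" by (simp add: of_nat_nat)
    also have "\<dots> = Exp Z [^] int (nat i)" by (simp only: pow int_pow_int)
    finally show ?thesis using True by simp
  next
    case False
    then have i: "i = - int (nat (- i))" by simp
    have "real (nat (- i)) = - of_int i" using False by (simp add: of_nat_nat)
    then have "of_int i *\<^sub>R Z = - (real (nat (- i)) *\<^sub>R Z)" by simp
    then have "Exp (of_int i *\<^sub>R Z) = inv (Exp Z [^] nat (- i))" by (simp only: inv pow)
    also have "\<dots> = Exp Z [^] (- int (nat (- i)))"
      by (simp only: int_pow_neg int_pow_int carrier_UNIV UNIV_I)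
    finally show ?thesis using i by (simp only:)
  qed
  have add: "Exp ((s + t) *\<^sub>R Z) = Exp (s *\<^sub>R Z) \<otimes> Exp (t *\<^sub>R Z)" for s t Z
  proof -
    \<comment> \<open>Dyadic approximation of the time: at multiples of \<open>1 / 2 ^ n\<close>
      additivity is the law of integer powers, and continuity extends it to all real times.\<close>
    define f where "f n s = of_int \<lfloor>s * 2 ^ n\<rfloor> / (2 ^ n :: real)" for n and s :: real
    have f: "(\<lambda>n. f n s) \<longlonglongrightarrow> s" for s
    proof -
      have lim: "(\<lambda>n. (1 / 2) ^ n) \<longlonglongrightarrow> (0::real)" by (intro LIMSEQ_power_zero) simp
      have "\<bar>f n s - s\<bar> \<le> (1 / 2) ^ n" for n
      proof -
        have fl: "\<bar>of_int \<lfloor>s * 2 ^ n\<rfloor> - s * 2 ^ n\<bar> \<le> 1" by linarith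
        have "f n s - s = (of_int \<lfloor>s * 2 ^ n\<rfloor> - s * 2 ^ n) / 2 ^ n" by (simp add: f_def diff_divide_distrib)
        then have "\<bar>f n s - s\<bar> = \<bar>of_int \<lfloor>s * 2 ^ n\<rfloor> - s * 2 ^ n\<bar> / 2 ^ n" by simp
        also have "\<dots> \<le> 1 / 2 ^ n" using fl by (intro divide_right_mono) auto
        finally show ?thesis by (simp add: power_one_over)
      qed
      then have "(\<lambda>n. f n s - s) \<longlonglongrightarrow> 0"
        by (intro Lim_null_comparison[OF _ lim] always_eventually allI) simp
      then show ?thesis by (rule LIM_zero_cancel)
    qed
    have fin: "Exp ((f n s + f n t) *\<^sub>R Z) = Exp (f n s *\<^sub>R Z) \<otimes> Exp (f n t *\<^sub>R Z)" for n
    proof -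
      have e1: "(f n s + f n t) *\<^sub>R Z = of_int (\<lfloor>s * 2 ^ n\<rfloor> + \<lfloor>t * 2 ^ n\<rfloor>) *\<^sub>R (Z /\<^sub>R 2 ^ n)"
        by (simp add: f_def divide_inverse distrib_right[symmetric] scaleR_add_left[symmetric])
      have e2: "f n r *\<^sub>R Z = of_int \<lfloor>r * 2 ^ n\<rfloor> *\<^sub>R (Z /\<^sub>R 2 ^ n)" for r
        by (simp add: f_def divide_inverse)
      show ?thesis unfolding e1 e2 ipow by (simp only: int_pow_mult carrier_UNIV UNIV_I)
    qed
    have isC: "isCont Exp z" for z using cont by (simp add: continuous_on_eq_continuous_at)
    have l1: "(\<lambda>n. Exp ((f n s + f n t) *\<^sub>R Z)) \<longlonglongrightarrow> Exp ((s + t) *\<^sub>R Z)"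
      by (intro isCont_tendsto_compose[OF isC] tendsto_intros f)
    have "(\<lambda>n. (Exp (f n s *\<^sub>R Z), Exp (f n t *\<^sub>R Z))) \<longlonglongrightarrow> (Exp (s *\<^sub>R Z), Exp (t *\<^sub>R Z))"
      by (intro tendsto_Pair isCont_tendsto_compose[OF isC] tendsto_intros f)
    then have "(\<lambda>n. (\<lambda>(g, h). g \<otimes> h) (Exp (f n s *\<^sub>R Z), Exp (f n t *\<^sub>R Z))) \<longlonglongrightarrow> (\<lambda>(g, h). g \<otimes> h) (Exp (s *\<^sub>R Z), Exp (t *\<^sub>R Z))"
      by (rule isCont_tendsto_compose[rotated]) (use continuous_mult in \<open>simp add: continuous_on_eq_continuous_at\<close>)
    then have l2: "(\<lambda>n. Exp ((f n s + f n t) *\<^sub>R Z)) \<longlonglongrightarrow> Exp (s *\<^sub>R Z) \<otimes> Exp (t *\<^sub>R Z)"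
      unfolding fin by simp
    show ?thesis using l1 l2 by (rule LIMSEQ_unique)
  qed
  have one: "one_parameter_subgroup G c Z (\<lambda>t. Exp (t *\<^sub>R Z))" for Z
    unfolding one_parameter_subgroup_def
  proof (intro conjI allI add)
    show "continuous_on UNIV (\<lambda>t. Exp (t *\<^sub>R Z))"
      by (intro continuous_on_compose2[OF cont] continuous_intros) auto
    show "(snd c \<circ> (\<lambda>t. Exp (t *\<^sub>R Z)) has_vector_derivative Z) (at 0)"
      using der by (simp add: o_def)
  qed
  have uniq: "\<gamma> = (\<lambda>t. Exp (t *\<^sub>R Z))" if "one_parameter_subgroup G c Z \<gamma>" for \<gamma> Z
    using eqI[OF one_parameter_root_seq[OF that]] by auto
  have "(THE \<gamma>. one_parameter_subgroup G c Z \<gamma>) = (\<lambda>t. Exp (t *\<^sub>R Z))" for Z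
    by (rule the_equality[where a = "\<lambda>t. Exp (t *\<^sub>R Z)"]) (use one uniq in auto)
  then have lie_exp: "lie_exp G c = Exp" by (auto simp: lie_exp_def)
  show "continuous_on UNIV (lie_exp G c)" "lie_exp G c (- Z) = inv (lie_exp G c Z)"
    using cont inv by (simp_all add: lie_exp)
  show "h \<otimes> lie_exp G c Z \<otimes> inv h = lie_exp G c (Ad G c h Z)"
    using eqI[OF root_seq_conj[OF root[of Z], of h]] by (simp add: lie_exp)
qed

end


section \<open>Invariance of the uniform measure on a sphere\<close>

text \<open>Uniqueness of Haar measure, tested on a symmetric \<open>T\<close>-invariant set \<open>A\<close>: integrating
  \<open>indicator A y * indicator C (T x + y)\<close> in both orders gives the invariance of Lebesgue measure.\<close>

lemma nn_integral_lborel_translate: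
  assumes "f \<in> borel_measurable (borel :: 'e::euclidean_space measure)"
  shows "(\<integral>\<^sup>+ x. f (x + a) \<partial>lborel) = (\<integral>\<^sup>+ x. f x \<partial>lborel)"
proof -
  have "(\<integral>\<^sup>+ x. f x \<partial>lborel) = (\<integral>\<^sup>+ x. f x \<partial>distr lborel borel ((+) a))"
    by (simp add: lborel_distr_plus)
  also have "\<dots> = (\<integral>\<^sup>+ x. f (a + x) \<partial>lborel)" by (rule nn_integral_distr) (use assms in auto)
  finally show ?thesis by (simp add: add.commute)
qed

lemma lborel_invariant_under_linear:
  fixes T :: "'e::euclidean_space \<Rightarrow> 'e"
  assumes T: "linear T" "surj T" and A: "A \<in> sets borel" "emeasure lborel A \<noteq> 0" "emeasure lborel A \<noteq> \<infinity>"
    and inv: "\<And>x. T x \<in> A \<longleftrightarrow> x \<in> A" "\<And>x. - x \<in> A \<longleftrightarrow> x \<in> A"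
  shows "distr lborel borel T = lborel"
proof -
  have T_meas [measurable]: "T \<in> borel_measurable borel"
    using T(1) by (intro borel_measurable_continuous_onI linear_continuous_on linear_conv_bounded_linear[THEN iffD1])
  note A(1) [measurable]
  show ?thesis
  proof (rule measure_eqI)
    fix C assume "C \<in> sets (distr lborel borel T)"
    then have C [measurable]: "C \<in> sets borel" by simp
    have shift: "(\<integral>\<^sup>+ x. indicator C (T x + y) \<partial>lborel) = (\<integral>\<^sup>+ x. indicator C (T x) \<partial>lborel)" for y
    proof -
      obtain y' where y': "y = T y'" using T(2) by blast
      have "(\<integral>\<^sup>+ x. indicator C (T (x + y')) \<partial>lborel) = (\<integral>\<^sup>+ x. indicator C (T x) \<partial>lborel :: ennreal)"
        by (rule nn_integral_lborel_translate) simp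
      then show ?thesis by (simp add: y' linear_add[OF T(1)])
    qed
    have inner: "(\<integral>\<^sup>+ x. indicator A (y - T x) \<partial>lborel) = emeasure lborel A" for y
    proof -
      obtain y' where y': "y = T y'" using T(2) by blast
      have "y - T x \<in> A \<longleftrightarrow> x - y' \<in> A" for x
        using inv(1)[of "y' - x"] inv(2)[of "y' - x"] by (simp add: y' linear_diff[OF T(1)])
      then have "(\<integral>\<^sup>+ x. indicator A (y - T x) \<partial>lborel) = (\<integral>\<^sup>+ x. indicator A (x + (- y')) \<partial>lborel :: ennreal)"
        by (intro nn_integral_cong) (auto simp: indicator_def)
      also have "\<dots> = (\<integral>\<^sup>+ x. indicator A x \<partial>lborel)" by (rule nn_integral_lborel_translate) simp
      finally show ?thesis by simp
    qed
    have "emeasure (distr lborel borel T) C * emeasure lborel A =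
        (\<integral>\<^sup>+ y. indicator A y * (\<integral>\<^sup>+ x. indicator C (T x) \<partial>lborel) \<partial>lborel)"
    proof -
      have "emeasure (distr lborel borel T) C = (\<integral>\<^sup>+ x. indicator C (T x) \<partial>lborel)"
        by (simp add: nn_integral_indicator[symmetric] nn_integral_distr del: nn_integral_indicator)
      then show ?thesis by (simp add: nn_integral_multc mult.commute)
    qed
    also have "\<dots> = (\<integral>\<^sup>+ y. \<integral>\<^sup>+ x. indicator A y * indicator C (T x + y) \<partial>lborel \<partial>lborel)"
      by (simp add: shift nn_integral_cmult)
    also have "\<dots> = (\<integral>\<^sup>+ x. \<integral>\<^sup>+ y. indicator A y * indicator C (T x + y) \<partial>lborel \<partial>lborel)"
      by (rule lborel_pair.Fubini') simp
    also have "\<dots> = (\<integral>\<^sup>+ x. \<integral>\<^sup>+ y. indicator A (y - T x) * indicator C y \<partial>lborel \<partial>lborel)"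
    proof (rule nn_integral_cong)
      fix x :: 'e
      show "(\<integral>\<^sup>+ y. indicator A y * indicator C (T x + y) \<partial>lborel) = (\<integral>\<^sup>+ y. indicator A (y - T x) * indicator C y \<partial>lborel :: ennreal)"
        using nn_integral_lborel_translate[of "\<lambda>y. indicator A (y - T x) * indicator C y :: ennreal" "T x"]
        by (simp add: add.commute)
    qed
    also have "\<dots> = (\<integral>\<^sup>+ y. \<integral>\<^sup>+ x. indicator A (y - T x) * indicator C y \<partial>lborel \<partial>lborel)"
      by (rule lborel_pair.Fubini') simp
    also have "\<dots> = (\<integral>\<^sup>+ y. emeasure lborel A * indicator C y \<partial>lborel)"
      by (simp add: nn_integral_multc inner)
    also have "\<dots> = emeasure lborel C * emeasure lborel A"
      by (subst nn_integral_cmult_indicator) (simp_all add: mult.commute)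
    finally have "emeasure lborel A * emeasure (distr lborel borel T) C = emeasure lborel A * emeasure lborel C"
      by (simp only: mult.commute)
    then show "emeasure (distr lborel borel T) C = emeasure lborel C"
      using A(2,3) unfolding ennreal_mult_cancel_left by auto
  qed simp
qed

section \<open>Scalar products and the uniform measure on their spheres\<close>

context
  fixes B :: "'e::euclidean_space \<Rightarrow> 'e \<Rightarrow> real"
  assumes B: "is_scalar_product B"
begin

lemma scalar_product_cont: "continuous_on UNIV (\<lambda>Z. B Z Z)"
proof -
  have "bounded_bilinear B" using B by (simp add: is_scalar_product_def bilinear_conv_bounded_bilinear)
  from bounded_bilinear.continuous_on[OF this continuous_on_id continuous_on_id] show ?thesis .
qed

lemma scalar_product_scale: "B (a *\<^sub>R Z) (a *\<^sub>R Z) = a\<^sup>2 * B Z Z"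
  using B bilinear_lmul[of B a Z "a *\<^sub>R Z"] bilinear_rmul[of B Z a Z]
  by (simp add: is_scalar_product_def power2_eq_square)

text \<open>The mass is positive because the set contains a Euclidean ball, and finite because
  \<open>B\<close> has a positive minimum on the Euclidean unit sphere, which bounds the
  set.\<close>

lemma scalar_ball: "{Z. B Z Z \<le> 1} \<in> sets borel" "emeasure lborel {Z. B Z Z \<le> 1} \<noteq> 0"
  "emeasure lborel {Z. B Z Z \<le> 1} \<noteq> \<infinity>"
proof -
  show m: "{Z. B Z Z \<le> 1} \<in> sets borel"
    by (intro borel_closed closed_Collect_le scalar_product_cont continuous_on_const)
  have "open {Z. B Z Z < 1}" by (intro open_Collect_less scalar_product_cont continuous_on_const)
  moreover have "B 0 0 = 0" using scalar_product_scale[of 0 0] by simp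
  ultimately obtain r where r: "r > 0" "ball 0 r \<subseteq> {Z. B Z Z < 1}"
    using openE[of "{Z. B Z Z < 1}" 0] by auto
  then have "ball 0 r \<subseteq> {Z. B Z Z \<le> 1}" by auto
  then have "emeasure lborel (ball (0::'e) r) \<le> emeasure lborel {Z. B Z Z \<le> 1}" using m by (intro emeasure_mono) auto
  moreover have "emeasure lborel (ball (0::'e) r) > 0"
  proof -
    have "emeasure lborel (ball (0::'e) r) = ennreal (measure lborel (ball (0::'e) r))"
      using emeasure_lborel_ball_finite[of "0::'e" r] by (intro emeasure_eq_ennreal_measure) auto
    then show ?thesis using content_ball_pos[OF r(1), of "0::'e"] by simp
  qed
  ultimately show "emeasure lborel {Z. B Z Z \<le> 1} \<noteq> 0" by auto
  obtain b :: 'e where b: "b \<in> Basis" using nonempty_Basis by blast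
  have "\<exists>z\<in>sphere 0 1. \<forall>y\<in>sphere 0 1. B z z \<le> B y y"
  proof (rule continuous_attains_inf)
    show "sphere (0::'e) 1 \<noteq> {}" using norm_Basis[OF b] by (auto simp: set_eq_iff intro!: exI[of _ b])
    show "continuous_on (sphere 0 1) (\<lambda>Z. B Z Z)" using scalar_product_cont continuous_on_subset by blast
  qed simp
  then obtain z where z: "z \<in> sphere 0 1" "\<And>y. y \<in> sphere 0 1 \<Longrightarrow> B z z \<le> B y y" by blast
  have "z \<noteq> 0" using z(1) by auto
  then have Bz: "B z z > 0" using B by (simp add: is_scalar_product_def)
  have "norm Z \<le> 1 / sqrt (B z z)" if "B Z Z \<le> 1" for Z
  proof (cases "Z = 0")
    case False
    have "B z z \<le> B (Z /\<^sub>R norm Z) (Z /\<^sub>R norm Z)" by (rule z(2)) (use False in simp)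
    also have "\<dots> = B Z Z / (norm Z)\<^sup>2" by (simp add: scalar_product_scale power2_eq_square field_simps)
    also have "\<dots> \<le> 1 / (norm Z)\<^sup>2" using that by (intro divide_right_mono) auto
    finally have "(norm Z)\<^sup>2 \<le> 1 / B z z" using False Bz by (simp add: field_simps)
    then have "sqrt ((norm Z)\<^sup>2) \<le> sqrt (1 / B z z)" by (rule real_sqrt_le_mono)
    then show ?thesis by (simp add: real_sqrt_divide)
  qed (use Bz in simp)
  then have "bounded {Z. B Z Z \<le> 1}" by (auto simp: bounded_iff)
  from emeasure_bounded_finite[OF this] show "emeasure lborel {Z. B Z Z \<le> 1} \<noteq> \<infinity>" by simp
qed

lemma radial_measurable [measurable]: "(\<lambda>Z. (r / sqrt (B Z Z)) *\<^sub>R Z) \<in> borel_measurable borel"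
  using borel_measurable_continuous_onI[OF scalar_product_cont] by measurable

lemma prob_space_uniform_sphere: "prob_space (uniform_sphere B r)"
  unfolding uniform_sphere_def
  by (intro prob_space.prob_space_distr prob_space_uniform_measure scalar_ball)
    (use scalar_ball radial_measurable in \<open>auto simp: measurable_def\<close>)

lemma sets_uniform_sphere [simp]: "sets (uniform_sphere B r) = sets borel"
  by (simp add: uniform_sphere_def)

text \<open>The unit ball of \<open>B\<close> is symmetric and invariant under \<open>T\<close>, so
  it can serve as the test set in \<open>lborel_invariant_under_linear\<close>. The uniform measure
  on this ball is then invariant too, and \<open>T\<close> commutes with the radial
  projection.\<close>

lemma uniform_sphere_isometry:
  assumes T: "linear T" "\<And>Z. B (T Z) (T Z) = B Z Z"
  shows "distr (uniform_sphere B r) borel T = uniform_sphere B r"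
proof -
  let ?A = "{Z. B Z Z \<le> 1}" and ?f = "\<lambda>Z. (r / sqrt (B Z Z)) *\<^sub>R Z"
  have "inj T"
  proof (rule linear_injective_0[OF T(1), THEN iffD2], intro allI impI)
    fix Z assume "T Z = 0"
    moreover have "B 0 0 = 0" using scalar_product_scale[of 0 0] by simp
    ultimately show "Z = 0" using T(2)[of Z] B by (auto simp: is_scalar_product_def)
  qed
  then have surj: "surj T" using linear_injective_imp_surjective[OF T(1)] by simp
  have T_meas [measurable]: "T \<in> borel_measurable borel"
    using T(1) by (intro borel_measurable_continuous_onI linear_continuous_on linear_conv_bounded_linear[THEN iffD1])
  note scalar_ball(1) [measurable]
  have lT: "distr lborel borel T = lborel"
    by (rule lborel_invariant_under_linear[OF T(1) surj scalar_ball])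
      (use T(2) scalar_product_scale[of "-1"] in auto)
  have uT: "distr (uniform_measure lborel ?A) borel T = uniform_measure lborel ?A"
  proof (rule measure_eqI)
    fix C assume "C \<in> sets (distr (uniform_measure lborel ?A) borel T)"
    then have C [measurable]: "C \<in> sets borel" by simp
    have v: "?A \<inter> T -` C = T -` (?A \<inter> C)" using T(2) by auto
    have "emeasure (distr (uniform_measure lborel ?A) borel T) C = emeasure lborel (?A \<inter> T -` C) / emeasure lborel ?A"
    proof -
      have "T -` C \<in> sets lborel" using measurable_sets_borel[OF T_meas C] by simp
      then show ?thesis
        by (subst emeasure_distr) (auto simp: measurable_cong_sets[OF sets_uniform_measure refl])
    qed
    also have "emeasure lborel (?A \<inter> T -` C) = emeasure (distr lborel borel T) (?A \<inter> C)"
      unfolding v by (subst emeasure_distr) auto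
    finally show "emeasure (distr (uniform_measure lborel ?A) borel T) C = emeasure (uniform_measure lborel ?A) C"
      by (simp add: lT)
  qed simp
  have "distr (uniform_sphere B r) borel T = distr (uniform_measure lborel ?A) borel (T \<circ> ?f)"
    unfolding uniform_sphere_def by (rule distr_distr) (auto simp: measurable_cong_sets[OF sets_uniform_measure refl])
  also have "T \<circ> ?f = ?f \<circ> T" by (auto simp: T(2) linear_scale[OF T(1)])
  also have "distr (uniform_measure lborel ?A) borel (?f \<circ> T) = distr (distr (uniform_measure lborel ?A) borel T) borel ?f"
    by (rule distr_distr[symmetric]) (auto simp: measurable_cong_sets[OF sets_uniform_measure refl])
  finally show ?thesis unfolding uT by (simp add: uniform_sphere_def)
qed

end


section \<open>Central measures on a topological group\<close>

text \<open>Here \<open>\<nu>\<close> will be the law of the exponential of a uniform vector on the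
  sphere. Conjugation and inversion are exactly the moves in the reduction of a basis.\<close>

locale central_measure = group G
  for G :: "('g::{t2_space, second_countable_topology}) monoid" (structure) +
  fixes \<nu> :: "'g measure"
  assumes UN: "carrier G = UNIV"
    and mult_cont: "continuous_on UNIV (\<lambda>(g, h). g \<otimes> h)" and inv_cont: "continuous_on UNIV (\<lambda>g. inv g)"
    and prob: "prob_space \<nu>" and sets_nu [simp, measurable_cong]: "sets \<nu> = sets borel"
    and conj_inv: "distr \<nu> borel (\<lambda>g. h \<otimes> g \<otimes> inv h) = \<nu>"
    and inv_inv_law: "distr \<nu> borel (\<lambda>g. inv g) = \<nu>"
begin

lemma measurable_mult [measurable (raw)]:
  assumes "f \<in> borel_measurable M" "g \<in> borel_measurable M"
  shows "(\<lambda>x. f x \<otimes> g x) \<in> borel_measurable M"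
proof -
  have "(\<lambda>x. (f x, g x)) \<in> M \<rightarrow>\<^sub>M borel" using assms by (rule borel_measurable_Pair)
  from measurable_compose[OF this borel_measurable_continuous_onI[OF mult_cont]] show ?thesis by simp
qed

lemma measurable_inv [measurable (raw)]:
  "f \<in> borel_measurable M \<Longrightarrow> (\<lambda>x. inv f x) \<in> borel_measurable M"
  using measurable_compose[OF _ borel_measurable_continuous_onI[OF inv_cont]] .

lemma measurable_weval:
  "(\<And>x. x \<in> fst ` set w \<Longrightarrow> (\<lambda>z. f z x) \<in> borel_measurable M) \<Longrightarrow> (\<lambda>z. weval G (f z) w) \<in> borel_measurable M"
proof (induction w)
  case (Cons a w)
  then have "(\<lambda>z. f z (fst a)) \<in> borel_measurable M" "(\<lambda>z. weval G (f z) w) \<in> borel_measurable M" by auto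
  then show ?case by (cases "snd a") (auto intro: measurable_mult measurable_inv)
qed simp

abbreviation \<nu>s :: "'x set \<Rightarrow> ('x \<Rightarrow> 'g) measure" where "\<nu>s B \<equiv> Pi\<^sub>M B (\<lambda>_. \<nu>)"

lemma space_nu [simp]: "space \<nu> = UNIV"
  using sets_eq_imp_space_eq[OF sets_nu] by simp

lemma product_sigma_finite_nu: "product_sigma_finite (\<lambda>_. \<nu>)"
  by (intro product_sigma_finite.intro prob_space_imp_sigma_finite prob)

text \<open>Fubini: once the other coordinates are frozen, \<open>k f\<close> is a fixed map that
  preserves \<open>\<nu>\<close>, because it does not look at the coordinate \<open>x\<close> which
  it moves.\<close>

lemma preserves_coordinate_change:
  fixes k :: "('x \<Rightarrow> 'g) \<Rightarrow> 'g \<Rightarrow> 'g"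
  assumes fin: "finite B" "x \<in> B"
    and k: "(\<lambda>f. k f (f x)) \<in> \<nu>s B \<rightarrow>\<^sub>M borel" "\<And>f g. k (f(x := g)) = k f"
    and law: "\<And>f. k f \<in> borel_measurable borel \<and> distr \<nu> borel (k f) = \<nu>"
  shows "(\<lambda>f. f(x := k f (f x))) \<in> \<nu>s B \<rightarrow>\<^sub>M \<nu>s B" "distr (\<nu>s B) (\<nu>s B) (\<lambda>f. f(x := k f (f x))) = \<nu>s B"
proof -
  interpret P: product_sigma_finite "\<lambda>_::'x. \<nu>" by (rule product_sigma_finite_nu)
  have B: "B = insert x (B - {x})" using fin by auto
  have "(\<lambda>f. f(x := k f (f x))) \<in> \<nu>s B \<rightarrow>\<^sub>M Pi\<^sub>M (insert x B) (\<lambda>_. \<nu>)"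
    by (rule measurable_fun_upd[where J = B]) (use k(1) in \<open>auto simp: measurable_cong_sets[OF refl sets_nu]\<close>)
  then show m [measurable]: "(\<lambda>f. f(x := k f (f x))) \<in> \<nu>s B \<rightarrow>\<^sub>M \<nu>s B"
    using fin by (simp add: insert_absorb)
  show "distr (\<nu>s B) (\<nu>s B) (\<lambda>f. f(x := k f (f x))) = \<nu>s B"
  proof (rule measure_eqI)
    fix C assume "C \<in> sets (distr (\<nu>s B) (\<nu>s B) (\<lambda>f. f(x := k f (f x))))"
    then have C [measurable]: "C \<in> sets (\<nu>s B)" by simp
    have C' [measurable]: "C \<in> sets (Pi\<^sub>M (insert x (B - {x})) (\<lambda>_. \<nu>))" using C B by simp
    have sec: "(\<lambda>g. f(x := g)) \<in> \<nu> \<rightarrow>\<^sub>M Pi\<^sub>M (insert x (B - {x})) (\<lambda>_. \<nu>)" if "f \<in> space (\<nu>s (B - {x}))" for f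
      using measurable_fun_upd[of "insert x (B - {x})" "B - {x}" x] that 
      by (intro measurable_PiM_single') (auto simp: space_PiM PiE_def extensional_def fun_upd_def)
    have "emeasure (distr (\<nu>s B) (\<nu>s B) (\<lambda>f. f(x := k f (f x)))) C =
        (\<integral>\<^sup>+ f. indicator C (f(x := k f (f x))) \<partial>\<nu>s B)"
      by (simp add: nn_integral_indicator[symmetric] nn_integral_distr del: nn_integral_indicator)
    also have "\<dots> = (\<integral>\<^sup>+ f. indicator C (f(x := k f (f x))) \<partial>Pi\<^sub>M (insert x (B - {x})) (\<lambda>_. \<nu>))" using B by simp
    also have "\<dots> = (\<integral>\<^sup>+ f. \<integral>\<^sup>+ g. indicator C ((f(x := g))(x := k (f(x := g)) ((f(x := g)) x))) \<partial>\<nu> \<partial>\<nu>s (B - {x}))"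
      by (rule P.product_nn_integral_insert) (use fin B m C in \<open>auto intro!: measurable_compose[OF m]\<close>)
    also have "\<dots> = (\<integral>\<^sup>+ f. \<integral>\<^sup>+ g. indicator C (f(x := k f g)) \<partial>\<nu> \<partial>\<nu>s (B - {x}))"
      by (simp add: k(2))
    also have "\<dots> = (\<integral>\<^sup>+ f. \<integral>\<^sup>+ g. indicator C (f(x := g)) \<partial>\<nu> \<partial>\<nu>s (B - {x}))"
    proof (rule nn_integral_cong)
      fix f assume f: "f \<in> space (\<nu>s (B - {x}))"
      have "(\<integral>\<^sup>+ g. indicator C (f(x := g)) \<partial>\<nu>) = (\<integral>\<^sup>+ g. indicator C (f(x := g)) \<partial>distr \<nu> borel (k f) :: ennreal)"
        using law[of f] by simp
      also have "\<dots> = (\<integral>\<^sup>+ g. indicator C (f(x := k f g)) \<partial>\<nu>)"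
      proof (rule nn_integral_distr[where f = "\<lambda>g. indicator C (f(x := g))"])
        show "k f \<in> \<nu> \<rightarrow>\<^sub>M borel" using law[of f] by (simp add: measurable_cong_sets[OF sets_nu refl])
        show "(\<lambda>g. indicator C (f(x := g))) \<in> borel_measurable (distr \<nu> borel (k f))"
          using measurable_compose[OF sec[OF f] borel_measurable_indicator[OF C']]
          by (simp add: measurable_cong_sets[OF sets_nu refl])
      qed
      finally show "(\<integral>\<^sup>+ g. indicator C (f(x := k f g)) \<partial>\<nu>) = (\<integral>\<^sup>+ g. indicator C (f(x := g)) \<partial>\<nu> :: ennreal)" ..
    qed
    also have "\<dots> = (\<integral>\<^sup>+ f. indicator C f \<partial>Pi\<^sub>M (insert x (B - {x})) (\<lambda>_. \<nu>))"
      by (rule P.product_nn_integral_insert[OF _ _ borel_measurable_indicator[OF C'], symmetric]) (use fin in auto)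
    also have "\<dots> = emeasure (\<nu>s B) C" using B by simp
    finally show "emeasure (distr (\<nu>s B) (\<nu>s B) (\<lambda>f. f(x := k f (f x)))) C = emeasure (\<nu>s B) C" .
  qed simp
qed

text \<open>Both moves change one coordinate by a \<open>\<nu>\<close>-preserving map that depends
  on the others. Surjectivity is carried along with the law: it will exclude relations between basis
  elements, which an almost sure statement could not do for given values in
  \<open>G\<close>.\<close>

theorem generating_conjugates_preserve:
  fixes u v p :: "'x \<Rightarrow> ('x \<times> bool) list"
  assumes fin: "finite B"
    and u: "\<And>x. x \<in> B \<Longrightarrow> u x \<in> carrier (freeg B)"
    and p: "\<And>x. x \<in> B \<Longrightarrow> p x \<in> carrier (freeg B) \<and> fst ` set (p x) \<subseteq> {x}"
    and v: "\<And>x. x \<in> B \<Longrightarrow> v x = u x \<otimes>\<^bsub>freeg B\<^esub> p x \<otimes>\<^bsub>freeg B\<^esub> inv\<^bsub>freeg B\<^esub> (u x)"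
    and gen: "generate (freeg B) (v ` B) = carrier (freeg B)"
  defines "\<Psi> \<equiv> \<lambda>g. \<lambda>x\<in>B. weval G g (v x)"
  shows "\<Psi> \<in> \<nu>s B \<rightarrow>\<^sub>M \<nu>s B" "distr (\<nu>s B) (\<nu>s B) \<Psi> = \<nu>s B"
    "\<And>f. f \<in> PiE B (\<lambda>_. UNIV) \<Longrightarrow> \<exists>g. \<Psi> g = f"
proof -
  have "\<exists>e. p x = [(x, e)]" if "x \<in> B" for x
    using generating_conjugates_of_powers[OF u p v gen that] by blast
  then obtain e where e: "\<And>x. x \<in> B \<Longrightarrow> p x = [(x, e x)]" by metis
  have v': "v x = u x \<otimes>\<^bsub>freeg B\<^esub> [(x, e x)] \<otimes>\<^bsub>freeg B\<^esub> inv\<^bsub>freeg B\<^esub> (u x)" if "x \<in> B" for x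
    using v[OF that] e[OF that] by simp
  define Q where "Q \<Psi> \<longleftrightarrow> \<Psi> \<in> \<nu>s B \<rightarrow>\<^sub>M \<nu>s B \<and> distr (\<nu>s B) (\<nu>s B) \<Psi> = \<nu>s B \<and>
    (\<forall>f\<in>PiE B (\<lambda>_. UNIV). \<exists>g. \<Psi> g = f)" for \<Psi> :: "('x \<Rightarrow> 'g) \<Rightarrow> 'x \<Rightarrow> 'g"
  have Q_comp: "Q (\<lambda>g. m (\<Psi> g))" if "Q \<Psi>" "m \<in> \<nu>s B \<rightarrow>\<^sub>M \<nu>s B" "distr (\<nu>s B) (\<nu>s B) m = \<nu>s B"
    "\<forall>f\<in>PiE B (\<lambda>_. UNIV). \<exists>g\<in>PiE B (\<lambda>_. UNIV). m g = f" for m \<Psi>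
    unfolding Q_def
  proof (intro conjI ballI)
    show "(\<lambda>g. m (\<Psi> g)) \<in> \<nu>s B \<rightarrow>\<^sub>M \<nu>s B" using that by (auto simp: Q_def intro: measurable_compose)
    show "distr (\<nu>s B) (\<nu>s B) (\<lambda>g. m (\<Psi> g)) = \<nu>s B"
      using distr_distr[of m "\<nu>s B" "\<nu>s B" \<Psi> "\<nu>s B"] that by (simp add: Q_def o_def)
    fix f :: "'x \<Rightarrow> 'g" assume "f \<in> PiE B (\<lambda>_. UNIV)"
    then show "\<exists>g. m (\<Psi> g) = f" using that(1,4) unfolding Q_def by metis
  qed
  have "Q (\<lambda>g. \<lambda>x\<in>B. weval G g (v x))"
  proof (rule generating_conjugates_induct[OF is_group UN fin _ _ _ u v' gen])
    have "(\<lambda>g. restrict g B) \<in> \<nu>s B \<rightarrow>\<^sub>M \<nu>s B" by (rule measurable_restrict_subset) simp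
    moreover have "distr (\<nu>s B) (\<nu>s B) (\<lambda>g. restrict g B) = \<nu>s B"
      by (subst distr_cong[where g = "\<lambda>g. g", OF refl refl]) (auto simp: space_PiM PiE_restrict)
    ultimately show "Q (\<lambda>g. restrict g B)"
      unfolding Q_def by (auto intro!: exI[of _ "_::'x \<Rightarrow> 'g"] PiE_restrict)
  next
    fix \<Psi> :: "('x \<Rightarrow> 'g) \<Rightarrow> 'x \<Rightarrow> 'g" and x y s assume x: "x \<in> B" and y: "y \<in> B" and xy: "x \<noteq> y" and Q: "Q \<Psi>"
    define a where "a f = (if s then f y else inv (f y))" for f :: "'x \<Rightarrow> 'g"
    define k where "k f g = a f \<otimes> g \<otimes> inv (a f)" for f g
    have [measurable]: "(\<lambda>f. f y) \<in> \<nu>s B \<rightarrow>\<^sub>M borel" "(\<lambda>f. f x) \<in> \<nu>s B \<rightarrow>\<^sub>M borel"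
      using measurable_component_singleton[OF y, of "\<lambda>_. \<nu>"] measurable_component_singleton[OF x, of "\<lambda>_. \<nu>"]
      by (simp_all add: measurable_cong_sets[OF refl sets_nu])
    have k1: "(\<lambda>f. k f (f x)) \<in> \<nu>s B \<rightarrow>\<^sub>M borel" unfolding k_def a_def by (cases s) simp_all
    have k2: "k (f(x := g)) = k f" for f g using xy by (auto simp: k_def a_def)
    have k3: "k f \<in> borel_measurable borel \<and> distr \<nu> borel (k f) = \<nu>" for f
      unfolding k_def using conj_inv[of "a f"] by simp
    have "Q (\<lambda>g. (\<Psi> g)(x := k (\<Psi> g) (\<Psi> g x)))"
    proof (rule Q_comp[OF Q, of "\<lambda>f. f(x := k f (f x))"])
      show "\<forall>f\<in>PiE B (\<lambda>_. UNIV). \<exists>g\<in>PiE B (\<lambda>_. UNIV). g(x := k g (g x)) = f"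
      proof
        fix f :: "'x \<Rightarrow> 'g" assume f: "f \<in> PiE B (\<lambda>_. UNIV)"
        \<comment> \<open>The conjugating element depends only on the coordinate \<open>y\<close>,
          which the move leaves in place, so the opposite conjugation undoes the move.\<close>
        let ?g = "f(x := inv (a f) \<otimes> f x \<otimes> a f)"
        have "k ?g (?g x) = f x"
          unfolding k2 unfolding k_def using UN by (simp add: m_assoc) (simp add: m_assoc[symmetric])
        moreover have "?g \<in> PiE B (\<lambda>_. UNIV)" using f x by (auto simp: PiE_def extensional_def)
        ultimately show "\<exists>g\<in>PiE B (\<lambda>_. UNIV). g(x := k g (g x)) = f"
          by (intro bexI[of _ ?g]) auto
      qed
    qed (rule preserves_coordinate_change[OF fin x k1 k2 k3])+
    then show "Q (\<lambda>g. (\<Psi> g)(x := (if s then \<Psi> g y else inv \<Psi> g y) \<otimes> \<Psi> g x \<otimes> inv (if s then \<Psi> g y else inv \<Psi> g y)))"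
      unfolding k_def a_def .
  next
    fix \<Psi> :: "('x \<Rightarrow> 'g) \<Rightarrow> 'x \<Rightarrow> 'g" and x assume x: "x \<in> B" and Q: "Q \<Psi>"
    define k where "k f g = inv g" for f :: "'x \<Rightarrow> 'g" and g
    have [measurable]: "(\<lambda>f. f x) \<in> \<nu>s B \<rightarrow>\<^sub>M borel"
      using measurable_component_singleton[OF x, of "\<lambda>_. \<nu>"]
      by (simp add: measurable_cong_sets[OF refl sets_nu])
    have k1: "(\<lambda>f. k f (f x)) \<in> \<nu>s B \<rightarrow>\<^sub>M borel" unfolding k_def by simp
    have k2: "k (f(x := g)) = k f" for f g by (auto simp: k_def)
    have k3: "k f \<in> borel_measurable borel \<and> distr \<nu> borel (k f) = \<nu>" for f
      unfolding k_def using inv_inv_law by simp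
    have "Q (\<lambda>g. (\<Psi> g)(x := k (\<Psi> g) (\<Psi> g x)))"
    proof (rule Q_comp[OF Q, of "\<lambda>f. f(x := k f (f x))"])
      show "\<forall>f\<in>PiE B (\<lambda>_. UNIV). \<exists>g\<in>PiE B (\<lambda>_. UNIV). g(x := k g (g x)) = f"
      proof
        fix f :: "'x \<Rightarrow> 'g" assume f: "f \<in> PiE B (\<lambda>_. UNIV)"
        have "f(x := inv (f x)) \<in> PiE B (\<lambda>_. UNIV)" using f x by (auto simp: PiE_def extensional_def)
        then show "\<exists>g\<in>PiE B (\<lambda>_. UNIV). g(x := k g (g x)) = f"
          by (intro bexI[of _ "f(x := inv (f x))"]) (auto simp: k_def UN)
      qed
    qed (rule preserves_coordinate_change[OF fin x k1 k2 k3])+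
    then show "Q (\<lambda>g. (\<Psi> g)(x := inv \<Psi> g x))" unfolding k_def .
  qed
  then show "\<Psi> \<in> \<nu>s B \<rightarrow>\<^sub>M \<nu>s B" "distr (\<nu>s B) (\<nu>s B) \<Psi> = \<nu>s B"
    "\<And>f. f \<in> PiE B (\<lambda>_. UNIV) \<Longrightarrow> \<exists>g. \<Psi> g = f"
    unfolding Q_def \<Psi>_def by blast+
qed

end


section \<open>Configurations and void events\<close>

abbreviation void_event :: "'a set \<Rightarrow> 'a set set" where
  "void_event D \<equiv> {S. S \<inter> D = {}}"

text \<open>A family stable under intersection, since voids in two sets amount to a void in their
  union. Bounded sets have finite area, so that the Poisson hypotheses give their void
  probabilities.\<close>

definition bounded_voids :: "'a::metric_space set set set" where
  "bounded_voids = {void_event D | D. D \<in> sets borel \<and> bounded D}"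

lemma bounded_voidsI: "D \<in> sets borel \<Longrightarrow> bounded D \<Longrightarrow> void_event D \<in> bounded_voids"
  unfolding bounded_voids_def by blast

lemma bounded_voidsE:
  assumes "V \<in> bounded_voids"
  obtains D where "V = void_event D" "D \<in> sets borel" "bounded D"
  using assms unfolding bounded_voids_def by blast

lemma space_config [simp]: "space (config_algebra N) = UNIV"
  by (simp add: config_algebra_def space_measure_of_conv)

lemma count_event: "A \<in> sets N \<Longrightarrow> {S. finite (S \<inter> A) \<and> card (S \<inter> A) = n} \<in> sets (config_algebra N)"
  by (auto simp: config_algebra_def)

lemma void_event_sets: "A \<in> sets N \<Longrightarrow> void_event A \<in> sets (config_algebra N)"
proof -
  have "void_event A = {S. finite (S \<inter> A) \<and> card (S \<inter> A) = 0}" by (auto simp: card_eq_0_iff)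
  then show "A \<in> sets N \<Longrightarrow> void_event A \<in> sets (config_algebra N)" using count_event[of A N 0] by simp
qed

lemma sigma_algebra_voids: "sigma_algebra UNIV (sigma_sets UNIV bounded_voids)"
  by (rule sigma_algebra_sigma_sets) simp

lemma void_in_sigma:
  assumes "D \<in> sets (borel :: 'a::euclidean_space measure)"
  shows "void_event D \<in> sigma_sets UNIV bounded_voids"
proof -
  interpret sigma_algebra UNIV "sigma_sets UNIV (bounded_voids :: 'a set set set)"
    by (rule sigma_algebra_voids)
  have "void_event D = (\<Inter>k. void_event (D \<inter> cball 0 (real k)))"
  proof (intro subset_antisym subsetI)
    fix S assume S: "S \<in> (\<Inter>k. void_event (D \<inter> cball 0 (real k)))"
    have "x \<notin> S \<inter> D" for x
    proof
      assume "x \<in> S \<inter> D"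
      moreover obtain k where "norm x \<le> real k" using real_arch_simple by blast
      ultimately have "x \<in> S \<inter> (D \<inter> cball 0 (real k))" by auto
      moreover have "S \<inter> (D \<inter> cball 0 (real k)) = {}" using S by blast
      ultimately show False by blast
    qed
    then show "S \<in> void_event D" by auto
  qed auto
  moreover have "void_event (D \<inter> cball 0 (real k)) \<in> sigma_sets UNIV bounded_voids" for k
    using assms by (intro sigma_sets.Basic bounded_voidsI) (auto simp: bounded_Int)
  then have "(\<Inter>k. void_event (D \<inter> cball 0 (real k))) \<in> sigma_sets UNIV bounded_voids"
    by (intro countable_INT'' sigma_sets_top) auto
  ultimately show ?thesis by (simp only:)
qed

text \<open>There are at least \<open>n + 1\<close> points in \<open>A\<close> if and only if some
  basic open set \<open>V\<close> contains a point of \<open>S \<inter> A\<close> while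
  \<open>A - V\<close> still contains \<open>n\<close> of them; a countable basis suffices. An
  infinite intersection counts as at least \<open>n\<close> for every \<open>n\<close>.\<close>

lemma atleast_in_sigma:
  assumes "A \<in> sets (borel :: 'a::euclidean_space measure)"
  shows "{S. infinite (S \<inter> A) \<or> n \<le> card (S \<inter> A)} \<in> sigma_sets UNIV bounded_voids"
  using assms
proof (induction n arbitrary: A)
  case 0
  have "{S. infinite (S \<inter> A) \<or> 0 \<le> card (S \<inter> A)} = UNIV" by auto
  then show ?case by (simp add: sigma_sets_top)
next
  case (Suc n)
  interpret sigma_algebra UNIV "sigma_sets UNIV (bounded_voids :: 'a set set set)"
    by (rule sigma_algebra_voids)
  obtain \<B> :: "'a set set" where \<B>: "countable \<B>" "topological_basis \<B>"
    using ex_countable_basis by blast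
  have "{S. infinite (S \<inter> A) \<or> Suc n \<le> card (S \<inter> A)} =
    (\<Union>V\<in>\<B>. (UNIV - void_event (A \<inter> V)) \<inter> {S. infinite (S \<inter> (A - V)) \<or> n \<le> card (S \<inter> (A - V))})"
  proof (intro subset_antisym subsetI)
    fix S assume "S \<in> {S. infinite (S \<inter> A) \<or> Suc n \<le> card (S \<inter> A)}"
    then have S: "infinite (S \<inter> A) \<or> Suc n \<le> card (S \<inter> A)" by simp
    have "\<exists>F. finite F \<and> card F = Suc n \<and> F \<subseteq> S \<inter> A"
    proof (cases "finite (S \<inter> A)")
      case True
      then have "Suc n \<le> card (S \<inter> A)" using S by simp
      then obtain T where "T \<subseteq> S \<inter> A" "card T = Suc n" "finite T" by (rule obtain_subset_with_card_n)
      then show ?thesis by (intro exI[of _ T] conjI)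
    qed (rule infinite_arbitrarily_large)
    then obtain F where F: "F \<subseteq> S \<inter> A" "finite F" "card F = Suc n" by blast
    then obtain x where x: "x \<in> F" by fastforce
    have "open (- (F - {x}))" using F(2) by (intro open_Compl finite_imp_closed) auto
    then obtain V where V: "V \<in> \<B>" "x \<in> V" "V \<subseteq> - (F - {x})"
      by (rule topological_basisE[OF \<B>(2), where x = x]) auto
    have sub: "F - {x} \<subseteq> S \<inter> (A - V)" using F(1) V(3) by auto
    have "infinite (S \<inter> (A - V)) \<or> n \<le> card (S \<inter> (A - V))"
      using card_mono[OF _ sub] F x by (cases "finite (S \<inter> (A - V))") simp_all
    moreover have "S \<notin> void_event (A \<inter> V)" using x V F(1) by auto
    ultimately show "S \<in> (\<Union>V\<in>\<B>. (UNIV - void_event (A \<inter> V)) \<inter> {S. infinite (S \<inter> (A - V)) \<or> n \<le> card (S \<inter> (A - V))})"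
      using V(1) by auto
  next
    fix S assume "S \<in> (\<Union>V\<in>\<B>. (UNIV - void_event (A \<inter> V)) \<inter> {S. infinite (S \<inter> (A - V)) \<or> n \<le> card (S \<inter> (A - V))})"
    then obtain V x where V: "x \<in> S \<inter> A \<inter> V" "infinite (S \<inter> (A - V)) \<or> n \<le> card (S \<inter> (A - V))" by auto
    show "S \<in> {S. infinite (S \<inter> A) \<or> Suc n \<le> card (S \<inter> A)}"
    proof (cases "finite (S \<inter> A)")
      case True
      have sub: "insert x (S \<inter> (A - V)) \<subseteq> S \<inter> A" using V(1) by auto
      have fin: "finite (S \<inter> (A - V))" using True by (rule rev_finite_subset) auto
      have "Suc n \<le> card (insert x (S \<inter> (A - V)))" using V fin by simp
      also have "\<dots> \<le> card (S \<inter> A)" using True sub by (rule card_mono)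
      finally show ?thesis by simp
    qed simp
  qed
  also have "\<dots> \<in> sigma_sets UNIV bounded_voids"
  proof (rule countable_UN'[OF \<B>(1)], rule image_subsetI)
    fix V assume "V \<in> \<B>"
    then have V: "open V" by (rule topological_basis_open[OF \<B>(2)])
    have "void_event (A \<inter> V) \<in> sigma_sets UNIV bounded_voids"
      using V Suc.prems by (intro void_in_sigma) auto
    moreover have "{S. infinite (S \<inter> (A - V)) \<or> n \<le> card (S \<inter> (A - V))} \<in> sigma_sets UNIV bounded_voids"
      using V Suc.prems by (intro Suc.IH) auto
    ultimately show "(UNIV - void_event (A \<inter> V)) \<inter> {S. infinite (S \<inter> (A - V)) \<or> n \<le> card (S \<inter> (A - V))}
        \<in> sigma_sets UNIV bounded_voids" by (intro Int compl_sets)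
  qed
  finally show ?case .
qed

text \<open>Counting events are differences of two events of the form at least \<open>n\<close>,
  hence void events generate the whole algebra. This is the principle behind Renyi's
  characterization of point processes by void probabilities.\<close>

lemma sets_config_borel: "sets (config_algebra (borel :: 'a::euclidean_space measure)) = sigma_sets UNIV bounded_voids"
proof -
  interpret sigma_algebra UNIV "sigma_sets UNIV (bounded_voids :: 'a set set set)"
    by (rule sigma_algebra_voids)
  have eq: "sets (config_algebra (borel :: 'a measure)) =
      sigma_sets UNIV {{S. finite (S \<inter> A) \<and> card (S \<inter> A) = n} | A n. A \<in> sets borel}"
    by (simp add: config_algebra_def)
  have "{S. finite (S \<inter> A) \<and> card (S \<inter> A) = n} \<in> sigma_sets UNIV bounded_voids"
    if "A \<in> sets (borel :: 'a measure)" for A n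
  proof -
    have "{S. finite (S \<inter> A) \<and> card (S \<inter> A) = n} =
      {S. infinite (S \<inter> A) \<or> n \<le> card (S \<inter> A)} - {S. infinite (S \<inter> A) \<or> Suc n \<le> card (S \<inter> A)}" by auto
    then show ?thesis
      using Diff[OF atleast_in_sigma[OF that, of n] atleast_in_sigma[OF that, of "Suc n"]] by (simp only:)
  qed
  then have "sets (config_algebra (borel :: 'a measure)) \<subseteq> sigma_sets UNIV bounded_voids"
    unfolding eq by (intro sigma_sets_subset subsetI) (elim CollectE exE conjE, simp only:)
  moreover have "sigma_sets UNIV (bounded_voids :: 'a set set set) \<subseteq> sets (config_algebra (borel :: 'a measure))"
    using sets.sigma_sets_subset[of bounded_voids "config_algebra (borel :: 'a measure)"]
    by (auto elim!: bounded_voidsE intro: void_event_sets)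
  ultimately show ?thesis by auto
qed

lemma Int_stable_bounded_voids: "Int_stable bounded_voids"
proof (rule Int_stableI)
  fix a b :: "'a set set" assume "a \<in> bounded_voids" "b \<in> bounded_voids"
  then obtain D D' where D: "a = void_event D" "b = void_event D'" "D \<in> sets borel" "bounded D" "D' \<in> sets borel" "bounded D'"
    by (elim bounded_voidsE)
  then have "a \<inter> b = void_event (D \<union> D')" by auto
  then show "a \<inter> b \<in> bounded_voids" using D by (simp add: bounded_voidsI del: Int_Un_distrib)
qed

lemma measurable_config_borelI:
  fixes Y :: "'w \<Rightarrow> 'a::euclidean_space set"
  assumes "\<And>D. D \<in> sets borel \<Longrightarrow> bounded D \<Longrightarrow> {w \<in> space M. Y w \<inter> D = {}} \<in> sets M"
  shows "Y \<in> M \<rightarrow>\<^sub>M config_algebra borel"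
proof (rule measurable_sigma_sets[OF sets_config_borel])
  fix V :: "'a set set" assume "V \<in> bounded_voids"
  then obtain D where D: "V = void_event D" "D \<in> sets borel" "bounded D" by (rule bounded_voidsE)
  have "Y -` V \<inter> space M = {w \<in> space M. Y w \<inter> D = {}}" unfolding D(1) by auto
  with assms[OF D(2,3)] show "Y -` V \<inter> space M \<in> sets M" by simp
qed auto

text \<open>A Dynkin class argument. With \<open>A\<close> and \<open>A'\<close> the whole space and
  \<open>c = 1\<close> it compares two laws; with \<open>A\<close> an event about marks it shows
  that this event is independent of the configuration, \<open>c\<close> being its conditional
  probability.\<close>

lemma (in prob_space) void_probabilities_determine:
  fixes Y Y' :: "'a \<Rightarrow> 'b::euclidean_space set"
  assumes Y: "Y \<in> M \<rightarrow>\<^sub>M config_algebra borel" "Y' \<in> M \<rightarrow>\<^sub>M config_algebra borel"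
    and A: "A \<in> sets M" "A' \<in> sets M"
    and void: "\<And>D. D \<in> sets borel \<Longrightarrow> bounded D \<Longrightarrow>
      prob (A \<inter> {w \<in> space M. Y w \<inter> D = {}}) = c * prob (A' \<inter> {w \<in> space M. Y' w \<inter> D = {}})"
    and E: "E \<in> sets (config_algebra borel)"
  shows "prob (A \<inter> (Y -` E \<inter> space M)) = c * prob (A' \<inter> (Y' -` E \<inter> space M))"
proof -
  have meas: "A \<inter> (Y -` E \<inter> space M) \<in> sets M" "A' \<inter> (Y' -` E \<inter> space M) \<in> sets M"
    if "E \<in> sigma_sets UNIV bounded_voids" for E
    using that A by (auto intro!: sets.Int measurable_sets[OF Y(1)] measurable_sets[OF Y(2)] simp: sets_config_borel)
  have all: "prob A = c * prob A'"
    using void[of "{}"] A by (simp add: Int_absorb2 sets.sets_into_space)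
  have "bounded_voids \<subseteq> Pow (UNIV :: 'b set set)" by simp
  moreover have "E \<in> sigma_sets UNIV bounded_voids" using E by (simp add: sets_config_borel)
  ultimately show ?thesis
  proof (induction rule: sigma_sets_induct_disjoint[OF Int_stable_bounded_voids, consumes 2, case_names basic empty compl union])
    case (basic V)
    then obtain D where D: "V = void_event D" "D \<in> sets borel" "bounded D" by (rule bounded_voidsE)
    have "Y -` V \<inter> space M = {w \<in> space M. Y w \<inter> D = {}}" "Y' -` V \<inter> space M = {w \<in> space M. Y' w \<inter> D = {}}"
      unfolding D(1) by auto
    with void[OF D(2,3)] show ?case by simp
  next
    case (compl V)
    have "A \<inter> (Y -` (UNIV - V) \<inter> space M) = A - A \<inter> (Y -` V \<inter> space M)"
      "A' \<inter> (Y' -` (UNIV - V) \<inter> space M) = A' - A' \<inter> (Y' -` V \<inter> space M)"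
      using sets.sets_into_space[OF A(1)] sets.sets_into_space[OF A(2)] by auto
    then show ?case
      using meas[OF compl(1)] A compl(2) all
      by (simp add: finite_measure_Diff right_diff_distrib)
  next
    case (union V)
    let ?f = "\<lambda>i. A \<inter> (Y -` V i \<inter> space M)" and ?g = "\<lambda>i. A' \<inter> (Y' -` V i \<inter> space M)"
    have V: "V i \<in> sigma_sets UNIV bounded_voids" for i using union(2) by auto
    have "A \<inter> (Y -` (\<Union>i. V i) \<inter> space M) = (\<Union>i. ?f i)" "A' \<inter> (Y' -` (\<Union>i. V i) \<inter> space M) = (\<Union>i. ?g i)" by auto
    moreover have "(\<lambda>i. prob (?f i)) sums prob (\<Union>i. ?f i)"
      using meas(1)[OF V] union(1) by (intro finite_measure_UNION) (auto simp: disjoint_family_on_def)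
    moreover have "(\<lambda>i. prob (?g i)) sums prob (\<Union>i. ?g i)"
      using meas(2)[OF V] union(1) by (intro finite_measure_UNION) (auto simp: disjoint_family_on_def)
    then have "(\<lambda>i. prob (?f i)) sums (c * prob (\<Union>i. ?g i))"
      unfolding union(3) by (rule sums_mult)
    ultimately show ?case using sums_unique2 by metis
  qed simp
qed


section \<open>Marked Poisson processes\<close>

locale marked_poisson = prob_space M for M :: "'w measure" +
  fixes K :: real and \<mu> :: "'e::euclidean_space measure" and P :: "'w \<Rightarrow> (complex \<times> 'e) set"
  assumes K: "K > 0" and prob_mu: "prob_space \<mu>" and sets_mu [simp, measurable_cong]: "sets \<mu> = sets borel"
    and poisson: "poisson_process M (scale_measure (ennreal K) (lborel \<Otimes>\<^sub>M \<mu>)) P"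
begin

definition \<Lambda> :: "(complex \<times> 'e) measure" where "\<Lambda> = scale_measure (ennreal K) (lborel \<Otimes>\<^sub>M \<mu>)"
definition X :: "'w \<Rightarrow> complex set" where "X w = fst ` P w"
definition poi :: "real \<Rightarrow> nat \<Rightarrow> real" where "poi a n = a ^ n / fact n * exp (- a)"

lemma space_mu [simp]: "space \<mu> = UNIV"
  using sets_eq_imp_space_eq[OF sets_mu] by simp

lemma rect_sets: "A \<in> sets borel \<Longrightarrow> C \<in> sets borel \<Longrightarrow> A \<times> C \<in> sets \<Lambda>"
  by (simp add: \<Lambda>_def)

lemma rect_emeasure:
  assumes "A \<in> sets borel" "C \<in> sets borel"
  shows "emeasure \<Lambda> (A \<times> C) = ennreal K * (emeasure lborel A * emeasure \<mu> C)"
proof -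
  interpret \<mu>: prob_space \<mu> by (rule prob_mu)
  interpret \<mu>s: sigma_finite_measure \<mu> by unfold_locales
  show ?thesis using assms by (simp add: \<Lambda>_def \<mu>.emeasure_pair_measure_Times)
qed

lemma rect_finite:
  assumes "A \<in> sets borel" "bounded A" "C \<in> sets borel"
  shows "emeasure \<Lambda> (A \<times> C) < \<infinity>" "measure \<Lambda> (A \<times> C) = K * measure lborel A * measure \<mu> C"
proof -
  interpret \<mu>: prob_space \<mu> by (rule prob_mu)
  have "emeasure lborel A < \<infinity>" using emeasure_bounded_finite[OF assms(2)] by simp
  then show "emeasure \<Lambda> (A \<times> C) < \<infinity>"
    using assms \<mu>.emeasure_finite[of C] by (simp add: rect_emeasure ennreal_mult_eq_top_iff less_top[symmetric])
  show "measure \<Lambda> (A \<times> C) = K * measure lborel A * measure \<mu> C"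
    using rect_emeasure[OF assms(1,3)] K by (simp add: measure_def enn2real_mult)
qed

lemma P_measurable: "P \<in> M \<rightarrow>\<^sub>M config_algebra \<Lambda>"
  using poisson by (simp add: poisson_process_def \<Lambda>_def)

lemma P_finite: "A \<in> sets \<Lambda> \<Longrightarrow> emeasure \<Lambda> A < \<infinity> \<Longrightarrow> AE w in M. finite (P w \<inter> A)"
  using poisson by (simp add: poisson_process_def \<Lambda>_def)

lemma P_count: "A \<in> sets \<Lambda> \<Longrightarrow> emeasure \<Lambda> A < \<infinity> \<Longrightarrow>
    prob {w \<in> space M. card (P w \<inter> A) = n} = poi (measure \<Lambda> A) n"
  using poisson by (simp add: poisson_process_def \<Lambda>_def poi_def)

lemma P_indep:
  "disjoint_family A \<Longrightarrow> (\<And>i. A i \<in> sets \<Lambda> \<and> emeasure \<Lambda> (A i) < \<infinity>) \<Longrightarrow>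
    indep_vars (\<lambda>_. count_space UNIV) (\<lambda>i w. card (P w \<inter> A i)) (UNIV :: nat set)"
  using poisson by (simp add: poisson_process_def \<Lambda>_def)

lemma count_sets:
  "A \<in> sets \<Lambda> \<Longrightarrow> {w \<in> space M. finite (P w \<inter> A) \<and> card (P w \<inter> A) = n} \<in> sets M"
  using measurable_sets[OF P_measurable count_event[of A \<Lambda> n]] by (simp add: vimage_def Int_def conj_commute)

text \<open>Independence is given for sequences of domains indexed by \<open>nat\<close>; a finite
  family is enumerated and continued by empty sets.\<close>

lemma P_joint:
  assumes I: "finite I" and A: "disjoint_family_on A I" "\<And>i. i \<in> I \<Longrightarrow> A i \<in> sets \<Lambda>" "\<And>i. i \<in> I \<Longrightarrow> emeasure \<Lambda> (A i) < \<infinity>"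
  shows "prob {w \<in> space M. \<forall>i\<in>I. card (P w \<inter> A i) = n i} = (\<Prod>i\<in>I. poi (measure \<Lambda> (A i)) (n i))"
proof (cases "I = {}")
  case False
  obtain h where h: "bij_betw h {0..<card I} I" using ex_bij_betw_nat_finite[OF I] by blast
  define A' where "A' j = (if j < card I then A (h j) else {})" for j
  have hI: "h j \<in> I" if "j < card I" for j using h that by (auto simp: bij_betw_def)
  have inj: "inj_on h {0..<card I}" using h by (simp add: bij_betw_def)
  have "disjoint_family A'"
    unfolding disjoint_family_on_def
  proof (intro ballI impI)
    fix j k :: nat assume jk: "j \<noteq> k"
    show "A' j \<inter> A' k = {}"
    proof (cases "j < card I \<and> k < card I")
      case True
      then have "h j \<noteq> h k" using inj jk by (auto simp: inj_on_def)
      then show ?thesis using True hI A(1) by (simp add: A'_def disjoint_family_on_def)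
    qed (auto simp: A'_def)
  qed
  moreover have A'2: "A' j \<in> sets \<Lambda> \<and> emeasure \<Lambda> (A' j) < \<infinity>" for j
    using A(2,3) hI by (simp add: A'_def)
  ultimately have ind: "indep_vars (\<lambda>_. count_space UNIV) (\<lambda>i w. card (P w \<inter> A' i)) (UNIV :: nat set)"
    by (rule P_indep)
  have ne: "{0..<card I} \<noteq> {}" using False I by (simp add: card_gt_0_iff)
  have "prob (\<Inter>j\<in>{0..<card I}. (\<lambda>w. card (P w \<inter> A' j)) -` {n (h j)} \<inter> space M) =
      (\<Prod>j\<in>{0..<card I}. prob ((\<lambda>w. card (P w \<inter> A' j)) -` {n (h j)} \<inter> space M))"
    by (rule indep_varsD[OF ind ne]) auto
  also have "(\<Inter>j\<in>{0..<card I}. (\<lambda>w. card (P w \<inter> A' j)) -` {n (h j)} \<inter> space M) =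
      {w \<in> space M. \<forall>i\<in>I. card (P w \<inter> A i) = n i}"
  proof -
    have 1: "(\<Inter>j\<in>J. (\<lambda>w. card (P w \<inter> A' j)) -` {n (h j)} \<inter> space M) =
        {w \<in> space M. \<forall>j\<in>J. card (P w \<inter> A' j) = n (h j)}" if "J \<noteq> {}" for J
      using that by auto
    have 2: "(\<forall>i\<in>I. card (P w \<inter> A i) = n i) \<longleftrightarrow> (\<forall>j\<in>{0..<card I}. card (P w \<inter> A' j) = n (h j))" for w
    proof -
      have "(\<forall>i\<in>I. card (P w \<inter> A i) = n i) \<longleftrightarrow> (\<forall>i\<in>h ` {0..<card I}. card (P w \<inter> A i) = n i)"
        by (simp only: bij_betw_imp_surj_on[OF h])
      also have "\<dots> \<longleftrightarrow> (\<forall>j\<in>{0..<card I}. card (P w \<inter> A' j) = n (h j))"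
        by (auto simp: A'_def)
      finally show ?thesis .
    qed
    show ?thesis unfolding 1[OF ne] 2 ..
  qed
  also have "(\<Prod>j\<in>{0..<card I}. prob ((\<lambda>w. card (P w \<inter> A' j)) -` {n (h j)} \<inter> space M)) =
      (\<Prod>j\<in>{0..<card I}. poi (measure \<Lambda> (A (h j))) (n (h j)))"
  proof (rule prod.cong[OF refl])
    fix j assume j: "j \<in> {0..<card I}"
    have "(\<lambda>w. card (P w \<inter> A' j)) -` {n (h j)} \<inter> space M = {w \<in> space M. card (P w \<inter> A' j) = n (h j)}" by auto
    then show "prob ((\<lambda>w. card (P w \<inter> A' j)) -` {n (h j)} \<inter> space M) = poi (measure \<Lambda> (A (h j))) (n (h j))"
      using P_count[of "A' j" "n (h j)"] A'2[of j] j by (simp add: A'_def)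
  qed
  also have "\<dots> = (\<Prod>i\<in>I. poi (measure \<Lambda> (A i)) (n i))"
    by (rule prod.reindex_bij_betw[OF h])
  finally show ?thesis .
qed (simp add: prob_space)

lemma X_void: "X w \<inter> D = {} \<longleftrightarrow> P w \<inter> D \<times> UNIV = {}"
  by (auto simp: X_def)

lemma void_sets: "D \<in> sets borel \<Longrightarrow> {w \<in> space M. X w \<inter> D = {}} \<in> sets M"
proof -
  assume D: "D \<in> sets borel"
  have "{w \<in> space M. X w \<inter> D = {}} = {w \<in> space M. finite (P w \<inter> D \<times> UNIV) \<and> card (P w \<inter> D \<times> UNIV) = 0}"
    unfolding X_void by (auto simp: card_eq_0_iff)
  with count_sets[OF rect_sets[OF D], of UNIV 0] show ?thesis by simp
qed

lemma X_measurable: "X \<in> M \<rightarrow>\<^sub>M config_algebra borel"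
  by (rule measurable_config_borelI) (rule void_sets)

lemma void_prob:
  assumes D: "D \<in> sets borel" "emeasure lborel D < \<infinity>"
  shows "prob {w \<in> space M. X w \<inter> D = {}} = exp (- (K * measure lborel D))"
proof -
  interpret \<mu>: prob_space \<mu> by (rule prob_mu)
  have fin: "emeasure \<Lambda> (D \<times> UNIV) < \<infinity>"
    using D \<mu>.emeasure_finite[of UNIV] by (simp add: rect_emeasure ennreal_mult_eq_top_iff less_top[symmetric])
  have m: "measure \<Lambda> (D \<times> UNIV) = K * measure lborel D"
    using rect_emeasure[OF D(1), of UNIV] \<mu>.emeasure_space_1 K by (simp add: measure_def enn2real_mult)
  have r: "D \<times> UNIV \<in> sets \<Lambda>" by (rule rect_sets[OF D(1)]) simp
  have "prob {w \<in> space M. X w \<inter> D = {}} = prob {w \<in> space M. card (P w \<inter> D \<times> UNIV) = 0}"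
  proof (rule prob_eq_AE)
    show "AE w in M. X w \<inter> D = {} \<longleftrightarrow> card (P w \<inter> D \<times> UNIV) = 0"
      using P_finite[OF r fin] by eventually_elim (simp add: X_void)
    show "{w \<in> space M. X w \<inter> D = {}} \<in> events" by (rule void_sets[OF D(1)])
    have ind: "indep_vars (\<lambda>_. count_space UNIV) (\<lambda>i w. card (P w \<inter> (if i = 0 then D \<times> UNIV else {}))) (UNIV :: nat set)"
      by (rule P_indep) (use r fin in \<open>auto simp: disjoint_family_on_def\<close>)
    have "(\<lambda>w. card (P w \<inter> (if (0::nat) = 0 then D \<times> UNIV else {}))) \<in> M \<rightarrow>\<^sub>M count_space UNIV"
      using bspec[OF conjunct1[OF ind[unfolded indep_vars_def]] UNIV_I, of 0] .
    then have "(\<lambda>w. card (P w \<inter> D \<times> UNIV)) \<in> M \<rightarrow>\<^sub>M count_space UNIV" by simp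
    from measurable_sets[OF this, of "{0}"]
    show "{w \<in> space M. card (P w \<inter> D \<times> UNIV) = 0} \<in> events" by (simp add: vimage_def Int_def conj_commute)
  qed
  also have "\<dots> = exp (- (K * measure lborel D))"
    using P_count[OF r fin, of 0] by (simp add: poi_def m)
  finally show ?thesis .
qed

end


section \<open>Distinct abscissas, and invariance under area-preserving maps\<close>

context marked_poisson
begin

text \<open>The algebra of configurations sees a count only together with finiteness. Measurability
  of the bare \<open>card\<close> is part of the independence hypothesis, used for the sequence
  \<open>A\<close>, \<open>{}\<close>, \<open>{}\<close> and so on.\<close>

lemma card_rv:
  assumes "A \<in> sets \<Lambda>" "emeasure \<Lambda> A < \<infinity>"
  shows "(\<lambda>w. card (P w \<inter> A)) \<in> M \<rightarrow>\<^sub>M count_space UNIV"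
proof -
  have ind: "indep_vars (\<lambda>_. count_space UNIV) (\<lambda>i w. card (P w \<inter> (if i = 0 then A else {}))) (UNIV :: nat set)"
    by (rule P_indep) (use assms in \<open>auto simp: disjoint_family_on_def\<close>)
  have "(\<lambda>w. card (P w \<inter> (if (0::nat) = 0 then A else {}))) \<in> M \<rightarrow>\<^sub>M count_space UNIV"
    using bspec[OF conjunct1[OF ind[unfolded indep_vars_def]] UNIV_I, of 0] .
  then show ?thesis by simp
qed

lemma card_sets:
  assumes "A \<in> sets \<Lambda>" "emeasure \<Lambda> A < \<infinity>"
  shows "{w \<in> space M. card (P w \<inter> A) = n} \<in> sets M"
  using measurable_sets[OF card_rv[OF assms], of "{n}"] by (simp add: vimage_def Int_def conj_commute)

text \<open>The probability is \<open>1 - (1 + a) * exp (- a)\<close>, and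
  \<open>exp (- a) \<ge> 1 - a\<close> bounds it by the square of \<open>a\<close>.\<close>

lemma prob_at_most_one:
  assumes A: "A \<in> sets \<Lambda>" "emeasure \<Lambda> A < \<infinity>"
  shows "prob {w \<in> space M. \<not> (finite (P w \<inter> A) \<and> card (P w \<inter> A) \<le> 1)} \<le> (measure \<Lambda> A)\<^sup>2"
    and "{w \<in> space M. \<not> (finite (P w \<inter> A) \<and> card (P w \<inter> A) \<le> 1)} \<in> sets M"
proof -
  define a where "a = measure \<Lambda> A"
  let ?C = "\<lambda>n. {w \<in> space M. card (P w \<inter> A) = n}"
  let ?B = "{w \<in> space M. \<not> (finite (P w \<inter> A) \<and> card (P w \<inter> A) \<le> 1)}"
  have "?B = space M - ({w \<in> space M. finite (P w \<inter> A) \<and> card (P w \<inter> A) = 0} \<union> {w \<in> space M. finite (P w \<inter> A) \<and> card (P w \<inter> A) = 1})"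
    by (auto simp: le_Suc_eq)
  then show meas: "?B \<in> sets M"
    using count_sets[OF A(1), of 0] count_sets[OF A(1), of 1] by simp
  have "prob ?B = prob (space M - (?C 0 \<union> ?C 1))"
  proof (rule finite_measure_eq_AE)
    show "AE w in M. w \<in> ?B \<longleftrightarrow> w \<in> space M - (?C 0 \<union> ?C 1)"
      using P_finite[OF A]
    proof eventually_elim
      case (elim w)
      have "\<not> k \<le> 1 \<longleftrightarrow> k \<noteq> 0 \<and> k \<noteq> 1" for k :: nat by arith
      with elim show ?case by blast
    qed
  qed (use meas card_sets[OF A] in auto)
  also have "\<dots> = 1 - (prob (?C 0) + prob (?C 1))"
  proof -
    have "prob (?C 0 \<union> ?C 1) = prob (?C 0) + prob (?C 1)"
      by (rule finite_measure_Union[OF card_sets[OF A] card_sets[OF A]]) auto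
    then show ?thesis using card_sets[OF A] by (subst prob_compl) auto
  qed
  also have "\<dots> = 1 - (1 + a) * exp (- a)"
    using P_count[OF A, of 0] P_count[OF A, of 1] by (simp add: poi_def a_def algebra_simps)
  also have "\<dots> \<le> 1 - (1 + a) * (1 + (- a))"
    using exp_ge_add_one_self[of "- a"] by (intro diff_left_mono mult_left_mono) (auto simp: a_def)
  also have "\<dots> = a\<^sup>2" by (simp add: power2_eq_square algebra_simps)
  finally show "prob ?B \<le> (measure \<Lambda> A)\<^sup>2" by (simp add: a_def)
qed

lemma strip_emeasure:
  fixes L a b :: real
  assumes "L \<ge> 0" "a \<le> b"
  shows "emeasure lborel {z. a \<le> Re z \<and> Re z \<le> b \<and> \<bar>Im z\<bar> \<le> L} = ennreal ((b - a) * (2 * L))"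
proof -
  have "{z. a \<le> Re z \<and> Re z \<le> b \<and> \<bar>Im z\<bar> \<le> L} = cbox (Complex a (- L)) (Complex b L)"
    by (auto simp: cbox_def Basis_complex_def)
  then show ?thesis using assms
    by (simp add: emeasure_lborel_cbox_eq Basis_complex_def ennreal_mult'[symmetric] ennreal_1)
qed

text \<open>Cut a large disc into \<open>O(n)\<close> strips of width \<open>1 / n\<close>: the probability that one of them contains two
  points is \<open>O(1 / n)\<close>.\<close>

lemma AE_generic:
  fixes \<psi> :: "complex \<Rightarrow> complex"
  assumes cont: "continuous_on UNIV \<psi>"
    and pres: "\<And>A. A \<in> sets borel \<Longrightarrow> emeasure lborel (\<psi> -` A) = emeasure lborel A"
  shows "AE w in M. \<forall>a\<in>P w. \<forall>b\<in>P w. Re (\<psi> (fst a)) = Re (\<psi> (fst b)) \<longrightarrow> a = b"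
proof -
  interpret \<mu>: prob_space \<mu> by (rule prob_mu)
  have \<psi>m: "\<psi> -` A \<in> sets borel" if "A \<in> sets borel" for A
    using measurable_sets_borel[OF borel_measurable_continuous_onI[OF cont] that] .
  have main: "AE w in M. \<forall>a\<in>P w. \<forall>b\<in>P w. fst a \<in> cball 0 k \<longrightarrow> fst b \<in> cball 0 k \<longrightarrow>
      Re (\<psi> (fst a)) = Re (\<psi> (fst b)) \<longrightarrow> a = b" for k :: real
  proof -
    have "compact (\<psi> ` cball 0 k)" using cont by (intro compact_continuous_image continuous_on_subset[OF cont]) auto
    then obtain L0 where L0: "\<And>z. z \<in> cball 0 k \<Longrightarrow> norm (\<psi> z) \<le> L0"
      using compact_imp_bounded bounded_iff by (metis imageI)
    obtain L :: nat where L: "L > 0" "L0 \<le> real L" using real_arch_simple[of "max 1 L0"] 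
      by (metis le_max_iff_disj linorder_not_le max.boundedE of_nat_0 order.trans zero_less_one le_zero_eq not_one_le_zero gr0I)
    define S where "S n i = {z. real i / real n - real L \<le> Re z \<and> Re z \<le> real (Suc i) / real n - real L \<and> \<bar>Im z\<bar> \<le> real L}" for n i :: nat
    define R where "R n i = cball 0 k \<inter> \<psi> -` S n i" for n i
    \<comment> \<open>The index \<open>2 * L * n\<close> adds a strip beyond the abscissa
      \<open>L\<close>, so that the index obtained below by rounding down is admissible even for a
      point with abscissa exactly \<open>L\<close>.\<close>
    define Bad where "Bad n = (\<Union>i\<le>2 * L * n. {w \<in> space M. \<not> (finite (P w \<inter> R n i \<times> UNIV) \<and> card (P w \<inter> R n i \<times> UNIV) \<le> 1)})" for n
    have S: "S n i \<in> sets borel" "emeasure lborel (S n i) = ennreal (2 * real L / real n)" if "n > 0" for n i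
    proof -
      have "real (Suc i) / real n - real L - (real i / real n - real L) = 1 / real n" by (simp add: diff_divide_distrib[symmetric])
      then show "emeasure lborel (S n i) = ennreal (2 * real L / real n)"
        unfolding S_def using that by (subst strip_emeasure) (auto simp: divide_right_mono)
      have "closed (S n i)" unfolding S_def
        by (intro closed_Collect_conj closed_Collect_le continuous_intros)
      then show "S n i \<in> sets borel" by simp
    qed
    have R: "R n i \<times> UNIV \<in> sets \<Lambda>" "emeasure \<Lambda> (R n i \<times> UNIV) < \<infinity>" "measure \<Lambda> (R n i \<times> UNIV) \<le> K * (2 * real L / real n)"
      if n: "n > 0" for n i
    proof -
      have Rm: "R n i \<in> sets borel" "bounded (R n i)" using \<psi>m[OF S(1)[OF n]] by (auto simp: R_def bounded_Int)
      show "R n i \<times> UNIV \<in> sets \<Lambda>" by (rule rect_sets[OF Rm(1)]) simp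
      show "emeasure \<Lambda> (R n i \<times> UNIV) < \<infinity>" by (rule rect_finite[OF Rm]) simp
      have fin: "emeasure lborel (R n i) < \<infinity>" using emeasure_bounded_finite[OF Rm(2)] by simp
      have "emeasure lborel (R n i) \<le> emeasure lborel (\<psi> -` S n i)"
        unfolding R_def using \<psi>m[OF S(1)[OF n]] by (intro emeasure_mono) auto
      also have "\<dots> = ennreal (2 * real L / real n)" using pres[OF S(1)[OF n]] S(2)[OF n] by simp
      finally have "measure lborel (R n i) \<le> 2 * real L / real n"
        unfolding measure_def by (metis enn2real_leI divide_nonneg_nonneg mult_nonneg_nonneg of_nat_0_le_iff zero_le_numeral)
      then show "measure \<Lambda> (R n i \<times> UNIV) \<le> K * (2 * real L / real n)"
        using rect_finite(2)[OF Rm, of UNIV] \<mu>.prob_space K by (simp add: mult_left_mono del: times_divide_eq_right)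
    qed
    have Bad_sets: "Bad n \<in> sets M" if "n > 0" for n
      unfolding Bad_def using prob_at_most_one(2)[OF R(1,2)[OF that]] by (intro sets.finite_UN) auto
    have Bad_prob: "prob (Bad n) \<le> (12 * K\<^sup>2 * real L ^ 3) * (1 / real n)" if n: "n > 0" for n
    proof -
      have "prob (Bad n) \<le> (\<Sum>i\<le>2 * L * n. prob {w \<in> space M. \<not> (finite (P w \<inter> R n i \<times> UNIV) \<and> card (P w \<inter> R n i \<times> UNIV) \<le> 1)})"
        unfolding Bad_def using prob_at_most_one(2)[OF R(1,2)[OF n]] by (intro finite_measure_subadditive_finite) auto
      also have "\<dots> \<le> (\<Sum>i\<le>2 * L * n. (K * (2 * real L / real n))\<^sup>2)"
      proof (rule sum_mono)
        fix i
        have "prob {w \<in> space M. \<not> (finite (P w \<inter> R n i \<times> UNIV) \<and> card (P w \<inter> R n i \<times> UNIV) \<le> 1)} \<le> (measure \<Lambda> (R n i \<times> UNIV))\<^sup>2"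
          by (rule prob_at_most_one(1)[OF R(1,2)[OF n]])
        also have "\<dots> \<le> (K * (2 * real L / real n))\<^sup>2" by (intro power_mono R(3)[OF n]) simp
        finally show "prob {w \<in> space M. \<not> (finite (P w \<inter> R n i \<times> UNIV) \<and> card (P w \<inter> R n i \<times> UNIV) \<le> 1)} \<le> (K * (2 * real L / real n))\<^sup>2" .
      qed
      also have "\<dots> = (2 * real L * real n + 1) * (K * (2 * real L / real n))\<^sup>2" by simp
      also have "\<dots> \<le> (3 * real L * real n) * (K * (2 * real L / real n))\<^sup>2"
      proof (rule mult_right_mono)
        have "1 * 1 \<le> real L * real n" using L(1) n by (intro mult_mono) auto
        then show "2 * real L * real n + 1 \<le> 3 * real L * real n" by simp
      qed simp
      also have "\<dots> = (12 * K\<^sup>2 * real L ^ 3) * (1 / real n)" using n by (simp add: power2_eq_square power3_eq_cube field_simps)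
      finally show ?thesis .
    qed
    let ?N = "\<Inter>n. Bad (Suc n)"
    have N_sets: "?N \<in> sets M" by (rule sets.countable_INT') (auto intro: Bad_sets)
    have "prob ?N \<le> 0"
    proof (rule LIMSEQ_le_const)
      have "(\<lambda>n. (12 * K\<^sup>2 * real L ^ 3) * (1 / real (Suc n))) \<longlonglongrightarrow> (12 * K\<^sup>2 * real L ^ 3) * 0"
        by (intro tendsto_mult tendsto_const lim_inverse_n'[THEN LIMSEQ_Suc])
      then show "(\<lambda>n. (12 * K\<^sup>2 * real L ^ 3) * (1 / real (Suc n))) \<longlonglongrightarrow> 0" by simp
      have "prob ?N \<le> (12 * K\<^sup>2 * real L ^ 3) * (1 / real (Suc n))" for n
      proof (rule order_trans[OF finite_measure_mono Bad_prob])
        show "?N \<subseteq> Bad (Suc n)" by blast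
      qed (auto intro: Bad_sets)
      then show "\<exists>N. \<forall>n\<ge>N. prob ?N \<le> (12 * K\<^sup>2 * real L ^ 3) * (1 / real (Suc n))" by blast
    qed
    then have "prob ?N = 0" by (simp add: measure_le_0_iff)
    then have "emeasure M ?N = 0" by (simp add: emeasure_eq_measure)
    show ?thesis
    proof (rule AE_I[OF _ \<open>emeasure M ?N = 0\<close> N_sets], rule subsetI)
      fix w assume "w \<in> {w \<in> space M. \<not> (\<forall>a\<in>P w. \<forall>b\<in>P w. fst a \<in> cball 0 k \<longrightarrow> fst b \<in> cball 0 k \<longrightarrow>
          Re (\<psi> (fst a)) = Re (\<psi> (fst b)) \<longrightarrow> a = b)}"
      then obtain a b where ab: "w \<in> space M" "a \<in> P w" "b \<in> P w" "fst a \<in> cball 0 k" "fst b \<in> cball 0 k"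
        "Re (\<psi> (fst a)) = Re (\<psi> (fst b))" "a \<noteq> b" by blast
      have bd: "norm (\<psi> (fst a)) \<le> real L" "norm (\<psi> (fst b)) \<le> real L"
        using L0[OF ab(4)] L0[OF ab(5)] L(2) by auto
      define t where "t = Re (\<psi> (fst a)) + real L"
      have t: "0 \<le> t" "t \<le> 2 * real L" using abs_Re_le_cmod[of "\<psi> (fst a)"] bd(1) by (auto simp: t_def)
      have "w \<in> Bad (Suc n)" for n
      proof -
        define i where "i = nat \<lfloor>t * real (Suc n)\<rfloor>"
        have tn: "0 \<le> t * real (Suc n)" "t * real (Suc n) \<le> 2 * real L * real (Suc n)"
          using t by (auto intro: mult_right_mono simp del: of_nat_Suc)
        have i: "real i \<le> t * real (Suc n)" "t * real (Suc n) \<le> real (Suc i)"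
          using tn(1) by (auto simp: i_def simp del: of_nat_Suc) (simp_all add: nat_add_distrib, linarith+)
        have "real i \<le> real (2 * L * Suc n)" using i(1) tn(2) by (simp only: of_nat_mult of_nat_numeral)
        then have ile: "i \<le> 2 * L * Suc n" by (simp only: of_nat_le_iff)
        have "real i / real (Suc n) \<le> t" "t \<le> real (Suc i) / real (Suc n)"
          using i by (simp_all only: pos_divide_le_eq pos_le_divide_eq of_nat_0_less_iff zero_less_Suc)
        then have "\<psi> (fst a) \<in> S (Suc n) i" "\<psi> (fst b) \<in> S (Suc n) i"
          using bd abs_Im_le_cmod[of "\<psi> (fst a)"] abs_Im_le_cmod[of "\<psi> (fst b)"] ab(6)
          unfolding S_def t_def by auto
        then have "{a, b} \<subseteq> P w \<inter> R (Suc n) i \<times> UNIV" using ab by (cases a; cases b) (auto simp: R_def)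
        then have "\<not> (finite (P w \<inter> R (Suc n) i \<times> UNIV) \<and> card (P w \<inter> R (Suc n) i \<times> UNIV) \<le> 1)"
          using card_mono[of "P w \<inter> R (Suc n) i \<times> UNIV" "{a, b}"] ab(7) by auto
        then show ?thesis unfolding Bad_def using ile ab(1) by blast
      qed
      then show "w \<in> ?N" by blast
    qed
  qed
  have "AE w in M. \<forall>k::nat. \<forall>a\<in>P w. \<forall>b\<in>P w. fst a \<in> cball 0 (real k) \<longrightarrow> fst b \<in> cball 0 (real k) \<longrightarrow>
      Re (\<psi> (fst a)) = Re (\<psi> (fst b)) \<longrightarrow> a = b"
    unfolding AE_all_countable by (intro allI main)
  then show ?thesis
  proof eventually_elim
    case (elim w)
    show ?case
    proof (intro ballI impI)
      fix a b assume ab: "a \<in> P w" "b \<in> P w" "Re (\<psi> (fst a)) = Re (\<psi> (fst b))"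
      obtain k :: nat where "max (norm (fst a)) (norm (fst b)) \<le> real k" using real_arch_simple by blast
      then show "a = b" using elim ab by (meson max.bounded_iff mem_cball_0)
    qed
  qed
qed

text \<open>A void of the image in \<open>D\<close> is a void of \<open>X\<close> in the preimage of
  \<open>D\<close>, which has the same area and hence the same probability; void probabilities
  determine the law.\<close>

lemma law_invariant:
  fixes \<psi> :: "complex \<Rightarrow> complex"
  assumes cont: "continuous_on UNIV \<psi>"
    and pres: "\<And>A. A \<in> sets borel \<Longrightarrow> emeasure lborel (\<psi> -` A) = emeasure lborel A"
  shows "(\<lambda>w. \<psi> ` X w) \<in> M \<rightarrow>\<^sub>M config_algebra borel"
    and "distr M (config_algebra borel) (\<lambda>w. \<psi> ` X w) = distr M (config_algebra borel) X"
proof -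
  have \<psi>m: "\<psi> -` A \<in> sets borel" if "A \<in> sets borel" for A
    using measurable_sets_borel[OF borel_measurable_continuous_onI[OF cont] that] .
  have void: "\<psi> ` X w \<inter> D = {} \<longleftrightarrow> X w \<inter> \<psi> -` D = {}" for w D by blast
  show Y: "(\<lambda>w. \<psi> ` X w) \<in> M \<rightarrow>\<^sub>M config_algebra borel"
    by (rule measurable_config_borelI) (simp only: void void_sets \<psi>m)
  show "distr M (config_algebra borel) (\<lambda>w. \<psi> ` X w) = distr M (config_algebra borel) X"
  proof (rule measure_eqI)
    fix E :: "complex set set" assume "E \<in> sets (distr M (config_algebra borel) (\<lambda>w. \<psi> ` X w))"
    then have E: "E \<in> sets (config_algebra borel)" by simp
    have "prob (space M \<inter> ((\<lambda>w. \<psi> ` X w) -` E \<inter> space M)) = 1 * prob (space M \<inter> (X -` E \<inter> space M))"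
    proof (rule void_probabilities_determine[OF Y X_measurable _ _ _ E])
      fix D :: "complex set" assume D: "D \<in> sets borel" "bounded D"
      have f: "emeasure lborel D < \<infinity>" "emeasure lborel (\<psi> -` D) < \<infinity>"
        using emeasure_bounded_finite[OF D(2)] pres[OF D(1)] by auto
      have "space M \<inter> {w \<in> space M. \<psi> ` X w \<inter> D = {}} = {w \<in> space M. X w \<inter> \<psi> -` D = {}}"
        "space M \<inter> {w \<in> space M. X w \<inter> D = {}} = {w \<in> space M. X w \<inter> D = {}}" by (auto simp: void)
      then show "prob (space M \<inter> {w \<in> space M. \<psi> ` X w \<inter> D = {}}) = 1 * prob (space M \<inter> {w \<in> space M. X w \<inter> D = {}})"
        using void_prob[OF D(1) f(1)] void_prob[OF \<psi>m[OF D(1)] f(2)] pres[OF D(1)] by (simp add: measure_def)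
    qed auto
    then have "prob ((\<lambda>w. \<psi> ` X w) -` E \<inter> space M) = prob (X -` E \<inter> space M)"
      by (simp add: Int_commute Int_left_absorb Int_left_commute)
    then show "emeasure (distr M (config_algebra borel) (\<lambda>w. \<psi> ` X w)) E = emeasure (distr M (config_algebra borel) X) E"
      using E Y X_measurable by (simp add: emeasure_distr emeasure_eq_measure)
  qed simp
qed

section \<open>Marks of the points in disjoint discs\<close>

definition single :: "complex set \<Rightarrow> 'w \<Rightarrow> bool" where
  "single Q w \<longleftrightarrow> finite (P w \<inter> Q \<times> UNIV) \<and> card (P w \<inter> Q \<times> UNIV) = 1"

text \<open>The mark is addressed through a fixed set \<open>Q\<close> instead of the random point
  in it; it is meaningful under \<open>single Q w\<close> only.\<close>

definition mark :: "complex set \<Rightarrow> 'w \<Rightarrow> 'e" where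
  "mark Q w = snd (the_elem (P w \<inter> Q \<times> UNIV))"

lemma single_elem:
  assumes "single Q w"
  obtains x where "P w \<inter> Q \<times> UNIV = {(x, mark Q w)}" "x \<in> Q"
proof -
  obtain q where q: "P w \<inter> Q \<times> UNIV = {q}"
    using assms unfolding single_def by (metis card_1_singletonE)
  then have "mark Q w = snd q" by (simp add: mark_def)
  moreover have "fst q \<in> Q" using q by (cases q) auto
  ultimately show ?thesis using that[of "fst q"] q by simp
qed

lemma single_sets: "Q \<in> sets borel \<Longrightarrow> {w \<in> space M. single Q w} \<in> sets M"
  unfolding single_def by (rule count_sets[OF rect_sets]) auto

text \<open>Turns a condition on the mark into a counting event, to which the Poisson hypotheses
  apply.\<close>

lemma mark_in_iff:
  assumes "single Q w"
  shows "mark Q w \<in> C \<longleftrightarrow> finite (P w \<inter> Q \<times> C) \<and> card (P w \<inter> Q \<times> C) = 1"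
proof -
  obtain x where x: "P w \<inter> Q \<times> UNIV = {(x, mark Q w)}" "x \<in> Q" by (rule single_elem[OF assms])
  have "P w \<inter> Q \<times> C = (P w \<inter> Q \<times> UNIV) \<inter> UNIV \<times> C" by auto
  also have "\<dots> = (if mark Q w \<in> C then {(x, mark Q w)} else {})" unfolding x by auto
  finally show ?thesis by simp
qed

context
  fixes J :: "'j set" and Q :: "'j \<Rightarrow> complex set"
  assumes finJ: "finite J" and Q: "\<And>j. j \<in> J \<Longrightarrow> Q j \<in> sets borel" "\<And>j. j \<in> J \<Longrightarrow> bounded (Q j)"
    and disj: "disjoint_family_on Q J"
begin

text \<open>Each \<open>Q j - D\<close> is split according to whether the mark is in
  \<open>C j\<close>. The event prescribes one point in one half, none in the other and none in
  \<open>D\<close>, which are independent Poisson counts. The exponentials of the two halves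
  recombine, so that \<open>C j\<close> enters only through the factor
  \<open>measure \<mu> (C j)\<close>.\<close>

lemma void_mark_prob:
  assumes C: "\<And>j. j \<in> J \<Longrightarrow> C j \<in> sets borel" and D: "D \<in> sets borel" "bounded D"
  shows "prob ({w \<in> space M. \<forall>j\<in>J. single (Q j) w \<and> mark (Q j) w \<in> C j} \<inter> {w \<in> space M. X w \<inter> D = {}}) =
    exp (- (K * measure lborel D)) *
      (\<Prod>j\<in>J. K * measure lborel (Q j - D) * exp (- (K * measure lborel (Q j - D))) * measure \<mu> (C j))"
    and "{w \<in> space M. \<forall>j\<in>J. single (Q j) w \<and> mark (Q j) w \<in> C j} \<in> sets M"
proof -
  interpret \<mu>: prob_space \<mu> by (rule prob_mu)
  \<comment> \<open>\<open>None\<close> indexes the void over \<open>D\<close>, and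
    \<open>Some (j, b)\<close> the half of \<open>Q j - D\<close> with marks in \<open>C j\<close>
    or in its complement; \<open>n\<close> gives the prescribed counts.\<close>
  define A where "A i = (case i of None \<Rightarrow> D \<times> UNIV | Some (j, b) \<Rightarrow> (Q j - D) \<times> (if b then C j else - C j))" for i
  define n where "n i = (case i of None \<Rightarrow> 0 | Some (j, b) \<Rightarrow> if b then 1 else (0 :: nat))" for i :: "('j \<times> bool) option"
  define I where "I = insert None (Some ` (J \<times> (UNIV :: bool set)))"
  have finI: "finite I" unfolding I_def using finJ by (intro finite.insertI finite_imageI finite_cartesian_product) auto
  have disjA: "disjoint_family_on A I"
    unfolding disjoint_family_on_def
  proof (intro ballI impI)
    fix i i' assume i: "i \<in> I" "i' \<in> I" "i \<noteq> i'"
    show "A i \<inter> A i' = {}"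
    proof (cases i; cases i')
      fix a b assume ab: "i = Some a" "i' = Some b"
      then have J: "fst a \<in> J" "fst b \<in> J" using i by (auto simp: I_def)
      show ?thesis
      proof (cases "fst a = fst b")
        case True
        then have "snd a \<noteq> snd b" using ab i(3) by (auto simp: prod_eq_iff)
        then show ?thesis using True ab by (auto simp: A_def split: prod.splits if_splits)
      next
        case False
        then have "Q (fst a) \<inter> Q (fst b) = {}" using disj J by (auto simp: disjoint_family_on_def)
        then show ?thesis using ab by (auto simp: A_def split: prod.splits)
      qed
    qed (use i in \<open>auto simp: A_def split: prod.splits\<close>)
  qed
  have CC: "(if b then C j else - C j) \<in> sets borel" if "j \<in> J" for j b using C[OF that] by auto
  have setsA: "A i \<in> sets \<Lambda>" "emeasure \<Lambda> (A i) < \<infinity>" if "i \<in> I" for i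
  proof -
    have "A i \<in> sets \<Lambda> \<and> emeasure \<Lambda> (A i) < \<infinity>"
    proof (cases i)
      case None
      then show ?thesis using rect_sets[OF D(1), of UNIV] rect_finite(1)[OF D, of UNIV] by (simp add: A_def)
    next
      case (Some a)
      obtain j b where jb: "a = (j, b)" by (cases a)
      then have j: "j \<in> J" using that Some by (auto simp: I_def)
      have QD: "Q j - D \<in> sets borel" "bounded (Q j - D)" using Q[OF j] D by (auto intro: bounded_diff)
      have "A i = (Q j - D) \<times> (if b then C j else - C j)" using Some jb by (simp add: A_def)
      then show ?thesis using rect_sets[OF QD(1) CC[OF j, of b]] rect_finite(1)[OF QD CC[OF j, of b]] by (simp only:)
    qed
    then show "A i \<in> sets \<Lambda>" "emeasure \<Lambda> (A i) < \<infinity>" by auto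
  qed
  let ?S = "{w \<in> space M. \<forall>j\<in>J. single (Q j) w \<and> mark (Q j) w \<in> C j}"
  have S_eq: "?S = {w \<in> space M. \<forall>j\<in>J. single (Q j) w \<and> finite (P w \<inter> Q j \<times> C j) \<and> card (P w \<inter> Q j \<times> C j) = 1}"
    using mark_in_iff by blast
  show S_sets: "?S \<in> sets M"
    unfolding S_eq
  proof (intro sets.sets_Collect_finite_All finJ)
    fix j assume j: "j \<in> J"
    have "{w \<in> space M. finite (P w \<inter> Q j \<times> C j) \<and> card (P w \<inter> Q j \<times> C j) = 1} \<in> sets M"
      by (rule count_sets[OF rect_sets[OF Q(1)[OF j] C[OF j]]])
    from sets.sets_Collect_conj[OF this single_sets[OF Q(1)[OF j]]]
    show "{w \<in> space M. single (Q j) w \<and> finite (P w \<inter> Q j \<times> C j) \<and> card (P w \<inter> Q j \<times> C j) = 1} \<in> sets M" .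
  qed
  have "prob (?S \<inter> {w \<in> space M. X w \<inter> D = {}}) = prob {w \<in> space M. \<forall>i\<in>I. card (P w \<inter> A i) = n i}"
  proof (rule finite_measure_eq_AE)
    show "?S \<inter> {w \<in> space M. X w \<inter> D = {}} \<in> sets M" using S_sets void_sets[OF D(1)] by auto
    show "{w \<in> space M. \<forall>i\<in>I. card (P w \<inter> A i) = n i} \<in> sets M"
      using card_sets[OF setsA] finI by (intro sets.sets_Collect_finite_All) (auto simp: I_def)
    have "AE w in M. \<forall>i\<in>I. finite (P w \<inter> A i)"
      using finI P_finite[OF setsA] by (simp add: AE_ball_countable countable_finite)
    then show "AE w in M. w \<in> ?S \<inter> {w \<in> space M. X w \<inter> D = {}} \<longleftrightarrow> w \<in> {w \<in> space M. \<forall>i\<in>I. card (P w \<inter> A i) = n i}"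
    proof eventually_elim
      case (elim w)
      have fin: "finite (P w \<inter> D \<times> UNIV)" "\<And>j. j \<in> J \<Longrightarrow> finite (P w \<inter> (Q j - D) \<times> C j)"
        "\<And>j. j \<in> J \<Longrightarrow> finite (P w \<inter> (Q j - D) \<times> (- C j))"
      proof -
        show "finite (P w \<inter> D \<times> UNIV)" using bspec[OF elim, of None] by (simp add: I_def A_def)
        show "finite (P w \<inter> (Q j - D) \<times> C j)" if "j \<in> J" for j
          using bspec[OF elim, of "Some (j, True)"] that by (simp add: I_def A_def)
        show "finite (P w \<inter> (Q j - D) \<times> (- C j))" if "j \<in> J" for j
          using bspec[OF elim, of "Some (j, False)"] that by (simp add: I_def A_def)
      qed
      have all: "(\<forall>i\<in>I. card (P w \<inter> A i) = n i) \<longleftrightarrow> card (P w \<inter> D \<times> UNIV) = 0 \<and>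
        (\<forall>j\<in>J. card (P w \<inter> (Q j - D) \<times> C j) = 1 \<and> card (P w \<inter> (Q j - D) \<times> (- C j)) = 0)"
      proof -
        have "(\<forall>i\<in>I. R i) \<longleftrightarrow> R None \<and> (\<forall>j\<in>J. R (Some (j, True)) \<and> R (Some (j, False)))" for R
        proof -
          have "(\<forall>b. R (Some (j, b))) \<longleftrightarrow> R (Some (j, True)) \<and> R (Some (j, False))" for j
            by (metis (full_types))
          then show ?thesis by (auto simp: I_def)
        qed
        then show ?thesis by (simp add: A_def n_def)
      qed
      have each: "single (Q j) w \<and> mark (Q j) w \<in> C j \<longleftrightarrow>
          card (P w \<inter> (Q j - D) \<times> C j) = 1 \<and> card (P w \<inter> (Q j - D) \<times> (- C j)) = 0"
        if j: "j \<in> J" and void: "X w \<inter> D = {}" for j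
      proof -
        have e: "P w \<inter> (Q j - D) \<times> V = P w \<inter> Q j \<times> V" for V using void unfolding X_void by blast
        have f: "finite (P w \<inter> Q j \<times> C j)" "finite (P w \<inter> Q j \<times> (- C j))" using fin(2,3)[OF j] unfolding e .
        have u: "P w \<inter> Q j \<times> UNIV = (P w \<inter> Q j \<times> C j) \<union> (P w \<inter> Q j \<times> (- C j))" by auto
        have c: "card (P w \<inter> Q j \<times> UNIV) = card (P w \<inter> Q j \<times> C j) + card (P w \<inter> Q j \<times> (- C j))"
          unfolding u by (rule card_Un_disjoint[OF f]) auto
        have s: "single (Q j) w \<longleftrightarrow> card (P w \<inter> Q j \<times> UNIV) = 1"
          using f unfolding single_def by (simp add: u)
        show ?thesis
          unfolding e using mark_in_iff[of "Q j" w "C j"] s c f by auto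
      qed
      have v: "X w \<inter> D = {} \<longleftrightarrow> card (P w \<inter> D \<times> UNIV) = 0" using fin(1) by (simp add: X_void)
      show ?case unfolding mem_Collect_eq Int_iff all using each v by blast
    qed
  qed
  also have "\<dots> = (\<Prod>i\<in>I. poi (measure \<Lambda> (A i)) (n i))"
    by (rule P_joint[OF finI disjA setsA])
  also have "\<dots> = poi (measure \<Lambda> (A None)) (n None) * (\<Prod>i\<in>J \<times> UNIV. poi (measure \<Lambda> (A (Some i))) (n (Some i)))"
    unfolding I_def using finJ by (subst prod.insert) (auto simp: prod.reindex)
  also have "(\<Prod>i\<in>J \<times> UNIV. poi (measure \<Lambda> (A (Some i))) (n (Some i))) =
      (\<Prod>j\<in>J. \<Prod>b\<in>UNIV. poi (measure \<Lambda> (A (Some (j, b)))) (n (Some (j, b))))"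
    by (simp add: prod.cartesian_product)
  also have "\<dots> = (\<Prod>j\<in>J. K * measure lborel (Q j - D) * exp (- (K * measure lborel (Q j - D))) * measure \<mu> (C j))"
  proof (rule prod.cong[OF refl])
    fix j assume j: "j \<in> J"
    define a where "a = K * measure lborel (Q j - D)"
    have QD: "Q j - D \<in> sets borel" "bounded (Q j - D)" using Q[OF j] D by (auto intro: bounded_diff)
    have m1: "measure \<Lambda> ((Q j - D) \<times> C j) = a * measure \<mu> (C j)"
      using rect_finite(2)[OF QD C[OF j]] by (simp add: a_def)
    have "measure \<mu> (- C j) = 1 - measure \<mu> (C j)"
      using \<mu>.prob_compl[of "C j"] C[OF j] by (simp add: Compl_eq_Diff_UNIV)
    then have m2: "measure \<Lambda> ((Q j - D) \<times> (- C j)) = a * (1 - measure \<mu> (C j))"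
      using rect_finite(2)[OF QD borel_comp[OF C[OF j]]] by (simp add: a_def)
    have "exp (- (a * measure \<mu> (C j))) * exp (- (a * (1 - measure \<mu> (C j)))) = exp (- a)"
      by (simp add: exp_add[symmetric] algebra_simps)
    then show "(\<Prod>b\<in>UNIV. poi (measure \<Lambda> (A (Some (j, b)))) (n (Some (j, b)))) = a * exp (- a) * measure \<mu> (C j)"
      by (simp add: UNIV_bool A_def n_def m1 m2 poi_def mult_ac) 
  qed
  also have "poi (measure \<Lambda> (A None)) (n None) = exp (- (K * measure lborel D))"
    using rect_finite(2)[OF D, of UNIV] \<mu>.prob_space by (simp add: A_def n_def poi_def)
  finally show "prob (?S \<inter> {w \<in> space M. X w \<inter> D = {}}) = exp (- (K * measure lborel D)) *
      (\<Prod>j\<in>J. K * measure lborel (Q j - D) * exp (- (K * measure lborel (Q j - D))) * measure \<mu> (C j))" .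
qed

lemma mark_sets:
  "(\<And>j. j \<in> J \<Longrightarrow> C j \<in> sets borel) \<Longrightarrow> {w \<in> space M. \<forall>j\<in>J. single (Q j) w \<and> mark (Q j) w \<in> C j} \<in> sets M"
  by (rule void_mark_prob(2)[where D = "{}"]) auto

text \<open>The formula for rectangles of marks together with voids in \<open>D\<close> extends from
  voids to every event \<open>E\<close> of the configuration by
  \<open>void_probabilities_determine\<close>. The law of the marks, conditioned on
  \<open>N\<close>, then agrees with the product measure on rectangles, hence everywhere.\<close>

theorem mark_law:
  fixes f :: "'e \<Rightarrow> 'g::topological_space"
  assumes f: "f \<in> borel_measurable borel" and E: "E \<in> sets (config_algebra borel)"
    and B: "B \<in> sets (Pi\<^sub>M J (\<lambda>_. distr \<mu> borel f))"
  defines "N \<equiv> {w \<in> space M. \<forall>j\<in>J. single (Q j) w} \<inter> (X -` E \<inter> space M)"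
  shows "N \<in> sets M" "{w \<in> N. (\<lambda>j\<in>J. f (mark (Q j) w)) \<in> B} \<in> sets M"
    "prob {w \<in> N. (\<lambda>j\<in>J. f (mark (Q j) w)) \<in> B} = measure (Pi\<^sub>M J (\<lambda>_. distr \<mu> borel f)) B * prob N"
proof -
  interpret \<mu>: prob_space \<mu> by (rule prob_mu)
  have fm: "f \<in> \<mu> \<rightarrow>\<^sub>M borel" using f by (simp add: measurable_cong_sets[OF sets_mu refl])
  interpret \<nu>: prob_space "distr \<mu> borel f" by (rule \<mu>.prob_space_distr[OF fm])
  let ?P = "Pi\<^sub>M J (\<lambda>_. distr \<mu> borel f)"
  interpret PP: product_prob_space "\<lambda>_::'j. distr \<mu> borel f" by unfold_locales
  have XE: "X -` E \<inter> space M \<in> sets M" by (rule measurable_sets[OF X_measurable E])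
  have S0: "{w \<in> space M. \<forall>j\<in>J. single (Q j) w} \<in> sets M"
    using mark_sets[of "\<lambda>_. UNIV"] by simp
  show N: "N \<in> sets M" using XE S0 by (auto simp: N_def)
  have rect: "prob ({w \<in> space M. \<forall>j\<in>J. single (Q j) w \<and> mark (Q j) w \<in> C j} \<inter> (X -` E \<inter> space M)) =
      (\<Prod>j\<in>J. measure \<mu> (C j)) * prob N" if C: "\<And>j. j \<in> J \<Longrightarrow> C j \<in> sets borel" for C
    unfolding N_def
  proof (rule void_probabilities_determine[OF X_measurable X_measurable _ S0 _ E])
    show "{w \<in> space M. \<forall>j\<in>J. single (Q j) w \<and> mark (Q j) w \<in> C j} \<in> events" by (rule mark_sets[OF C])
    fix D :: "complex set" assume D: "D \<in> sets borel" "bounded D"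
    show "prob ({w \<in> space M. \<forall>j\<in>J. single (Q j) w \<and> mark (Q j) w \<in> C j} \<inter> {w \<in> space M. X w \<inter> D = {}}) =
      (\<Prod>j\<in>J. measure \<mu> (C j)) * prob ({w \<in> space M. \<forall>j\<in>J. single (Q j) w} \<inter> {w \<in> space M. X w \<inter> D = {}})"
      using void_mark_prob(1)[OF C D] void_mark_prob(1)[of "\<lambda>_. UNIV", OF _ D] \<mu>.prob_space
      by (simp add: prod.distrib)
  qed
  have rect_sets: "{w \<in> N. \<forall>j\<in>J. mark (Q j) w \<in> C j} \<in> sets M" if C: "\<And>j. j \<in> J \<Longrightarrow> C j \<in> sets borel" for C
  proof -
    have "{w \<in> N. \<forall>j\<in>J. mark (Q j) w \<in> C j} =
      {w \<in> space M. \<forall>j\<in>J. single (Q j) w \<and> mark (Q j) w \<in> C j} \<inter> (X -` E \<inter> space M)" by (auto simp: N_def)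
    then show ?thesis using mark_sets[OF C] XE by simp
  qed
  define T where "T w = (\<lambda>j\<in>J. f (mark (Q j) w))" for w
  have T_meas: "T \<in> restrict_space M N \<rightarrow>\<^sub>M ?P"
    unfolding T_def
  proof (rule measurable_restrict)
    fix j assume j: "j \<in> J"
    have "(\<lambda>w. f (mark (Q j) w)) \<in> restrict_space M N \<rightarrow>\<^sub>M borel"
    proof (rule measurableI)
      fix A :: "'g set" assume A: "A \<in> sets borel"
      have fA: "f -` A \<in> sets borel" by (rule measurable_sets_borel[OF f A])
      have "{w \<in> N. \<forall>i\<in>J. mark (Q i) w \<in> (if i = j then f -` A else UNIV)} \<in> sets M"
        by (rule rect_sets) (use fA in auto)
      also have "{w \<in> N. \<forall>i\<in>J. mark (Q i) w \<in> (if i = j then f -` A else UNIV)} = (\<lambda>w. f (mark (Q j) w)) -` A \<inter> N"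
        using j by auto
      finally show "(\<lambda>w. f (mark (Q j) w)) -` A \<inter> space (restrict_space M N) \<in> sets (restrict_space M N)"
        using N sets.sets_into_space[OF N] by (simp add: sets_restrict_space_iff space_restrict_space Int_absorb2)
    qed simp
    then show "(\<lambda>w. f (mark (Q j) w)) \<in> restrict_space M N \<rightarrow>\<^sub>M distr \<mu> borel f" by simp
  qed
  have TB: "{w \<in> N. T w \<in> B'} \<in> sets M" if "B' \<in> sets ?P" for B'
  proof -
    have "T -` B' \<inter> space (restrict_space M N) = {w \<in> N. T w \<in> B'}"
      using sets.sets_into_space[OF N] by (auto simp: space_restrict_space)
    then show ?thesis
      using measurable_sets[OF T_meas that] N sets.sets_into_space[OF N] by (simp add: sets_restrict_space_iff Int_absorb2)
  qed
  show "{w \<in> N. (\<lambda>j\<in>J. f (mark (Q j) w)) \<in> B} \<in> sets M" using TB[OF B] by (simp add: T_def)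
  show "prob {w \<in> N. (\<lambda>j\<in>J. f (mark (Q j) w)) \<in> B} = measure ?P B * prob N"
  proof (cases "prob N = 0")
    case True
    have "prob {w \<in> N. T w \<in> B} \<le> prob N" using N by (intro finite_measure_mono) auto
    with True show ?thesis by (simp add: T_def measure_le_0_iff)
  next
    case False
    have eN: "emeasure M N \<noteq> 0" "emeasure M N \<noteq> \<infinity>" using False by (auto simp: emeasure_eq_measure)
    have T_meas': "T \<in> restrict_space (uniform_measure M N) N \<rightarrow>\<^sub>M ?P"
    proof -
      have "sets (restrict_space (uniform_measure M N) N) = sets (restrict_space M N)"
        by (rule sets_restrict_space_cong) simp
      from measurable_cong_sets[OF this refl] T_meas show ?thesis by blast
    qed
    define D where "D = distr (restrict_space (uniform_measure M N) N) ?P T"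
    have emD: "emeasure D B' = emeasure M {w \<in> N. T w \<in> B'} / emeasure M N" if B': "B' \<in> sets ?P" for B'
    proof -
      have s: "T -` B' \<inter> space (restrict_space (uniform_measure M N) N) = {w \<in> N. T w \<in> B'}"
        using sets.sets_into_space[OF N] by (auto simp: space_restrict_space)
      have "emeasure D B' = emeasure (restrict_space (uniform_measure M N) N) {w \<in> N. T w \<in> B'}"
        unfolding D_def by (subst emeasure_distr[OF T_meas' B']) (simp only: s)
      also have "\<dots> = emeasure (uniform_measure M N) {w \<in> N. T w \<in> B'}"
        using N by (intro emeasure_restrict_space) auto
      also have "\<dots> = emeasure M (N \<inter> {w \<in> N. T w \<in> B'}) / emeasure M N"
        by (rule emeasure_uniform_measure[OF N TB[OF B']])
      also have "N \<inter> {w \<in> N. T w \<in> B'} = {w \<in> N. T w \<in> B'}" by auto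
      finally show ?thesis .
    qed
    have "D = ?P"
    proof (rule PP.PiM_eqI[OF finJ])
      show "sets D = sets ?P" by (simp add: D_def)
      fix A :: "'j \<Rightarrow> 'g set" assume A: "\<And>j. j \<in> J \<Longrightarrow> A j \<in> sets (distr \<mu> borel f)"
      have fA: "f -` A j \<in> sets borel" if "j \<in> J" for j using A[OF that] measurable_sets_borel[OF f] by simp
      have "Pi\<^sub>E J A \<in> sets ?P" using A finJ by (intro sets_PiM_I_finite) auto
      then have "emeasure D (Pi\<^sub>E J A) = emeasure M {w \<in> N. T w \<in> Pi\<^sub>E J A} / emeasure M N" by (rule emD)
      also have "{w \<in> N. T w \<in> Pi\<^sub>E J A} =
          {w \<in> space M. \<forall>j\<in>J. single (Q j) w \<and> mark (Q j) w \<in> f -` A j} \<inter> (X -` E \<inter> space M)"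
        by (auto simp: N_def T_def PiE_iff)
      also have "emeasure M \<dots> = ennreal ((\<Prod>j\<in>J. measure \<mu> (f -` A j)) * prob N)"
        using rect[of "\<lambda>j. f -` A j"] fA by (simp add: emeasure_eq_measure)
      also have "\<dots> / emeasure M N = ennreal (\<Prod>j\<in>J. measure \<mu> (f -` A j))"
        using False measure_nonneg[of M N] by (simp add: emeasure_eq_measure divide_ennreal prod_nonneg less_le)
      also have "\<dots> = (\<Prod>j\<in>J. emeasure (distr \<mu> borel f) (A j))"
      proof -
        have "emeasure (distr \<mu> borel f) (A j) = ennreal (measure \<mu> (f -` A j))" if "j \<in> J" for j
          using A[OF that] fm by (simp add: emeasure_distr \<mu>.emeasure_eq_measure)
        then show ?thesis by (simp add: prod_ennreal)
      qed
      finally show "emeasure D (Pi\<^sub>E J A) = (\<Prod>j\<in>J. emeasure (distr \<mu> borel f) (A j))" .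
    qed
    then have "emeasure ?P B = emeasure M {w \<in> N. T w \<in> B} / emeasure M N" using emD[OF B] by simp
    also have "\<dots> = ennreal (prob {w \<in> N. T w \<in> B} / prob N)"
      using False measure_nonneg[of M N] by (simp add: emeasure_eq_measure divide_ennreal less_le)
    finally have "enn2real (emeasure ?P B) = enn2real (ennreal (prob {w \<in> N. T w \<in> B} / prob N))" by (simp only:)
    then have "measure ?P B = prob {w \<in> N. T w \<in> B} / prob N" by (simp add: measure_def[of ?P])
    then show ?thesis using False by (simp add: T_def)
  qed
qed

end

end


section \<open>Fundamental groups\<close>

lemma loops_atD:
  assumes "p \<in> loops_at X a"
  shows "path p" "path_image p \<subseteq> X" "pathstart p = a" "pathfinish p = a"
  using assms by (auto simp: loops_at_def)

lemma loops_at_homotopic: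
  assumes "p \<in> loops_at X a" "homotopic_paths X p q"
  shows "q \<in> loops_at X a"
  using assms(1) homotopic_paths_imp_path[OF assms(2)] homotopic_paths_imp_subset[OF assms(2)]
    homotopic_paths_imp_pathstart[OF assms(2)] homotopic_paths_imp_pathfinish[OF assms(2)]
  by (simp add: loops_at_def)

lemma loop_class_self: "p \<in> loops_at X a \<Longrightarrow> p \<in> loop_class X p"
  by (simp add: loop_class_def loops_at_def)

lemma loop_class_eqI: "homotopic_paths X p q \<Longrightarrow> loop_class X p = loop_class X q"
proof -
  assume h: "homotopic_paths X p q"
  have "homotopic_paths X p r \<longleftrightarrow> homotopic_paths X q r" for r
    using homotopic_paths_trans[OF h] homotopic_paths_trans[OF homotopic_paths_sym[OF h]] by blast
  then show "loop_class X p = loop_class X q" by (simp add: loop_class_def)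
qed

lemma loop_class_eq_iff:
  "p \<in> loops_at X a \<Longrightarrow> loop_class X p = loop_class X q \<longleftrightarrow> homotopic_paths X p q"
  using loop_class_eqI[of X p q] loop_class_self[of p X a] homotopic_paths_sym[of X q p]
  unfolding loop_class_def by blast

lemma loops_at_join: "p \<in> loops_at X a \<Longrightarrow> q \<in> loops_at X a \<Longrightarrow> p +++ q \<in> loops_at X a"
  by (auto simp: loops_at_def path_image_join)

lemma loops_at_reverse: "p \<in> loops_at X a \<Longrightarrow> reversepath p \<in> loops_at X a"
  by (auto simp: loops_at_def)

lemma loops_at_const: "a \<in> X \<Longrightarrow> (\<lambda>_. a) \<in> loops_at X a"
  by (auto simp: loops_at_def path_def path_image_def pathstart_def pathfinish_def)

text \<open>The product is defined as a union over all representatives; since concatenation respects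
  homotopy, all sets in this union coincide.\<close>

lemma pi1_mult:
  assumes p: "p \<in> loops_at X a" and q: "q \<in> loops_at X a"
  shows "loop_class X p \<otimes>\<^bsub>pi1 X a\<^esub> loop_class X q = loop_class X (p +++ q)"
proof -
  have eq: "loop_class X (p' +++ q') = loop_class X (p +++ q)" if "p' \<in> loop_class X p" "q' \<in> loop_class X q" for p' q'
  proof -
    have h: "homotopic_paths X p p'" "homotopic_paths X q q'" using that by (auto simp: loop_class_def)
    have "homotopic_paths X (p +++ q) (p' +++ q')"
      by (rule homotopic_paths_join[OF h]) (simp add: loops_atD[OF p] loops_atD[OF q])
    then show ?thesis by (rule loop_class_eqI[symmetric])
  qed
  have "(\<Union>p'\<in>loop_class X p. \<Union>q'\<in>loop_class X q. loop_class X (p' +++ q')) =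
      (\<Union>p'\<in>loop_class X p. \<Union>q'\<in>loop_class X q. loop_class X (p +++ q))"
    by (intro SUP_cong refl eq)
  also have "\<dots> = loop_class X (p +++ q)"
    using loop_class_self[OF p] loop_class_self[OF q] by blast
  finally show ?thesis by (simp add: pi1_def)
qed

lemma pi1_carrierE:
  assumes "c \<in> carrier (pi1 X a)"
  obtains p where "p \<in> loops_at X a" "c = loop_class X p"
  using assms by (auto simp: pi1_def)

lemma loop_class_carrier: "p \<in> loops_at X a \<Longrightarrow> loop_class X p \<in> carrier (pi1 X a)"
  by (simp add: pi1_def)

lemma pi1_one: "\<one>\<^bsub>pi1 X a\<^esub> = loop_class X (\<lambda>_. a)"
  by (simp add: pi1_def)

lemma group_pi1: assumes "(a :: 'a::real_normed_vector) \<in> X" shows "group (pi1 X a)"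
proof (rule groupI)
  have k: "linepath a a = (\<lambda>_. a)" by (simp add: linepath_refl)
  show "\<one>\<^bsub>pi1 X a\<^esub> \<in> carrier (pi1 X a)"
    unfolding pi1_one by (rule loop_class_carrier[OF loops_at_const[OF assms]])
  fix x assume "x \<in> carrier (pi1 X a)"
  then obtain p where p: "p \<in> loops_at X a" "x = loop_class X p" by (rule pi1_carrierE)
  note pD = loops_atD[OF p(1)]
  have "homotopic_paths X ((\<lambda>_. a) +++ p) p"
    using homotopic_paths_lid[OF pD(1,2)] by (simp add: pD k)
  then show "\<one>\<^bsub>pi1 X a\<^esub> \<otimes>\<^bsub>pi1 X a\<^esub> x = x"
    unfolding p(2) pi1_one pi1_mult[OF loops_at_const[OF assms] p(1)] by (rule loop_class_eqI)
  have "homotopic_paths X (reversepath p +++ p) (\<lambda>_. a)"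
    using homotopic_paths_linv[OF pD(1,2)] by (simp add: pD k)
  then have "loop_class X (reversepath p) \<otimes>\<^bsub>pi1 X a\<^esub> x = \<one>\<^bsub>pi1 X a\<^esub>"
    unfolding p(2) pi1_one pi1_mult[OF loops_at_reverse[OF p(1)] p(1)] by (rule loop_class_eqI)
  then show "\<exists>y\<in>carrier (pi1 X a). y \<otimes>\<^bsub>pi1 X a\<^esub> x = \<one>\<^bsub>pi1 X a\<^esub>"
    using loop_class_carrier[OF loops_at_reverse[OF p(1)]] by blast
  fix y assume "y \<in> carrier (pi1 X a)"
  then obtain q where q: "q \<in> loops_at X a" "y = loop_class X q" by (rule pi1_carrierE)
  show "x \<otimes>\<^bsub>pi1 X a\<^esub> y \<in> carrier (pi1 X a)"
    unfolding p(2) q(2) pi1_mult[OF p(1) q(1)] by (rule loop_class_carrier[OF loops_at_join[OF p(1) q(1)]])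
  fix z assume "z \<in> carrier (pi1 X a)"
  then obtain r where r: "r \<in> loops_at X a" "z = loop_class X r" by (rule pi1_carrierE)
  have "homotopic_paths X (p +++ (q +++ r)) ((p +++ q) +++ r)"
    using loops_atD[OF p(1)] loops_atD[OF q(1)] loops_atD[OF r(1)] by (intro homotopic_paths_assoc) auto
  then show "x \<otimes>\<^bsub>pi1 X a\<^esub> y \<otimes>\<^bsub>pi1 X a\<^esub> z = x \<otimes>\<^bsub>pi1 X a\<^esub> (y \<otimes>\<^bsub>pi1 X a\<^esub> z)"
    unfolding p(2) q(2) r(2) pi1_mult[OF p(1) q(1)] pi1_mult[OF q(1) r(1)]
      pi1_mult[OF loops_at_join[OF p(1) q(1)] r(1)] pi1_mult[OF p(1) loops_at_join[OF q(1) r(1)]]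
    by (rule loop_class_eqI[symmetric])
qed

lemma pi1_inv:
  assumes "(a :: 'a::real_normed_vector) \<in> X" "p \<in> loops_at X a"
  shows "inv\<^bsub>pi1 X a\<^esub> (loop_class X p) = loop_class X (reversepath p)"
proof -
  note pD = loops_atD[OF assms(2)]
  have "homotopic_paths X (reversepath p +++ p) (\<lambda>_. a)"
    using homotopic_paths_linv[OF pD(1,2)] by (simp add: pD linepath_refl)
  then have "loop_class X (reversepath p) \<otimes>\<^bsub>pi1 X a\<^esub> loop_class X p = \<one>\<^bsub>pi1 X a\<^esub>"
    unfolding pi1_one pi1_mult[OF loops_at_reverse[OF assms(2)] assms(2)] by (rule loop_class_eqI)
  then show ?thesis
    by (rule group.inv_equality[OF group_pi1[OF assms(1)] _ loop_class_carrier[OF assms(2)] loop_class_carrier[OF loops_at_reverse[OF assms(2)]]])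
qed

section \<open>Generating families of loops around the points of a configuration\<close>

text \<open>A lasso, up to homeomorphism: go along \<open>p\<close>, run through a loop which can be contracted to \<open>x\<close>
  in the complement of the other points, and come back.\<close>

definition shrinking_lasso :: "complex set \<Rightarrow> complex \<Rightarrow> (real \<Rightarrow> complex) set \<Rightarrow> bool" where
  "shrinking_lasso S x c \<longleftrightarrow> (\<exists>p h. path p \<and> pathstart p = 0 \<and> path_image p \<subseteq> - S \<and> pathfinish p = h (1, 0) \<and>
     continuous_on ({0..1} \<times> {0..1}) h \<and> (\<forall>t\<in>{0..1}. h (0, t) = x) \<and>
     (\<forall>s\<in>{0<..1}. \<forall>t\<in>{0..1}. h (s, t) \<notin> S) \<and> (\<forall>s\<in>{0..1}. h (s, 0) = h (s, 1)) \<and>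
     c = loop_class (- S) (p +++ ((\<lambda>t. h (1::real, t::real)) +++ reversepath p)))"

definition lasso_basis :: "complex set \<Rightarrow> (complex \<Rightarrow> (real \<Rightarrow> complex) set) \<Rightarrow> bool" where
  "lasso_basis S b \<longleftrightarrow> good_config S \<and> (\<forall>x\<in>S. shrinking_lasso S x (b x)) \<and>
     generate (pi1 (- S) 0) (b ` S) = carrier (pi1 (- S) 0)"

text \<open>The circle contracts radially inside \<open>cball x \<epsilon>\<close>, which contains
  no other point. The truncated arc avoids \<open>S\<close>: it stops before \<open>x\<close>, and
  it meets the arcs to the other points only at 0, which is not in \<open>S\<close>.\<close>

lemma proper_imp_lasso_basis:
  assumes "proper_basis S b"
  shows "lasso_basis S b"
proof -
  have good: "good_config S" and gen: "generate (pi1 (- S) 0) (b ` S) = carrier (pi1 (- S) 0)"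
    using assms by (simp_all only: proper_basis_def)
  obtain \<gamma> where A: "\<forall>x\<in>S. arc (\<gamma> x) \<and> pathstart (\<gamma> x) = 0 \<and> pathfinish (\<gamma> x) = x"
    and A': "\<forall>x\<in>S. \<forall>y\<in>S. x \<noteq> y \<longrightarrow> path_image (\<gamma> x) \<inter> path_image (\<gamma> y) = {0}"
    and A'': "\<forall>x\<in>S. is_lasso_class S x (\<gamma> x) (b x)"
    using assms unfolding proper_basis_def by (elim conjE exE) (rule that)
  have \<gamma>: "arc (\<gamma> x)" "pathstart (\<gamma> x) = 0" "pathfinish (\<gamma> x) = x" "is_lasso_class S x (\<gamma> x) (b x)"
    if "x \<in> S" for x
    using A[rule_format, OF that] A''[rule_format, OF that] by simp_all
  have \<gamma>dis: "path_image (\<gamma> x) \<inter> path_image (\<gamma> y) = {0}" if "x \<in> S" "y \<in> S" "x \<noteq> y" for x y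
    using A'[rule_format, OF that] .
  have "shrinking_lasso S x (b x)" if x: "x \<in> S" for x
  proof -
    obtain \<epsilon> t where e: "\<epsilon> > 0" "0 < t" "t < 1" "cball x \<epsilon> \<inter> S = {x}" "\<gamma> x ` {t..1} \<subseteq> cball x \<epsilon>"
      "b x = loop_class (- S) (lasso x (\<gamma> x) t)"
      using \<gamma>(4)[OF x] unfolding is_lasso_class_def by blast
    have inj: "inj_on (\<gamma> x) {0..1}" and path\<gamma>: "path (\<gamma> x)" using \<gamma>(1)[OF x] by (auto simp: arc_def)
    have end1: "\<gamma> x 1 = x" and start0: "\<gamma> x 0 = 0" using \<gamma>(2,3)[OF x] by (auto simp: pathfinish_def pathstart_def)
    have neq: "\<gamma> x s \<noteq> x" if "s \<in> {0..t}" for s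
      using inj_onD[OF inj, of s 1] end1 that e(2,3) by auto
    have avoid: "y \<notin> path_image (\<gamma> x)" if "y \<in> S" "y \<noteq> x" for y
    proof
      assume "y \<in> path_image (\<gamma> x)"
      moreover have "y \<in> path_image (\<gamma> y)" using \<gamma>(3)[OF that(1)] pathfinish_in_path_image by metis
      ultimately have "y \<in> {0}" using \<gamma>dis[OF x that(1)] that(2) by blast
      then have "y = 0" by simp
      then show False using that(1) good by (simp add: good_config_def)
    qed
    define h where "h = (\<lambda>(s, \<tau>). x + complex_of_real s * ((\<gamma> x t - x) * cis (2 * pi * \<tau>)))"
    have d: "norm (\<gamma> x t - x) \<le> \<epsilon>" "\<gamma> x t \<noteq> x"
      using e(2,3,5) neq[of t] by (auto simp: image_subset_iff dist_norm norm_minus_commute)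
    let ?p = "subpath 0 t (\<gamma> x)"
    have t01: "t \<in> {0..1}" using e by auto
    show ?thesis
      unfolding shrinking_lasso_def
    proof (intro exI[of _ ?p] exI[of _ h] conjI ballI)
      show "path ?p" using path\<gamma> t01 by (intro path_subpath) auto
      show "pathstart ?p = 0" using start0 by (simp add: pathstart_subpath)
      have im: "path_image ?p = \<gamma> x ` {0..t}" using e(2) by (simp add: path_image_subpath)
      show "path_image ?p \<subseteq> - S"
      proof
        fix z assume z: "z \<in> path_image ?p"
        then have "z \<in> path_image (\<gamma> x)" unfolding im using e(2,3) by (auto simp: path_image_def)
        then show "z \<in> - S" using z avoid[of z] neq unfolding im by auto
      qed
      show "pathfinish ?p = h (1, 0)" by (simp add: h_def pathfinish_subpath)
      show "continuous_on ({0..1} \<times> {0..1}) h"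
        unfolding h_def case_prod_unfold by (intro continuous_intros)
      show "h (0, \<tau>) = x" for \<tau> by (simp add: h_def)
      show "h (s, \<tau>) \<notin> S" if s: "s \<in> {0<..1}" for s \<tau>
      proof -
        have n: "norm (h (s, \<tau>) - x) = s * norm (\<gamma> x t - x)" using s by (simp add: h_def norm_mult)
        have "s * norm (\<gamma> x t - x) \<le> 1 * \<epsilon>" using s d(1) by (intro mult_mono) auto
        then have "h (s, \<tau>) \<in> cball x \<epsilon>" using n by (simp add: dist_norm norm_minus_commute)
        moreover have "h (s, \<tau>) \<noteq> x" using n s d(2) by auto
        ultimately show ?thesis using e(4) by blast
      qed
      show "h (s, 0) = h (s, 1)" for s by (simp add: h_def)
      have "(\<lambda>\<tau>. h (1, \<tau>)) = (\<lambda>s. x + (\<gamma> x t - x) * cis (2 * pi * s))" by (simp add: h_def)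
      then show "b x = loop_class (- S) (?p +++ ((\<lambda>t. h (1, t)) +++ reversepath ?p))"
        unfolding e(6) lasso_def by (simp only:)
    qed
  qed
  with good gen show ?thesis by (simp add: lasso_basis_def)
qed

lemma good_config_facts:
  assumes "good_config S"
  shows "0 \<in> - S" "closed S" "countable S" "open (- S)" "finite (S \<inter> cball 0 r)"
proof -
  have fin: "finite (S \<inter> cball 0 r)" for r using assms by (simp add: good_config_def)
  then show "finite (S \<inter> cball 0 r)" .
  show "0 \<in> - S" using assms by (simp add: good_config_def)
  show closed: "closed S"
    unfolding closed_limpt
  proof (intro allI impI)
    fix x assume "x islimpt S"
    then have "\<forall>e>0. infinite (S \<inter> cball x e)" unfolding islimpt_eq_infinite_cball .
    then have "infinite (S \<inter> cball x 1)" using zero_less_one by blast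
    moreover have "finite (S \<inter> cball x 1)" using assms compact_cball[of x 1] unfolding good_config_def by blast
    ultimately show "x \<in> S" by contradiction
  qed
  then show "open (- S)" by (simp add: open_Compl)
  have "S \<subseteq> (\<Union>n. S \<inter> cball 0 (real n))"
  proof
    fix x assume x: "x \<in> S"
    obtain n where "norm x \<le> real n" using real_arch_simple by blast
    then have "x \<in> S \<inter> cball 0 (real n)" using x by simp
    then show "x \<in> (\<Union>n. S \<inter> cball 0 (real n))" by blast
  qed
  moreover have "countable (\<Union>n. S \<inter> cball 0 (real n))" by (rule countable_UN[OF countableI_type countable_finite[OF fin]])
  ultimately show "countable S" by (rule countable_subset)
qed

text \<open>Reading the crossing words of the loops after applying a homeomorphism \<open>\<psi>\<close> of the plane.\<close>

locale lasso_basis_image =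
  fixes S :: "complex set" and b :: "complex \<Rightarrow> (real \<Rightarrow> complex) set" and \<psi> \<phi> :: "complex \<Rightarrow> complex" and B :: "complex set"
  assumes basis: "lasso_basis S b"
    and homeo: "continuous_on UNIV \<psi>" "continuous_on UNIV \<phi>" "\<And>z. \<phi> (\<psi> z) = z" "\<And>z. \<psi> (\<phi> z) = z" "\<psi> 0 = 0"
    and B: "finite B" "B \<subseteq> \<psi> ` S" "inj_on Re B"
begin

abbreviation "\<Gamma> \<equiv> pi1 (- S) 0"

text \<open>The choice of a representative is immaterial, as \<open>theta_class\<close> shows
  through homotopy invariance.\<close>

definition \<theta> :: "(real \<Rightarrow> complex) set \<Rightarrow> (complex \<times> bool) list" where
  "\<theta> c = plane_hol B (\<psi> \<circ> (SOME p. p \<in> c))"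

lemma S_facts: "0 \<in> - S" "countable S" "open (- S)"
  using good_config_facts basis unfolding lasso_basis_def by auto

lemma phi_zero: "\<phi> 0 = 0" using homeo(3)[of 0] homeo(5) by simp

lemma psi_avoids: assumes "z \<notin> S" shows "\<psi> z \<notin> B"
proof
  assume z: "\<psi> z \<in> B"
  then obtain x where "x \<in> S" "\<psi> z = \<psi> x" using B(2) by blast
  then have "\<phi> (\<psi> z) = \<phi> (\<psi> x)" by (simp only:)
  then have "z = x" unfolding homeo(3) .
  then show False using assms \<open>x \<in> S\<close> by simp
qed

lemma psi_path:
  assumes "path p" "path_image p \<subseteq> - S"
  shows "path (\<psi> \<circ> p)" "path_image (\<psi> \<circ> p) \<subseteq> - B"
proof -
  show "path (\<psi> \<circ> p)" by (rule path_continuous_image[OF assms(1)]) (rule continuous_on_subset[OF homeo(1)], simp)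
  show "path_image (\<psi> \<circ> p) \<subseteq> - B" using assms(2) psi_avoids unfolding path_image_compose by blast
qed

lemma psi_join: "\<psi> \<circ> (p +++ q) = (\<psi> \<circ> p) +++ (\<psi> \<circ> q)"
  by (auto simp: joinpaths_def)

lemma theta_class:
  assumes p: "p \<in> loops_at (- S) 0"
  shows "\<theta> (loop_class (- S) p) = plane_hol B (\<psi> \<circ> p)"
proof -
  define q where "q = (SOME q. q \<in> loop_class (- S) p)"
  have "q \<in> loop_class (- S) p" unfolding q_def by (rule someI[of "\<lambda>q. q \<in> loop_class (- S) p", OF loop_class_self[OF p]])
  then have h: "homotopic_paths (- S) p q" by (simp add: loop_class_def)
  have "homotopic_paths (- B) (\<psi> \<circ> p) (\<psi> \<circ> q)"
    by (rule homotopic_paths_continuous_image[OF h]) (use homeo(1) psi_avoids in \<open>auto intro: continuous_on_subset\<close>)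
  moreover have "pathstart (\<psi> \<circ> p) = pathfinish (\<psi> \<circ> p)"
    using loops_atD(3,4)[OF p] by (simp add: pathstart_def pathfinish_def)
  ultimately have "plane_hol B (\<psi> \<circ> p) = plane_hol B (\<psi> \<circ> q)"
    by (rule plane_hol_homotopic[OF B(1,3)])
  then show ?thesis by (simp add: \<theta>_def q_def)
qed

lemma theta_hom: "group_hom \<Gamma> (freeg B) \<theta>"
proof (intro group_hom.intro group_hom_axioms.intro homI group_pi1 group_freeg S_facts)
  fix x assume "x \<in> carrier \<Gamma>"
  then obtain p where p: "p \<in> loops_at (- S) 0" "x = loop_class (- S) p" by (rule pi1_carrierE)
  note pp = psi_path[OF loops_atD(1,2)[OF p(1)]]
  show "\<theta> x \<in> carrier (freeg B)"
    unfolding p(2) theta_class[OF p(1)] by (rule plane_hol_closed[OF B(1,3) pp])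
  fix y assume "y \<in> carrier \<Gamma>"
  then obtain q where q: "q \<in> loops_at (- S) 0" "y = loop_class (- S) q" by (rule pi1_carrierE)
  note qq = psi_path[OF loops_atD(1,2)[OF q(1)]]
  have "pathfinish (\<psi> \<circ> p) = pathstart (\<psi> \<circ> q)"
    using loops_atD(4)[OF p(1)] loops_atD(3)[OF q(1)] by (simp add: pathstart_def pathfinish_def)
  then show "\<theta> (x \<otimes>\<^bsub>\<Gamma>\<^esub> y) = \<theta> x \<otimes>\<^bsub>freeg B\<^esub> \<theta> y"
    unfolding p(2) q(2) pi1_mult[OF p(1) q(1)] theta_class[OF p(1)] theta_class[OF q(1)]
      theta_class[OF loops_at_join[OF p(1) q(1)]] psi_join
    by (rule plane_hol_join[OF B(1,3) pp qq])
qed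

text \<open>The loop that realises a word has to avoid the image of all of \<open>S\<close>, and not
  only \<open>B\<close>, for its pullback by \<open>\<phi>\<close> to be a loop off
  \<open>S\<close>; this is the purpose of the countable set in
  \<open>plane_hol_surj\<close>.\<close>

lemma theta_surj: "carrier (freeg B) \<subseteq> \<theta> ` carrier \<Gamma>"
proof
  fix a assume "a \<in> carrier (freeg B)"
  moreover have "countable (\<psi> ` S)" using S_facts(2) by simp
  moreover have z: "0 \<notin> \<psi> ` S"
  proof
    assume "0 \<in> \<psi> ` S"
    then obtain x where "x \<in> S" "0 = \<psi> x" by blast
    then have "x = 0" using phi_zero homeo(3)[of x] by simp
    then show False using \<open>x \<in> S\<close> S_facts(1) by simp
  qed
  ultimately have "a \<in> plane_hol B ` loops_at (- (\<psi> ` S)) 0"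
    using plane_hol_surj[OF B(1,3) _ B(2)] by simp
  then obtain l where l: "l \<in> loops_at (- (\<psi> ` S)) 0" "plane_hol B l = a" by blast
  note lD = loops_atD[OF l(1)]
  have \<phi>l: "\<phi> \<circ> l \<in> loops_at (- S) 0"
    unfolding loops_at_def
  proof (intro CollectI conjI)
    show "path (\<phi> \<circ> l)" by (rule path_continuous_image[OF lD(1)]) (rule continuous_on_subset[OF homeo(2)], simp)
    have "\<phi> z \<notin> S" if "z \<notin> \<psi> ` S" for z using that homeo(4) by (metis imageI)
    then show "path_image (\<phi> \<circ> l) \<subseteq> - S" using lD(2) by (auto simp: path_image_compose)
    show "pathstart (\<phi> \<circ> l) = 0" "pathfinish (\<phi> \<circ> l) = 0" using lD(3,4) phi_zero by (simp_all add: pathstart_def pathfinish_def)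
  qed
  have "\<psi> \<circ> (\<phi> \<circ> l) = l" by (simp add: fun_eq_iff homeo(4))
  then have "a = \<theta> (loop_class (- S) (\<phi> \<circ> l))" using theta_class[OF \<phi>l] l(2) by simp
  then show "a \<in> \<theta> ` carrier \<Gamma>" using loop_class_carrier[OF \<phi>l] by blast
qed

lemma basis_carrier: "b ` S \<subseteq> carrier \<Gamma>"
proof
  fix c assume "c \<in> b ` S"
  then have "c \<in> generate \<Gamma> (b ` S)" by (rule generate.incl)
  then show "c \<in> carrier \<Gamma>" using basis by (simp add: lasso_basis_def)
qed

text \<open>\<open>\<psi>\<close> carries the contraction of the loop to a contraction to
  \<open>\<psi> x\<close>, to which \<open>plane_hol_shrinking\<close> applies.\<close>

lemma theta_basis:
  assumes x: "x \<in> S"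
  shows "\<psi> x \<notin> B \<Longrightarrow> \<theta> (b x) = []"
    and "\<psi> x \<in> B \<Longrightarrow> \<exists>u w. u \<in> carrier (freeg B) \<and> w \<in> carrier (freeg B) \<and> fst ` set w \<subseteq> {\<psi> x} \<and>
      \<theta> (b x) = u \<otimes>\<^bsub>freeg B\<^esub> w \<otimes>\<^bsub>freeg B\<^esub> inv\<^bsub>freeg B\<^esub> u"
proof -
  obtain p h where p: "path p" "pathstart p = 0" "path_image p \<subseteq> - S" "pathfinish p = h (1, 0)"
    and h: "continuous_on ({0..1} \<times> {0..1}) h" "\<forall>t\<in>{0..1}. h (0, t) = x"
      "\<forall>s\<in>{0<..1}. \<forall>t\<in>{0..1}. h (s, t) \<notin> S" "\<forall>s\<in>{0..1}. h (s, 0) = h (s, 1)"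
    and bx: "b x = loop_class (- S) (p +++ ((\<lambda>t. h (1::real, t::real)) +++ reversepath p))"
    using basis x unfolding lasso_basis_def shrinking_lasso_def by blast
  define q where "q = (\<lambda>t. h (1, t))"
  have q: "path q" "path_image q \<subseteq> - S" "pathstart q = pathfinish p" "pathfinish q = pathfinish p"
  proof -
    show "path q" unfolding q_def path_def
      by (rule continuous_on_compose2[OF h(1)]) (auto intro!: continuous_intros)
    show "path_image q \<subseteq> - S" using h(3) by (auto simp: q_def path_image_def)
    show "pathstart q = pathfinish p" "pathfinish q = pathfinish p"
      using p(4) h(4) by (auto simp: q_def pathstart_def pathfinish_def)
  qed
  have loop: "p +++ (q +++ reversepath p) \<in> loops_at (- S) 0"
    using p q by (auto simp: loops_at_def path_image_join)
  have "\<theta> (b x) = plane_hol B (\<psi> \<circ> (p +++ (q +++ reversepath p)))"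
    unfolding bx q_def[symmetric] by (rule theta_class[OF loop])
  also have "\<psi> \<circ> (p +++ (q +++ reversepath p)) = (\<psi> \<circ> p) +++ ((\<lambda>t. (\<psi> \<circ> h) (1, t)) +++ reversepath (\<psi> \<circ> p))"
  proof -
    have "\<psi> \<circ> q = (\<lambda>t. (\<psi> \<circ> h) (1, t))" by (simp add: q_def fun_eq_iff)
    moreover have "\<psi> \<circ> reversepath p = reversepath (\<psi> \<circ> p)" by (simp add: reversepath_def fun_eq_iff)
    ultimately show ?thesis by (simp only: psi_join)
  qed
  finally have th: "\<theta> (b x) = plane_hol B ((\<psi> \<circ> p) +++ ((\<lambda>t. (\<psi> \<circ> h) (1, t)) +++ reversepath (\<psi> \<circ> p)))" .
  have ch: "continuous_on ({0..1} \<times> {0..1}) (\<psi> \<circ> h)"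
    by (rule continuous_on_compose[OF h(1) continuous_on_subset[OF homeo(1)]]) simp
  have fin: "pathfinish (\<psi> \<circ> p) = (\<psi> \<circ> h) (1, 0)" using p(4) by (simp add: pathfinish_def)
  have h0: "(\<psi> \<circ> h) (0, t) = \<psi> x" if "t \<in> {0..1}" for t using h(2) that by simp
  have h1: "(\<psi> \<circ> h) (s, t) \<notin> B" if "s \<in> {0<..1}" "t \<in> {0..1}" for s t using h(3) that psi_avoids by simp
  have hl: "(\<psi> \<circ> h) (s, 0) = (\<psi> \<circ> h) (s, 1)" if "s \<in> {0..1}" for s using h(4) that by simp
  show "\<psi> x \<notin> B \<Longrightarrow> \<theta> (b x) = []"
    unfolding th by (rule plane_hol_shrinking(1)[OF B(1,3) psi_path[OF p(1,3)] fin ch h0 h1 hl])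
  show "\<psi> x \<in> B \<Longrightarrow> \<exists>u w. u \<in> carrier (freeg B) \<and> w \<in> carrier (freeg B) \<and> fst ` set w \<subseteq> {\<psi> x} \<and>
      \<theta> (b x) = u \<otimes>\<^bsub>freeg B\<^esub> w \<otimes>\<^bsub>freeg B\<^esub> inv\<^bsub>freeg B\<^esub> u"
    unfolding th by (rule plane_hol_shrinking(2)[OF B(1,3) psi_path[OF p(1,3)] fin ch h0 h1 hl])
qed

text \<open>A surjective homomorphism maps generators to generators, and the basis elements of
  points outside the window \<open>B\<close> become trivial: the infinite basis is replaced by a
  finite family.\<close>

lemma theta_generate: "generate (freeg B) ((\<lambda>y. \<theta> (b (\<phi> y))) ` B) = carrier (freeg B)"
proof
  interpret h: group_hom \<Gamma> "freeg B" \<theta> by (rule theta_hom)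
  have phiS: "\<phi> y \<in> S" if y: "y \<in> B" for y
  proof -
    obtain x where "x \<in> S" "y = \<psi> x" using B(2) y by blast
    then show ?thesis by (simp add: homeo(3))
  qed
  have im: "(\<lambda>y. \<theta> (b (\<phi> y))) ` B \<subseteq> carrier (freeg B)"
    using basis_carrier phiS by (auto intro!: h.hom_closed)
  show "generate (freeg B) ((\<lambda>y. \<theta> (b (\<phi> y))) ` B) \<subseteq> carrier (freeg B)"
    by (rule h.H.generate_incl[OF im])
  interpret sub: subgroup "generate (freeg B) ((\<lambda>y. \<theta> (b (\<phi> y))) ` B)" "freeg B"
    by (rule h.H.generate_is_subgroup[OF im])
  have bx: "\<theta> (b x) \<in> generate (freeg B) ((\<lambda>y. \<theta> (b (\<phi> y))) ` B)" if x: "x \<in> S" for x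
  proof (cases "\<psi> x \<in> B")
    case True
    have "\<theta> (b x) = \<theta> (b (\<phi> (\<psi> x)))" by (simp add: homeo(3))
    then show ?thesis using True by (auto intro!: generate.incl)
  next
    case False
    then have "\<theta> (b x) = \<one>\<^bsub>freeg B\<^esub>" using theta_basis(1)[OF x] by simp
    then show ?thesis using sub.one_closed by (simp only:)
  qed
  have "\<theta> c \<in> generate (freeg B) ((\<lambda>y. \<theta> (b (\<phi> y))) ` B)" if "c \<in> generate \<Gamma> (b ` S)" for c
    using that
  proof induction
    case one
    then show ?case using h.hom_one sub.one_closed by simp
  next
    case (incl c)
    then show ?case using bx by auto
  next
    case (inv c)
    then show ?case using bx basis_carrier by (auto simp: h.hom_inv)
  next
    case (eng c d)
    have "c \<in> carrier \<Gamma>" "d \<in> carrier \<Gamma>" using eng h.G.generate_incl[OF basis_carrier] by auto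
    then show ?case using eng by (simp only: h.hom_mult sub.m_closed)
  qed
  then show "carrier (freeg B) \<subseteq> generate (freeg B) ((\<lambda>y. \<theta> (b (\<phi> y))) ` B)"
    using theta_surj basis unfolding lasso_basis_def by blast
qed

end


section \<open>Words in independent random elements\<close>

definition rename :: "('x \<Rightarrow> 'y) \<Rightarrow> ('x \<times> bool) list \<Rightarrow> ('y \<times> bool) list" where
  "rename \<sigma> = map (\<lambda>a. (\<sigma> (fst a), snd a))"

lemma letters_rename [simp]: "fst ` set (rename \<sigma> w) = \<sigma> ` fst ` set w"
  by (auto simp: rename_def image_image)

lemma weval_rename: "weval H f (rename \<sigma> w) = weval H (\<lambda>j. f (\<sigma> j)) w"
  unfolding rename_def by (rule weval_map)

text \<open>The unreduced word of the crossings seen at \<open>n\<close> sampling steps. It involves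
  no limit, and it depends on \<open>B\<close> only through the membership of its points in finitely
  many fixed regions, which makes it accessible to measurability.\<close>

definition cword :: "complex set \<Rightarrow> (real \<Rightarrow> complex) \<Rightarrow> nat \<Rightarrow> (complex \<times> bool) list" where
  "cword B l n = concat (map (\<lambda>j. stepw B (l (real j / real n)) (l (real (Suc j) / real n))) [0..<n])"

lemma letters_cword: "fst ` set (cword B l n) \<subseteq> B"
proof
  fix x assume "x \<in> fst ` set (cword B l n)"
  then obtain j where "x \<in> fst ` set (stepw B (l (real j / real n)) (l (real (Suc j) / real n)))"
    unfolding cword_def by auto
  then show "x \<in> B" using stepw_letters by blast
qed

lemma stepw_rename:
  assumes \<sigma>: "bij_betw \<sigma> B B'" and R: "\<And>x. x \<in> B \<Longrightarrow> \<sigma> x \<in> crossing z z' \<longleftrightarrow> x \<in> crossing z z'"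
  shows "stepw B' z z' = rename \<sigma> (stepw B z z')"
proof -
  let ?R = "crossing z z'"
  have im: "B' \<inter> ?R = \<sigma> ` (B \<inter> ?R)"
    using R bij_betw_imp_surj_on[OF \<sigma>] by blast
  have inj: "inj_on \<sigma> (B \<inter> ?R)" using bij_betw_imp_inj_on[OF \<sigma>] by (rule inj_on_subset) simp
  show ?thesis
  proof (cases "\<exists>x. B \<inter> ?R = {x}")
    case True
    then obtain x where x: "B \<inter> ?R = {x}" ..
    then have "B' \<inter> ?R = {\<sigma> x}" using im by simp
    then show ?thesis by (simp add: stepw_one[OF x] stepw_one rename_def)
  next
    case False
    have "\<nexists>y. B' \<inter> ?R = {y}"
    proof
      assume "\<exists>y. B' \<inter> ?R = {y}"
      then obtain y where "\<sigma> ` (B \<inter> ?R) = {y}" using im by auto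
      then have "card (B \<inter> ?R) = 1" using card_image[OF inj] by simp
      then show False using False by (meson card_1_singletonE)
    qed
    then have "\<not> (\<exists>!y. y \<in> B' \<inter> ?R)" by (metis is_singletonI' is_singleton_the_elem empty_iff)
    moreover have "\<not> (\<exists>!y. y \<in> B \<inter> ?R)" using False by (metis is_singletonI' is_singleton_the_elem empty_iff)
    ultimately show ?thesis by (simp add: stepw_def rename_def)
  qed
qed

lemma cword_rename:
  assumes \<sigma>: "bij_betw \<sigma> B B'"
    and R: "\<And>x j. x \<in> B \<Longrightarrow> j < n \<Longrightarrow> \<sigma> x \<in> crossing (l (real j / real n)) (l (real (Suc j) / real n)) \<longleftrightarrow>
      x \<in> crossing (l (real j / real n)) (l (real (Suc j) / real n))"
  shows "cword B' l n = rename \<sigma> (cword B l n)"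
proof -
  have "map (\<lambda>j. stepw B' (l (real j / real n)) (l (real (Suc j) / real n))) [0..<n] =
      map (\<lambda>j. rename \<sigma> (stepw B (l (real j / real n)) (l (real (Suc j) / real n)))) [0..<n]"
  proof (rule map_cong[OF refl])
    fix j assume "j \<in> set [0..<n]"
    then have "j < n" by simp
    then show "stepw B' (l (real j / real n)) (l (real (Suc j) / real n)) =
        rename \<sigma> (stepw B (l (real j / real n)) (l (real (Suc j) / real n)))"
      by (intro stepw_rename[OF \<sigma>] R)
  qed
  then show ?thesis unfolding cword_def rename_def map_concat map_map o_def by (simp only:)
qed

lemma crossing_sets: "crossing z z' \<in> sets borel"
proof -
  have [measurable]: "Re \<in> borel_measurable borel" "Im \<in> borel_measurable borel"
    by (intro borel_measurable_continuous_onI continuous_intros)+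
  have "crossing z z' = {x \<in> space borel. Im x < Im z \<and> (Re z < Re x \<and> Re x \<le> Re z' \<or> Re z' < Re x \<and> Re x \<le> Re z)}"
    by (simp add: crossing_def)
  also have "\<dots> \<in> sets borel" by measurable
  finally show ?thesis .
qed

text \<open>Bijections between the level sets of \<open>s\<close> are glued together.\<close>

lemma bij_preserving:
  assumes fin: "finite B" "finite B'" "finite E"
    and card: "\<And>\<tau>. \<tau> \<subseteq> E \<Longrightarrow> card {x \<in> B. s x = \<tau>} = card {x \<in> B'. s x = \<tau>}"
    and s: "\<And>x. s x \<subseteq> E"
  obtains \<sigma> where "bij_betw \<sigma> B B'" "\<And>x. x \<in> B \<Longrightarrow> s (\<sigma> x) = s x"
proof -
  have "\<exists>f. bij_betw f {x \<in> B. s x = \<tau>} {x \<in> B'. s x = \<tau>}" if "\<tau> \<subseteq> E" for \<tau>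
    using card[OF that] fin by (intro finite_same_card_bij) auto
  then obtain f where f: "\<And>\<tau>. \<tau> \<subseteq> E \<Longrightarrow> bij_betw (f \<tau>) {x \<in> B. s x = \<tau>} {x \<in> B'. s x = \<tau>}" by metis
  define \<sigma> where "\<sigma> x = f (s x) x" for x
  have b: "bij_betw \<sigma> {x \<in> B. s x = \<tau>} {x \<in> B'. s x = \<tau>}" if "\<tau> \<in> Pow E" for \<tau>
  proof -
    have "bij_betw (f \<tau>) {x \<in> B. s x = \<tau>} {x \<in> B'. s x = \<tau>}" using f that by simp
    then show ?thesis by (rule bij_betw_cong[THEN iffD1, rotated]) (simp add: \<sigma>_def)
  qed
  have "bij_betw \<sigma> (\<Union>\<tau>\<in>Pow E. {x \<in> B. s x = \<tau>}) (\<Union>\<tau>\<in>Pow E. {x \<in> B'. s x = \<tau>})"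
    by (rule bij_betw_UNION_disjoint[OF _ b]) (auto simp: disjoint_family_on_def)
  moreover have "(\<Union>\<tau>\<in>Pow E. {x \<in> B. s x = \<tau>}) = B" "(\<Union>\<tau>\<in>Pow E. {x \<in> B'. s x = \<tau>}) = B'" using s by blast+
  ultimately have bij: "bij_betw \<sigma> B B'" by simp
  have "s (\<sigma> x) = s x" if x: "x \<in> B" for x
  proof -
    have "\<sigma> x \<in> {y \<in> B'. s y = s x}"
      by (rule bij_betwE[OF b, rule_format]) (use x s in auto)
    then show ?thesis by simp
  qed
  with bij show ?thesis by (rule that)
qed

section \<open>The law of random words as a function of the configuration\<close>

context central_measure
begin

definition wprob :: "'x set \<Rightarrow> 'i set \<Rightarrow> ('i \<Rightarrow> 'g set) \<Rightarrow> ('i \<Rightarrow> ('x \<times> bool) list) \<Rightarrow> real" where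
  "wprob J I A W = measure (\<nu>s J) {g \<in> space (\<nu>s J). \<forall>i\<in>I. weval G g (W i) \<in> A i}"

lemma weval_rv:
  assumes "fst ` set w \<subseteq> J" shows "(\<lambda>g. weval G g w) \<in> borel_measurable (\<nu>s J)"
proof (rule measurable_weval)
  fix x assume "x \<in> fst ` set w"
  then have "x \<in> J" using assms by blast
  from measurable_component_singleton[OF this, of "\<lambda>_. \<nu>"]
  show "(\<lambda>g. g x) \<in> borel_measurable (\<nu>s J)" by (simp add: measurable_cong_sets[OF refl sets_nu])
qed

lemma word_event:
  assumes I: "finite I" and A: "\<And>i. i \<in> I \<Longrightarrow> A i \<in> sets borel" and W: "\<And>i. i \<in> I \<Longrightarrow> fst ` set (W i) \<subseteq> J"
  shows "{g \<in> space (\<nu>s J). \<forall>i\<in>I. weval G g (W i) \<in> A i} \<in> sets (\<nu>s J)"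
proof (rule sets.sets_Collect_finite_All[OF _ I])
  fix i assume i: "i \<in> I"
  from measurable_sets[OF weval_rv[OF W[OF i]] A[OF i]]
  show "{g \<in> space (\<nu>s J). weval G g (W i) \<in> A i} \<in> sets (\<nu>s J)" by (simp add: vimage_def Int_def conj_commute)
qed

text \<open>Selecting coordinates of an independent family along an injection gives again an
  independent family, so neither the names of the letters nor the size of the alphabet
  matter.\<close>

lemma wprob_rename:
  assumes I: "finite I" and A: "\<And>i. i \<in> I \<Longrightarrow> A i \<in> sets borel" and W: "\<And>i. i \<in> I \<Longrightarrow> fst ` set (W i) \<subseteq> J"
    and \<sigma>: "inj_on \<sigma> J" "\<sigma> ` J \<subseteq> B"
  shows "wprob B I A (\<lambda>i. rename \<sigma> (W i)) = wprob J I A W"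
proof -
  let ?r = "\<lambda>g. \<lambda>j\<in>J. g (\<sigma> j)"
  have d: "distr (\<nu>s B) (\<nu>s J) ?r = \<nu>s J"
    using distr_PiM_reindex[of B "\<lambda>_. \<nu>" \<sigma> J] prob \<sigma> by auto
  have r: "?r \<in> \<nu>s B \<rightarrow>\<^sub>M \<nu>s J"
    by (rule measurable_restrict) (use \<sigma>(2) in \<open>auto intro!: measurable_component_singleton\<close>)
  have "wprob J I A W = measure (distr (\<nu>s B) (\<nu>s J) ?r) {g \<in> space (\<nu>s J). \<forall>i\<in>I. weval G g (W i) \<in> A i}"
    unfolding wprob_def d ..
  also have "\<dots> = measure (\<nu>s B) (?r -` {g \<in> space (\<nu>s J). \<forall>i\<in>I. weval G g (W i) \<in> A i} \<inter> space (\<nu>s B))"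
    by (rule measure_distr[OF r word_event[OF I A W]])
  also have "?r -` {g \<in> space (\<nu>s J). \<forall>i\<in>I. weval G g (W i) \<in> A i} \<inter> space (\<nu>s B) =
      {g \<in> space (\<nu>s B). \<forall>i\<in>I. weval G g (rename \<sigma> (W i)) \<in> A i}"
  proof -
    have "weval G (?r g) (W i) = weval G g (rename \<sigma> (W i))" if "i \<in> I" for g i
      unfolding weval_rename by (rule weval_cong) (use W[OF that] in auto)
    moreover have "?r g \<in> space (\<nu>s J)" for g by (simp add: space_PiM)
    ultimately show ?thesis by auto
  qed
  finally show ?thesis unfolding wprob_def ..
qed

text \<open>Evaluation in \<open>G\<close> does not see cancellations, so the word need not be
  reduced.\<close>

lemma weval_seqprod:
  assumes s: "\<And>j. s j \<in> carrier (freeg B)"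
  shows "weval G g (seqprod (freeg B) s n) = weval G g (concat (map s [0..<n]))"
proof (induction n)
  case (Suc n)
  interpret h: group_hom "freeg B" G "weval G g" by (rule weval_hom) (simp add: UN)
  have "weval G g (seqprod (freeg B) s (Suc n)) = weval G g (seqprod (freeg B) s n) \<otimes> weval G g (s n)"
    unfolding seqprod.simps(2) by (rule h.hom_mult[OF h.G.seqprod_closed[OF s] s])
  also have "\<dots> = weval G g (concat (map s [0..<n]) @ s n)"
    unfolding Suc.IH by (rule weval_append[symmetric]) (simp_all add: UN)
  finally show ?case by simp
qed simp

text \<open>A crossing word needs finitely many points, hence the restriction to a ball; the value 0
  for infinitely many points is a default.\<close>

definition config_prob :: "('i \<Rightarrow> real \<Rightarrow> complex) \<Rightarrow> 'i set \<Rightarrow> ('i \<Rightarrow> 'g set) \<Rightarrow> nat \<Rightarrow> nat \<Rightarrow> complex set \<Rightarrow> real" where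
  "config_prob l I A N n S = (if finite (S \<inter> ball 0 (real N))
     then wprob (S \<inter> ball 0 (real N)) I A (\<lambda>i. cword (S \<inter> ball 0 (real N)) (l i) n) else 0)"

text \<open>The law of a family of words does not change when the letters are renamed, so \<open>config_prob l I A N n S\<close>
  is a function of the numbers of points of \<open>S\<close> in finitely many domains.\<close>

lemma config_prob_measurable:
  assumes I: "finite I" and A: "\<And>i. i \<in> I \<Longrightarrow> A i \<in> sets borel"
  shows "config_prob l I A N n \<in> borel_measurable (config_algebra borel)"
proof -
  define E where "E = I \<times> {..<n}"
  define R where "R e = crossing (l (fst e) (real (snd e) / real n)) (l (fst e) (real (Suc (snd e)) / real n))" for e
  \<comment> \<open>The signature of a point: the sampling steps at which its cut is crossed. The
    cells \<open>U \<tau>\<close> of equal signature are finitely many Borel sets.\<close>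
  define s where "s x = {e \<in> E. x \<in> R e}" for x
  define U where "U \<tau> = {x \<in> ball 0 (real N). s x = \<tau>}" for \<tau>
  have finE: "finite E" using I by (simp add: E_def)
  have sE: "s x \<subseteq> E" for x by (auto simp: s_def)
  have Rm: "R e \<in> sets borel" for e unfolding R_def by (rule crossing_sets)
  have Um: "U \<tau> \<in> sets borel" if "\<tau> \<in> Pow E" for \<tau>
  proof -
    have "U \<tau> = ball 0 (real N) \<inter> {x \<in> space borel. \<forall>e\<in>E. x \<in> R e \<longleftrightarrow> e \<in> \<tau>}"
      using that by (auto simp: U_def s_def)
    moreover have "{x \<in> space borel. \<forall>e\<in>E. x \<in> R e \<longleftrightarrow> e \<in> \<tau>} \<in> sets borel"
    proof (rule sets.sets_Collect_finite_All[OF _ finE])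
      fix e
      have "{x \<in> space borel. x \<in> R e \<longleftrightarrow> e \<in> \<tau>} = (if e \<in> \<tau> then R e else - R e)" by auto
      then show "{x \<in> space borel. x \<in> R e \<longleftrightarrow> e \<in> \<tau>} \<in> sets borel" using Rm by (simp add: borel_comp)
    qed
    ultimately show ?thesis by auto
  qed
  have ballU: "S \<inter> ball 0 (real N) = (\<Union>\<tau>\<in>Pow E. S \<inter> U \<tau>)" for S
    using sE unfolding U_def by blast
  \<comment> \<open>The numbers of points in the cells, a countably valued function of the
    configuration. Equal counts give a bijection of the points that preserves signatures, that is, a
    renaming of the letters.\<close>
  define c where "c S = (if finite (S \<inter> ball 0 (real N)) then Some (\<lambda>\<tau>\<in>Pow E. card (S \<inter> U \<tau>)) else None)" for S
  define Y where "Y = insert None (Some ` (PiE (Pow E) (\<lambda>_. UNIV :: nat set)))"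
  have cY: "c S \<in> Y" for S by (auto simp: c_def Y_def)
  have countY: "countable Y"
    unfolding Y_def using finE by (intro countable_insert countable_image countable_PiE) auto
  have inv: "config_prob l I A N n S = config_prob l I A N n S'" if eq: "c S = c S'" for S S'
  proof (cases "finite (S \<inter> ball 0 (real N))")
    case True
    then have fin': "finite (S' \<inter> ball 0 (real N))" and res: "(\<lambda>\<tau>\<in>Pow E. card (S \<inter> U \<tau>)) = (\<lambda>\<tau>\<in>Pow E. card (S' \<inter> U \<tau>))"
      using eq by (auto simp: c_def split: if_splits)
    let ?B = "S \<inter> ball 0 (real N)" and ?B' = "S' \<inter> ball 0 (real N)"
    have "card {x \<in> ?B. s x = \<tau>} = card {x \<in> ?B'. s x = \<tau>}" if "\<tau> \<subseteq> E" for \<tau>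
    proof -
      have "{x \<in> ?B. s x = \<tau>} = S \<inter> U \<tau>" "{x \<in> ?B'. s x = \<tau>} = S' \<inter> U \<tau>" by (auto simp: U_def)
      moreover have "card (S \<inter> U \<tau>) = card (S' \<inter> U \<tau>)" using fun_cong[OF res, of \<tau>] that by simp
      ultimately show ?thesis by simp
    qed
    from bij_preserving[OF True fin' finE this sE] obtain \<sigma>
      where \<sigma>: "bij_betw \<sigma> ?B ?B'" "\<And>x. x \<in> ?B \<Longrightarrow> s (\<sigma> x) = s x" by blast
    have "cword ?B' (l i) n = rename \<sigma> (cword ?B (l i) n)" if i: "i \<in> I" for i
    proof (rule cword_rename[OF \<sigma>(1)])
      fix x j assume x: "x \<in> ?B" and j: "j < n"
      have "(i, j) \<in> s (\<sigma> x) \<longleftrightarrow> (i, j) \<in> s x" using \<sigma>(2)[OF x] by simp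
      then show "\<sigma> x \<in> crossing (l i (real j / real n)) (l i (real (Suc j) / real n)) \<longleftrightarrow>
          x \<in> crossing (l i (real j / real n)) (l i (real (Suc j) / real n))"
        using i j by (simp add: s_def E_def R_def)
    qed
    then have "wprob ?B' I A (\<lambda>i. cword ?B' (l i) n) = wprob ?B' I A (\<lambda>i. rename \<sigma> (cword ?B (l i) n))"
      unfolding wprob_def by (intro arg_cong[of _ _ "measure (\<nu>s ?B')"]) auto
    also have "\<dots> = wprob ?B I A (\<lambda>i. cword ?B (l i) n)"
      by (rule wprob_rename[OF I A letters_cword]) (use \<sigma>(1) in \<open>auto simp: bij_betw_def\<close>)
    finally show ?thesis using True fin' by (simp add: config_prob_def)
  next
    case False
    then have "infinite (S' \<inter> ball 0 (real N))" using eq by (auto simp: c_def split: if_splits)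
    then show ?thesis using False by (simp add: config_prob_def)
  qed
  have some: "c -` {Some m} \<in> sets (config_algebra borel)" if m: "m \<in> PiE (Pow E) (\<lambda>_. UNIV)" for m
  proof -
    have "c -` {Some m} = {S \<in> space (config_algebra borel). \<forall>\<tau>\<in>Pow E. finite (S \<inter> U \<tau>) \<and> card (S \<inter> U \<tau>) = m \<tau>}"
    proof (rule subset_antisym; rule subsetI)
      fix S assume "S \<in> c -` {Some m}"
      then have f: "finite (S \<inter> ball 0 (real N))" and m: "m = (\<lambda>\<tau>\<in>Pow E. card (S \<inter> U \<tau>))"
        by (auto simp: c_def split: if_splits)
      have "finite (S \<inter> U \<tau>)" for \<tau> by (rule finite_subset[OF _ f]) (auto simp: U_def)
      then show "S \<in> {S \<in> space (config_algebra borel). \<forall>\<tau>\<in>Pow E. finite (S \<inter> U \<tau>) \<and> card (S \<inter> U \<tau>) = m \<tau>}"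
        unfolding m by simp
    next
      fix S assume S: "S \<in> {S \<in> space (config_algebra borel). \<forall>\<tau>\<in>Pow E. finite (S \<inter> U \<tau>) \<and> card (S \<inter> U \<tau>) = m \<tau>}"
      have "finite (\<Union>\<tau>\<in>Pow E. S \<inter> U \<tau>)" using finE S by blast
      then have "finite (S \<inter> ball 0 (real N))" using ballU by (simp only:)
      moreover have "(\<lambda>\<tau>\<in>Pow E. card (S \<inter> U \<tau>)) = m"
        by (rule PiE_ext[OF _ m]) (use S in auto)
      ultimately show "S \<in> c -` {Some m}" by (simp add: c_def)
    qed
    also have "\<dots> \<in> sets (config_algebra borel)"
    proof (rule sets.sets_Collect_finite_All)
      fix \<tau> assume "\<tau> \<in> Pow E"
      then show "{S \<in> space (config_algebra borel). finite (S \<inter> U \<tau>) \<and> card (S \<inter> U \<tau>) = m \<tau>} \<in> sets (config_algebra borel)"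
        using count_event[OF Um, of \<tau> "m \<tau>"] by simp
    qed (simp add: finE)
    finally show ?thesis .
  qed
  have none: "c -` {None} \<in> sets (config_algebra borel)"
  proof -
    have "c -` {None} = space (config_algebra borel) - (\<Union>k. {S. finite (S \<inter> ball 0 (real N)) \<and> card (S \<inter> ball 0 (real N)) = k})"
      by (auto simp: c_def)
    also have "\<dots> \<in> sets (config_algebra borel)"
      by (intro sets.compl_sets sets.countable_UN) (auto intro!: count_event)
    finally show ?thesis .
  qed
  have "c \<in> config_algebra borel \<rightarrow>\<^sub>M count_space Y"
    unfolding measurable_count_space_eq_countable[OF countY]
    using cY some none unfolding Y_def by auto
  \<comment> \<open>\<open>config_prob\<close> factors through \<open>c\<close>: it is evaluated at
    an arbitrary configuration with the given counts.\<close>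
  then have "(\<lambda>S. (\<lambda>y. config_prob l I A N n (SOME S'. c S' = y)) (c S)) \<in> borel_measurable (config_algebra borel)"
    by (rule measurable_compose) simp
  moreover have "config_prob l I A N n (SOME S'. c S' = c S) = config_prob l I A N n S" for S
    by (rule inv) (rule someI[of "\<lambda>S'. c S' = c S"], rule refl)
  ultimately show ?thesis by (simp add: cong: measurable_cong)
qed

text \<open>The lower limits make this a measurable function of every configuration; in the cases of
  interest both sequences are eventually constant, first in \<open>n\<close>, then in
  \<open>N\<close>.\<close>

definition config_limit :: "('i \<Rightarrow> real \<Rightarrow> complex) \<Rightarrow> 'i set \<Rightarrow> ('i \<Rightarrow> 'g set) \<Rightarrow> complex set \<Rightarrow> ennreal" where
  "config_limit l I A S = liminf (\<lambda>N. liminf (\<lambda>n. ennreal (config_prob l I A N n S)))"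

lemma config_limit_measurable:
  assumes "finite I" and "\<And>i. i \<in> I \<Longrightarrow> A i \<in> sets borel"
  shows "config_limit l I A \<in> borel_measurable (config_algebra borel)"
proof -
  have [measurable]: "config_prob l I A N n \<in> borel_measurable (config_algebra borel)" for N n
    by (rule config_prob_measurable[OF assms])
  show ?thesis unfolding config_limit_def[abs_def] by measurable
qed

lemma config_limit_eqI:
  assumes "\<And>N. N \<ge> N0 \<Longrightarrow> \<exists>n0. \<forall>n\<ge>n0. config_prob l I A N n S = a"
  shows "config_limit l I A S = ennreal a"
proof -
  have "liminf (\<lambda>n. ennreal (config_prob l I A N n S)) = ennreal a" if N: "N \<ge> N0" for N
  proof -
    have "\<forall>\<^sub>F n in sequentially. ennreal a = ennreal (config_prob l I A N n S)"
      using assms[OF N] unfolding eventually_sequentially by (elim exE) (rule exI, auto)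
    from Liminf_eq[OF this] show ?thesis by (simp add: Liminf_const)
  qed
  then have "\<forall>\<^sub>F N in sequentially. ennreal a = liminf (\<lambda>n. ennreal (config_prob l I A N n S))"
    unfolding eventually_sequentially by (intro exI[of _ N0]) simp
  from Liminf_eq[OF this] show ?thesis unfolding config_limit_def by (simp add: Liminf_const)
qed

end


section \<open>Holonomies through words\<close>

locale central_basis = central_measure G \<nu> + lasso_basis_image S b \<psi> \<phi> B
  for G :: "('g::{t2_space, second_countable_topology}) monoid" (structure) and \<nu> S b \<psi> \<phi> B
begin

definition v :: "complex \<Rightarrow> (complex \<times> bool) list" where "v y = \<theta> (b (\<phi> y))"

text \<open>The change of variables from the letters of the cuts to the basis: if the letters take
  the values \<open>g\<close>, the basis element attached to \<open>y\<close> takes the value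
  \<open>\<Psi> g y\<close>.\<close>

definition \<Psi> :: "(complex \<Rightarrow> 'g) \<Rightarrow> complex \<Rightarrow> 'g" where "\<Psi> g = (\<lambda>y\<in>B. weval G g (v y))"

lemma phi_mem: "y \<in> B \<Longrightarrow> \<phi> y \<in> S"
  using B(2) homeo(3) by auto

lemma v_psi: "v (\<psi> x) = \<theta> (b x)"
  by (simp add: v_def homeo(3))

lemma Psi_facts:
  "\<Psi> \<in> \<nu>s B \<rightarrow>\<^sub>M \<nu>s B" "distr (\<nu>s B) (\<nu>s B) \<Psi> = \<nu>s B" "f \<in> PiE B (\<lambda>_. UNIV) \<Longrightarrow> \<exists>g. \<Psi> g = f"
proof -
  have "\<exists>u w. u \<in> carrier (freeg B) \<and> w \<in> carrier (freeg B) \<and> fst ` set w \<subseteq> {y} \<and>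
      v y = u \<otimes>\<^bsub>freeg B\<^esub> w \<otimes>\<^bsub>freeg B\<^esub> inv\<^bsub>freeg B\<^esub> u" if y: "y \<in> B" for y
    using theta_basis(2)[OF phi_mem[OF y]] y unfolding v_def homeo(4) by blast
  then obtain u p where up: "\<forall>y\<in>B. u y \<in> carrier (freeg B) \<and> p y \<in> carrier (freeg B) \<and> fst ` set (p y) \<subseteq> {y} \<and>
      v y = u y \<otimes>\<^bsub>freeg B\<^esub> p y \<otimes>\<^bsub>freeg B\<^esub> inv\<^bsub>freeg B\<^esub> (u y)" by metis
  have v: "(\<lambda>y. \<theta> (b (\<phi> y))) ` B = v ` B" by (simp add: v_def)
  have 1: "\<And>x. x \<in> B \<Longrightarrow> u x \<in> carrier (freeg B)"
    and 2: "\<And>x. x \<in> B \<Longrightarrow> p x \<in> carrier (freeg B) \<and> fst ` set (p x) \<subseteq> {x}"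
    and 3: "\<And>x. x \<in> B \<Longrightarrow> v x = u x \<otimes>\<^bsub>freeg B\<^esub> p x \<otimes>\<^bsub>freeg B\<^esub> inv\<^bsub>freeg B\<^esub> (u x)"
    using up by simp_all
  note * = generating_conjugates_preserve[OF B(1) 1 2 3 theta_generate[unfolded v]]
  have P: "\<Psi> = (\<lambda>g. \<lambda>x\<in>B. weval G g (v x))" by (simp add: \<Psi>_def fun_eq_iff)
  show "\<Psi> \<in> \<nu>s B \<rightarrow>\<^sub>M \<nu>s B" unfolding P by (rule *(1))
  show "distr (\<nu>s B) (\<nu>s B) \<Psi> = \<nu>s B" unfolding P by (rule *(2))
  show "f \<in> PiE B (\<lambda>_. UNIV) \<Longrightarrow> \<exists>g. \<Psi> g = f" unfolding P by (rule *(3))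
qed

text \<open>Reading a class and evaluating its word at \<open>g\<close> is a homomorphism, with the
  value \<open>\<Psi> g (\<psi> x)\<close> at \<open>b x\<close>.\<close>

lemma theta_weval:
  assumes W: "fst ` set W \<subseteq> S" "\<psi> ` fst ` set W \<subseteq> B"
  shows "weval G g (\<theta> (weval \<Gamma> b W)) = weval G (\<lambda>x. \<Psi> g (\<psi> x)) W"
proof -
  interpret t: group_hom \<Gamma> "freeg B" \<theta> by (rule theta_hom)
  interpret h: group_hom "freeg B" G "weval G g" by (rule weval_hom) (simp add: UN)
  have c: "b ` fst ` set W \<subseteq> carrier \<Gamma>" using W(1) basis_carrier by blast
  have "weval G g (\<theta> (weval \<Gamma> b W)) = weval G g (weval (freeg B) (\<lambda>x. \<theta> (b x)) W)"
    by (simp only: t.hom_weval[OF c])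
  also have "\<dots> = weval G (\<lambda>x. weval G g (\<theta> (b x))) W"
    by (rule h.hom_weval) (use c in \<open>auto intro!: t.hom_closed\<close>)
  also have "\<dots> = weval G (\<lambda>x. \<Psi> g (\<psi> x)) W"
    by (rule weval_cong) (use W(2) in \<open>auto simp: \<Psi>_def v_psi\<close>)
  finally show ?thesis .
qed

text \<open>\<open>C i\<close> and \<open>V i\<close> describe the same class, by crossings and by
  the basis. Evaluating \<open>C i\<close> at \<open>g\<close> amounts to evaluating
  \<open>V i\<close> at \<open>\<Psi> g\<close>, and \<open>\<Psi>\<close> preserves the product
  law: this is where the basis disappears.\<close>

lemma wprob_words:
  assumes I: "finite I" and A: "\<And>i. i \<in> I \<Longrightarrow> A i \<in> sets borel"
    and J: "inj_on x J" "x ` J \<subseteq> S" "\<psi> ` x ` J \<subseteq> B"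
    and V: "\<And>i. i \<in> I \<Longrightarrow> fst ` set (V i) \<subseteq> J"
    and C: "\<And>i. i \<in> I \<Longrightarrow> fst ` set (C i) \<subseteq> B"
    and CV: "\<And>i g. i \<in> I \<Longrightarrow> weval G g (C i) = weval G g (\<theta> (weval \<Gamma> (\<lambda>j. b (x j)) (V i)))"
  shows "wprob B I A C = wprob J I A V"
proof -
  let ?V = "\<lambda>i. rename (\<lambda>j. \<psi> (x j)) (V i)"
  have VB: "fst ` set (?V i) \<subseteq> B" if "i \<in> I" for i using V[OF that] J(3) by auto
  have eq: "weval G g (C i) = weval G (\<Psi> g) (?V i)" if i: "i \<in> I" for g i
  proof -
    have "weval \<Gamma> (\<lambda>j. b (x j)) (V i) = weval \<Gamma> b (rename x (V i))" by (rule weval_rename[symmetric])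
    then have "weval G g (C i) = weval G g (\<theta> (weval \<Gamma> b (rename x (V i))))" using CV[OF i] by simp
    also have "\<dots> = weval G (\<lambda>x. \<Psi> g (\<psi> x)) (rename x (V i))"
      by (rule theta_weval; use V[OF i] J(2,3) in \<open>unfold letters_rename, blast\<close>)
    also have "\<dots> = weval G (\<Psi> g) (?V i)" unfolding weval_rename ..
    finally show ?thesis .
  qed
  have "wprob B I A ?V = measure (distr (\<nu>s B) (\<nu>s B) \<Psi>) {g \<in> space (\<nu>s B). \<forall>i\<in>I. weval G g (?V i) \<in> A i}"
    unfolding wprob_def Psi_facts(2) ..
  also have "\<dots> = measure (\<nu>s B) (\<Psi> -` {g \<in> space (\<nu>s B). \<forall>i\<in>I. weval G g (?V i) \<in> A i} \<inter> space (\<nu>s B))"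
    by (rule measure_distr[OF Psi_facts(1) word_event[OF I A VB]])
  also have "\<Psi> -` {g \<in> space (\<nu>s B). \<forall>i\<in>I. weval G g (?V i) \<in> A i} \<inter> space (\<nu>s B) =
      {g \<in> space (\<nu>s B). \<forall>i\<in>I. weval G g (C i) \<in> A i}"
    using measurable_space[OF Psi_facts(1)] eq by auto
  finally have "wprob B I A ?V = wprob B I A C" unfolding wprob_def .
  moreover have "wprob B I A ?V = wprob J I A V"
  proof (rule wprob_rename[OF I A V])
    have "inj \<psi>" using homeo(3) by (metis injI)
    then show "inj_on (\<lambda>j. \<psi> (x j)) J" using J(1) by (auto simp: inj_on_def)
    show "(\<lambda>j. \<psi> (x j)) ` J \<subseteq> B" using J(3) by auto
  qed
  ultimately show ?thesis by simp
qed

end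

text \<open>The relations satisfied by the basis hold in \<open>G\<close> since every \<open>\<omega>\<close> is of the form
  \<open>weval G g \<circ> \<theta> \<circ> b\<close> on the finitely many points involved.\<close>

lemma (in central_measure) weval_basis_eq:
  assumes b: "lasso_basis S b" "inj_on Re S"
    and W: "fst ` set W \<subseteq> S" "fst ` set W' \<subseteq> S"
    and eq: "weval (pi1 (- S) 0) b W = weval (pi1 (- S) 0) b W'"
  shows "weval G \<omega> W = weval G \<omega> W'"
proof -
  define B where "B = fst ` set W \<union> fst ` set W'"
  interpret central_basis G \<nu> S b "\<lambda>z. z" "\<lambda>z. z" B
  proof
    show "lasso_basis S b" by (rule b(1))
    show "finite B" "B \<subseteq> (\<lambda>z. z) ` S" using W by (auto simp: B_def)
    then show "inj_on Re B" using b(2) by (auto intro: inj_on_subset)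
  qed (auto intro: continuous_on_id)
  obtain g where g: "\<Psi> g = restrict \<omega> B" using Psi_facts(3)[of "restrict \<omega> B"] by auto
  have "weval G g (\<theta> (weval \<Gamma> b U)) = weval G \<omega> U" if "fst ` set U \<subseteq> S" "fst ` set U \<subseteq> B" for U
  proof -
    have "weval G g (\<theta> (weval \<Gamma> b U)) = weval G (\<lambda>x. \<Psi> g x) U" using theta_weval[of U g] that by simp
    also have "\<dots> = weval G \<omega> U" by (rule weval_cong) (use that(2) g in auto)
    finally show ?thesis .
  qed
  from this[of W] this[of W'] W eq show ?thesis by (simp add: B_def)
qed

text \<open>Resolves the description in \<open>holonomy_hom\<close>. By
  \<open>weval_basis_eq\<close> the value of a word in the basis depends only on its class, which
  gives existence; uniqueness holds because the basis generates.\<close>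

lemma (in central_measure) holonomy_weval:
  assumes b: "lasso_basis S b" "inj_on Re S" and S: "S = fst ` PG"
    and W: "fst ` set W \<subseteq> S" and l: "loop_class (- S) l = weval (pi1 (- S) 0) b W"
  shows "holonomy G b PG l = weval G (\<lambda>x. THE g. (x, g) \<in> PG) W"
proof -
  interpret lasso_basis_image S b "\<lambda>z. z" "\<lambda>z. z" "{}"
    by unfold_locales (auto intro: continuous_on_id b(1))
  interpret \<Gamma>: group \<Gamma> by (rule group_pi1[OF S_facts(1)])
  define \<omega> where "\<omega> x = (THE g. (x, g) \<in> PG)" for x
  have gen: "generate \<Gamma> (b ` S) = carrier \<Gamma>" using b(1) by (simp add: lasso_basis_def)
  have "\<exists>W. fst ` set W \<subseteq> S \<and> weval \<Gamma> b W = c" if "c \<in> carrier \<Gamma>" for c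
    using \<Gamma>.generate_weval[of c b S] that gen basis_carrier by metis
  then obtain R where R: "\<And>c. c \<in> carrier \<Gamma> \<Longrightarrow> fst ` set (R c) \<subseteq> S" "\<And>c. c \<in> carrier \<Gamma> \<Longrightarrow> weval \<Gamma> b (R c) = c"
    by metis
  have cl: "weval \<Gamma> b U \<in> carrier \<Gamma>" if "fst ` set U \<subseteq> S" for U
    by (rule \<Gamma>.weval_closed) (use that basis_carrier in blast)
  define h where "h = (\<lambda>c\<in>carrier \<Gamma>. weval G \<omega> (R c))"
  have h: "h (weval \<Gamma> b U) = weval G \<omega> U" if U: "fst ` set U \<subseteq> S" for U
    unfolding h_def restrict_apply'[OF cl[OF U]]
    by (rule weval_basis_eq[OF b R(1)[OF cl[OF U]] U R(2)[OF cl[OF U]]])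
  have hom: "h \<in> hom \<Gamma> G"
  proof (rule homI)
    fix c d assume c: "c \<in> carrier \<Gamma>" and d: "d \<in> carrier \<Gamma>"
    show "h c \<in> carrier G" by (simp add: UN)
    have "c \<otimes>\<^bsub>\<Gamma>\<^esub> d = weval \<Gamma> b (R c @ R d)"
      by (subst \<Gamma>.weval_append) (use R c d basis_carrier in \<open>auto simp: image_subset_iff\<close>)
    then have "h (c \<otimes>\<^bsub>\<Gamma>\<^esub> d) = weval G \<omega> (R c @ R d)"
      using R(1)[OF c] R(1)[OF d] by (subst h[symmetric]) (auto simp: image_Un)
    also have "\<dots> = h c \<otimes> h d" using c d by (subst weval_append) (simp_all add: UN h_def)
    finally show "h (c \<otimes>\<^bsub>\<Gamma>\<^esub> d) = h c \<otimes> h d" .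
  qed
  have hb: "h (b x) = \<omega> x" if x: "x \<in> S" for x
  proof -
    have "b x \<in> carrier \<Gamma>" using basis_carrier x by blast
    then have "weval \<Gamma> b [(x, True)] = b x" by simp
    then show ?thesis using h[of "[(x, True)]"] x by (simp add: UN)
  qed
  have "holonomy_hom G b PG = h"
    unfolding holonomy_hom_def S[symmetric]
  proof (rule the_equality)
    show "h \<in> hom \<Gamma> G \<inter> extensional (carrier \<Gamma>) \<and> (\<forall>x\<in>S. h (b x) = (THE g. (x, g) \<in> PG))"
      using hom hb by (simp add: h_def \<omega>_def)
    fix k assume k: "k \<in> hom \<Gamma> G \<inter> extensional (carrier \<Gamma>) \<and> (\<forall>x\<in>S. k (b x) = (THE g. (x, g) \<in> PG))"
    then interpret k: group_hom \<Gamma> G k by unfold_locales simp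
    show "k = h"
    proof (rule extensionalityI[of k "carrier \<Gamma>" h])
      show "k \<in> extensional (carrier \<Gamma>)" using k by simp
      show "h \<in> extensional (carrier \<Gamma>)" by (simp add: h_def)
      fix c assume c: "c \<in> carrier \<Gamma>"
      have "k (weval \<Gamma> b (R c)) = weval G (\<lambda>x. k (b x)) (R c)"
        by (rule k.hom_weval) (use R(1)[OF c] basis_carrier in blast)
      also have "\<dots> = weval G \<omega> (R c)"
        by (rule weval_cong) (use R(1)[OF c] k in \<open>auto simp: \<omega>_def\<close>)
      finally show "k c = h c" using R(2)[OF c] c by (simp add: h_def)
    qed
  qed
  moreover have "\<omega> = (\<lambda>x. THE g. (x, g) \<in> PG)" by (simp add: \<omega>_def fun_eq_iff)
  ultimately show ?thesis unfolding holonomy_def S[symmetric] using h[OF W] l by simp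
qed

text \<open>As soon as the ball contains the finitely many points \<open>\<psi> (x j)\<close> and
  the mesh is fine enough for the finitely many loops, the sampled crossing words represent the
  classes of the loops, and \<open>wprob_words\<close> gives a value in which neither
  \<open>N\<close> nor \<open>n\<close> occurs.\<close>

lemma (in central_measure) config_limit_eq_wprob:
  assumes b: "lasso_basis S b" and homeo: "continuous_on UNIV \<psi>" "continuous_on UNIV \<phi>" "\<And>z. \<phi> (\<psi> z) = z" "\<And>z. \<psi> (\<phi> z) = z" "\<psi> 0 = 0"
    and inj: "inj_on Re (\<psi> ` S)"
    and I: "finite I" and A: "\<And>i. i \<in> I \<Longrightarrow> A i \<in> sets borel"
    and J: "finite J" "inj_on x J" "x ` J \<subseteq> S"
    and l: "\<And>i. i \<in> I \<Longrightarrow> \<phi> \<circ> l i \<in> loops_at (- S) 0"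
    and V: "\<And>i. i \<in> I \<Longrightarrow> fst ` set (V i) \<subseteq> J"
      "\<And>i. i \<in> I \<Longrightarrow> loop_class (- S) (\<phi> \<circ> l i) = weval (pi1 (- S) 0) (\<lambda>j. b (x j)) (V i)"
  shows "config_limit l I A (\<psi> ` S) = ennreal (wprob J I A V)"
proof -
  have "finite (\<psi> ` x ` J)" using J(1) by simp
  then obtain r where r: "\<forall>y\<in>\<psi> ` x ` J. norm y \<le> r" using finite_imp_bounded bounded_iff by metis
  obtain N0 where N0: "r < real N0" using reals_Archimedean2 by blast
  show ?thesis
  proof (rule config_limit_eqI[of N0])
    fix N assume N: "N0 \<le> N"
    define B where "B = \<psi> ` S \<inter> ball 0 (real N)"
    \<comment> \<open>The points of the image in a ball come from points of \<open>S\<close> in the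
      compact image of the closed ball under \<open>\<phi>\<close>, so they are finitely
      many.\<close>
    have "compact (\<phi> ` cball 0 (real N))"
      by (rule compact_continuous_image[OF continuous_on_subset[OF homeo(2)]]) auto
    then have "finite (S \<inter> \<phi> ` cball 0 (real N))" using b by (simp add: lasso_basis_def good_config_def)
    then have "finite (\<psi> ` (S \<inter> \<phi> ` cball 0 (real N)))" by (rule finite_imageI)
    moreover have "B \<subseteq> \<psi> ` (S \<inter> \<phi> ` cball 0 (real N))"
    proof
      fix y assume "y \<in> B"
      then obtain z where z: "z \<in> S" "y = \<psi> z" "norm y < real N" by (auto simp: B_def)
      then have "z = \<phi> y" "y \<in> cball 0 (real N)" using homeo(3) by auto
      then show "y \<in> \<psi> ` (S \<inter> \<phi> ` cball 0 (real N))" using z by blast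
    qed
    ultimately have finB: "finite B" by (rule finite_subset[rotated])
    have BS: "B \<subseteq> \<psi> ` S" by (simp add: B_def)
    have injB: "inj_on Re B" by (rule inj_on_subset[OF inj BS])
    interpret central_basis G \<nu> S b \<psi> \<phi> B
      by unfold_locales (use b homeo finB BS injB in auto)
    have JB: "\<psi> ` x ` J \<subseteq> B" using r N0 N J(3) by (force simp: B_def)
    have \<psi>l: "\<psi> \<circ> (\<phi> \<circ> l i) = l i" for i by (simp add: fun_eq_iff homeo(4))
    have "\<exists>n0>0. \<forall>n\<ge>n0. plane_hol B (l i) = seqprod (freeg B) (\<lambda>j. stepw B (l i (real j / real n)) (l i (real (Suc j) / real n))) n"
      if i: "i \<in> I" for i
    proof -
      note p = psi_path[OF loops_atD(1,2)[OF l[OF i]], unfolded \<psi>l]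
      show ?thesis by (rule plane_hol_eq_H[OF finB injB p]) (intro exI conjI allI impI, assumption, blast)
    qed
    then have "\<forall>i\<in>I. \<exists>n0. \<forall>n\<ge>n0. plane_hol B (l i) = seqprod (freeg B) (\<lambda>j. stepw B (l i (real j / real n)) (l i (real (Suc j) / real n))) n"
      by fast
    from bchoice[OF this] obtain n0 where n0: "\<And>i n. i \<in> I \<Longrightarrow> n \<ge> n0 i \<Longrightarrow>
        plane_hol B (l i) = seqprod (freeg B) (\<lambda>j. stepw B (l i (real j / real n)) (l i (real (Suc j) / real n))) n"
      by fast
    define n1 where "n1 = (\<Sum>i\<in>I. n0 i)"
    have "config_prob l I A N n (\<psi> ` S) = wprob J I A V" if n: "n \<ge> n1" for n
    proof -
      have "wprob B I A (\<lambda>i. cword B (l i) n) = wprob J I A V"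
      proof (rule wprob_words[OF I A J(2,3) JB V(1) letters_cword])
        fix i g assume i: "i \<in> I"
        have "n0 i \<le> n" using n member_le_sum[of i I n0] i I by (simp add: n1_def)
        then have "\<theta> (weval \<Gamma> (\<lambda>j. b (x j)) (V i)) =
            seqprod (freeg B) (\<lambda>j. stepw B (l i (real j / real n)) (l i (real (Suc j) / real n))) n"
          using n0[OF i] theta_class[OF l[OF i]] V(2)[OF i] by (simp add: \<psi>l)
        then show "weval G g (cword B (l i) n) = weval G g (\<theta> (weval \<Gamma> (\<lambda>j. b (x j)) (V i)))"
          unfolding cword_def by (simp only: weval_seqprod[OF stepw_closed])
      qed
      then show ?thesis using finB by (simp add: config_prob_def B_def)
    qed
    then show "\<exists>n0. \<forall>n\<ge>n0. config_prob l I A N n (\<psi> ` S) = wprob J I A V" by blast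
  qed
qed


section \<open>Countably many loops\<close>

definition dense_points :: "complex set" where
  "dense_points = (SOME D. countable D \<and> (\<forall>X. open X \<longrightarrow> X \<noteq> {} \<longrightarrow> (\<exists>d\<in>D. d \<in> X)))"

lemma dense_points: "countable dense_points" "open X \<Longrightarrow> X \<noteq> {} \<Longrightarrow> \<exists>d\<in>dense_points. d \<in> X"
proof -
  have "\<exists>D :: complex set. countable D \<and> (\<forall>X. open X \<longrightarrow> X \<noteq> {} \<longrightarrow> (\<exists>d\<in>D. d \<in> X))" by (rule countable_dense_exists)
  from someI_ex[OF this] have *: "countable dense_points \<and> (\<forall>X. open X \<longrightarrow> X \<noteq> {} \<longrightarrow> (\<exists>d\<in>dense_points. d \<in> X))"
    unfolding dense_points_def .
  show "countable dense_points" using * ..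
  show "open X \<Longrightarrow> X \<noteq> {} \<Longrightarrow> \<exists>d\<in>dense_points. d \<in> X" using * by blast
qed

definition discs :: "complex set set" where
  "discs = (\<lambda>(d, k). ball d (1 / real (Suc k))) ` (dense_points \<times> UNIV)"

lemma countable_discs: "countable discs"
  unfolding discs_def by (intro countable_image countable_SIGMA dense_points(1)) auto

lemma discs_facts: "Q \<in> discs \<Longrightarrow> open Q \<and> convex Q \<and> bounded Q"
  by (auto simp: discs_def)

lemma disc_in_ball:
  assumes "e > 0"
  obtains Q r where "Q \<in> discs" "r > 0" "ball x r \<subseteq> Q" "Q \<subseteq> ball x e"
proof -
  obtain k where k: "1 / real (Suc k) < e / 2" using nat_approx_posE[of "e / 2"] assms by (auto simp: field_simps)
  \<comment> \<open>Half the radius of the disc: a centre within \<open>r\<close> of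
    \<open>x\<close> and a radius \<open>r + r\<close> make the disc contain
    \<open>ball x r\<close>, and \<open>3 * r < e\<close> keeps it inside
    \<open>ball x e\<close>.\<close>
  define r where "r = 1 / real (Suc k) / 2"
  have r: "r > 0" by (simp add: r_def)
  have rr: "r + r = 1 / real (Suc k)" unfolding r_def by (rule field_sum_of_halves)
  obtain d where d: "d \<in> dense_points" "dist x d < r"
    using dense_points(2)[of "ball x r"] r by (auto simp: mem_ball)
  have "ball x r \<subseteq> ball d (1 / real (Suc k))"
  proof
    fix y assume "y \<in> ball x r"
    then have "dist d y < r + r" using d(2) dist_triangle[of d y x] by (simp add: dist_commute)
    then show "y \<in> ball d (1 / real (Suc k))" unfolding mem_ball rr .
  qed
  moreover have "ball d (1 / real (Suc k)) \<subseteq> ball x e"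
  proof
    fix y assume "y \<in> ball d (1 / real (Suc k))"
    then have "dist d y < r + r" unfolding rr mem_ball .
    then have "dist x y < r + (r + r)" using d(2) dist_triangle[of x y d] by linarith
    moreover have "r + r < e / 2" using k unfolding rr .
    ultimately show "y \<in> ball x e" using r by simp
  qed
  moreover have "ball d (1 / real (Suc k)) \<in> discs" unfolding discs_def using d(1) by force
  ultimately show ?thesis using r that by blast
qed

lemma disc_in_open:
  assumes "open U" "x \<in> U"
  obtains Q where "Q \<in> discs" "x \<in> Q" "Q \<subseteq> U"
proof -
  obtain e where e: "e > 0" "ball x e \<subseteq> U" using assms open_contains_ball by blast
  obtain Q r where "Q \<in> discs" "r > 0" "ball x r \<subseteq> Q" "Q \<subseteq> ball x e" by (rule disc_in_ball[OF e(1)])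
  then show ?thesis using e(2) that[of Q] by (meson centre_in_ball subset_iff)
qed

definition follows :: "(real \<Rightarrow> complex) \<Rightarrow> complex set list \<Rightarrow> bool" where
  "follows p Us \<longleftrightarrow> p \<in> loops_at UNIV 0 \<and>
     (\<forall>i<length Us. \<forall>t. real i \<le> t * real (length Us) \<and> t * real (length Us) \<le> real i + 1 \<longrightarrow> p t \<in> Us ! i)"

text \<open>One loop for every finite chain of discs that some loop follows; chains, unlike loops,
  are countably many.\<close>

definition loop_repr :: "(real \<Rightarrow> complex) set" where
  "loop_repr = (\<lambda>Us. SOME p. follows p Us) ` {Us \<in> lists discs. \<exists>p. follows p Us}"

lemma countable_loop_repr: "countable loop_repr"
  unfolding loop_repr_def
  by (intro countable_image countable_subset[OF _ countable_lists[OF countable_discs]]) auto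

lemma loop_repr_loop: "p \<in> loop_repr \<Longrightarrow> p \<in> loops_at UNIV 0"
proof -
  assume "p \<in> loop_repr"
  then obtain Us where "p = (SOME p. follows p Us)" "\<exists>p. follows p Us" unfolding loop_repr_def by blast
  then have "follows p Us" by (metis someI_ex)
  then show ?thesis by (simp add: follows_def)
qed

text \<open>Two loops which follow the same chain of discs are homotopic along segments.\<close>

lemma loop_repr_dense:
  assumes U: "open U" and q: "q \<in> loops_at U 0"
  obtains p where "p \<in> loop_repr" "homotopic_paths U q p"
proof -
  note qD = loops_atD[OF q]
  obtain e where e: "e > 0" "(\<Union>x\<in>path_image q. ball x e) \<subseteq> U"
    by (rule compact_subset_open_imp_ball_epsilon_subset[OF compact_path_image[OF qD(1)] U qD(2)])
  obtain k where k: "1 / real (Suc k) < e / 2" using nat_approx_posE[of "e / 2"] e(1) by (auto simp: field_simps)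
  define r where "r = 1 / real (Suc k) / 2"
  have r: "r > 0" by (simp add: r_def)
  have rr: "r + r = 1 / real (Suc k)" unfolding r_def by (rule field_sum_of_halves)
  have "uniformly_continuous_on {0..1} q"
    by (rule compact_uniformly_continuous) (use qD(1) in \<open>auto simp: path_def\<close>)
  then obtain d where d: "d > 0" "\<And>s t. s \<in> {0..1} \<Longrightarrow> t \<in> {0..1} \<Longrightarrow> dist s t < d \<Longrightarrow> dist (q s) (q t) < r"
    unfolding uniformly_continuous_on_def using r by metis
  obtain n0 where n0: "1 / real (Suc n0) < d" using nat_approx_posE[OF d(1)] by blast
  define n where "n = Suc n0"
  have n: "n > 0" "1 / real n < d" using n0 by (simp_all add: n_def)
  have "\<exists>z\<in>dense_points. dist (q (real i / real n)) z < r" for i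
    using dense_points(2)[of "ball (q (real i / real n)) r"] r by (auto simp: mem_ball)
  then obtain z where z: "\<And>i. z i \<in> dense_points" "\<And>i. dist (q (real i / real n)) (z i) < r" by metis
  define Us where "Us = map (\<lambda>i. ball (z i) (1 / real (Suc k))) [0..<n]"
  have len: "length Us = n" by (simp add: Us_def)
  have nth: "Us ! i = ball (z i) (1 / real (Suc k))" if "i < n" for i using that by (simp add: Us_def)
  have Us: "Us \<in> lists discs" unfolding Us_def discs_def using z(1) by force
  have in01: "t \<in> {0..1}" "real i / real n \<in> {0..1}" "dist (real i / real n) t < d"
    if "i < n" "real i \<le> t * real n" "t * real n \<le> real i + 1" for i t
  proof -
    have a: "real i / real n \<le> t" "t \<le> (real i + 1) / real n" using that n(1) by (simp_all add: field_simps)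
    have b: "0 \<le> real i / real n" "(real i + 1) / real n \<le> 1" "real i / real n \<le> 1" using that(1) by (simp_all add: field_simps)
    show "t \<in> {0..1}" using order_trans[OF b(1) a(1)] order_trans[OF a(2) b(2)] by simp
    show "real i / real n \<in> {0..1}" using b by simp
    have "t - real i / real n \<le> 1 / real n" using a(2) by (simp add: add_divide_distrib)
    then show "dist (real i / real n) t < d" using a(1) n(2) by (simp add: dist_real_def)
  qed
  have sub: "Us ! i \<subseteq> U" if i: "i < n" for i
  proof
    fix y assume "y \<in> Us ! i"
    then have "dist (z i) y < r + r" unfolding nth[OF i] rr mem_ball .
    then have "dist (q (real i / real n)) y < r + (r + r)"
      using z(2)[of i] dist_triangle[of "q (real i / real n)" y "z i"] by linarith
    moreover have "r + r < e / 2" using k unfolding rr .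
    ultimately have "y \<in> ball (q (real i / real n)) e" using r by simp
    moreover have "q (real i / real n) \<in> path_image q"
      unfolding path_image_def by (rule imageI) (use i in \<open>simp add: field_simps\<close>)
    ultimately show "y \<in> U" using e(2) by blast
  qed
  have fq: "follows q Us"
    unfolding follows_def len
  proof (intro conjI allI impI)
    show "q \<in> loops_at UNIV 0" using q by (simp add: loops_at_def)
    fix i t assume i: "i < n" and t: "real i \<le> t * real n \<and> t * real n \<le> real i + 1"
    have "dist (q (real i / real n)) (q t) < r"
      by (rule d(2)) (use in01[OF i] t in auto)
    then have "dist (z i) (q t) < r + r"
      using z(2)[of i] dist_triangle[of "z i" "q t" "q (real i / real n)"] by (simp add: dist_commute)
    then show "q t \<in> Us ! i" unfolding nth[OF i] rr mem_ball .
  qed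
  define p where "p = (SOME p. follows p Us)"
  have fp: "follows p Us" unfolding p_def by (rule someI[of "\<lambda>p. follows p Us", OF fq])
  have pl: "p \<in> loops_at UNIV 0" using fp by (simp add: follows_def)
  have "p \<in> loop_repr" unfolding loop_repr_def p_def using Us fq by blast
  moreover have "homotopic_paths U q p"
  proof (rule homotopic_paths_linear)
    show "path q" "path p" using qD(1) loops_atD(1)[OF pl] by auto
    show "pathstart p = pathstart q" "pathfinish p = pathfinish q" using qD(3,4) loops_atD(3,4)[OF pl] by auto
    fix t :: real assume t: "t \<in> {0..1}"
    define i where "i = (if t = 1 then n - 1 else nat \<lfloor>t * real n\<rfloor>)"
    have i: "i < n" "real i \<le> t * real n" "t * real n \<le> real i + 1"
    proof -
      have "i < n \<and> real i \<le> t * real n \<and> t * real n \<le> real i + 1"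
      proof (cases "t = 1")
        case True
        then show ?thesis using n(1) by (simp add: i_def of_nat_diff)
      next
        case False
        then have "0 \<le> t * real n" "t * real n < real n" using t n(1) by auto
        then have "real (nat \<lfloor>t * real n\<rfloor>) \<le> t * real n" "t * real n < real (nat \<lfloor>t * real n\<rfloor>) + 1" by linarith+
        moreover from this(1) \<open>t * real n < real n\<close> have "nat \<lfloor>t * real n\<rfloor> < n" by linarith
        ultimately show ?thesis using False by (simp add: i_def)
      qed
      then show "i < n" "real i \<le> t * real n" "t * real n \<le> real i + 1" by auto
    qed
    have "q t \<in> Us ! i" "p t \<in> Us ! i" using fq fp i unfolding follows_def len by auto
    moreover have "convex (Us ! i)" using nth[OF i(1)] by simp
    ultimately have "closed_segment (q t) (p t) \<subseteq> Us ! i" by (rule closed_segment_subset)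
    then show "closed_segment (q t) (p t) \<subseteq> U" using sub[OF i(1)] by blast
  qed
  ultimately show ?thesis by (rule that)
qed

definition disc_unions :: "complex set set" where
  "disc_unions = Union ` {F. finite F \<and> F \<subseteq> discs}"

lemma countable_disc_unions: "countable disc_unions"
  unfolding disc_unions_def by (intro countable_image countable_Collect_finite_subset countable_discs)

lemma disc_unions_sets: "U \<in> disc_unions \<Longrightarrow> U \<in> sets borel"
proof -
  assume "U \<in> disc_unions"
  then obtain F where "U = \<Union>F" "F \<subseteq> discs" unfolding disc_unions_def by blast
  then have "open U" using discs_facts by blast
  then show ?thesis by simp
qed

text \<open>The image of a homotopy is compact, hence covered by finitely many discs of the
  countable family off \<open>S\<close>. Homotopy in the complement of a random set thus becomes a
  countable union of void events.\<close>

lemma homotopic_iff_disc_unions: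
  assumes S: "open (- S)"
  shows "homotopic_paths (- S) p q \<longleftrightarrow> (\<exists>U\<in>{U \<in> disc_unions. homotopic_paths U p q}. S \<inter> U = {})"
proof
  assume "homotopic_paths (- S) p q"
  then obtain h where h: "continuous_on ({0..1} \<times> {0..1}) h" "h \<in> ({0..1} \<times> {0..1}) \<rightarrow> - S"
    "(\<forall>x \<in> {0..1}. h(0,x) = p x) \<and> (\<forall>x \<in> {0..1}. h(1,x) = q x) \<and>
     (\<forall>t \<in> {0..1::real}. pathstart(h \<circ> Pair t) = pathstart p \<and> pathfinish(h \<circ> Pair t) = pathfinish p)"
    unfolding homotopic_paths by (elim exE conjE) (rule that, auto)
  define C where "C = h ` ({0..1} \<times> {0..1})"
  have C: "compact C" unfolding C_def by (intro compact_continuous_image[OF h(1)] compact_Times) auto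
  have CS: "C \<subseteq> - S" unfolding C_def using h(2) by blast
  have cov: "C \<subseteq> \<Union>{Q \<in> discs. Q \<subseteq> - S}"
  proof
    fix x assume "x \<in> C"
    then have "x \<in> - S" using CS by blast
    then obtain Q where "Q \<in> discs" "x \<in> Q" "Q \<subseteq> - S" by (rule disc_in_open[OF S])
    then show "x \<in> \<Union>{Q \<in> discs. Q \<subseteq> - S}" by blast
  qed
  obtain F where F: "F \<subseteq> {Q \<in> discs. Q \<subseteq> - S}" "finite F" "C \<subseteq> \<Union>F"
    by (rule compactE[OF C cov]) (use discs_facts in auto)
  have "homotopic_paths (\<Union>F) p q"
    unfolding homotopic_paths using h(1,3) F(3) unfolding C_def by (intro exI[of _ h]) auto
  moreover have "\<Union>F \<in> disc_unions" unfolding disc_unions_def using F by blast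
  moreover have "S \<inter> \<Union>F = {}" using F(1) by blast
  ultimately show "\<exists>U\<in>{U \<in> disc_unions. homotopic_paths U p q}. S \<inter> U = {}" by blast
next
  assume "\<exists>U\<in>{U \<in> disc_unions. homotopic_paths U p q}. S \<inter> U = {}"
  then obtain U where "homotopic_paths U p q" "S \<inter> U = {}" by blast
  then show "homotopic_paths (- S) p q" by (elim homotopic_paths_subset) blast
qed

primrec pword :: "('j \<Rightarrow> real \<Rightarrow> complex) \<Rightarrow> ('j \<times> bool) list \<Rightarrow> real \<Rightarrow> complex" where
  "pword p [] = (\<lambda>_. 0)"
| "pword p (a # V) = (if snd a then p (fst a) else reversepath (p (fst a))) +++ pword p V"

lemma pword:
  assumes X: "0 \<in> X" and p: "\<And>j. j \<in> fst ` set V \<Longrightarrow> p j \<in> loops_at X 0"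
  shows "pword p V \<in> loops_at X 0 \<and> loop_class X (pword p V) = weval (pi1 X 0) (\<lambda>j. loop_class X (p j)) V"
  using p
proof (induction V)
  case Nil
  then show ?case using loops_at_const[OF X] by (simp add: pi1_one)
next
  case (Cons a V)
  let ?q = "if snd a then p (fst a) else reversepath (p (fst a))"
  have IH: "pword p V \<in> loops_at X 0" "loop_class X (pword p V) = weval (pi1 X 0) (\<lambda>j. loop_class X (p j)) V"
    using Cons by auto
  have pa: "p (fst a) \<in> loops_at X 0" using Cons.prems by auto
  have q: "?q \<in> loops_at X 0" using pa loops_at_reverse[OF pa] by simp
  have qc: "loop_class X ?q = (if snd a then loop_class X (p (fst a)) else inv\<^bsub>pi1 X 0\<^esub> (loop_class X (p (fst a))))"
    using pi1_inv[OF X pa] by simp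
  show ?case
    using loops_at_join[OF q IH(1)] pi1_mult[OF q IH(1)] qc IH(2) by simp
qed

text \<open>Discs that isolate finitely many points of the configuration, loops that represent the corresponding
  elements of the basis, and words: countably many codes suffice to describe the holonomies of a finite
  family of loops.\<close>

type_synonym 'i code = "(complex set \<times> (real \<Rightarrow> complex)) list \<times> ('i \<Rightarrow> (nat \<times> bool) list)"

definition codes :: "'i set \<Rightarrow> 'i code set" where
  "codes I = {(xs, V). xs \<in> lists (discs \<times> loop_repr) \<and> disjoint_family_on (\<lambda>j. fst (xs ! j)) {..<length xs} \<and>
     V \<in> PiE I (\<lambda>_. {W. fst ` set W \<subseteq> {..<length xs}})}"

definition described :: "complex set \<Rightarrow> (complex \<Rightarrow> (real \<Rightarrow> complex) set) \<Rightarrow> 'i set \<Rightarrow> ('i \<Rightarrow> real \<Rightarrow> complex) \<Rightarrow> 'i code \<Rightarrow> bool" where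
  "described S b I f D \<longleftrightarrow>
     (\<forall>j\<in>{..<length (fst D)}. \<exists>x. S \<inter> fst (fst D ! j) = {x} \<and> path_image (snd (fst D ! j)) \<inter> S = {} \<and>
        b x = loop_class (- S) (snd (fst D ! j))) \<and>
     (\<forall>i\<in>I. homotopic_paths (- S) (f i) (pword (\<lambda>j. snd (fst D ! j)) (snd D i)))"

lemma countable_codes: assumes "finite I" shows "countable (codes I)"
proof (rule countable_subset)
  show "codes I \<subseteq> lists (discs \<times> loop_repr) \<times> PiE I (\<lambda>_. UNIV)" by (auto simp: codes_def PiE_iff extensional_def)
  show "countable (lists (discs \<times> loop_repr) \<times> PiE I (\<lambda>_. UNIV :: (nat \<times> bool) list set))"
    using assms countable_discs countable_loop_repr by (intro countable_SIGMA countable_lists countable_PiE) auto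
qed

lemma isolating_discs:
  assumes good: "good_config S" and L: "finite L" "L \<subseteq> S"
  shows "\<exists>Q. (\<forall>x\<in>L. Q x \<in> discs \<and> S \<inter> Q x = {x}) \<and> disjoint_family_on Q L"
proof -
  have "\<exists>e>0. \<forall>y\<in>L. y \<noteq> x \<longrightarrow> e \<le> dist x y" for x by (rule finite_set_avoid[OF L(1)])
  then obtain e where e: "\<And>x. e x > 0" "\<And>x y. y \<in> L \<Longrightarrow> y \<noteq> x \<Longrightarrow> e x \<le> dist x y" by metis
  have "\<exists>Q\<in>discs. S \<inter> Q = {x} \<and> Q \<subseteq> ball x (e x / 2)" if x: "x \<in> L" for x
  proof -
    have "finite ((S - {x}) \<inter> C)" if "compact C" for C
      using good that by (intro finite_subset[of "(S - {x}) \<inter> C" "S \<inter> C"]) (auto simp: good_config_def)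
    then have "good_config (S - {x})" using good by (simp add: good_config_def)
    then have "open (- (S - {x}) \<inter> ball x (e x / 2))" by (intro open_Int open_ball good_config_facts(4))
    moreover have "x \<in> - (S - {x}) \<inter> ball x (e x / 2)" using e(1)[of x] by simp
    ultimately obtain Q where "Q \<in> discs" "x \<in> Q" "Q \<subseteq> - (S - {x}) \<inter> ball x (e x / 2)" by (rule disc_in_open)
    then show ?thesis using x L(2) by (intro bexI[of _ Q]) auto
  qed
  then obtain Q where Q: "\<And>x. x \<in> L \<Longrightarrow> Q x \<in> discs" "\<And>x. x \<in> L \<Longrightarrow> S \<inter> Q x = {x}"
    "\<And>x. x \<in> L \<Longrightarrow> Q x \<subseteq> ball x (e x / 2)" by metis
  have "disjoint_family_on Q L"
    unfolding disjoint_family_on_def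
  proof (intro ballI impI)
    fix x y assume xy: "x \<in> L" "y \<in> L" "x \<noteq> y"
    show "Q x \<inter> Q y = {}"
    proof (rule ccontr)
      assume "Q x \<inter> Q y \<noteq> {}"
      then obtain z where z: "z \<in> Q x" "z \<in> Q y" by blast
      then have "z \<in> ball x (e x / 2)" "z \<in> ball y (e y / 2)" using Q(3)[OF xy(1)] Q(3)[OF xy(2)] by blast+
      then have "dist x z < e x / 2" "dist y z < e y / 2" unfolding mem_ball .
      moreover have "e x \<le> dist x y" "e y \<le> dist x y" using e(2)[of y x] e(2)[of x y] xy by (auto simp: dist_commute)
      moreover have "dist x y \<le> dist x z + dist y z" using dist_triangle2 by blast
      ultimately show False by simp
    qed
  qed
  with Q(1,2) show ?thesis by blast
qed

text \<open>The classes of finitely many loops are words in finitely many basis elements. Their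
  points are isolated by discs, and each of these elements is represented by a loop from the
  countable family.\<close>

lemma described_exists:
  assumes b: "lasso_basis S b" and I: "finite I" and f: "\<And>i. i \<in> I \<Longrightarrow> f i \<in> loops_at (- S) 0"
  obtains D where "D \<in> codes I" "described S b I f D"
proof -
  have good: "good_config S" using b by (simp add: lasso_basis_def)
  note S = good_config_facts[OF good]
  let ?\<Gamma> = "pi1 (- S) 0"
  interpret \<Gamma>: group ?\<Gamma> by (rule group_pi1[OF S(1)])
  have gen: "generate ?\<Gamma> (b ` S) = carrier ?\<Gamma>" using b by (simp add: lasso_basis_def)
  have bc: "b ` S \<subseteq> carrier ?\<Gamma>" unfolding gen[symmetric] by (auto intro: generate.incl)
  have "\<exists>W. fst ` set W \<subseteq> S \<and> weval ?\<Gamma> b W = loop_class (- S) (f i)" if i: "i \<in> I" for i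
  proof -
    have "loop_class (- S) (f i) \<in> generate ?\<Gamma> (b ` S)" unfolding gen by (rule loop_class_carrier[OF f[OF i]])
    then obtain W where "fst ` set W \<subseteq> S" "weval ?\<Gamma> b W = loop_class (- S) (f i)" by (rule \<Gamma>.generate_weval[OF _ bc])
    then show ?thesis by blast
  qed
  then obtain W where W: "\<And>i. i \<in> I \<Longrightarrow> fst ` set (W i) \<subseteq> S" "\<And>i. i \<in> I \<Longrightarrow> weval ?\<Gamma> b (W i) = loop_class (- S) (f i)"
    by metis
  define L where "L = (\<Union>i\<in>I. fst ` set (W i))"
  have L: "finite L" "L \<subseteq> S" using I W(1) by (auto simp: L_def)
  obtain Q where Q: "\<And>x. x \<in> L \<Longrightarrow> Q x \<in> discs" "\<And>x. x \<in> L \<Longrightarrow> S \<inter> Q x = {x}" "disjoint_family_on Q L"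
    using isolating_discs[OF good L] by blast
  have "\<exists>p\<in>loop_repr. p \<in> loops_at (- S) 0 \<and> b x = loop_class (- S) p" if x: "x \<in> L" for x
  proof -
    have "b x \<in> carrier ?\<Gamma>" using bc x L(2) by blast
    then obtain q where q: "q \<in> loops_at (- S) 0" "b x = loop_class (- S) q" by (rule pi1_carrierE)
    obtain p where p: "p \<in> loop_repr" "homotopic_paths (- S) q p" by (rule loop_repr_dense[OF S(4) q(1)])
    then show ?thesis using loops_at_homotopic[OF q(1) p(2)] loop_class_eqI[OF p(2)] q(2) by blast
  qed
  then obtain p where p: "\<And>x. x \<in> L \<Longrightarrow> p x \<in> loop_repr" "\<And>x. x \<in> L \<Longrightarrow> p x \<in> loops_at (- S) 0"
    "\<And>x. x \<in> L \<Longrightarrow> b x = loop_class (- S) (p x)" by metis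
  obtain xl where xl: "set xl = L" "distinct xl" using finite_distinct_list[OF L(1)] by blast
  define xs where "xs = map (\<lambda>x. (Q x, p x)) xl"
  have len: "length xs = length xl" and nth: "j < length xl \<Longrightarrow> xs ! j = (Q (xl ! j), p (xl ! j))" for j by (simp_all add: xs_def)
  have xlL: "j < length xl \<Longrightarrow> xl ! j \<in> L" for j using xl(1) by auto
  have "\<exists>j<length xl. xl ! j = x" if "x \<in> L" for x using that xl(1) by (metis in_set_conv_nth)
  then obtain \<iota> where \<iota>: "\<And>x. x \<in> L \<Longrightarrow> \<iota> x < length xl" "\<And>x. x \<in> L \<Longrightarrow> xl ! \<iota> x = x" by metis
  define V where "V = (\<lambda>i\<in>I. rename \<iota> (W i))"
  have V: "fst ` set (V i) \<subseteq> {..<length xs}" if i: "i \<in> I" for i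
    using \<iota>(1) i unfolding V_def len by (auto simp: L_def)
  have "(xs, V) \<in> codes I"
    unfolding codes_def
  proof (intro CollectI case_prodI conjI)
    show "xs \<in> lists (discs \<times> loop_repr)" unfolding xs_def using Q(1) p(1) xl(1) by auto
    show "disjoint_family_on (\<lambda>j. fst (xs ! j)) {..<length xs}"
      unfolding disjoint_family_on_def len
    proof (intro ballI impI)
      fix i j assume ij: "i \<in> {..<length xl}" "j \<in> {..<length xl}" "i \<noteq> j"
      then have "xl ! i \<noteq> xl ! j" using xl(2) by (simp add: nth_eq_iff_index_eq)
      then have "Q (xl ! i) \<inter> Q (xl ! j) = {}" using Q(3) xlL ij by (simp add: disjoint_family_on_def)
      then show "fst (xs ! i) \<inter> fst (xs ! j) = {}" using ij nth by simp
    qed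
    show "V \<in> PiE I (\<lambda>_. {W. fst ` set W \<subseteq> {..<length xs}})" using V by (auto simp: PiE_iff V_def)
  qed
  moreover have "described S b I f (xs, V)"
    unfolding described_def fst_conv snd_conv
  proof (intro conjI ballI)
    fix j assume "j \<in> {..<length xs}"
    then have j: "j < length xl" by (simp add: len)
    have x: "xl ! j \<in> L" by (rule xlL[OF j])
    show "\<exists>x. S \<inter> fst (xs ! j) = {x} \<and> path_image (snd (xs ! j)) \<inter> S = {} \<and> b x = loop_class (- S) (snd (xs ! j))"
      using Q(2)[OF x] p(3)[OF x] loops_atD(2)[OF p(2)[OF x]] nth[OF j] by (intro exI[of _ "xl ! j"]) auto
  next
    fix i assume i: "i \<in> I"
    have pl: "snd (xs ! j) \<in> loops_at (- S) 0" if "j \<in> fst ` set (V i)" for j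
    proof -
      have "j < length xl" using that V[OF i] by (auto simp: len)
      then show ?thesis using nth p(2) xlL by simp
    qed
    have "loop_class (- S) (pword (\<lambda>j. snd (xs ! j)) (V i)) = weval ?\<Gamma> (\<lambda>j. loop_class (- S) (snd (xs ! j))) (V i)"
      using pword[OF S(1), of "V i" "\<lambda>j. snd (xs ! j)"] pl by blast
    also have "\<dots> = weval ?\<Gamma> (\<lambda>x. loop_class (- S) (snd (xs ! \<iota> x))) (W i)"
      using i by (simp only: V_def restrict_apply' weval_rename)
    also have "\<dots> = weval ?\<Gamma> b (W i)"
    proof (rule weval_cong)
      fix x assume "x \<in> fst ` set (W i)"
      then have "x \<in> L" using i by (auto simp: L_def)
      then show "loop_class (- S) (snd (xs ! \<iota> x)) = b x" using \<iota> nth p(3) by simp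
    qed
    also have "\<dots> = loop_class (- S) (f i)" by (rule W(2)[OF i])
    finally have "loop_class (- S) (f i) = loop_class (- S) (pword (\<lambda>j. snd (xs ! j)) (V i))" ..
    then show "homotopic_paths (- S) (f i) (pword (\<lambda>j. snd (xs ! j)) (V i))"
      using loop_class_eq_iff[OF f[OF i]] by blast
  qed
  ultimately show ?thesis by (rule that)
qed

lemma described_words:
  assumes D: "D \<in> codes I" "described S b I f D" and S: "good_config S" and i: "i \<in> I" and f: "f i \<in> loops_at UNIV 0"
    and x: "\<And>j. j < length (fst D) \<Longrightarrow> S \<inter> fst (fst D ! j) = {x j}"
  shows "f i \<in> loops_at (- S) 0" "loop_class (- S) (f i) = weval (pi1 (- S) 0) (\<lambda>j. b (x j)) (snd D i)"
proof -
  have V: "fst ` set (snd D i) \<subseteq> {..<length (fst D)}" using D(1) i by (auto simp: codes_def PiE_iff split: prod.splits)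
  have h: "homotopic_paths (- S) (f i) (pword (\<lambda>j. snd (fst D ! j)) (snd D i))" using D(2) i by (simp add: described_def)
  show fS: "f i \<in> loops_at (- S) 0"
    using f homotopic_paths_imp_subset[OF h] by (simp add: loops_at_def)
  have j: "snd (fst D ! j) \<in> loops_at (- S) 0 \<and> b (x j) = loop_class (- S) (snd (fst D ! j))" if "j \<in> fst ` set (snd D i)" for j
  proof -
    have j: "j < length (fst D)" using that V by blast
    then obtain y where y: "S \<inter> fst (fst D ! j) = {y}" "path_image (snd (fst D ! j)) \<inter> S = {}"
      "b y = loop_class (- S) (snd (fst D ! j))" using D(2) unfolding described_def by blast
    have "fst D ! j \<in> discs \<times> loop_repr" using D(1) j nth_mem[OF j] by (auto simp: codes_def split: prod.splits)
    then have "snd (fst D ! j) \<in> loops_at UNIV 0" by (intro loop_repr_loop) auto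
    then have "snd (fst D ! j) \<in> loops_at (- S) 0" using y(2) by (auto simp: loops_at_def)
    moreover have "x j = y" using x[OF j] y(1) by simp
    ultimately show ?thesis using y(3) by simp
  qed
  have "loop_class (- S) (f i) = weval (pi1 (- S) 0) (\<lambda>j. loop_class (- S) (snd (fst D ! j))) (snd D i)"
    using loop_class_eqI[OF h] pword[OF good_config_facts(1)[OF S], of "snd D i" "\<lambda>j. snd (fst D ! j)"] j by simp
  also have "\<dots> = weval (pi1 (- S) 0) (\<lambda>j. b (x j)) (snd D i)" by (rule weval_cong) (use j in simp)
  finally show "loop_class (- S) (f i) = weval (pi1 (- S) 0) (\<lambda>j. b (x j)) (snd D i)" .
qed


section \<open>The law of the holonomies\<close>

text \<open>Closed balls of integer radius stand for all compact sets.\<close>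

lemma good_config_event: "{S. good_config S} \<in> sets (config_algebra borel)"
proof -
  have "{S. good_config S} = void_event {0} \<inter> (\<Inter>n. \<Union>m. {S. finite (S \<inter> cball 0 (real n)) \<and> card (S \<inter> cball 0 (real n)) = m})"
  proof (rule subset_antisym; rule subsetI)
    fix S :: "complex set" assume "S \<in> {S. good_config S}"
    then have "good_config S" by simp
    then show "S \<in> void_event {0} \<inter> (\<Inter>n. \<Union>m. {S. finite (S \<inter> cball 0 (real n)) \<and> card (S \<inter> cball 0 (real n)) = m})"
      using good_config_facts(1,5) by auto
  next
    fix S :: "complex set"
    assume S: "S \<in> void_event {0} \<inter> (\<Inter>n. \<Union>m. {S. finite (S \<inter> cball 0 (real n)) \<and> card (S \<inter> cball 0 (real n)) = m})"
    have "finite (S \<inter> C)" if C: "compact C" for C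
    proof -
      obtain r where r: "\<forall>x\<in>C. norm x \<le> r" using compact_imp_bounded[OF C, unfolded bounded_iff] by blast
      obtain n where n: "r \<le> real n" using real_arch_simple by blast
      have "S \<inter> C \<subseteq> S \<inter> cball 0 (real n)" using r n by force
      moreover have "finite (S \<inter> cball 0 (real n))" using S by auto
      ultimately show ?thesis by (rule finite_subset)
    qed
    then show "S \<in> {S. good_config S}" using S by (simp add: good_config_def)
  qed
  also have "\<dots> \<in> sets (config_algebra borel)"
  proof (intro sets.Int void_event_sets sets.countable_INT subsetI)
    fix A assume "A \<in> range (\<lambda>n. \<Union>m. {S. finite (S \<inter> cball (0 :: complex) (real n)) \<and> card (S \<inter> cball 0 (real n)) = m})"
    then obtain n where "A = (\<Union>m. {S. finite (S \<inter> cball (0 :: complex) (real n)) \<and> card (S \<inter> cball 0 (real n)) = m})" by blast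
    then show "A \<in> sets (config_algebra borel)" by (auto intro!: sets.countable_UN count_event)
  qed auto
  finally show ?thesis .
qed

lemma homotopic_event: "{S. good_config S \<and> homotopic_paths (- S) p q} \<in> sets (config_algebra borel)"
proof -
  let ?U = "{U \<in> disc_unions. homotopic_paths U p q}"
  have "{S. good_config S \<and> homotopic_paths (- S) p q} = {S. good_config S} \<inter> (\<Union>U\<in>?U. void_event U)"
    using homotopic_iff_disc_unions[OF good_config_facts(4)] by blast
  also have "\<dots> \<in> sets (config_algebra borel)"
  proof (intro sets.Int good_config_event sets.countable_UN'')
    show "countable ?U" by (rule countable_subset[OF _ countable_disc_unions]) blast
    show "void_event U \<in> sets (config_algebra borel)" if "U \<in> ?U" for U
      using that disc_unions_sets by (intro void_event_sets) blast
  qed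
  finally show ?thesis .
qed

section \<open>Events determined by the configuration\<close>

context marked_poisson
begin

lemma sets_sigma_config: "sets (sigma_config M X) = {X -` E \<inter> space M | E. E \<in> sets (config_algebra borel)}"
  unfolding sigma_config_def by (rule sets_vimage_algebra2) simp

lemma space_sigma_config [simp]: "space (sigma_config M X) = space M"
  by (simp add: sigma_config_def)

lemma sigma_configI: "E \<in> sets (config_algebra borel) \<Longrightarrow> {w \<in> space M. X w \<in> E} \<in> sets (sigma_config M X)"
  unfolding sets_sigma_config by (intro CollectI exI[of _ E]) auto

lemma one_point_set: "Q \<in> sets borel \<Longrightarrow> {w \<in> space M. \<exists>x. X w \<inter> Q = {x}} \<in> sets (sigma_config M X)"
proof -
  assume Q: "Q \<in> sets borel"
  have "{w \<in> space M. \<exists>x. X w \<inter> Q = {x}} = {w \<in> space M. X w \<in> {S. finite (S \<inter> Q) \<and> card (S \<inter> Q) = 1}}"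
    by (auto simp: card_1_singleton_iff)
  with sigma_configI[OF count_event[OF Q, of 1]] show ?thesis by simp
qed

text \<open>The measurability of the basis concerns pairs \<open>(w, x)\<close>. Inserting for
  \<open>x\<close> the only point of the configuration in \<open>Q\<close>, itself a measurable
  function of the configuration, gives an event about \<open>w\<close> alone.\<close>

lemma basis_event:
  assumes b: "measurable_proper_basis M X b" and Q: "Q \<in> sets borel" and p: "p \<in> loops_at UNIV 0"
  shows "{w \<in> space M. good_config (X w) \<and> (\<exists>x. X w \<inter> Q = {x} \<and> path_image p \<inter> X w = {} \<and> b w x = loop_class (- X w) p)}
    \<in> sets (sigma_config M X)"
proof -
  let ?S = "sigma_config M X"
  define U where "U = {w \<in> space M. \<exists>x. X w \<inter> Q = {x}}"
  define T where "T = {(w, x). w \<in> space M \<and> good_config (X w) \<and> x \<in> X w \<and> path_image p \<inter> X w = {} \<and> b w x = loop_class (- X w) p}"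
  have T: "T \<in> sets (?S \<Otimes>\<^sub>M borel)" using b p unfolding measurable_proper_basis_def T_def by blast
  have U: "U \<in> sets ?S" unfolding U_def by (rule one_point_set[OF Q])
  \<comment> \<open>The value 0 off \<open>U\<close> is a default, discarded below by the
    intersection with \<open>U\<close>.\<close>
  define \<xi> where "\<xi> w = (if w \<in> U then the_elem (X w \<inter> Q) else 0)" for w
  have \<xi>: "\<xi> \<in> ?S \<rightarrow>\<^sub>M borel"
  proof (rule measurableI)
    fix D :: "complex set" assume D: "D \<in> sets borel"
    have "\<xi> -` D \<inter> space ?S = (U \<inter> {w \<in> space M. \<exists>x. X w \<inter> (Q \<inter> D) = {x}}) \<union> (if 0 \<in> D then space ?S - U else {})"
    proof (rule subset_antisym; rule subsetI)
      fix w assume w: "w \<in> \<xi> -` D \<inter> space ?S"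
      show "w \<in> (U \<inter> {w \<in> space M. \<exists>x. X w \<inter> (Q \<inter> D) = {x}}) \<union> (if 0 \<in> D then space ?S - U else {})"
      proof (cases "w \<in> U")
        case True
        then obtain x where x: "X w \<inter> Q = {x}" by (auto simp: U_def)
        then have "x \<in> D" using w True by (simp add: \<xi>_def)
        then have "X w \<inter> (Q \<inter> D) = {x}" using x by blast
        then show ?thesis using True w by auto
      qed (use w in \<open>auto simp: \<xi>_def\<close>)
    next
      fix w assume w: "w \<in> (U \<inter> {w \<in> space M. \<exists>x. X w \<inter> (Q \<inter> D) = {x}}) \<union> (if 0 \<in> D then space ?S - U else {})"
      show "w \<in> \<xi> -` D \<inter> space ?S"
      proof (cases "w \<in> U")
        case True
        then have "w \<in> {w \<in> space M. \<exists>x. X w \<inter> (Q \<inter> D) = {x}}" using w by (auto split: if_splits)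
        then obtain x y where x: "X w \<inter> Q = {x}" "X w \<inter> (Q \<inter> D) = {y}" using True by (auto simp: U_def)
        then have "y \<in> X w \<inter> (Q \<inter> D)" by simp
        then have "y \<in> {x}" "y \<in> D" unfolding x(1)[symmetric] by simp_all
        then have "x \<in> D" by simp
        then show ?thesis using True x(1) by (simp add: \<xi>_def U_def)
      qed (use w in \<open>auto simp: \<xi>_def split: if_splits\<close>)
    qed
    also have "\<dots> \<in> sets ?S"
    proof (rule sets.Un)
      show "U \<inter> {w \<in> space M. \<exists>x. X w \<inter> (Q \<inter> D) = {x}} \<in> sets ?S"
        by (rule sets.Int[OF U one_point_set]) (use Q D in blast)
      show "(if 0 \<in> D then space ?S - U else {}) \<in> sets ?S" using sets.compl_sets[OF U] by (cases "0 \<in> D") (simp_all only: sets.empty_sets if_True if_False)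
    qed
    finally show "\<xi> -` D \<inter> space ?S \<in> sets ?S" .
  qed simp
  have "(\<lambda>w. (w, \<xi> w)) \<in> ?S \<rightarrow>\<^sub>M ?S \<Otimes>\<^sub>M borel" using \<xi> by (intro measurable_Pair) auto
  from measurable_sets[OF this T] have "(\<lambda>w. (w, \<xi> w)) -` T \<inter> space ?S \<in> sets ?S" .
  then have "U \<inter> ((\<lambda>w. (w, \<xi> w)) -` T \<inter> space ?S) \<in> sets ?S" using U by blast
  also have "U \<inter> ((\<lambda>w. (w, \<xi> w)) -` T \<inter> space ?S) = {w \<in> space M. good_config (X w) \<and>
      (\<exists>x. X w \<inter> Q = {x} \<and> path_image p \<inter> X w = {} \<and> b w x = loop_class (- X w) p)}"
  proof (rule subset_antisym; rule subsetI)
    fix w assume w: "w \<in> U \<inter> ((\<lambda>w. (w, \<xi> w)) -` T \<inter> space ?S)"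
    then obtain x where x: "X w \<inter> Q = {x}" by (auto simp: U_def)
    then have "\<xi> w = x" using w by (simp add: \<xi>_def)
    then show "w \<in> {w \<in> space M. good_config (X w) \<and>
      (\<exists>x. X w \<inter> Q = {x} \<and> path_image p \<inter> X w = {} \<and> b w x = loop_class (- X w) p)}"
      using w x by (auto simp: T_def)
  next
    fix w assume "w \<in> {w \<in> space M. good_config (X w) \<and>
      (\<exists>x. X w \<inter> Q = {x} \<and> path_image p \<inter> X w = {} \<and> b w x = loop_class (- X w) p)}"
    then obtain x where w: "w \<in> space M" "good_config (X w)" and x: "X w \<inter> Q = {x}" "path_image p \<inter> X w = {}"
      "b w x = loop_class (- X w) p" by blast
    have "w \<in> U" using w x by (auto simp: U_def)
    moreover then have "\<xi> w = x" using x(1) by (simp add: \<xi>_def)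
    moreover have "x \<in> X w" using x(1) by blast
    ultimately show "w \<in> U \<inter> ((\<lambda>w. (w, \<xi> w)) -` T \<inter> space ?S)" using w x by (simp add: T_def)
  qed
  finally show ?thesis .
qed

text \<open>Finitely many conditions: \<open>basis_event\<close> treats the discs,
  \<open>homotopic_event\<close> the loops.\<close>

lemma described_event:
  assumes b: "measurable_proper_basis M X b" and D: "D \<in> codes I" and I: "finite I"
  shows "{w \<in> space M. good_config (X w) \<and> described (X w) (b w) I F D} \<in> sets (sigma_config M X)"
proof -
  let ?S = "sigma_config M X" and ?n = "length (fst D)"
  let ?A = "\<lambda>j. {w \<in> space M. good_config (X w) \<and> (\<exists>x. X w \<inter> fst (fst D ! j) = {x} \<and>
      path_image (snd (fst D ! j)) \<inter> X w = {} \<and> b w x = loop_class (- X w) (snd (fst D ! j)))}"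
  let ?B = "\<lambda>i. {w \<in> space M. X w \<in> {S. good_config S \<and> homotopic_paths (- S) (F i) (pword (\<lambda>j. snd (fst D ! j)) (snd D i))}}"
  have A: "?A j \<in> sets ?S" if j: "j < ?n" for j
  proof -
    have "fst D ! j \<in> discs \<times> loop_repr" using D nth_mem[OF j] by (auto simp: codes_def split: prod.splits)
    then have "fst (fst D ! j) \<in> discs" "snd (fst D ! j) \<in> loop_repr" by auto
    then show ?thesis using discs_facts by (intro basis_event[OF b] loop_repr_loop) auto
  qed
  have 1: "{w \<in> space ?S. \<forall>j\<in>{..<?n}. w \<in> ?A j} \<in> sets ?S"
  proof (rule sets.sets_Collect_finite_All)
    fix j assume "j \<in> {..<?n}"
    then have "?A j \<in> sets ?S" using A by simp
    moreover have "{w \<in> space ?S. w \<in> ?A j} = ?A j" by auto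
    ultimately show "{w \<in> space ?S. w \<in> ?A j} \<in> sets ?S" by (simp only:)
  qed simp
  have 2: "{w \<in> space ?S. \<forall>i\<in>I. w \<in> ?B i} \<in> sets ?S"
  proof (rule sets.sets_Collect_finite_All[OF _ I])
    fix i
    have "?B i \<in> sets ?S" by (rule sigma_configI[OF homotopic_event])
    moreover have "{w \<in> space ?S. w \<in> ?B i} = ?B i" by auto
    ultimately show "{w \<in> space ?S. w \<in> ?B i} \<in> sets ?S" by (simp only:)
  qed
  have "{w \<in> space M. X w \<in> {S. good_config S}} \<in> sets ?S" by (rule sigma_configI[OF good_config_event])
  then have "{w \<in> space M. X w \<in> {S. good_config S}} \<inter> ({w \<in> space ?S. \<forall>j\<in>{..<?n}. w \<in> ?A j} \<inter> {w \<in> space ?S. \<forall>i\<in>I. w \<in> ?B i}) \<in> sets ?S"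
    using 1 2 by (intro sets.Int)
  also have "{w \<in> space M. X w \<in> {S. good_config S}} \<inter> ({w \<in> space ?S. \<forall>j\<in>{..<?n}. w \<in> ?A j} \<inter> {w \<in> space ?S. \<forall>i\<in>I. w \<in> ?B i}) =
      {w \<in> space M. good_config (X w) \<and> described (X w) (b w) I F D}"
    unfolding described_def space_sigma_config by (rule subset_antisym; rule subsetI; simp)
  finally show ?thesis .
qed

lemma AE_avoid:
  assumes "l \<in> null_loops" shows "AE w in M. path_image l \<inter> X w = {}"
proof -
  have l: "path l" "path_image l \<in> null_sets lborel" using assms by (auto simp: null_loops_def loops_at_def)
  have c: "path_image l \<in> sets borel" using compact_imp_closed[OF compact_path_image[OF l(1)]] by (rule borel_closed)
  have "measure lborel (path_image l) = 0" using l(2) by (simp add: measure_eq_0_null_sets)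
  then have "prob {w \<in> space M. X w \<inter> path_image l = {}} = 1"
    using void_prob[OF c] l(2) by (simp add: null_setsD1)
  then have "AE w in M. X w \<inter> path_image l = {}" using prob_Collect_eq_1[OF void_sets[OF c]] by simp
  then show ?thesis by (simp add: Int_commute)
qed

end

section \<open>The law of finitely many holonomies\<close>

locale random_holonomy = marked_poisson M K \<mu> P + central_measure G "distr \<mu> borel f"
  for M :: "'w measure" and K and \<mu> :: "'e::euclidean_space measure" and P
    and G :: "('g::{t2_space, second_countable_topology}) monoid" (structure) and f +
  assumes f: "f \<in> borel_measurable borel"
begin

definition marks :: "'w \<Rightarrow> (complex \<times> 'g) set" where
  "marks w = (\<lambda>(x, Z). (x, f Z)) ` P w"

lemma fst_marks: "fst ` marks w = X w"
  by (force simp: marks_def X_def)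

lemma mark_eq:
  assumes inj: "\<forall>a\<in>P w. \<forall>b\<in>P w. fst a = fst b \<longrightarrow> a = b" and s: "single Q w" and x: "X w \<inter> Q = {x}"
  shows "(THE g. (x, g) \<in> marks w) = f (mark Q w)"
proof -
  obtain y where y: "P w \<inter> Q \<times> UNIV = {(y, mark Q w)}" "y \<in> Q" by (rule single_elem[OF s])
  then have yP: "(y, mark Q w) \<in> P w" by blast
  then have "y \<in> X w" unfolding X_def by force
  then have "y = x" using x y(2) by blast
  then have xP: "(x, mark Q w) \<in> P w" using yP by simp
  show ?thesis
  proof (rule the_equality)
    show "(x, f (mark Q w)) \<in> marks w" unfolding marks_def using xP by force
    fix g assume "(x, g) \<in> marks w"
    then obtain Z where Z: "(x, Z) \<in> P w" "g = f Z" unfolding marks_def by auto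
    then have "(x, Z) = (x, mark Q w)" using inj[rule_format, OF Z(1) xP] by simp
    then show "g = f (mark Q w)" using Z(2) by simp
  qed
qed

lemma single_if_inj:
  assumes inj: "\<forall>a\<in>P w. \<forall>b\<in>P w. fst a = fst b \<longrightarrow> a = b" and x: "X w \<inter> Q = {x}"
  shows "single Q w"
proof -
  have "x \<in> X w" "x \<in> Q" using x by auto
  then obtain Z where Z: "(x, Z) \<in> P w" unfolding X_def by force
  have "P w \<inter> Q \<times> UNIV = {(x, Z)}"
  proof (rule subset_antisym; rule subsetI)
    fix a assume a: "a \<in> P w \<inter> Q \<times> UNIV"
    then have "fst a \<in> X w \<inter> Q" unfolding X_def by auto
    then have "fst a = fst (x, Z)" using x by simp
    then have "a = (x, Z)" using inj[rule_format, of a "(x, Z)"] a Z by blast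
    then show "a \<in> {(x, Z)}" by simp
  qed (use Z \<open>x \<in> Q\<close> in auto)
  then show ?thesis by (simp add: single_def)
qed

text \<open>\<open>Y\<close> is a version of the holonomies that is measurable before completion. On
  the piece \<open>N n\<close> they are the words \<open>V n i\<close> in marks that are independent
  of the configuration, which yields the conditional probability
  \<open>wprob (J n) I A (V n)\<close>. By \<open>config_limit_eq_wprob\<close> this number is a
  function of the image configuration alone, so the sum over the pieces is an integral from which
  codes and basis have vanished.\<close>

theorem holonomy_law:
  fixes I :: "'i set" and l :: "'i \<Rightarrow> real \<Rightarrow> complex"
  assumes b: "measurable_proper_basis M X b" and I: "finite I"
    and homeo: "continuous_on UNIV \<psi>" "continuous_on UNIV \<phi>" "\<And>z. \<phi> (\<psi> z) = z" "\<And>z. \<psi> (\<phi> z) = z" "\<psi> 0 = 0"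
    and pres: "\<And>A. A \<in> sets borel \<Longrightarrow> emeasure lborel (\<psi> -` A) = emeasure lborel A"
    and l: "\<And>i. i \<in> I \<Longrightarrow> \<phi> \<circ> l i \<in> null_loops"
  shows "\<exists>Y. (\<forall>i\<in>I. Y i \<in> borel_measurable M) \<and>
    (\<forall>i\<in>I. AE w in M. Y i w = holonomy G (b w) (marks w) (\<phi> \<circ> l i)) \<and>
    (\<forall>A. (\<forall>i\<in>I. A i \<in> sets borel) \<longrightarrow>
      emeasure M {w \<in> space M. \<forall>i\<in>I. Y i w \<in> A i} = (\<integral>\<^sup>+w. config_limit l I A (X w) \<partial>M))"
proof -
  define F where "F i = \<phi> \<circ> l i" for i
  have F: "F i \<in> loops_at UNIV 0" "F i \<in> null_loops" if "i \<in> I" for i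
    using l[OF that] by (simp_all add: F_def null_loops_def)
  have ne: "codes I \<noteq> {}"
  proof -
    have "([], \<lambda>i\<in>I. []) \<in> codes I" by (simp add: codes_def disjoint_family_on_def)
    then show ?thesis by blast
  qed
  define e where "e = from_nat_into (codes I)"
  have e: "e n \<in> codes I" for n unfolding e_def by (rule from_nat_into[OF ne])
  have e_surj: "\<exists>n. e n = D" if "D \<in> codes I" for D
    unfolding e_def using from_nat_into_surj[OF countable_codes[OF I] that] .
  define J where "J n = {..<length (fst (e n))}" for n
  define Q where "Q n j = fst (fst (e n) ! j)" for n j
  define V where "V n = snd (e n)" for n
  have finJ: "finite (J n)" for n by (simp add: J_def)
  have Qd: "Q n j \<in> discs" if "j \<in> J n" for n j
  proof -
    have "fst (e n) ! j \<in> discs \<times> loop_repr" using e[of n] that nth_mem[of j "fst (e n)"] by (auto simp: codes_def J_def split: prod.splits)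
    then show ?thesis by (auto simp: Q_def)
  qed
  have Q: "Q n j \<in> sets borel" "bounded (Q n j)" if "j \<in> J n" for n j using discs_facts[OF Qd[OF that]] by auto
  have Qdis: "disjoint_family_on (Q n) (J n)" for n
    using e[of n] by (auto simp: codes_def J_def Q_def[abs_def] split: prod.splits)
  have V: "fst ` set (V n i) \<subseteq> J n" if "i \<in> I" for n i
    using e[of n] that by (auto simp: codes_def J_def V_def PiE_iff split: prod.splits)
  define T where "T n = {w \<in> space M. good_config (X w) \<and> described (X w) (b w) I F (e n)}" for n
  have "\<exists>E. E \<in> sets (config_algebra borel) \<and> T n = X -` E \<inter> space M" for n
    using described_event[OF b e[of n] I, of F] unfolding T_def[symmetric] sets_sigma_config by blast
  then obtain E where E: "\<And>n. E n \<in> sets (config_algebra borel)" "\<And>n. T n = X -` E n \<inter> space M" by metis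
  \<comment> \<open>Only the first code that describes the configuration is kept, which makes the
    pieces disjoint; each is still an event of the configuration, as \<open>mark_law\<close>
    requires.\<close>
  define E' where "E' = disjointed E"
  have E': "E' n \<in> sets (config_algebra borel)" for n
    using sets.range_disjointed_sets[of E "config_algebra borel"] E(1) unfolding E'_def by blast
  have E'_sub: "E' n \<subseteq> E n" for n unfolding E'_def by (rule disjointed_subset)
  define N where "N n = {w \<in> space M. \<forall>j\<in>J n. single (Q n j) w} \<inter> (X -` E' n \<inter> space M)" for n
  let ?y = "\<lambda>n w. \<lambda>j\<in>J n. f (mark (Q n j) w)"
  have law: "{w \<in> N n. ?y n w \<in> B} \<in> sets M" "prob {w \<in> N n. ?y n w \<in> B} = measure (\<nu>s (J n)) B * prob (N n)"
    if "B \<in> sets (\<nu>s (J n))" for n B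
    unfolding N_def by (rule mark_law[OF finJ Q Qdis f E' that]; assumption)+
  have Nm: "N n \<in> sets M" for n
    unfolding N_def by (rule mark_law(1)[OF finJ Q Qdis f E' sets.empty_sets])
  have Ndis: "disjoint_family N"
    unfolding disjoint_family_on_def
  proof (intro ballI impI)
    fix m n :: nat assume "m \<noteq> n"
    then have "E' m \<inter> E' n = {}" using disjoint_family_disjointed[of E] unfolding E'_def disjoint_family_on_def by blast
    then show "N m \<inter> N n = {}" unfolding N_def by blast
  qed
  define good where "good w \<longleftrightarrow> lasso_basis (X w) (b w) \<and> (\<forall>a\<in>P w. \<forall>b\<in>P w. Re (fst a) = Re (fst b) \<longrightarrow> a = b) \<and>
      (\<forall>a\<in>P w. \<forall>b\<in>P w. Re (\<psi> (fst a)) = Re (\<psi> (fst b)) \<longrightarrow> a = b) \<and> (\<forall>i\<in>I. path_image (F i) \<inter> X w = {})" for w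
  have AEgood: "AE w in M. good w"
  proof -
    have 1: "AE w in M. lasso_basis (X w) (b w)"
      using conjunct1[OF b[unfolded measurable_proper_basis_def]]
      by (rule AE_mp[OF _ AE_I2]) (intro impI proper_imp_lasso_basis)
    have 2: "AE w in M. \<forall>a\<in>P w. \<forall>b\<in>P w. Re (fst a) = Re (fst b) \<longrightarrow> a = b"
      using AE_generic[of "\<lambda>z. z"] by (simp add: continuous_on_id)
    have 3: "AE w in M. \<forall>a\<in>P w. \<forall>b\<in>P w. Re (\<psi> (fst a)) = Re (\<psi> (fst b)) \<longrightarrow> a = b"
      by (rule AE_generic[OF homeo(1) pres])
    have 4: "AE w in M. \<forall>i\<in>I. path_image (F i) \<inter> X w = {}"
      by (rule AE_finite_allI[OF I]) (rule AE_avoid[OF F(2)])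
    show ?thesis using 1 2 3 4 unfolding good_def by eventually_elim blast
  qed
  have good_inj: "\<forall>a\<in>P w. \<forall>b\<in>P w. fst a = fst b \<longrightarrow> a = b" "inj_on Re (X w)" "inj_on Re (\<psi> ` X w)" if w: "good w" for w
  proof -
    have i: "\<forall>a\<in>P w. \<forall>b\<in>P w. Re (fst a) = Re (fst b) \<longrightarrow> a = b"
      "\<forall>a\<in>P w. \<forall>b\<in>P w. Re (\<psi> (fst a)) = Re (\<psi> (fst b)) \<longrightarrow> a = b" using w by (simp_all add: good_def)
    show "\<forall>a\<in>P w. \<forall>b\<in>P w. fst a = fst b \<longrightarrow> a = b" using i(1) by metis
    show "inj_on Re (X w)" "inj_on Re (\<psi> ` X w)" unfolding X_def inj_on_def using i by blast+
  qed
  have cover: "\<exists>n. w \<in> N n" if w: "w \<in> space M" "good w" for w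
  proof -
    have lb: "lasso_basis (X w) (b w)" using w by (simp add: good_def)
    have "F i \<in> loops_at (- X w) 0" if "i \<in> I" for i
      using F(1)[OF that] w(2) that by (auto simp: loops_at_def good_def)
    then obtain D where D: "D \<in> codes I" "described (X w) (b w) I F D" by (rule described_exists[OF lb I])
    obtain n where "e n = D" using e_surj[OF D(1)] by blast
    then have "w \<in> T n" using D(2) w(1) lb by (simp add: T_def lasso_basis_def)
    then have "X w \<in> (\<Union>n. E n)" using E(2) by blast
    then have "X w \<in> (\<Union>n. E' n)" unfolding E'_def by (simp add: UN_disjointed_eq)
    then obtain m where m: "X w \<in> E' m" by blast
    then have "w \<in> T m" using E(2)[of m] E'_sub[of m] w(1) by blast
    then have "described (X w) (b w) I F (e m)" by (simp add: T_def)
    then have "\<exists>x. X w \<inter> Q m j = {x}" if "j \<in> J m" for j using that unfolding described_def J_def Q_def by blast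
    then have "single (Q m j) w" if "j \<in> J m" for j using that single_if_inj[OF good_inj(1)[OF w(2)]] by blast
    then have "w \<in> N m" using m w(1) by (simp add: N_def)
    then show ?thesis ..
  qed
  have on_N: "i \<in> I \<Longrightarrow> holonomy G (b w) (marks w) (F i) = weval G (?y n w) (V n i)" 
    and lim_N: "(\<And>i. i \<in> I \<Longrightarrow> A i \<in> sets borel) \<Longrightarrow> config_limit l I A (\<psi> ` X w) = ennreal (wprob (J n) I A (V n))"
    if n: "w \<in> N n" and w: "good w" for w n i A
  proof -
    have wM: "w \<in> space M" using n by (simp add: N_def)
    have lb: "lasso_basis (X w) (b w)" using w by (simp add: good_def)
    have "w \<in> T n" using n E(2)[of n] E'_sub[of n] by (auto simp: N_def)
    then have desc: "described (X w) (b w) I F (e n)" and gc: "good_config (X w)" by (simp_all add: T_def)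
    have "\<forall>j\<in>J n. \<exists>x. X w \<inter> Q n j = {x}" using desc unfolding described_def J_def Q_def by blast
    then obtain x where x: "\<And>j. j \<in> J n \<Longrightarrow> X w \<inter> Q n j = {x j}" by metis
    have xX: "x ` J n \<subseteq> X w" using x by blast
    have xinj: "inj_on x (J n)"
    proof (rule inj_onI, rule ccontr)
      fix j k assume jk: "j \<in> J n" "k \<in> J n" "x j = x k" "j \<noteq> k"
      then have "Q n j \<inter> Q n k = {}" using Qdis[of n] by (simp add: disjoint_family_on_def)
      moreover have "x j \<in> Q n j" "x k \<in> Q n k" using x jk by blast+
      ultimately show False using jk(3) by auto
    qed
    have words: "F i \<in> loops_at (- X w) 0" "loop_class (- X w) (F i) = weval (pi1 (- X w) 0) (\<lambda>j. b w (x j)) (V n i)"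
      if "i \<in> I" for i
      using described_words[where D = "e n" and S = "X w" and b = "b w" and f = F and x = x, OF e desc gc that F(1)[OF that]] x
      unfolding J_def Q_def V_def by auto
    show "holonomy G (b w) (marks w) (F i) = weval G (?y n w) (V n i)" if i: "i \<in> I"
    proof -
      let ?\<omega> = "\<lambda>x. THE g. (x, g) \<in> marks w"
      have "loop_class (- X w) (F i) = weval (pi1 (- X w) 0) (b w) (rename x (V n i))"
        using words(2)[OF i] by (simp only: weval_rename)
      then have "holonomy G (b w) (marks w) (F i) = weval G ?\<omega> (rename x (V n i))"
        by (rule holonomy_weval[OF lb good_inj(2)[OF w] fst_marks[symmetric], rotated]) (use V[OF i] xX in auto)
      also have "\<dots> = weval G (\<lambda>j. ?\<omega> (x j)) (V n i)" by (rule weval_rename)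
      also have "\<dots> = weval G (?y n w) (V n i)"
      proof (rule weval_cong)
        fix j assume "j \<in> fst ` set (V n i)"
        then have j: "j \<in> J n" using V[OF i] by blast
        have "single (Q n j) w" using n j by (simp add: N_def)
        from mark_eq[OF good_inj(1)[OF w] this x[OF j]] show "?\<omega> (x j) = ?y n w j" using j by simp
      qed
      finally show ?thesis .
    qed
    show "config_limit l I A (\<psi> ` X w) = ennreal (wprob (J n) I A (V n))" if "\<And>i. i \<in> I \<Longrightarrow> A i \<in> sets borel"
      by (rule config_limit_eq_wprob[OF lb homeo good_inj(3)[OF w] I that finJ xinj xX words(1)[unfolded F_def] V words(2)[unfolded F_def]])
  qed
  define c where "c A n = ennreal (wprob (J n) I A (V n))" for A n
  \<comment> \<open>The index of the piece is unique because the pieces are disjoint; off the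
    pieces, on a null set, the unit is a default.\<close>
  define Y where "Y i w = (if \<exists>n. w \<in> N n then weval G (?y (THE n. w \<in> N n) w) (V (THE n. w \<in> N n) i) else \<one>)" for i w
  have Y_N: "Y i w = weval G (?y n w) (V n i)" if "w \<in> N n" for i w n
  proof -
    have "(THE m. w \<in> N m) = n"
      using that Ndis unfolding disjoint_family_on_def by (intro the_equality) blast+
    then show ?thesis using that by (auto simp: Y_def)
  qed
  have Y_0: "Y i w = \<one>" if "\<nexists>n. w \<in> N n" for i w
    using that by (simp only: Y_def if_False)
  have split: "{w \<in> space M. \<forall>i\<in>I'. Y i w \<in> A i} =
      (\<Union>n. {w \<in> N n. \<forall>i\<in>I'. Y i w \<in> A i}) \<union> (if \<forall>i\<in>I'. \<one> \<in> A i then space M - (\<Union>n. N n) else {})" for I' A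
  proof (rule subset_antisym; rule subsetI)
    fix w assume w: "w \<in> {w \<in> space M. \<forall>i\<in>I'. Y i w \<in> A i}"
    show "w \<in> (\<Union>n. {w \<in> N n. \<forall>i\<in>I'. Y i w \<in> A i}) \<union> (if \<forall>i\<in>I'. \<one> \<in> A i then space M - (\<Union>n. N n) else {})"
    proof (cases "\<exists>n. w \<in> N n")
      case False
      then have "\<forall>i\<in>I'. \<one> \<in> A i" using w Y_0[OF False] by simp
      then show ?thesis using w False by simp
    qed (use w in auto)
  next
    fix w assume w: "w \<in> (\<Union>n. {w \<in> N n. \<forall>i\<in>I'. Y i w \<in> A i}) \<union> (if \<forall>i\<in>I'. \<one> \<in> A i then space M - (\<Union>n. N n) else {})"
    show "w \<in> {w \<in> space M. \<forall>i\<in>I'. Y i w \<in> A i}"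
    proof (cases "\<exists>n. w \<in> N n")
      case True
      then show ?thesis using w sets.sets_into_space[OF Nm] by (auto split: if_splits)
    next
      case False
      then have "w \<in> space M" "\<forall>i\<in>I'. \<one> \<in> A i" using w by (auto split: if_splits)
      then show ?thesis using Y_0[OF False] by simp
    qed
  qed
  have y_space: "?y n w \<in> space (\<nu>s (J n))" for n w by (simp add: space_PiM)
  have piece: "{w \<in> N n. \<forall>i\<in>I'. Y i w \<in> A i} \<in> sets M"
    "prob {w \<in> N n. \<forall>i\<in>I'. Y i w \<in> A i} = wprob (J n) I' A (V n) * prob (N n)"
    if A: "\<And>i. i \<in> I' \<Longrightarrow> A i \<in> sets borel" and I': "I' \<subseteq> I" for A n I'
  proof -
    let ?W = "{g \<in> space (\<nu>s (J n)). \<forall>i\<in>I'. weval G g (V n i) \<in> A i}"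
    have eq: "{w \<in> N n. ?y n w \<in> ?W} = {w \<in> N n. \<forall>i\<in>I'. Y i w \<in> A i}"
      using Y_N[of _ n] y_space[of n] by auto
    have W: "?W \<in> sets (\<nu>s (J n))"
      by (rule word_event[OF finite_subset[OF I' I] A V]) (use I' in auto)
    have 1: "{w \<in> N n. ?y n w \<in> ?W} \<in> sets M" by (rule law(1)[OF W])
    then show "{w \<in> N n. \<forall>i\<in>I'. Y i w \<in> A i} \<in> sets M" unfolding eq .
    have "prob {w \<in> N n. ?y n w \<in> ?W} = measure (\<nu>s (J n)) ?W * prob (N n)" by (rule law(2)[OF W])
    then show "prob {w \<in> N n. \<forall>i\<in>I'. Y i w \<in> A i} = wprob (J n) I' A (V n) * prob (N n)" unfolding eq wprob_def .
  qed
  show ?thesis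
  proof (intro exI[of _ Y] conjI ballI allI impI)
    fix i assume i: "i \<in> I"
    show "Y i \<in> borel_measurable M"
    proof (rule measurableI)
      fix A :: "'g set" assume A: "A \<in> sets borel"
      have "Y i -` A \<inter> space M = {w \<in> space M. \<forall>i\<in>{i}. Y i w \<in> A}" by auto
      also have "\<dots> \<in> sets M"
        unfolding split using piece(1)[of "{i}" "\<lambda>_. A"] A i Nm by (intro sets.Un sets.countable_UN) auto
      finally show "Y i -` A \<inter> space M \<in> sets M" .
    qed simp
  next
    fix i assume i: "i \<in> I"
    show "AE w in M. Y i w = holonomy G (b w) (marks w) (\<phi> \<circ> l i)"
      using AEgood
    proof (rule AE_mp[OF _ AE_I2], intro impI)
      fix w assume w: "w \<in> space M" "good w"
      then obtain n where "w \<in> N n" using cover by blast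
      then show "Y i w = holonomy G (b w) (marks w) (\<phi> \<circ> l i)"
        using Y_N on_N[OF _ w(2)] i unfolding F_def by simp
    qed
  next
    fix A :: "'i \<Rightarrow> 'g set" assume "\<forall>i\<in>I. A i \<in> sets borel"
    then have A: "\<And>i. i \<in> I \<Longrightarrow> A i \<in> sets borel" by blast
    let ?R = "\<lambda>n. {w \<in> N n. \<forall>i\<in>I. Y i w \<in> A i}"
    have R: "range ?R \<subseteq> sets M" by (rule image_subsetI) (rule piece(1)[OF A subset_refl])
    have Rdis: "disjoint_family ?R" by (rule disjoint_family_subset[OF Ndis]) simp
    have AEc: "AE w in M. \<exists>n. w \<in> N n" using AEgood by (rule AE_mp[OF _ AE_I2]) (intro impI cover)
    have YA: "{w \<in> space M. \<forall>i\<in>I. Y i w \<in> A i} \<in> sets M"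
    proof -
      have "(\<Union>n. ?R n) \<union> (if \<forall>i\<in>I. \<one> \<in> A i then space M - (\<Union>n. N n) else {}) \<in> sets M"
        using R Nm by (intro sets.Un sets.countable_UN) auto
      then show ?thesis unfolding split[symmetric] .
    qed
    have cR: "emeasure M (?R n) = c A n * emeasure M (N n)" for n
    proof -
      have "prob (?R n) = wprob (J n) I A (V n) * prob (N n)" by (rule piece(2)[OF A subset_refl])
      then show ?thesis by (simp only: emeasure_eq_measure c_def ennreal_mult''[OF measure_nonneg])
    qed
    have "emeasure M {w \<in> space M. \<forall>i\<in>I. Y i w \<in> A i} = emeasure M (\<Union>n. ?R n)"
    proof (rule emeasure_eq_AE[OF _ YA sets.countable_UN[OF R]])
      show "AE w in M. w \<in> {w \<in> space M. \<forall>i\<in>I. Y i w \<in> A i} \<longleftrightarrow> w \<in> (\<Union>n. ?R n)"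
        using AEc AE_space by eventually_elim auto
    qed
    also have "\<dots> = (\<Sum>n. c A n * emeasure M (N n))"
      unfolding cR[symmetric] by (rule suminf_emeasure[OF R Rdis, symmetric])
    also have "\<dots> = (\<Sum>n. \<integral>\<^sup>+w. c A n * indicator (N n) w \<partial>M)"
      using Nm by (simp add: nn_integral_cmult_indicator)
    also have "\<dots> = (\<integral>\<^sup>+w. (\<Sum>n. c A n * indicator (N n) w) \<partial>M)"
      using Nm by (intro nn_integral_suminf[symmetric]) simp
    also have "\<dots> = (\<integral>\<^sup>+w. config_limit l I A (\<psi> ` X w) \<partial>M)"
    proof (rule nn_integral_cong_AE)
      show "AE w in M. (\<Sum>n. c A n * indicator (N n) w) = config_limit l I A (\<psi> ` X w)"
        using AEgood AEc
      proof eventually_elim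
        case (elim w)
        then obtain n where n: "w \<in> N n" by blast
        have "(\<Sum>n. c A n * indicator (N n) w) = c A n" by (rule suminf_cmult_indicator[OF Ndis n])
        also have "\<dots> = config_limit l I A (\<psi> ` X w)" unfolding c_def using lim_N[OF n elim(1) A] by simp
        finally show ?case .
      qed
    qed
    \<comment> \<open>The integrand depends on \<open>w\<close> only through the image of
      \<open>X w\<close> under \<open>\<psi>\<close>, whose law is that of
      \<open>X w\<close>.\<close>
    also have "\<dots> = (\<integral>\<^sup>+S. config_limit l I A S \<partial>distr M (config_algebra borel) (\<lambda>w. \<psi> ` X w))"
      by (rule nn_integral_distr[symmetric, OF law_invariant(1)[OF homeo(1) pres]])
        (use config_limit_measurable[OF I A] in simp_all)
    also have "\<dots> = (\<integral>\<^sup>+w. config_limit l I A (X w) \<partial>M)"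
    proof -
      have m: "config_limit l I A \<in> borel_measurable (distr M (config_algebra borel) X)"
        using config_limit_measurable[OF I A] by simp
      have "distr M (config_algebra borel) (\<lambda>w. \<psi> ` X w) = distr M (config_algebra borel) X"
        by (rule law_invariant(2)[OF homeo(1) pres])
      then show ?thesis using nn_integral_distr[OF X_measurable m] by (simp only:)
    qed
    finally show "emeasure M {w \<in> space M. \<forall>i\<in>I. Y i w \<in> A i} = (\<integral>\<^sup>+w. config_limit l I A (X w) \<partial>M)" .
  qed
qed

end


section \<open>Almost sure versions, completion and infinite families of loops\<close>

lemma measurable_completion_AE:
  fixes H :: "'w \<Rightarrow> 'b::topological_space"
  assumes Y: "Y \<in> borel_measurable M" and eq: "AE w in M. Y w = H w"
  shows "H \<in> borel_measurable (completion M)"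
proof (rule measurableI)
  fix A :: "'b set" assume A: "A \<in> sets borel"
  obtain N where N: "{w \<in> space M. Y w \<noteq> H w} \<subseteq> N" "N \<in> null_sets M"
    using AE_E[OF eq] by (metis null_setsI)
  have "Y -` A \<inter> space M - N \<in> sets M" using measurable_sets[OF Y A] N(2) by auto
  then have "(Y -` A \<inter> space M - N) \<union> (H -` A \<inter> space M \<inter> N) \<in> sets (completion M)"
    using null_sets_completion[OF N(2)] by (intro sets.Un) auto
  also have "(Y -` A \<inter> space M - N) \<union> (H -` A \<inter> space M \<inter> N) = H -` A \<inter> space (completion M)"
    using N(1) by auto
  finally show "H -` A \<inter> space (completion M) \<in> sets (completion M)" .
qed simp

text \<open>Finite-dimensional cylinders determine a finite measure on a product over any index set,
  which covers the uncountable family of all loops with negligible range.\<close>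

lemma same_distributionI:
  fixes H H' :: "'i \<Rightarrow> 'w \<Rightarrow> 'b::topological_space"
  assumes M: "prob_space M"
    and m: "\<And>i. i \<in> L \<Longrightarrow> H i \<in> borel_measurable (completion M)" "\<And>i. i \<in> L \<Longrightarrow> H' i \<in> borel_measurable (completion M)"
    and eq: "\<And>I A. finite I \<Longrightarrow> I \<subseteq> L \<Longrightarrow> (\<And>i. i \<in> I \<Longrightarrow> A i \<in> sets borel) \<Longrightarrow>
      emeasure (completion M) {w \<in> space M. \<forall>i\<in>I. H i w \<in> A i} = emeasure (completion M) {w \<in> space M. \<forall>i\<in>I. H' i w \<in> A i}"
  shows "same_distribution M (Pi\<^sub>M L (\<lambda>_. borel)) (\<lambda>w. \<lambda>i\<in>L. H i w) (\<lambda>w. \<lambda>i\<in>L. H' i w)"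
proof -
  let ?B = "Pi\<^sub>M L (\<lambda>_. borel :: 'b measure)"
  have r: "(\<lambda>w. \<lambda>i\<in>L. H i w) \<in> completion M \<rightarrow>\<^sub>M ?B" "(\<lambda>w. \<lambda>i\<in>L. H' i w) \<in> completion M \<rightarrow>\<^sub>M ?B"
    by (rule measurable_restrict; rule m; assumption)+
  have "distr (completion M) ?B (\<lambda>w. \<lambda>i\<in>L. H i w) = distr (completion M) ?B (\<lambda>w. \<lambda>i\<in>L. H' i w)"
  proof (rule measure_eqI_PiM_infinite)
    fix A :: "'i \<Rightarrow> 'b set" and J assume J: "finite J" "J \<subseteq> L" and A: "\<And>i. i \<in> J \<Longrightarrow> A i \<in> sets borel"
    have E: "prod_emb L (\<lambda>_. borel) J (Pi\<^sub>E J A) \<in> sets ?B" using J A by (intro sets_PiM_I) auto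
    have pre: "(\<lambda>w. \<lambda>i\<in>L. h i w) -` prod_emb L (\<lambda>_. borel :: 'b measure) J (Pi\<^sub>E J A) \<inter> space (completion M) =
        {w \<in> space M. \<forall>i\<in>J. h i w \<in> A i}" for h
      using J(2) by (auto simp: prod_emb_def PiE_iff subset_iff)
    show "emeasure (distr (completion M) ?B (\<lambda>w. \<lambda>i\<in>L. H i w)) (prod_emb L (\<lambda>_. borel) J (Pi\<^sub>E J A)) =
        emeasure (distr (completion M) ?B (\<lambda>w. \<lambda>i\<in>L. H' i w)) (prod_emb L (\<lambda>_. borel) J (Pi\<^sub>E J A))"
      unfolding emeasure_distr[OF r(1) E] emeasure_distr[OF r(2) E] pre by (rule eq[OF J A])
  next
    have "finite_measure (completion M)"
      using prob_space.emeasure_space_1[OF M] by (intro finite_measureI) simp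
    then show "finite_measure (distr (completion M) ?B (\<lambda>w. \<lambda>i\<in>L. H i w))" by (rule finite_measure.finite_measure_distr[OF _ r(1)])
  qed simp_all
  with r show ?thesis by (simp add: same_distribution_def)
qed

context random_holonomy
begin

lemma holonomy_completion:
  assumes b: "measurable_proper_basis M X b"
    and homeo: "continuous_on UNIV \<psi>" "continuous_on UNIV \<phi>" "\<And>z. \<phi> (\<psi> z) = z" "\<And>z. \<psi> (\<phi> z) = z" "\<psi> 0 = 0"
    and pres: "\<And>A. A \<in> sets borel \<Longrightarrow> emeasure lborel (\<psi> -` A) = emeasure lborel A"
    and I: "finite I" and l: "\<And>i. i \<in> I \<Longrightarrow> \<phi> \<circ> l i \<in> null_loops"
  shows "i \<in> I \<Longrightarrow> (\<lambda>w. holonomy G (b w) (marks w) (\<phi> \<circ> l i)) \<in> borel_measurable (completion M)"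
    and "(\<And>i. i \<in> I \<Longrightarrow> A i \<in> sets borel) \<Longrightarrow>
      emeasure (completion M) {w \<in> space M. \<forall>i\<in>I. holonomy G (b w) (marks w) (\<phi> \<circ> l i) \<in> A i} = (\<integral>\<^sup>+w. config_limit l I A (X w) \<partial>M)"
proof -
  have "\<exists>Y. (\<forall>i\<in>I. Y i \<in> borel_measurable M) \<and>
    (\<forall>i\<in>I. AE w in M. Y i w = holonomy G (b w) (marks w) (\<phi> \<circ> l i)) \<and>
    (\<forall>A. (\<forall>i\<in>I. A i \<in> sets borel) \<longrightarrow>
      emeasure M {w \<in> space M. \<forall>i\<in>I. Y i w \<in> A i} = (\<integral>\<^sup>+w. config_limit l I A (X w) \<partial>M))"
    by (rule holonomy_law[OF b I homeo pres l])
  then obtain Y where Y': "\<forall>i\<in>I. Y i \<in> borel_measurable M"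
    "\<forall>i\<in>I. AE w in M. Y i w = holonomy G (b w) (marks w) (\<phi> \<circ> l i)"
    "\<forall>A. (\<forall>i\<in>I. A i \<in> sets borel) \<longrightarrow>
      emeasure M {w \<in> space M. \<forall>i\<in>I. Y i w \<in> A i} = (\<integral>\<^sup>+w. config_limit l I A (X w) \<partial>M)"
    by (elim exE conjE)
  have Y: "Y i \<in> borel_measurable M" "AE w in M. Y i w = holonomy G (b w) (marks w) (\<phi> \<circ> l i)" if "i \<in> I" for i
    using Y'(1)[rule_format, OF that] Y'(2)[rule_format, OF that] .
  show H: "(\<lambda>w. holonomy G (b w) (marks w) (\<phi> \<circ> l i)) \<in> borel_measurable (completion M)" if i: "i \<in> I" for i
    by (rule measurable_completion_AE[OF Y(1)[OF i] Y(2)[OF i]])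
  assume A: "\<And>i. i \<in> I \<Longrightarrow> A i \<in> sets borel"
  have ev: "{w \<in> space N. \<forall>i\<in>I. h i w \<in> A i} \<in> sets N" if h: "\<And>i. i \<in> I \<Longrightarrow> h i \<in> borel_measurable N" for h N
  proof (rule sets.sets_Collect_finite_All[OF _ I])
    fix i assume i: "i \<in> I"
    show "{w \<in> space N. h i w \<in> A i} \<in> sets N"
      using measurable_sets[OF h[OF i] A[OF i]] by (simp add: vimage_def Int_def conj_commute)
  qed
  have YM: "{w \<in> space M. \<forall>i\<in>I. Y i w \<in> A i} \<in> sets M" by (rule ev) (rule Y(1))
  have HM: "{w \<in> space M. \<forall>i\<in>I. holonomy G (b w) (marks w) (\<phi> \<circ> l i) \<in> A i} \<in> sets (completion M)"
    using ev[of "\<lambda>i w. holonomy G (b w) (marks w) (\<phi> \<circ> l i)" "completion M"] H by simp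
  have "emeasure (completion M) {w \<in> space M. \<forall>i\<in>I. holonomy G (b w) (marks w) (\<phi> \<circ> l i) \<in> A i} =
      emeasure (completion M) {w \<in> space M. \<forall>i\<in>I. Y i w \<in> A i}"
  proof (rule emeasure_eq_AE[OF AE_completion HM sets_completionI_sets[OF YM]])
    have "AE w in M. \<forall>i\<in>I. Y i w = holonomy G (b w) (marks w) (\<phi> \<circ> l i)"
      by (rule AE_finite_allI[OF I]) (rule Y(2))
    then show "AE w in M. w \<in> {w \<in> space M. \<forall>i\<in>I. holonomy G (b w) (marks w) (\<phi> \<circ> l i) \<in> A i} \<longleftrightarrow>
        w \<in> {w \<in> space M. \<forall>i\<in>I. Y i w \<in> A i}"
      by (rule AE_mp[OF _ AE_I2]) simp
  qed
  also have "\<dots> = emeasure M {w \<in> space M. \<forall>i\<in>I. Y i w \<in> A i}"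
    using YM by simp
  also have "\<dots> = (\<integral>\<^sup>+w. config_limit l I A (X w) \<partial>M)" using Y'(3) A by blast
  finally show "emeasure (completion M) {w \<in> space M. \<forall>i\<in>I. holonomy G (b w) (marks w) (\<phi> \<circ> l i) \<in> A i} =
    (\<integral>\<^sup>+w. config_limit l I A (X w) \<partial>M)" .
qed

text \<open>The left-hand side is computed with the identity as change of coordinates, the
  right-hand side with \<open>\<phi>\<close> and another basis; both give the same integral of
  \<open>config_limit\<close>. The identity for \<open>\<phi>\<close> yields independence of the
  basis, and \<open>b' = b\<close> yields invariance.\<close>

lemma holonomy_same_distribution:
  assumes b: "measurable_proper_basis M X b" "measurable_proper_basis M X b'"
    and homeo: "continuous_on UNIV \<psi>" "continuous_on UNIV \<phi>" "\<And>z. \<phi> (\<psi> z) = z" "\<And>z. \<psi> (\<phi> z) = z" "\<psi> 0 = 0"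
    and pres: "\<And>A. A \<in> sets borel \<Longrightarrow> emeasure lborel (\<psi> -` A) = emeasure lborel A"
    and l: "\<And>i::'i. i \<in> L \<Longrightarrow> l i \<in> null_loops" "\<And>i. i \<in> L \<Longrightarrow> \<phi> \<circ> l i \<in> null_loops"
  shows "same_distribution M (Pi\<^sub>M L (\<lambda>_. borel)) (\<lambda>w. \<lambda>i\<in>L. holonomy G (b w) (marks w) (l i))
    (\<lambda>w. \<lambda>i\<in>L. holonomy G (b' w) (marks w) (\<phi> \<circ> l i))"
proof -
  have id: "(\<lambda>z. z) \<circ> l i = l i" for i by (simp add: fun_eq_iff)
  show ?thesis
  proof (rule same_distributionI[OF prob_space_axioms])
    fix i assume i: "i \<in> L"
    have "(\<lambda>w. holonomy G (b w) (marks w) ((\<lambda>z. z) \<circ> l i)) \<in> borel_measurable (completion M)"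
      by (rule holonomy_completion(1)[where I = "{i}" and \<psi> = "\<lambda>z. z", OF b(1)]) (use l(1)[OF i] in \<open>simp_all add: id\<close>)
    then show "(\<lambda>w. holonomy G (b w) (marks w) (l i)) \<in> borel_measurable (completion M)" unfolding id .
    show "(\<lambda>w. holonomy G (b' w) (marks w) (\<phi> \<circ> l i)) \<in> borel_measurable (completion M)"
      by (rule holonomy_completion(1)[where I = "{i}", OF b(2) homeo pres]) (use l(2)[OF i] in simp_all)
  next
    fix I and A :: "'i \<Rightarrow> 'g set"
    assume I: "finite I" "I \<subseteq> L" and A: "\<And>i. i \<in> I \<Longrightarrow> A i \<in> sets borel"
    have lI: "l i \<in> null_loops" "\<phi> \<circ> l i \<in> null_loops" if "i \<in> I" for i using l I(2) that by blast+
    have "emeasure (completion M) {w \<in> space M. \<forall>i\<in>I. holonomy G (b w) (marks w) ((\<lambda>z. z) \<circ> l i) \<in> A i} =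
        (\<integral>\<^sup>+w. config_limit l I A (X w) \<partial>M)"
      by (rule holonomy_completion(2)[where \<psi> = "\<lambda>z. z", OF b(1)]) (use lI(1) I(1) A in \<open>simp_all add: id\<close>)
    moreover have "emeasure (completion M) {w \<in> space M. \<forall>i\<in>I. holonomy G (b' w) (marks w) (\<phi> \<circ> l i) \<in> A i} =
        (\<integral>\<^sup>+w. config_limit l I A (X w) \<partial>M)"
      by (rule holonomy_completion(2)[OF b(2) homeo pres I(1) lI(2) A])
    ultimately show "emeasure (completion M) {w \<in> space M. \<forall>i\<in>I. holonomy G (b w) (marks w) (l i) \<in> A i} =
        emeasure (completion M) {w \<in> space M. \<forall>i\<in>I. holonomy G (b' w) (marks w) (\<phi> \<circ> l i) \<in> A i}"
      unfolding id by simp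
  qed
qed

end

text \<open>Through the exponential, conjugation by \<open>h\<close> is the isometry
  \<open>Ad G c h\<close> and inversion is \<open>- 1\<close>, and both preserve the uniform measure
  on the sphere.\<close>

lemma (in lie_chart) central_measure_uniform_sphere:
  assumes B: "is_scalar_product B" and inv: "Ad_invariant G c B"
  shows "central_measure G (distr (uniform_sphere B r) borel (lie_exp G c))"
proof -
  let ?u = "uniform_sphere B r" and ?e = "lie_exp G c"
  have e: "?e \<in> ?u \<rightarrow>\<^sub>M borel"
    using borel_measurable_continuous_onI[OF lie_exp_facts(1)] by (simp add: measurable_cong_sets[OF sets_uniform_sphere[OF B] refl])
  have inv_law: "distr (distr ?u borel ?e) borel F = distr ?u borel ?e"
    if F: "continuous_on UNIV F" and T: "linear T" "\<And>Z. B (T Z) (T Z) = B Z Z" and FT: "\<And>Z. F (?e Z) = ?e (T Z)" for F T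
  proof -
    have Tm: "T \<in> ?u \<rightarrow>\<^sub>M borel"
      using borel_measurable_continuous_onI[OF linear_continuous_on[OF linear_conv_bounded_linear[THEN iffD1, OF T(1)]]]
      by (simp add: measurable_cong_sets[OF sets_uniform_sphere[OF B] refl])
    have "distr (distr ?u borel ?e) borel F = distr ?u borel (F \<circ> ?e)"
      by (rule distr_distr[OF borel_measurable_continuous_onI[OF F] e])
    also have "F \<circ> ?e = ?e \<circ> T" by (simp add: fun_eq_iff FT)
    also have "distr ?u borel (?e \<circ> T) = distr (distr ?u borel T) borel ?e"
      by (rule distr_distr[symmetric, OF borel_measurable_continuous_onI[OF lie_exp_facts(1)] Tm])
    also have "\<dots> = distr ?u borel ?e" by (simp only: uniform_sphere_isometry[OF B T])
    finally show ?thesis .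
  qed
  show ?thesis
  proof (intro central_measure.intro central_measure_axioms.intro is_group)
    show "carrier G = UNIV" by (rule carrier_UNIV)
    show "continuous_on UNIV (\<lambda>(g, h). g \<otimes> h)" by (rule continuous_mult)
    show "continuous_on UNIV (\<lambda>g. inv g)" by (rule continuous_inv)
    show "prob_space (distr ?u borel ?e)" by (rule prob_space.prob_space_distr[OF prob_space_uniform_sphere[OF B] e])
    show "distr (distr ?u borel ?e) borel (\<lambda>g. h \<otimes> g \<otimes> inv h) = distr ?u borel ?e" for h
    proof (rule inv_law[OF _ linear_Ad])
      show "continuous_on UNIV (\<lambda>g. h \<otimes> g \<otimes> inv h)" by (intro continuous_intros)
      show "B (Ad G c h Z) (Ad G c h Z) = B Z Z" for Z using inv by (simp add: Ad_invariant_def carrier_UNIV)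
    qed (rule lie_exp_facts(2))
    show "distr (distr ?u borel ?e) borel (\<lambda>g. inv g) = distr ?u borel ?e"
    proof (rule inv_law[OF continuous_inv linear_uminus])
      have "bilinear B" using B by (simp add: is_scalar_product_def)
      then show "B (- Z) (- Z) = B Z Z" for Z by (simp add: bilinear_lneg bilinear_rneg)
      show "inv (?e Z) = ?e (- Z)" for Z by (simp add: lie_exp_facts(3))
    qed
  qed simp
qed

theorem proposition3p11:
  fixes G :: "('g::{t2_space, second_countable_topology}) monoid"
    and \<A> :: "('g, 'e::euclidean_space) chart set"
    and c :: "('g, 'e) chart"
    and B :: "'e \<Rightarrow> 'e \<Rightarrow> real"
    and K :: real
    and M :: "'w measure"
    and P :: "'w \<Rightarrow> (complex \<times> 'e) set"
  assumes "lie_group G \<A>" and "compact (UNIV :: 'g set)" and "connected (UNIV :: 'g set)"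
    and "c \<in> \<A>" and "\<one>\<^bsub>G\<^esub> \<in> fst c"
    and "is_scalar_product B" and "Ad_invariant G c B"
    and "K > 0"
    and "prob_space M"
    and "poisson_process M
           (scale_measure (ennreal K) (lborel \<Otimes>\<^sub>M uniform_sphere B (1 / K))) P"
  shows "(\<forall>b b'.
            measurable_proper_basis M (\<lambda>w. fst ` exp_marks G c (P w)) b \<and>
            measurable_proper_basis M (\<lambda>w. fst ` exp_marks G c (P w)) b' \<longrightarrow>
            same_distribution M (Pi\<^sub>M null_loops (\<lambda>_. borel))
              (\<lambda>w. \<lambda>l\<in>null_loops. holonomy G (b w) (exp_marks G c (P w)) l)
              (\<lambda>w. \<lambda>l\<in>null_loops. holonomy G (b' w) (exp_marks G c (P w)) l)) \<and>
         (\<forall>b \<phi> (k::nat) l.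
            measurable_proper_basis M (\<lambda>w. fst ` exp_marks G c (P w)) b \<and>
            diffeomorphism \<phi> \<and> volume_preserving \<phi> \<and> \<phi> 0 = 0 \<and>
            (\<forall>i\<in>{1..k}. l i \<in> null_loops) \<longrightarrow>
            same_distribution M (Pi\<^sub>M {1..k} (\<lambda>_. borel))
              (\<lambda>w. \<lambda>i\<in>{1..k}. holonomy G (b w) (exp_marks G c (P w)) (l i))
              (\<lambda>w. \<lambda>i\<in>{1..k}. holonomy G (b w) (exp_marks G c (P w)) (\<phi> \<circ> l i)))"
proof (intro conjI allI impI)
  interpret lie_chart G \<A> c using assms(1,4,5) by unfold_locales
  let ?u = "uniform_sphere B (1 / K)"
  have exp: "lie_exp G c \<in> borel_measurable borel"
    by (rule borel_measurable_continuous_onI[OF lie_exp_facts(1)])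
  interpret random_holonomy M K ?u P G "lie_exp G c"
  proof (intro random_holonomy.intro marked_poisson.intro marked_poisson_axioms.intro random_holonomy_axioms.intro)
    show "prob_space M" "K > 0" by fact+
    show "prob_space ?u" by (rule prob_space_uniform_sphere[OF assms(6)])
    show "sets ?u = sets borel" by (rule sets_uniform_sphere[OF assms(6)])
    show "poisson_process M (scale_measure (ennreal K) (lborel \<Otimes>\<^sub>M ?u)) P" by fact
    show "central_measure G (distr ?u borel (lie_exp G c))" by (rule central_measure_uniform_sphere[OF assms(6,7)])
    show "lie_exp G c \<in> borel_measurable borel" by (rule exp)
  qed
  have marks: "exp_marks G c (P w) = marks w" for w by (simp add: exp_marks_def marks_def)
  {
    fix b b'
    assume "measurable_proper_basis M (\<lambda>w. fst ` exp_marks G c (P w)) b \<and>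
      measurable_proper_basis M (\<lambda>w. fst ` exp_marks G c (P w)) b'"
    then have b: "measurable_proper_basis M X b" "measurable_proper_basis M X b'"
      unfolding marks fst_marks by simp_all
    have id: "(\<lambda>z. z) \<circ> l = l" for l :: "real \<Rightarrow> complex" by (simp add: fun_eq_iff)
    show "same_distribution M (Pi\<^sub>M null_loops (\<lambda>_. borel))
        (\<lambda>w. \<lambda>l\<in>null_loops. holonomy G (b w) (exp_marks G c (P w)) l)
        (\<lambda>w. \<lambda>l\<in>null_loops. holonomy G (b' w) (exp_marks G c (P w)) l)"
      using holonomy_same_distribution[OF b, of "\<lambda>z. z" "\<lambda>z. z" null_loops "\<lambda>l. l"]
      unfolding marks id by simp
  next
    fix b \<phi> and k :: nat and l
    assume "measurable_proper_basis M (\<lambda>w. fst ` exp_marks G c (P w)) b \<and>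
      diffeomorphism \<phi> \<and> volume_preserving \<phi> \<and> \<phi> 0 = 0 \<and> (\<forall>i\<in>{1..k}. l i \<in> null_loops)"
    then have b: "measurable_proper_basis M X b" and diff: "diffeomorphism \<phi>" and vol: "volume_preserving \<phi>"
      and zero: "\<phi> 0 = 0" and l: "\<And>i. i \<in> {1..k} \<Longrightarrow> l i \<in> null_loops"
      unfolding marks fst_marks by simp_all
    define \<psi> where "\<psi> = inv_into UNIV \<phi>"
    have bij: "bij \<phi>" using diff by (simp add: diffeomorphism_def)
    have C1: "continuous_on UNIV g" if "Ck_on 1 g UNIV" for g :: "complex \<Rightarrow> complex"
      using that differentiable_imp_continuous_within by (auto simp: continuous_on_eq_continuous_within)
    have cont: "continuous_on UNIV \<psi>" "continuous_on UNIV \<phi>"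
      using diff C1 by (simp_all add: diffeomorphism_def \<psi>_def)
    have inv: "\<phi> (\<psi> z) = z" "\<psi> (\<phi> z) = z" for z
      using bij by (simp_all add: \<psi>_def bij_is_surj surj_f_inv_f bij_is_inj)
    \<comment> \<open>Preimages under \<open>\<psi>\<close> are images under \<open>\<phi>\<close>,
      the sets whose area \<open>volume_preserving\<close> controls.\<close>
    have "\<psi> -` A = \<phi> ` A" for A
    proof (rule subset_antisym; rule subsetI)
      show "z \<in> \<phi> ` A" if "z \<in> \<psi> -` A" for z using that inv(1)[of z] by (intro image_eqI[of z \<phi> "\<psi> z"]) simp_all
    qed (auto simp: inv(2))
    then have pres: "emeasure lborel (\<psi> -` A) = emeasure lborel A" if "A \<in> sets borel" for A
      using vol that by (simp add: volume_preserving_def)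
    \<comment> \<open>The range of the transported loop is the image of a null Borel set under
      \<open>\<phi>\<close>, hence null, and it is closed, hence Borel.\<close>
    have null: "\<phi> \<circ> p \<in> null_loops" if p: "p \<in> null_loops" for p
    proof -
      have pl: "p \<in> loops_at UNIV 0" "path_image p \<in> null_sets lborel" using p by (simp_all add: null_loops_def)
      note pD = loops_atD[OF pl(1)]
      have path: "path (\<phi> \<circ> p)" by (rule path_continuous_image[OF pD(1) continuous_on_subset[OF cont(2)]]) simp
      have "path_image (\<phi> \<circ> p) \<in> sets borel" by (rule borel_closed[OF closed_path_image[OF path]])
      moreover have "path_image p \<in> sets borel" using pl(2) by auto
      then have "emeasure lborel (\<phi> ` path_image p) = emeasure lborel (path_image p)"
        using vol by (simp add: volume_preserving_def)
      then have "emeasure lborel (path_image (\<phi> \<circ> p)) = 0" using pl(2) by (simp add: path_image_compose null_setsD1)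
      ultimately have "path_image (\<phi> \<circ> p) \<in> null_sets lborel" by (simp add: null_sets_def)
      then show ?thesis
        using path pD(3,4) zero by (simp add: null_loops_def loops_at_def pathstart_def pathfinish_def)
    qed
    have \<psi>0: "\<psi> 0 = 0" using inv(2)[of 0] zero by simp
    show "same_distribution M (Pi\<^sub>M {1..k} (\<lambda>_. borel))
        (\<lambda>w. \<lambda>i\<in>{1..k}. holonomy G (b w) (exp_marks G c (P w)) (l i))
        (\<lambda>w. \<lambda>i\<in>{1..k}. holonomy G (b w) (exp_marks G c (P w)) (\<phi> \<circ> l i))"
      unfolding marks by (rule holonomy_same_distribution[OF b b cont inv \<psi>0 pres l null[OF l]])
  }
qed

end
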